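(* The following theories are identical (i.e. have the same theorems): (a) ${\rm ZFC}+VP$, (b) ${\rm LZFC}^{sext}+VP$, (c) ${\rm LZFC}^{\Sigma_1sext}+VP$, (d) ${\rm LZFC}^{spec}+VP$.
   Context: All theories are in the language $\{\in\}$. BST is the theory with axioms: Empty set, Extensionality, Pair, Union, Cartesian Product, "$\omega$ exists", $\Delta_0$-Separation. $Loc({\rm ZFC})$ is the statement that every set belongs to a transitive model of ZFC; ${\rm LZFC}={\rm BST}+Loc({\rm ZFC})$. "Model" means a (set) transitive model of ZFC. For a property $\phi$ of models, $Loc^{\phi}({\rm ZFC})$ is the statement that every set belongs to a model having property $\phi$, and ${\rm LZFC}^\phi={\rm LZFC}+Loc^\phi({\rm ZFC})$. The properties used are: - $sext$: $M$ is strongly extendible, i.e., for every set $x$ there is a model $N$ with $x\in N$ and $M\prec N$. - $\Sigma_1sext$: $M$ is $\Sigma_1$-strongly extendible, i.e., for every set $x$ there is a model $N$ with $x\in N$ and $M\prec_{\Sigma_1}N$ (i.e. $M$ and $N$, with $M\subseteq N$, satisfy the same $\Sigma_1$ sentences with parameters from $M$). - $spec$: $M$ is special, i.e., for every ordinal $\alpha\in M$, ${\rm cf}^M(\alpha)=\omega\Leftrightarrow {\rm cf}(\alpha)=\omega$. $VP$ (Vopěnka's Principle) is the scheme consisting of the following statement for each formula $\phi(x)$ of the language $\{\in\}$ (set parameters allowed), where $X_\phi=\{x:\phi(x)\}$: if $X_\phi$ is a proper class of structures of some fixed first-order language, then there are distinct $x,y\in X_\phi$ and an elementary embedding $j:x\rightarrow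 y$ (possibly trivial, i.e. $x\prec y$). *)

theory Defs
  imports Main
begin

section \<open>First-order logic in the language of set theory\<close>

text \<open>Formulas with de Bruijn indices; the only terms are variables.\<close>

datatype fm = Mem nat nat | Eq nat nat | Bot | Imp fm fm | All fm

primrec ren :: "(nat \<Rightarrow> nat) \<Rightarrow> fm \<Rightarrow> fm" where
  "ren f (Mem i j) = Mem (f i) (f j)"
| "ren f (Eq i j) = Eq (f i) (f j)"
| "ren f Bot = Bot"
| "ren f (Imp p q) = Imp (ren f p) (ren f q)"
| "ren f (All p) = All (ren (case_nat 0 (\<lambda>i. Suc (f i))) p)"

abbreviation inst :: "nat \<Rightarrow> fm \<Rightarrow> fm" where
  "inst i \<equiv> ren (case_nat i (\<lambda>k. k))"

primrec scoped :: "nat \<Rightarrow> fm \<Rightarrow> bool" where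
  "scoped n (Mem i j) \<longleftrightarrow> i < n \<and> j < n"
| "scoped n (Eq i j) \<longleftrightarrow> i < n \<and> j < n"
| "scoped n Bot \<longleftrightarrow> True"
| "scoped n (Imp p q) \<longleftrightarrow> scoped n p \<and> scoped n q"
| "scoped n (All p) \<longleftrightarrow> scoped (Suc n) p"

text \<open>\<open>relat m p\<close> relativizes every quantifier of \<open>p\<close> to the elements of variable \<open>m\<close>.\<close>

primrec relat :: "nat \<Rightarrow> fm \<Rightarrow> fm" where
  "relat m (Mem i j) = Mem i j"
| "relat m (Eq i j) = Eq i j"
| "relat m Bot = Bot"
| "relat m (Imp p q) = Imp (relat m p) (relat m q)"
| "relat m (All p) = All (Imp (Mem 0 (Suc m)) (relat (Suc m) p))"

text \<open>Bounded existential quantification is \<open>\<not>\<forall>x\<in>y. \<not>\<close>.\<close>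

inductive delta0 :: "fm \<Rightarrow> bool" where
  "delta0 (Mem i j)"
| "delta0 (Eq i j)"
| "delta0 Bot"
| "delta0 p \<Longrightarrow> delta0 q \<Longrightarrow> delta0 (Imp p q)"
| "delta0 p \<Longrightarrow> delta0 (All (Imp (Mem 0 (Suc j)) p))"

text \<open>Classical natural deduction with equality.\<close>

inductive proves :: "fm set \<Rightarrow> fm \<Rightarrow> bool" (infix "\<turnstile>" 50) where
  assm: "p \<in> T \<Longrightarrow> T \<turnstile> p"
| impI: "insert p T \<turnstile> q \<Longrightarrow> T \<turnstile> Imp p q"
| impE: "T \<turnstile> Imp p q \<Longrightarrow> T \<turnstile> p \<Longrightarrow> T \<turnstile> q"
| raa: "insert (Imp p Bot) T \<turnstile> Bot \<Longrightarrow> T \<turnstile> p"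
| allI: "ren Suc ` T \<turnstile> p \<Longrightarrow> T \<turnstile> All p"
| allE: "T \<turnstile> All p \<Longrightarrow> T \<turnstile> inst i p"
| eq_refl: "T \<turnstile> Eq i i"
| eq_subst: "T \<turnstile> Eq i j \<Longrightarrow> T \<turnstile> inst i p \<Longrightarrow> T \<turnstile> inst j p"

definition theorems :: "fm set \<Rightarrow> fm set" where
  "theorems T = {p. T \<turnstile> p}"


section \<open>Writing formulas with bound variables\<close>

text \<open>
  A \<open>bld\<close> is a formula awaiting the number \<open>n\<close> of variables in scope. Variables in scope are
  referred to by their level (the outermost one has level 0, the next quantifier met binds
  level \<open>n\<close>), so HOL abstraction serves as the binder; level \<open>x\<close> has de Bruijn
  index \<open>n - 1 - x\<close>.
\<close>

type_synonym var = nat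
type_synonym bld = "nat \<Rightarrow> fm"

definition b_mem :: "var \<Rightarrow> var \<Rightarrow> bld" (infix "\<^bold>\<in>" 50) where
  "(x \<^bold>\<in> y) = (\<lambda>n. Mem (n - 1 - x) (n - 1 - y))"

definition b_eq :: "var \<Rightarrow> var \<Rightarrow> bld" (infix "\<^bold>=" 50) where
  "(x \<^bold>= y) = (\<lambda>n. Eq (n - 1 - x) (n - 1 - y))"

definition b_imp :: "bld \<Rightarrow> bld \<Rightarrow> bld" (infixr "\<^bold>\<longrightarrow>" 25) where
  "(P \<^bold>\<longrightarrow> Q) = (\<lambda>n. Imp (P n) (Q n))"

definition b_not :: "bld \<Rightarrow> bld" ("\<^bold>\<not> _" [40] 40) where
  "(\<^bold>\<not> P) = (\<lambda>n. Imp (P n) Bot)"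

definition b_and :: "bld \<Rightarrow> bld \<Rightarrow> bld" (infixr "\<^bold>\<and>" 35) where
  "(P \<^bold>\<and> Q) = (\<^bold>\<not> (P \<^bold>\<longrightarrow> \<^bold>\<not> Q))"

definition b_or :: "bld \<Rightarrow> bld \<Rightarrow> bld" (infixr "\<^bold>\<or>" 30) where
  "(P \<^bold>\<or> Q) = (\<^bold>\<not> P \<^bold>\<longrightarrow> Q)"

definition b_iff :: "bld \<Rightarrow> bld \<Rightarrow> bld" (infixr "\<^bold>\<longleftrightarrow>" 25) where
  "(P \<^bold>\<longleftrightarrow> Q) = ((P \<^bold>\<longrightarrow> Q) \<^bold>\<and> (Q \<^bold>\<longrightarrow> P))"

definition b_all :: "(var \<Rightarrow> bld) \<Rightarrow> bld" (binder "\<^bold>\<forall>" 10) where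
  "b_all P = (\<lambda>n. All (P n (Suc n)))"

definition b_ex :: "(var \<Rightarrow> bld) \<Rightarrow> bld" (binder "\<^bold>\<exists>" 10) where
  "b_ex P = (\<^bold>\<not> (\<^bold>\<forall>x. \<^bold>\<not> P x))"

definition b_ex1 :: "(var \<Rightarrow> bld) \<Rightarrow> bld" (binder "\<^bold>\<exists>\<^bold>!" 10) where
  "b_ex1 P = (\<^bold>\<exists>x. P x \<^bold>\<and> (\<^bold>\<forall>y. P y \<^bold>\<longrightarrow> y \<^bold>= x))"

definition all_in :: "var \<Rightarrow> (var \<Rightarrow> bld) \<Rightarrow> bld" where
  "all_in a P = (\<^bold>\<forall>x. x \<^bold>\<in> a \<^bold>\<longrightarrow> P x)"

definition ex_in :: "var \<Rightarrow> (var \<Rightarrow> bld) \<Rightarrow> bld" where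
  "ex_in a P = (\<^bold>\<exists>x. x \<^bold>\<in> a \<^bold>\<and> P x)"

definition relativized :: "var \<Rightarrow> bld \<Rightarrow> bld" where
  "relativized M P = (\<lambda>n. relat (n - 1 - M) (P n))"

primrec conjs :: "bld list \<Rightarrow> bld" where
  "conjs [] = (\<lambda>n. Imp Bot Bot)"
| "conjs (P # Ps) = (P \<^bold>\<and> conjs Ps)"

text \<open>
  In the matrix of \<open>closure k\<close> the levels \<open>0, \<dots>, k - 1\<close> are universally quantified
  parameters. \<open>plug p xs\<close> is \<open>p\<close> with its first free variables replaced by \<open>xs\<close> and the
  remaining ones by the parameters \<open>0, 1, \<dots>\<close>.
\<close>

definition closure :: "nat \<Rightarrow> bld \<Rightarrow> fm" where
  "closure k P = (All ^^ k) (P k)"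

definition plug :: "fm \<Rightarrow> var list \<Rightarrow> bld" where
  "plug p xs =
    (\<lambda>n. ren (\<lambda>i. n - 1 - (if i < length xs then xs ! i else i - length xs)) p)"


section \<open>Basic set-theoretic notions\<close>

definition sub :: "var \<Rightarrow> var \<Rightarrow> bld" where
  "sub x y = all_in x (\<lambda>z. z \<^bold>\<in> y)"

definition is_empty :: "var \<Rightarrow> bld" where
  "is_empty x = (\<^bold>\<forall>z. \<^bold>\<not> z \<^bold>\<in> x)"

definition is_upair :: "var \<Rightarrow> var \<Rightarrow> var \<Rightarrow> bld" where
  "is_upair p x y = (\<^bold>\<forall>z. z \<^bold>\<in> p \<^bold>\<longleftrightarrow> z \<^bold>= x \<^bold>\<or> z \<^bold>= y)"

definition is_opair :: "var \<Rightarrow> var \<Rightarrow> var \<Rightarrow> bld" where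
  "is_opair p x y = (\<^bold>\<exists>u v. is_upair u x x \<^bold>\<and> is_upair v x y \<^bold>\<and> is_upair p u v)"

definition is_bunion :: "var \<Rightarrow> var \<Rightarrow> var \<Rightarrow> bld" where
  "is_bunion c a b = (\<^bold>\<forall>z. z \<^bold>\<in> c \<^bold>\<longleftrightarrow> z \<^bold>\<in> a \<^bold>\<or> z \<^bold>\<in> b)"

definition is_succ :: "var \<Rightarrow> var \<Rightarrow> bld" where
  "is_succ y x = (\<^bold>\<forall>z. z \<^bold>\<in> y \<^bold>\<longleftrightarrow> z \<^bold>\<in> x \<^bold>\<or> z \<^bold>= x)"

definition transitive :: "var \<Rightarrow> bld" where
  "transitive x = all_in x (\<lambda>y. sub y x)"

text \<open>Well-foundedness is explicit, as Foundation is not an axiom of BST.\<close>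

definition ordinal :: "var \<Rightarrow> bld" where
  "ordinal x =
    (transitive x \<^bold>\<and>
     all_in x (\<lambda>y. all_in x (\<lambda>z. y \<^bold>\<in> z \<^bold>\<or> y \<^bold>= z \<^bold>\<or> z \<^bold>\<in> y)) \<^bold>\<and>
     (\<^bold>\<forall>u. sub u x \<^bold>\<and> \<^bold>\<not> is_empty u \<^bold>\<longrightarrow> ex_in u (\<lambda>y. all_in u (\<lambda>z. \<^bold>\<not> z \<^bold>\<in> y))))"

definition limit :: "var \<Rightarrow> bld" where
  "limit x = (ordinal x \<^bold>\<and> \<^bold>\<not> is_empty x \<^bold>\<and> all_in x (\<lambda>y. ex_in x (\<lambda>z. y \<^bold>\<in> z)))"

definition is_omega :: "var \<Rightarrow> bld" where
  "is_omega w = (limit w \<^bold>\<and> all_in w (\<lambda>y. \<^bold>\<not> limit y))"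

definition natural :: "var \<Rightarrow> bld" where
  "natural n = (\<^bold>\<exists>w. is_omega w \<^bold>\<and> n \<^bold>\<in> w)"

primrec is_num :: "nat \<Rightarrow> var \<Rightarrow> bld" where
  "is_num 0 x = is_empty x"
| "is_num (Suc k) x = (\<^bold>\<exists>y. is_num k y \<^bold>\<and> is_succ x y)"

text \<open>\<open>app f x y\<close> says \<open>f(x) = y\<close>.\<close>

definition app :: "var \<Rightarrow> var \<Rightarrow> var \<Rightarrow> bld" where
  "app f x y = (\<^bold>\<exists>p. is_opair p x y \<^bold>\<and> p \<^bold>\<in> f)"

definition is_fun_on :: "var \<Rightarrow> var \<Rightarrow> bld" where
  "is_fun_on f a =
    (all_in f (\<lambda>p. ex_in a (\<lambda>x. \<^bold>\<exists>y. is_opair p x y)) \<^bold>\<and> all_in a (\<lambda>x. \<^bold>\<exists>\<^bold>!y. app f x y))"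

definition is_fun :: "var \<Rightarrow> var \<Rightarrow> var \<Rightarrow> bld" where
  "is_fun f a b = (is_fun_on f a \<^bold>\<and> (\<^bold>\<forall>x y. app f x y \<^bold>\<longrightarrow> y \<^bold>\<in> b))"

text \<open>\<open>is_upd t s i x\<close> says \<open>t = s(i := x)\<close>, for a function \<open>s\<close> on \<open>n\<close>.\<close>

definition is_upd :: "var \<Rightarrow> var \<Rightarrow> var \<Rightarrow> var \<Rightarrow> var \<Rightarrow> bld" where
  "is_upd n t s i x =
    (is_fun_on t n \<^bold>\<and> app t i x \<^bold>\<and>
     all_in n (\<lambda>j. \<^bold>\<not> j \<^bold>= i \<^bold>\<longrightarrow> (\<^bold>\<forall>y. app s j y \<^bold>\<longrightarrow> app t j y)))"

text \<open>\<open>cofinal_map b a\<close>: some \<open>f : b \<rightarrow> a\<close> has unbounded range in the ordinal \<open>a\<close>.\<close>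

definition cofinal_map :: "var \<Rightarrow> var \<Rightarrow> bld" where
  "cofinal_map b a =
    (\<^bold>\<exists>f. is_fun f b a \<^bold>\<and>
      all_in a (\<lambda>x. ex_in b (\<lambda>i. \<^bold>\<exists>y. app f i y \<^bold>\<and> (x \<^bold>\<in> y \<^bold>\<or> x \<^bold>= y))))"

definition is_cf :: "var \<Rightarrow> var \<Rightarrow> bld" where
  "is_cf a b = (ordinal b \<^bold>\<and> cofinal_map b a \<^bold>\<and> all_in b (\<lambda>c. \<^bold>\<not> cofinal_map c a))"

definition cf_omega :: "var \<Rightarrow> bld" where
  "cf_omega a = (\<^bold>\<exists>w. is_omega w \<^bold>\<and> is_cf a w)"


section \<open>First-order languages and structures, inside set theory\<close>

text \<open>
  A language is given by disjoint sets \<open>R\<close> and \<open>F\<close> of relation and function symbols and an arity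
  function \<open>a : R \<union> F \<rightarrow> \<omega>\<close>; constants are function symbols of arity 0. A structure is a pair
  \<open>(A, I)\<close>, where tuples of length \<open>k\<close> are functions with domain \<open>k\<close>.
\<close>

definition is_lang :: "var \<Rightarrow> var \<Rightarrow> var \<Rightarrow> bld" where
  "is_lang R F a =
    (all_in R (\<lambda>x. \<^bold>\<not> x \<^bold>\<in> F) \<^bold>\<and> (\<^bold>\<exists>d w. is_bunion d R F \<^bold>\<and> is_omega w \<^bold>\<and> is_fun a d w))"

definition is_struct :: "var \<Rightarrow> var \<Rightarrow> var \<Rightarrow> var \<Rightarrow> bld" where
  "is_struct R F a X =
    (\<^bold>\<exists>A I d. is_opair X A I \<^bold>\<and> \<^bold>\<not> is_empty A \<^bold>\<and> is_bunion d R F \<^bold>\<and> is_fun_on I d \<^bold>\<and>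
      all_in R (\<lambda>r. \<^bold>\<exists>k e. app a r k \<^bold>\<and> app I r e \<^bold>\<and> all_in e (\<lambda>u. is_fun u k A)) \<^bold>\<and>
      all_in F (\<lambda>f. \<^bold>\<exists>k g. app a f k \<^bold>\<and> app I f g \<^bold>\<and>
        all_in g (\<lambda>p. \<^bold>\<exists>u y. is_opair p u y \<^bold>\<and> is_fun u k A \<^bold>\<and> y \<^bold>\<in> A) \<^bold>\<and>
        (\<^bold>\<forall>u. is_fun u k A \<^bold>\<longrightarrow> (\<^bold>\<exists>\<^bold>!y. app g u y))))"

text \<open>
  \<open>generated Q x\<close>: there is a finite sequence ending with \<open>x\<close>, each of whose entries \<open>y\<close>
  satisfies \<open>Q prev y\<close>, where \<open>prev z\<close> says that \<open>z\<close> is an earlier entry.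
\<close>

definition generated :: "((var \<Rightarrow> bld) \<Rightarrow> var \<Rightarrow> bld) \<Rightarrow> var \<Rightarrow> bld" where
  "generated Q x =
    (\<^bold>\<exists>m k f. natural m \<^bold>\<and> is_succ k m \<^bold>\<and> is_fun_on f k \<^bold>\<and> app f m x \<^bold>\<and>
      all_in k (\<lambda>i. \<^bold>\<exists>y. app f i y \<^bold>\<and> Q (\<lambda>z. ex_in i (\<lambda>j. app f j z)) y))"

text \<open>
  Codes of terms and formulas:
  variable \<open>v_i\<close> is \<open>(0, i)\<close>, term \<open>f(u)\<close> is \<open>(1, (f, u))\<close>;
  formula \<open>t = t'\<close> is \<open>(0, (t, t'))\<close>, \<open>r(u)\<close> is \<open>(1, (r, u))\<close>, falsity is \<open>(2, \<emptyset>)\<close>,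
  \<open>p \<rightarrow> q\<close> is \<open>(3, (p, q))\<close>, \<open>\<forall>v_i p\<close> is \<open>(4, (i, p))\<close>.
  The argument \<open>n\<close> below restricts (free and bound) variables to \<open>v_0, \<dots>, v_(n-1)\<close>, so that
  functions on \<open>n\<close> are the relevant assignments.
\<close>

definition node :: "nat \<Rightarrow> var \<Rightarrow> var \<Rightarrow> bld" where
  "node k c x = (\<^bold>\<exists>t. is_num k t \<^bold>\<and> is_opair c t x)"

definition node2 :: "nat \<Rightarrow> var \<Rightarrow> var \<Rightarrow> var \<Rightarrow> bld" where
  "node2 k c x y = (\<^bold>\<exists>p. is_opair p x y \<^bold>\<and> node k c p)"

definition c_var :: "var \<Rightarrow> var \<Rightarrow> bld" where "c_var = node 0"
definition c_fun :: "var \<Rightarrow> var \<Rightarrow> var \<Rightarrow> bld" where "c_fun = node2 1"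
definition c_eq :: "var \<Rightarrow> var \<Rightarrow> var \<Rightarrow> bld" where "c_eq = node2 0"
definition c_rel :: "var \<Rightarrow> var \<Rightarrow> var \<Rightarrow> bld" where "c_rel = node2 1"
definition c_bot :: "var \<Rightarrow> bld" where "c_bot c = (\<^bold>\<exists>e. is_empty e \<^bold>\<and> node 2 c e)"
definition c_imp :: "var \<Rightarrow> var \<Rightarrow> var \<Rightarrow> bld" where "c_imp = node2 3"
definition c_all :: "var \<Rightarrow> var \<Rightarrow> var \<Rightarrow> bld" where "c_all = node2 4"

definition c_not :: "var \<Rightarrow> var \<Rightarrow> bld" where
  "c_not c p = (\<^bold>\<exists>b. c_bot b \<^bold>\<and> c_imp c p b)"

definition c_ex :: "var \<Rightarrow> var \<Rightarrow> var \<Rightarrow> bld" where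
  "c_ex c i p = (\<^bold>\<exists>q r. c_not q p \<^bold>\<and> c_all r i q \<^bold>\<and> c_not c r)"

definition is_term :: "var \<Rightarrow> var \<Rightarrow> var \<Rightarrow> var \<Rightarrow> bld" where
  "is_term F a n =
    generated (\<lambda>prev t.
      ex_in n (\<lambda>i. c_var t i) \<^bold>\<or>
      ex_in F (\<lambda>f. \<^bold>\<exists>k u. app a f k \<^bold>\<and> is_fun_on u k \<^bold>\<and>
        (\<^bold>\<forall>i z. app u i z \<^bold>\<longrightarrow> prev z) \<^bold>\<and> c_fun t f u))"

definition term_tuple :: "var \<Rightarrow> var \<Rightarrow> var \<Rightarrow> var \<Rightarrow> var \<Rightarrow> bld" where
  "term_tuple F a n k u =
    (is_fun_on u k \<^bold>\<and> (\<^bold>\<forall>i z. app u i z \<^bold>\<longrightarrow> is_term F a n z))"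

definition is_form :: "var \<Rightarrow> var \<Rightarrow> var \<Rightarrow> var \<Rightarrow> var \<Rightarrow> bld" where
  "is_form R F a n =
    generated (\<lambda>prev c.
      (\<^bold>\<exists>t t'. is_term F a n t \<^bold>\<and> is_term F a n t' \<^bold>\<and> c_eq c t t') \<^bold>\<or>
      ex_in R (\<lambda>r. \<^bold>\<exists>k u. app a r k \<^bold>\<and> term_tuple F a n k u \<^bold>\<and> c_rel c r u) \<^bold>\<or>
      c_bot c \<^bold>\<or>
      (\<^bold>\<exists>p q. prev p \<^bold>\<and> prev q \<^bold>\<and> c_imp c p q) \<^bold>\<or>
      ex_in n (\<lambda>i. \<^bold>\<exists>p. prev p \<^bold>\<and> c_all c i p))"

text \<open>
  Tarski's clauses. \<open>V\<close> gives the values of terms and \<open>S\<close> the satisfaction relation of the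
  structure \<open>(A, I)\<close>, for terms, formulas and assignments in the variables below \<open>n\<close>.
\<close>

definition value_is :: "var \<Rightarrow> var \<Rightarrow> var \<Rightarrow> var \<Rightarrow> bld" where
  "value_is V t s x = (\<^bold>\<exists>q. is_opair q t s \<^bold>\<and> app V q x)"

definition values_are :: "var \<Rightarrow> var \<Rightarrow> var \<Rightarrow> var \<Rightarrow> var \<Rightarrow> var \<Rightarrow> bld" where
  "values_are V A k u s w =
    (is_fun w k A \<^bold>\<and> all_in k (\<lambda>i. \<^bold>\<exists>t x. app u i t \<^bold>\<and> app w i x \<^bold>\<and> value_is V t s x))"

definition term_values :: "var \<Rightarrow> var \<Rightarrow> var \<Rightarrow> var \<Rightarrow> var \<Rightarrow> var \<Rightarrow> bld" where
  "term_values F a A I n V =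
    (\<^bold>\<forall>s. is_fun s n A \<^bold>\<longrightarrow>
      (\<^bold>\<forall>i t x. i \<^bold>\<in> n \<^bold>\<and> c_var t i \<^bold>\<longrightarrow> (value_is V t s x \<^bold>\<longleftrightarrow> app s i x)) \<^bold>\<and>
      (\<^bold>\<forall>f k u t x. f \<^bold>\<in> F \<^bold>\<and> app a f k \<^bold>\<and> term_tuple F a n k u \<^bold>\<and> c_fun t f u \<^bold>\<longrightarrow>
        (value_is V t s x \<^bold>\<longleftrightarrow> (\<^bold>\<exists>w g. values_are V A k u s w \<^bold>\<and> app I f g \<^bold>\<and> app g w x))))"

definition sat_rel ::
  "var \<Rightarrow> var \<Rightarrow> var \<Rightarrow> var \<Rightarrow> var \<Rightarrow> var \<Rightarrow> var \<Rightarrow> bld" where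
  "sat_rel R F a A I n S =
    (\<^bold>\<exists>V. term_values F a A I n V \<^bold>\<and>
     (\<^bold>\<forall>s. is_fun s n A \<^bold>\<longrightarrow>
      (\<^bold>\<forall>t t' c. is_term F a n t \<^bold>\<and> is_term F a n t' \<^bold>\<and> c_eq c t t' \<^bold>\<longrightarrow>
        (app S c s \<^bold>\<longleftrightarrow> (\<^bold>\<exists>x. value_is V t s x \<^bold>\<and> value_is V t' s x))) \<^bold>\<and>
      (\<^bold>\<forall>r k u c. r \<^bold>\<in> R \<^bold>\<and> app a r k \<^bold>\<and> term_tuple F a n k u \<^bold>\<and> c_rel c r u \<^bold>\<longrightarrow>
        (app S c s \<^bold>\<longleftrightarrow> (\<^bold>\<exists>w e. values_are V A k u s w \<^bold>\<and> app I r e \<^bold>\<and> w \<^bold>\<in> e))) \<^bold>\<and>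
      (\<^bold>\<forall>c. c_bot c \<^bold>\<longrightarrow> \<^bold>\<not> app S c s) \<^bold>\<and>
      (\<^bold>\<forall>p q c. is_form R F a n p \<^bold>\<and> is_form R F a n q \<^bold>\<and> c_imp c p q \<^bold>\<longrightarrow>
        (app S c s \<^bold>\<longleftrightarrow> (app S p s \<^bold>\<longrightarrow> app S q s))) \<^bold>\<and>
      (\<^bold>\<forall>i p c. i \<^bold>\<in> n \<^bold>\<and> is_form R F a n p \<^bold>\<and> c_all c i p \<^bold>\<longrightarrow>
        (app S c s \<^bold>\<longleftrightarrow>
          (\<^bold>\<forall>x s'. x \<^bold>\<in> A \<^bold>\<and> is_upd n s' s i x \<^bold>\<longrightarrow> app S p s')))))"

text \<open>\<open>sats R F a A I n p s\<close> says \<open>(A, I) \<Turnstile> p[s]\<close>.\<close>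

definition sats ::
  "var \<Rightarrow> var \<Rightarrow> var \<Rightarrow> var \<Rightarrow> var \<Rightarrow> var \<Rightarrow> var \<Rightarrow> var \<Rightarrow> bld" where
  "sats R F a A I n p s = (\<^bold>\<exists>S. sat_rel R F a A I n S \<^bold>\<and> app S p s)"

definition elementary_embedding ::
  "var \<Rightarrow> var \<Rightarrow> var \<Rightarrow> var \<Rightarrow> var \<Rightarrow> var \<Rightarrow> bld" where
  "elementary_embedding R F a j X Y =
    (\<^bold>\<exists>A I B J. is_opair X A I \<^bold>\<and> is_opair Y B J \<^bold>\<and> is_fun j A B \<^bold>\<and>
      (\<^bold>\<forall>n p s t. natural n \<^bold>\<and> is_form R F a n p \<^bold>\<and> is_fun s n A \<^bold>\<and> is_fun t n B \<^bold>\<and>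
          all_in n (\<lambda>i. \<^bold>\<exists>x y. app s i x \<^bold>\<and> app j x y \<^bold>\<and> app t i y) \<^bold>\<longrightarrow>
        (sats R F a A I n p s \<^bold>\<longleftrightarrow> sats R F a B J n p t)))"


section \<open>The structures \<open>(M, \<in>)\<close>\<close>

text \<open>The language of set theory, with \<open>0\<close> as its binary relation symbol.\<close>

definition mem_lang :: "var \<Rightarrow> var \<Rightarrow> var \<Rightarrow> bld" where
  "mem_lang R F a =
    (\<^bold>\<exists>z k p. is_num 0 z \<^bold>\<and> is_num 2 k \<^bold>\<and> is_opair p z k \<^bold>\<and>
      is_upair R z z \<^bold>\<and> is_empty F \<^bold>\<and> is_upair a p p)"

definition mem_interp :: "var \<Rightarrow> var \<Rightarrow> bld" where
  "mem_interp M I =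
    (\<^bold>\<exists>z l k E p. is_num 0 z \<^bold>\<and> is_num 1 l \<^bold>\<and> is_num 2 k \<^bold>\<and> is_opair p z E \<^bold>\<and> is_upair I p p \<^bold>\<and>
      (\<^bold>\<forall>u. u \<^bold>\<in> E \<^bold>\<longleftrightarrow> is_fun u k M \<^bold>\<and> (\<^bold>\<exists>x y. app u z x \<^bold>\<and> app u l y \<^bold>\<and> x \<^bold>\<in> y)))"

definition mem_form :: "var \<Rightarrow> var \<Rightarrow> bld" where
  "mem_form n p = (\<^bold>\<exists>R F a. mem_lang R F a \<^bold>\<and> is_form R F a n p)"

definition mem_sat_rel :: "var \<Rightarrow> var \<Rightarrow> var \<Rightarrow> bld" where
  "mem_sat_rel M n S =
    (\<^bold>\<exists>R F a I. mem_lang R F a \<^bold>\<and> mem_interp M I \<^bold>\<and> sat_rel R F a M I n S)"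

definition mem_sats :: "var \<Rightarrow> var \<Rightarrow> var \<Rightarrow> var \<Rightarrow> bld" where
  "mem_sats M n p s = (\<^bold>\<exists>S. mem_sat_rel M n S \<^bold>\<and> app S p s)"

text \<open>Codes of the formulas \<open>v_i = v_j\<close> and \<open>v_i \<in> v_j\<close>.\<close>

definition c_var_eq :: "var \<Rightarrow> var \<Rightarrow> var \<Rightarrow> bld" where
  "c_var_eq c i j = (\<^bold>\<exists>t t'. c_var t i \<^bold>\<and> c_var t' j \<^bold>\<and> c_eq c t t')"

definition c_var_mem :: "var \<Rightarrow> var \<Rightarrow> var \<Rightarrow> bld" where
  "c_var_mem c i j =
    (\<^bold>\<exists>t t' z l k u. c_var t i \<^bold>\<and> c_var t' j \<^bold>\<and> is_num 0 z \<^bold>\<and> is_num 1 l \<^bold>\<and> is_num 2 k \<^bold>\<and>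
      is_fun_on u k \<^bold>\<and> app u z t \<^bold>\<and> app u l t' \<^bold>\<and> c_rel c z u)"

definition delta0_form :: "var \<Rightarrow> var \<Rightarrow> bld" where
  "delta0_form n =
    generated (\<lambda>prev c.
      ex_in n (\<lambda>i. ex_in n (\<lambda>j. c_var_eq c i j \<^bold>\<or> c_var_mem c i j)) \<^bold>\<or>
      c_bot c \<^bold>\<or>
      (\<^bold>\<exists>p q. prev p \<^bold>\<and> prev q \<^bold>\<and> c_imp c p q) \<^bold>\<or>
      ex_in n (\<lambda>i. ex_in n (\<lambda>j. \<^bold>\<not> i \<^bold>= j \<^bold>\<and>
        (\<^bold>\<exists>p m q. prev p \<^bold>\<and> c_var_mem m i j \<^bold>\<and> c_imp q m p \<^bold>\<and> c_all c i q))))"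

definition sigma1_form :: "var \<Rightarrow> var \<Rightarrow> bld" where
  "sigma1_form n =
    generated (\<lambda>prev c. delta0_form n c \<^bold>\<or> ex_in n (\<lambda>i. \<^bold>\<exists>p. prev p \<^bold>\<and> c_ex c i p))"

definition elem_sub :: "var \<Rightarrow> var \<Rightarrow> bld" where
  "elem_sub M N =
    (sub M N \<^bold>\<and>
     (\<^bold>\<forall>n p s. natural n \<^bold>\<and> mem_form n p \<^bold>\<and> is_fun s n M \<^bold>\<longrightarrow>
       (mem_sats M n p s \<^bold>\<longleftrightarrow> mem_sats N n p s)))"

definition elem_sub_sigma1 :: "var \<Rightarrow> var \<Rightarrow> bld" where
  "elem_sub_sigma1 M N =
    (sub M N \<^bold>\<and>
     (\<^bold>\<forall>n p s. natural n \<^bold>\<and> sigma1_form n p \<^bold>\<and> is_fun s n M \<^bold>\<longrightarrow>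
       (mem_sats M n p s \<^bold>\<longleftrightarrow> mem_sats N n p s)))"


section \<open>Axioms\<close>

definition ax_empty :: bld where
  "ax_empty = (\<^bold>\<exists>x. is_empty x)"

definition ax_extensionality :: bld where
  "ax_extensionality = (\<^bold>\<forall>x y. (\<^bold>\<forall>z. z \<^bold>\<in> x \<^bold>\<longleftrightarrow> z \<^bold>\<in> y) \<^bold>\<longrightarrow> x \<^bold>= y)"

definition ax_pair :: bld where
  "ax_pair = (\<^bold>\<forall>x y. \<^bold>\<exists>p. is_upair p x y)"

definition ax_union :: bld where
  "ax_union = (\<^bold>\<forall>x. \<^bold>\<exists>u. \<^bold>\<forall>z. z \<^bold>\<in> u \<^bold>\<longleftrightarrow> ex_in x (\<lambda>y. z \<^bold>\<in> y))"

definition ax_product :: bld where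
  "ax_product =
    (\<^bold>\<forall>a b. \<^bold>\<exists>c. \<^bold>\<forall>z. z \<^bold>\<in> c \<^bold>\<longleftrightarrow> ex_in a (\<lambda>x. ex_in b (\<lambda>y. is_opair z x y)))"

definition ax_omega :: bld where
  "ax_omega = (\<^bold>\<exists>w. is_omega w)"

definition ax_infinity :: bld where
  "ax_infinity =
    (\<^bold>\<exists>w. ex_in w (\<lambda>e. is_empty e) \<^bold>\<and> all_in w (\<lambda>x. ex_in w (\<lambda>y. is_succ y x)))"

definition ax_foundation :: bld where
  "ax_foundation = (\<^bold>\<forall>x. \<^bold>\<not> is_empty x \<^bold>\<longrightarrow> ex_in x (\<lambda>y. all_in x (\<lambda>z. \<^bold>\<not> z \<^bold>\<in> y)))"

definition ax_power :: bld where
  "ax_power = (\<^bold>\<forall>x. \<^bold>\<exists>p. \<^bold>\<forall>z. z \<^bold>\<in> p \<^bold>\<longleftrightarrow> sub z x)"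

definition ax_choice :: bld where
  "ax_choice =
    (\<^bold>\<forall>x. all_in x (\<lambda>y. \<^bold>\<not> is_empty y) \<^bold>\<and>
        all_in x (\<lambda>y. all_in x (\<lambda>z. (\<^bold>\<exists>v. v \<^bold>\<in> y \<^bold>\<and> v \<^bold>\<in> z) \<^bold>\<longrightarrow> y \<^bold>= z)) \<^bold>\<longrightarrow>
      (\<^bold>\<exists>c. all_in x (\<lambda>y. \<^bold>\<exists>\<^bold>!v. v \<^bold>\<in> y \<^bold>\<and> v \<^bold>\<in> c)))"

definition separation :: "nat \<Rightarrow> fm \<Rightarrow> fm" where
  "separation k p =
    closure k (\<^bold>\<forall>a. \<^bold>\<exists>b. \<^bold>\<forall>x. x \<^bold>\<in> b \<^bold>\<longleftrightarrow> x \<^bold>\<in> a \<^bold>\<and> plug p [x])"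

definition replacement :: "nat \<Rightarrow> fm \<Rightarrow> fm" where
  "replacement k p =
    closure k (\<^bold>\<forall>a.
      all_in a (\<lambda>x. \<^bold>\<forall>y z. plug p [x, y] \<^bold>\<and> plug p [x, z] \<^bold>\<longrightarrow> y \<^bold>= z) \<^bold>\<longrightarrow>
      (\<^bold>\<exists>b. \<^bold>\<forall>y. y \<^bold>\<in> b \<^bold>\<longleftrightarrow> ex_in a (\<lambda>x. plug p [x, y])))"

definition BST :: "fm set" where
  "BST =
    (\<lambda>P. P 0) ` {ax_empty, ax_extensionality, ax_pair, ax_union, ax_product, ax_omega} \<union>
    {separation k p | k p. scoped (k + 1) p \<and> delta0 p}"

definition zfc_single_axioms :: "bld list" where
  "zfc_single_axioms =
    [ax_extensionality, ax_foundation, ax_pair, ax_union, ax_power, ax_infinity, ax_choice]"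

definition ZFC :: "fm set" where
  "ZFC =
    (\<lambda>P. P 0) ` set zfc_single_axioms \<union>
    {separation k p | k p. scoped (k + 1) p} \<union>
    {replacement k p | k p. scoped (k + 2) p}"

text \<open>
  \<open>X_p\<close> being a proper class means that it is not a set; without full Separation this is weaker
  than being unbounded.
\<close>

definition vopenka :: "nat \<Rightarrow> fm \<Rightarrow> fm" where
  "vopenka k p =
    closure k (\<^bold>\<forall>R F a.
      is_lang R F a \<^bold>\<and>
      (\<^bold>\<forall>x. plug p [x] \<^bold>\<longrightarrow> is_struct R F a x) \<^bold>\<and>
      \<^bold>\<not> (\<^bold>\<exists>c. \<^bold>\<forall>x. x \<^bold>\<in> c \<^bold>\<longleftrightarrow> plug p [x]) \<^bold>\<longrightarrow>
      (\<^bold>\<exists>x y. plug p [x] \<^bold>\<and> plug p [y] \<^bold>\<and> \<^bold>\<not> x \<^bold>= y \<^bold>\<and>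
        (\<^bold>\<exists>j. elementary_embedding R F a j x y)))"

definition VP :: "fm set" where
  "VP = {vopenka k p | k p. scoped (k + 1) p}"


section \<open>Transitive models of ZFC and localization\<close>

text \<open>
  The two schemes in \<open>M\<close>, for the formula coded by \<open>p\<close> with parameters \<open>s\<close>, spelled out by
  Tarski's clauses; the distinguished variables are \<open>v_0\<close>, respectively \<open>v_0\<close> and \<open>v_1\<close>.
\<close>

definition sat_at :: "var \<Rightarrow> var \<Rightarrow> var \<Rightarrow> var \<Rightarrow> var \<Rightarrow> bld" where
  "sat_at M n p s x =
    (\<^bold>\<exists>i s'. is_num 0 i \<^bold>\<and> is_upd n s' s i x \<^bold>\<and> mem_sats M n p s')"

definition sat_at2 :: "var \<Rightarrow> var \<Rightarrow> var \<Rightarrow> var \<Rightarrow> var \<Rightarrow> var \<Rightarrow> bld" where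
  "sat_at2 M n p s x y =
    (\<^bold>\<exists>i j s' s''. is_num 0 i \<^bold>\<and> is_num 1 j \<^bold>\<and>
      is_upd n s' s i x \<^bold>\<and> is_upd n s'' s' j y \<^bold>\<and> mem_sats M n p s'')"

definition sat_separation :: "var \<Rightarrow> bld" where
  "sat_separation M =
    (\<^bold>\<forall>z n p s. is_num 0 z \<^bold>\<and> natural n \<^bold>\<and> z \<^bold>\<in> n \<^bold>\<and> mem_form n p \<^bold>\<and> is_fun s n M \<^bold>\<longrightarrow>
      all_in M (\<lambda>a. ex_in M (\<lambda>b. all_in M (\<lambda>x.
        x \<^bold>\<in> b \<^bold>\<longleftrightarrow> x \<^bold>\<in> a \<^bold>\<and> sat_at M n p s x))))"

definition sat_replacement :: "var \<Rightarrow> bld" where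
  "sat_replacement M =
    (\<^bold>\<forall>l n p s. is_num 1 l \<^bold>\<and> natural n \<^bold>\<and> l \<^bold>\<in> n \<^bold>\<and> mem_form n p \<^bold>\<and> is_fun s n M \<^bold>\<longrightarrow>
      all_in M (\<lambda>a.
        all_in M (\<lambda>x. x \<^bold>\<in> a \<^bold>\<longrightarrow> all_in M (\<lambda>y. all_in M (\<lambda>z.
          sat_at2 M n p s x y \<^bold>\<and> sat_at2 M n p s x z \<^bold>\<longrightarrow> y \<^bold>= z))) \<^bold>\<longrightarrow>
        ex_in M (\<lambda>b. all_in M (\<lambda>y.
          y \<^bold>\<in> b \<^bold>\<longleftrightarrow> ex_in M (\<lambda>x. x \<^bold>\<in> a \<^bold>\<and> sat_at2 M n p s x y)))))"

text \<open>
  BST does not prove that satisfaction relations exist, and \<open>mem_sats\<close> would be identically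
  false without one; hence their existence is part of being a model.
\<close>

definition model :: "var \<Rightarrow> bld" where
  "model M =
    (transitive M \<^bold>\<and>
     (\<^bold>\<forall>n. natural n \<^bold>\<longrightarrow> (\<^bold>\<exists>S. mem_sat_rel M n S)) \<^bold>\<and>
     relativized M (conjs zfc_single_axioms) \<^bold>\<and>
     sat_separation M \<^bold>\<and> sat_replacement M)"

definition strongly_extendible :: "var \<Rightarrow> bld" where
  "strongly_extendible M = (\<^bold>\<forall>x. \<^bold>\<exists>N. model N \<^bold>\<and> x \<^bold>\<in> N \<^bold>\<and> elem_sub M N)"

definition sigma1_strongly_extendible :: "var \<Rightarrow> bld" where
  "sigma1_strongly_extendible M = (\<^bold>\<forall>x. \<^bold>\<exists>N. model N \<^bold>\<and> x \<^bold>\<in> N \<^bold>\<and> elem_sub_sigma1 M N)"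

definition special :: "var \<Rightarrow> bld" where
  "special M =
    all_in M (\<lambda>a. ordinal a \<^bold>\<longrightarrow> (relativized M (cf_omega a) \<^bold>\<longleftrightarrow> cf_omega a))"

definition Loc :: "fm" where
  "Loc = (\<^bold>\<forall>x. \<^bold>\<exists>M. x \<^bold>\<in> M \<^bold>\<and> model M) 0"

definition Loc_prop :: "(var \<Rightarrow> bld) \<Rightarrow> fm" where
  "Loc_prop P = (\<^bold>\<forall>x. \<^bold>\<exists>M. x \<^bold>\<in> M \<^bold>\<and> model M \<^bold>\<and> P M) 0"

definition LZFC :: "fm set" where
  "LZFC = BST \<union> {Loc}"

definition LZFC_prop :: "(var \<Rightarrow> bld) \<Rightarrow> fm set" where
  "LZFC_prop P = LZFC \<union> {Loc_prop P}"

end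

theory Submission
  imports Defs "HOL-Library.Countable_Set"
begin

text \<open>By completeness it suffices that the theories have the same models with domain \<open>nat\<close>.

  Over LZFC, VP applied to one-element structures shows that a class whose members are told apart
  by subsets of a fixed set is a set; this gives full Separation, Power Set and Replacement, while
  Foundation, Infinity and Choice are inherited from the models containing a given set.

  Conversely, work in ZFC + VP and let \<open>M\<close> range over the levels of the cumulative hierarchy that
  satisfy second-order ZFC and contain a given set. They are special models. If none of them were
  strongly extendible, each would have a least level \<open>W M\<close> that no elementary extension contains.
  VP applied to structures coding a level \<open>X\<close> together with the \<open>W M\<close> for \<open>M \<in> X\<close> and for
  \<open>M = X\<close> yields a nontrivial embedding \<open>j\<close>. By Kunen's argument \<open>j\<close> is the identity on every
  level that it fixes. The union \<open>K\<close> of these levels satisfies second-order ZFC, is moved by \<open>j\<close>,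
  and is an elementary submodel of \<open>j K\<close>; since \<open>j\<close> fixes \<open>W K\<close>, we get
  \<open>W K \<in> K \<subseteq> j K\<close>, contradicting the choice of \<open>W K\<close>.\<close>

section \<open>Renaming, weakening and compactness\<close>

text \<open>In VP a proper class is a class that is not a set. Over LZFC this reading turns VP into
  a comprehension principle; over ZFC it just means unbounded. VP concerns definable classes, so
  every class and structure below has to be shown definable with parameters, and where only BST
  supplies sets even by \<open>delta0\<close> formulas. An elementary embedding carries no
  information unless satisfaction relations exist, so their existence is proved first. After that
  atomic formulas suffice, because a structure may carry any definable relation of the universe,
  satisfaction in \<open>M\<close> included; this is how \<open>K\<close> becomes an elementary
  submodel of \<open>j K\<close>. That \<open>j\<close> fixes \<open>W K\<close> is a squeeze.
  Elementary extension is transitive, so a level in no extension of \<open>K\<close> is in no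
  extension of \<open>j K\<close>, and \<open>j (W K)\<close>, being \<open>W (j K)\<close>, does
  not exceed \<open>W K\<close>; on the other hand an embedding lowers no level. It is not known
  beforehand which level \<open>K\<close> will be, only that it is at most \<open>X\<close>; hence
  the structure for \<open>X\<close> has to contain the witnesses of all levels up to
  \<open>X\<close>.\<close>

abbreviation neg :: "fm \<Rightarrow> fm" where "neg p \<equiv> Imp p Bot"

primrec fv :: "fm \<Rightarrow> nat set" where
  "fv (Mem i j) = {i, j}"
| "fv (Eq i j) = {i, j}"
| "fv Bot = {}"
| "fv (Imp p q) = fv p \<union> fv q"
| "fv (All p) = {i. Suc i \<in> fv p}"

lemma ren_cong: "(\<And>i. i \<in> fv p \<Longrightarrow> f i = g i) \<Longrightarrow> ren f p = ren g p"
proof (induction p arbitrary: f g)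
  case (Imp p q)
  from Imp.prems have "ren f p = ren g p" "ren f q = ren g q" by (auto intro!: Imp.IH)
  then show ?case by simp
next
  case (All p)
  have "ren (case_nat 0 (\<lambda>i. Suc (f i))) p = ren (case_nat 0 (\<lambda>i. Suc (g i))) p"
  proof (rule All.IH)
    show "case_nat 0 (\<lambda>i. Suc (f i)) i = case_nat 0 (\<lambda>i. Suc (g i)) i" if "i \<in> fv p" for i
      using that All.prems by (cases i) auto
  qed
  then show ?case by simp
qed simp_all

lemma ren_ren: "ren f (ren g p) = ren (f \<circ> g) p"
proof (induction p arbitrary: f g)
  case (All p)
  have "case_nat 0 (\<lambda>i. Suc (f i)) \<circ> case_nat 0 (\<lambda>i. Suc (g i)) = case_nat 0 (\<lambda>i. Suc ((f \<circ> g) i))"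
    by (rule ext) (simp split: nat.split)
  with All[of "case_nat 0 (\<lambda>i. Suc (f i))" "case_nat 0 (\<lambda>i. Suc (g i))"] show ?case
    unfolding ren.simps by argo
next
  case (Imp p q)
  then show ?case by (simp only: ren.simps)
qed simp_all

lemma ren_id [simp]: "ren (\<lambda>i. i) p = p"
proof (induction p)
  case (All p)
  have "case_nat 0 Suc = (\<lambda>i. i)" by (rule ext) (simp split: nat.split)
  with All show ?case by simp
qed auto

lemma finite_fv: "finite (fv p)"
proof (induction p)
  case (All p)
  have "finite (Suc -` fv p)" by (rule finite_vimageI[OF All]) simp
  then show ?case by (simp add: vimage_def)
qed simp_all

lemma fv_ren: "fv (ren f p) \<subseteq> f ` fv p"
proof (induction p arbitrary: f)
  case (All p)
  show ?case
  proof
    fix i assume "i \<in> fv (ren f (All p))"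
    then have "Suc i \<in> fv (ren (case_nat 0 (\<lambda>i. Suc (f i))) p)" by simp
    with All have "Suc i \<in> case_nat 0 (\<lambda>i. Suc (f i)) ` fv p" by blast
    then obtain k where k: "k \<in> fv p" "Suc i = case_nat 0 (\<lambda>i. Suc (f i)) k" by blast
    then show "i \<in> f ` fv (All p)" by (cases k) auto
  qed
next
  case (Imp p q)
  then show ?case unfolding ren.simps fv.simps image_Un by blast
qed auto

lemma ren_inst: "ren f (inst i p) = inst (f i) (ren (case_nat 0 (\<lambda>k. Suc (f k))) p)"
proof -
  have "f \<circ> case_nat i (\<lambda>k. k) = case_nat (f i) (\<lambda>k. k) \<circ> case_nat 0 (\<lambda>k. Suc (f k))"
    by (rule ext) (simp split: nat.split)
  then show ?thesis by (simp only: ren_ren)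
qed

lemma proves_mono: "T \<turnstile> p \<Longrightarrow> T \<subseteq> T' \<Longrightarrow> T' \<turnstile> p"
proof (induction arbitrary: T' rule: proves.induct)
  case (impI p T q)
  then show ?case by (meson insert_mono proves.impI)
next
  case (raa p T)
  then show ?case by (meson insert_mono proves.raa)
next
  case (allI T p)
  then show ?case by (meson image_mono proves.allI)
next
  case (impE T p q)
  then show ?case by (meson proves.impE)
next
  case (allE T p i)
  show ?case by (rule proves.allE, rule allE.IH, rule allE.prems)
next
  case (eq_subst T i j p)
  show ?case by (rule proves.eq_subst[of _ i j p]) (use eq_subst in auto)
qed (auto intro: proves.assm proves.eq_refl)

lemma proves_ren: "T \<turnstile> p \<Longrightarrow> ren f ` T \<turnstile> ren f p"
proof (induction arbitrary: f rule: proves.induct)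
  case (impI p T q)
  from impI.IH[of f] show ?case by (auto intro: proves.impI)
next
  case (raa p T)
  from raa.IH[of f] show ?case by (auto intro: proves.raa)
next
  case (impE T p q)
  then show ?case by (metis proves.impE ren.simps(4))
next
  case (allI T p)
  let ?f = "case_nat 0 (\<lambda>i. Suc (f i))"
  have "?f \<circ> Suc = Suc \<circ> f" by auto
  then have "ren ?f ` (ren Suc ` T) = ren Suc ` (ren f ` T)"
    by (simp add: image_image ren_ren)
  with allI.IH[of ?f] show ?case by (simp add: proves.allI)
next
  case (allE T p i)
  from allE.IH[of f] have "ren f ` T \<turnstile> All (ren (case_nat 0 (\<lambda>i. Suc (f i))) p)" by simp
  from proves.allE[OF this, of "f i"] show ?case by (simp add: ren_inst)
next
  case (eq_subst T i j p)
  let ?p = "ren (case_nat 0 (\<lambda>k. Suc (f k))) p"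
  have "ren f ` T \<turnstile> Eq (f i) (f j)" using eq_subst.IH(1)[of f] by simp
  moreover have "ren f ` T \<turnstile> inst (f i) ?p" using eq_subst.IH(2)[of f] unfolding ren_inst .
  ultimately show ?case unfolding ren_inst by (rule proves.eq_subst)
qed (auto intro: proves.assm proves.eq_refl)

lemma proves_finite: "T \<turnstile> p \<Longrightarrow> \<exists>F. finite F \<and> F \<subseteq> T \<and> F \<turnstile> p"
proof (induction rule: proves.induct)
  case (assm p T)
  then show ?case by (intro exI[of _ "{p}"]) (auto intro: proves.assm)
next
  case (impI p T q)
  then obtain F where F: "finite F" "F \<subseteq> insert p T" "F \<turnstile> q" by blast
  have "F - {p} \<turnstile> Imp p q" by (rule proves.impI, rule proves_mono[OF F(3)]) blast
  with F show ?case by (intro exI[of _ "F - {p}"]) auto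
next
  case (impE T p q)
  then obtain F G where F: "finite F" "F \<subseteq> T" "F \<turnstile> Imp p q" and G: "finite G" "G \<subseteq> T" "G \<turnstile> p"
    by blast
  have "F \<union> G \<turnstile> Imp p q" "F \<union> G \<turnstile> p" using F(3) G(3) by (auto elim: proves_mono)
  then have "F \<union> G \<turnstile> q" by (rule proves.impE)
  with F G show ?case by (intro exI[of _ "F \<union> G"]) auto
next
  case (raa p T)
  then obtain F where F: "finite F" "F \<subseteq> insert (neg p) T" "F \<turnstile> Bot" by blast
  have "F - {neg p} \<turnstile> p" by (rule proves.raa, rule proves_mono[OF F(3)]) blast
  with F show ?case by (intro exI[of _ "F - {neg p}"]) auto
next
  case (allI T p)
  then obtain F where F: "finite F" "F \<subseteq> ren Suc ` T" "F \<turnstile> p" by blast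
  then obtain G where "finite G" "G \<subseteq> T" "F = ren Suc ` G" by (metis finite_subset_image)
  with F show ?case by (auto intro: proves.allI)
next
  case (allE T p i)
  then obtain F where "finite F" "F \<subseteq> T" "F \<turnstile> All p" by blast
  then show ?case by (intro exI[of _ F] conjI proves.allE)
next
  case (eq_refl T i)
  then show ?case by (intro exI[of _ "{}"]) (auto intro: proves.eq_refl)
next
  case (eq_subst T i j p)
  then obtain F G where F: "finite F" "F \<subseteq> T" "F \<turnstile> Eq i j" and G: "finite G" "G \<subseteq> T" "G \<turnstile> inst i p"
    by blast
  have "F \<union> G \<turnstile> Eq i j" "F \<union> G \<turnstile> inst i p" using F(3) G(3) by (auto elim: proves_mono)
  then have "F \<union> G \<turnstile> inst j p" by (rule proves.eq_subst)
  with F G show ?case by (intro exI[of _ "F \<union> G"]) auto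
qed

section \<open>Soundness and completeness\<close>

primrec sat :: "'u set \<Rightarrow> ('u \<Rightarrow> 'u \<Rightarrow> bool) \<Rightarrow> (nat \<Rightarrow> 'u) \<Rightarrow> fm \<Rightarrow> bool" where
  "sat D E e (Mem i j) \<longleftrightarrow> E (e i) (e j)"
| "sat D E e (Eq i j) \<longleftrightarrow> e i = e j"
| "sat D E e Bot \<longleftrightarrow> False"
| "sat D E e (Imp p q) \<longleftrightarrow> (sat D E e p \<longrightarrow> sat D E e q)"
| "sat D E e (All p) \<longleftrightarrow> (\<forall>u\<in>D. sat D E (case_nat u e) p)"

lemma case_nat_comp: "case_nat u e \<circ> case_nat 0 (\<lambda>i. Suc (f i)) = case_nat u (e \<circ> f)"
  by (rule ext) (simp split: nat.split)

lemma sat_ren: "sat D E e (ren f p) \<longleftrightarrow> sat D E (e \<circ> f) p"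
  by (induction p arbitrary: e f) (simp_all add: case_nat_comp)

lemma sat_inst: "sat D E e (inst i p) \<longleftrightarrow> sat D E (case_nat (e i) e) p"
proof -
  have "e \<circ> case_nat i (\<lambda>k. k) = case_nat (e i) e" by (rule ext) (simp split: nat.split)
  then show ?thesis by (simp add: sat_ren)
qed

lemma sat_scoped: "scoped n p \<Longrightarrow> (\<And>i. i < n \<Longrightarrow> e i = e' i) \<Longrightarrow> sat D E e p \<longleftrightarrow> sat D E e' p"
proof (induction p arbitrary: n e e')
  case (All p)
  have "sat D E (case_nat u e) p \<longleftrightarrow> sat D E (case_nat u e') p" for u
    using All.prems by (intro All.IH[of "Suc n"]) (auto split: nat.split)
  then show ?case by simp
next
  case (Imp p q)
  have "sat D E e p \<longleftrightarrow> sat D E e' p" "sat D E e q \<longleftrightarrow> sat D E e' q"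
    using Imp.prems by (auto intro!: Imp.IH)
  then show ?case by simp
qed auto

lemma soundness:
  "T \<turnstile> p \<Longrightarrow> (\<And>i. e i \<in> D) \<Longrightarrow> (\<And>q. q \<in> T \<Longrightarrow> sat D E e q) \<Longrightarrow> sat D E e p"
proof (induction arbitrary: e rule: proves.induct)
  case (raa p T)
  show ?case
  proof (rule ccontr)
    assume "\<not> sat D E e p"
    then have "sat D E e Bot" using raa.prems by (intro raa.IH) auto
    then show False by simp
  qed
next
  case (allI T p)
  show ?case
  proof (simp, intro ballI)
    fix u assume u: "u \<in> D"
    show "sat D E (case_nat u e) p"
    proof (rule allI.IH)
      show "case_nat u e i \<in> D" for i using u allI.prems(1) by (simp split: nat.split)
      show "sat D E (case_nat u e) q" if "q \<in> ren Suc ` T" for q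
        using that allI.prems(2) by (auto simp: sat_ren comp_def)
    qed
  qed
next
  case (allE T p i)
  then show ?case by (auto simp: sat_inst)
next
  case (eq_subst T i j p)
  have "e i = e j" "sat D E e (inst i p)"
    using eq_subst.IH(1)[of e] eq_subst.IH(2)[of e] eq_subst.prems by auto
  then show ?case by (simp add: sat_inst)
qed auto

definition consistent :: "fm set \<Rightarrow> bool" where "consistent T \<longleftrightarrow> \<not> T \<turnstile> Bot"

lemma neg_intro: "insert p T \<turnstile> Bot \<Longrightarrow> T \<turnstile> neg p"
  by (rule proves.impI)

lemma proves_cut: "T \<turnstile> p \<Longrightarrow> insert p T \<turnstile> q \<Longrightarrow> T \<turnstile> q"
  by (meson proves.impE proves.impI)

text \<open>Because \<open>v\<close> occurs neither in \<open>T\<close> nor in \<open>All q\<close>,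
  one renaming sends \<open>v\<close> to 0 and shifts everything else. It undoes
  \<open>inst v\<close> on \<open>q\<close> and acts as \<open>Suc\<close> on \<open>T\<close>,
  which gives the premise of \<open>allI\<close>.\<close>

lemma generalize:
  assumes T: "T \<turnstile> inst v q" and v: "\<And>p. p \<in> T \<Longrightarrow> v \<notin> fv p" "v \<notin> fv (All q)"
  shows "T \<turnstile> All q"
proof (rule proves.allI)
  let ?f = "\<lambda>i. if i = v then 0 else Suc i"
  have "ren ?f ` T = ren Suc ` T"
    by (rule image_cong[OF refl], rule ren_cong) (use v in auto)
  moreover have "ren ?f (inst v q) = ren (\<lambda>i. i) q"
    unfolding ren_ren by (rule ren_cong) (use v in \<open>auto split: nat.split\<close>)
  ultimately show "ren Suc ` T \<turnstile> q" using proves_ren[OF T, of ?f] by simp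
qed

text \<open>Were the negated instance refutable, classical reasoning would prove the instance
  itself, hence \<open>All q\<close> since \<open>v\<close> is fresh, against
  \<open>neg (All q)\<close>.\<close>

lemma consistent_witness:
  assumes c: "consistent T" and T: "T \<turnstile> neg (All q)"
    and v: "\<And>p. p \<in> T \<Longrightarrow> v \<notin> fv p" "v \<notin> fv (All q)"
  shows "consistent (insert (neg (inst v q)) T)"
proof (rule ccontr)
  assume "\<not> ?thesis"
  then have "T \<turnstile> inst v q" by (simp add: consistent_def proves.raa)
  then have "T \<turnstile> All q" by (rule generalize) (use v in auto)
  with T have "T \<turnstile> Bot" by (rule proves.impE)
  with c show False by (simp add: consistent_def)
qed

instance fm :: countable by countable_datatype

section \<open>Henkin's construction of a complete consistent theory with witnesses\<close>

definition fresh :: "fm set \<Rightarrow> fm \<Rightarrow> nat" where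
  "fresh T q = (SOME v. (\<forall>p\<in>T. v \<notin> fv p) \<and> v \<notin> fv (All q))"

text \<open>The language has no constants, so free variables serve as witnesses. A negated universal
  formula receives its witness at the very stage that accepts it, while only finitely many formulas
  have been added to \<open>T\<close> and a fresh variable still exists.\<close>

primrec henkin :: "fm set \<Rightarrow> nat \<Rightarrow> fm set" where
  "henkin T 0 = T"
| "henkin T (Suc k) =
    (let p = from_nat k; S = henkin T k in
     if consistent (insert p S) then
       insert p S \<union> {neg (inst (fresh (insert p S) q) q) | q. p = neg (All q)}
     else S)"

text \<open>The even variables are those of the given theory; the odd ones serve as witnesses.\<close>

lemma henkin_finite: "\<exists>F. finite F \<and> henkin T k = T \<union> F"
proof (induction k)
  case (Suc k)
  then obtain F where F: "finite F" "henkin T k = T \<union> F" by blast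
  define p :: fm where "p = from_nat k"
  define W where "W = {neg (inst (fresh (insert p (henkin T k)) q) q) | q. p = neg (All q)}"
  have W: "finite W" by (cases "\<exists>q. p = neg (All q)") (auto simp: W_def)
  have S: "henkin T (Suc k) = (if consistent (insert p (henkin T k))
      then insert p (henkin T k) \<union> W else henkin T k)"
    unfolding henkin.simps Let_def p_def W_def ..
  show ?case
  proof (cases "consistent (insert p (henkin T k))")
    case True
    then have "henkin T (Suc k) = T \<union> insert p (F \<union> W)" unfolding S F(2) by auto
    with F(1) W show ?thesis by (intro exI[of _ "insert p (F \<union> W)"]) simp
  next
    case False
    with S F show ?thesis by (intro exI[of _ F]) simp
  qed
qed (rule exI[of _ "{}"], simp)

lemma fresh:
  assumes T: "\<And>p. p \<in> T \<Longrightarrow> fv p \<subseteq> {i. even i}"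
  shows "(\<forall>p\<in>insert r (henkin T k). fresh (insert r (henkin T k)) q \<notin> fv p)
    \<and> fresh (insert r (henkin T k)) q \<notin> fv (All q)"
proof -
  obtain F where F: "finite F" "henkin T k = T \<union> F" using henkin_finite by blast
  let ?X = "fv (All q) \<union> \<Union> (fv ` insert r F)"
  have "finite ?X" using F by (auto simp: finite_fv finite_fv[of "All q", simplified])
  moreover have "infinite {i::nat. odd i}"
  proof
    assume fin: "finite {i::nat. odd i}"
    let ?m = "2 * Max {i::nat. odd i} + 1"
    have "?m \<in> {i::nat. odd i}" by simp
    then have "?m \<le> Max {i::nat. odd i}" by (rule Max_ge[OF fin])
    then show False by simp
  qed
  ultimately have "\<not> {i. odd i} \<subseteq> ?X" using finite_subset by blast
  then obtain v where v: "odd v" "v \<notin> ?X" by blast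
  show ?thesis unfolding fresh_def
    by (rule someI[of _ v]) (use v F T in auto)
qed

lemma henkin_consistent:
  assumes "consistent T" and T: "\<And>p. p \<in> T \<Longrightarrow> fv p \<subseteq> {i. even i}"
  shows "consistent (henkin T k)"
proof (induction k)
  case (Suc k)
  define p :: fm where "p = from_nat k"
  let ?S = "insert p (henkin T k)"
  show ?case
  proof (cases "consistent ?S \<and> (\<exists>q. p = neg (All q))")
    case True
    then obtain q where q: "consistent ?S" "p = neg (All q)" by blast
    have "consistent (insert (neg (inst (fresh ?S q) q)) ?S)"
      using q fresh[of T p k q, OF T] by (intro consistent_witness) (auto intro: proves.assm)
    moreover have "{neg (inst (fresh ?S r) r) | r. p = neg (All r)} = {neg (inst (fresh ?S q) q)}"
      using q(2) by auto
    ultimately show ?thesis using q(1) by (simp add: Let_def p_def[symmetric])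
  next
    case False
    then show ?thesis using Suc by (auto simp: Let_def p_def[symmetric])
  qed
qed (use assms in simp)

lemma henkin_mono: "k \<le> l \<Longrightarrow> henkin T k \<subseteq> henkin T l"
  by (rule lift_Suc_mono_le) (auto simp: Let_def)

definition limit_theory :: "fm set \<Rightarrow> fm set" where "limit_theory T = (\<Union>k. henkin T k)"

text \<open>A derivation uses finitely many premises, so an inconsistency would show up at a finite
  stage; and every formula is treated at the stage numbered by its code.\<close>

lemma
  assumes c: "consistent T" and T: "\<And>p. p \<in> T \<Longrightarrow> fv p \<subseteq> {i. even i}"
  shows limit_closed: "limit_theory T \<turnstile> p \<Longrightarrow> p \<in> limit_theory T"
    and limit_complete: "p \<in> limit_theory T \<or> neg p \<in> limit_theory T"
    and limit_consistent: "Bot \<notin> limit_theory T"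
    and limit_henkin: "neg (All q) \<in> limit_theory T \<Longrightarrow> \<exists>v. neg (inst v q) \<in> limit_theory T"
proof -
  let ?S = "limit_theory T"
  have con: "consistent ?S"
  proof (rule ccontr)
    assume "\<not> consistent ?S"
    then obtain F where F: "finite F" "F \<subseteq> ?S" "F \<turnstile> Bot"
      unfolding consistent_def using proves_finite by blast
    have "\<exists>k. F \<subseteq> henkin T k" using F(1,2)
    proof (induction F)
      case (insert x F)
      then obtain k l where "F \<subseteq> henkin T k" "x \<in> henkin T l" by (auto simp: limit_theory_def)
      then have "insert x F \<subseteq> henkin T (max k l)"
        using henkin_mono[of k "max k l" T] henkin_mono[of l "max k l" T] by auto
      then show ?case by blast
    qed auto
    then obtain k where "henkin T k \<turnstile> Bot" using F(3) proves_mono by blast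
    then show False using henkin_consistent[OF c T] by (auto simp: consistent_def)
  qed
  have ins: "p \<in> ?S" if "consistent (insert p ?S)" for p
  proof -
    have k: "from_nat (to_nat p) = p" by simp
    have "insert p (henkin T (to_nat p)) \<subseteq> insert p ?S" by (auto simp: limit_theory_def)
    then have "consistent (insert p (henkin T (to_nat p)))"
      using that proves_mono unfolding consistent_def by blast
    then have "p \<in> henkin T (Suc (to_nat p))" by (simp add: Let_def k)
    then show ?thesis unfolding limit_theory_def by blast
  qed
  show closed: "p \<in> ?S" if "?S \<turnstile> p" for p
    using that con ins proves_cut unfolding consistent_def by blast
  show "Bot \<notin> ?S" using con proves.assm unfolding consistent_def by blast
  show "p \<in> ?S \<or> neg p \<in> ?S"
    using ins[of p] closed[of "neg p"] neg_intro[of p ?S] unfolding consistent_def by blast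
  show "\<exists>v. neg (inst v q) \<in> ?S" if "neg (All q) \<in> ?S"
  proof -
    let ?p = "neg (All q)"
    let ?k = "to_nat ?p"
    have k: "from_nat ?k = ?p" by simp
    have "insert ?p (henkin T ?k) \<subseteq> ?S" using that by (auto simp: limit_theory_def)
    then have "consistent (insert ?p (henkin T ?k))"
      using con proves_mono unfolding consistent_def by blast
    then have "neg (inst (fresh (insert ?p (henkin T ?k)) q) q) \<in> henkin T (Suc ?k)"
      by (simp add: Let_def k)
    then show ?thesis unfolding limit_theory_def by blast
  qed
qed

text \<open>The term model: its points are variables up to provable equality. Least representatives
  replace equivalence classes, so that the domain remains a set of natural numbers.\<close>

lemma model_existence:
  assumes c: "consistent T" and T: "\<And>p. p \<in> T \<Longrightarrow> fv p \<subseteq> {i. even i}"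
  shows "\<exists>(D :: nat set) E e. (\<forall>i. e i \<in> D) \<and> (\<forall>p\<in>T. sat D E e p)"
proof -
  let ?S = "limit_theory T"
  note closed = limit_closed[OF c T, simplified]
  note complete = limit_complete[OF c T, simplified]
  note cons = limit_consistent[OF c T, simplified]
  note henk = limit_henkin[OF c T, simplified]
  have ax: "?S \<turnstile> p" if "p \<in> ?S" for p using that by (rule proves.assm)
  have imp: "Imp p q \<in> ?S \<longleftrightarrow> (p \<in> ?S \<longrightarrow> q \<in> ?S)" for p q
  proof
    assume "Imp p q \<in> ?S"
    then show "p \<in> ?S \<longrightarrow> q \<in> ?S" using closed proves.impE[OF ax ax] by blast
  next
    assume a: "p \<in> ?S \<longrightarrow> q \<in> ?S"
    show "Imp p q \<in> ?S"
    proof (cases "p \<in> ?S")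
      case True
      then have "insert p ?S \<turnstile> q" using a by (intro proves.assm) simp
      then show ?thesis by (intro closed proves.impI)
    next
      case False
      then have "neg p \<in> ?S" using complete by blast
      then have "insert p (insert (neg q) ?S) \<turnstile> Bot"
        by (auto intro: proves.impE[OF proves.assm[of "neg p"] proves.assm[of p]])
      moreover have "insert p (insert (neg q) ?S) = insert (neg q) (insert p ?S)" by auto
      ultimately have "insert p ?S \<turnstile> q" by (metis proves.raa)
      then show ?thesis by (intro closed proves.impI)
    qed
  qed
  have all: "All p \<in> ?S \<longleftrightarrow> (\<forall>v. inst v p \<in> ?S)" for p
  proof
    assume "All p \<in> ?S"
    then show "\<forall>v. inst v p \<in> ?S" using closed[OF proves.allE[OF ax]] by blast
  next
    assume a: "\<forall>v. inst v p \<in> ?S"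
    show "All p \<in> ?S"
    proof (rule ccontr)
      assume "All p \<notin> ?S"
      then obtain v where "neg (inst v p) \<in> ?S" using complete henk by blast
      with a show False using imp cons by blast
    qed
  qed
  have refl: "Eq i i \<in> ?S" for i by (rule closed, rule proves.eq_refl)
  have subst: "inst j p \<in> ?S" if "Eq i j \<in> ?S" "inst i p \<in> ?S" for i j p
    by (rule closed, rule proves.eq_subst[OF ax ax]) (use that in auto)
  have sym: "Eq j i \<in> ?S" if "Eq i j \<in> ?S" for i j
    using subst[OF that, of "Eq 0 (Suc i)"] refl by simp
  have trans: "Eq i k \<in> ?S" if "Eq i j \<in> ?S" "Eq j k \<in> ?S" for i j k
    using subst[OF that(2), of "Eq (Suc i) 0"] that(1) by simp
  have mem: "Mem i' j' \<in> ?S" if "Eq i i' \<in> ?S" "Eq j j' \<in> ?S" "Mem i j \<in> ?S" for i i' j j'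
    using subst[OF that(1), of "Mem 0 (Suc j)"] subst[OF that(2), of "Mem (Suc i') 0"] that(3)
    by simp
  define rep where "rep i = (LEAST j. Eq i j \<in> ?S)" for i
  have rep: "Eq i (rep i) \<in> ?S" for i unfolding rep_def by (rule LeastI, rule refl)
  have rep_eq: "rep i = rep j \<longleftrightarrow> Eq i j \<in> ?S" for i j
  proof
    assume "rep i = rep j"
    then show "Eq i j \<in> ?S" using rep[of i] rep[of j] sym trans by metis
  next
    assume "Eq i j \<in> ?S"
    then have "Eq i k \<in> ?S \<longleftrightarrow> Eq j k \<in> ?S" for k using sym trans by metis
    then show "rep i = rep j" by (simp add: rep_def)
  qed
  let ?E = "\<lambda>i j. Mem i j \<in> ?S"
  let ?D = "range rep"
  \<comment> \<open>The renaming \<open>f\<close> is kept general because the case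
    \<open>All\<close> replaces the bound variable by an arbitrary \<open>v\<close>.\<close>
  have truth: "sat ?D ?E (rep \<circ> f) p \<longleftrightarrow> ren f p \<in> ?S" for p f
  proof (induction p arbitrary: f)
    case (Mem i j)
    have "Mem (rep (f i)) (rep (f j)) \<in> ?S \<longleftrightarrow> Mem (f i) (f j) \<in> ?S"
      using mem[OF rep rep] mem[OF sym[OF rep] sym[OF rep]] by blast
    then show ?case by simp
  next
    case (All p)
    have comp: "case_nat (rep v) (rep \<circ> f) = rep \<circ> case_nat v f" for v
      by (rule ext) (simp split: nat.split)
    have "case_nat v f = case_nat v (\<lambda>k. k) \<circ> case_nat 0 (\<lambda>i. Suc (f i))" for v
      by (rule ext) (simp split: nat.split)
    then have inst: "ren (case_nat v f) p = inst v (ren (case_nat 0 (\<lambda>i. Suc (f i))) p)" for v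
      by (simp only: ren_ren)
    have "sat ?D ?E (rep \<circ> f) (All p) \<longleftrightarrow> (\<forall>v. ren (case_nat v f) p \<in> ?S)"
      by (simp only: sat.simps ball_simps comp All)
    then show ?case by (simp only: inst all ren.simps)
  qed (auto simp: rep_eq cons imp)
  have "T \<subseteq> ?S" unfolding limit_theory_def using henkin.simps(1)[of T] by blast
  then have "\<forall>p\<in>T. sat ?D ?E rep p" using truth[of "\<lambda>i. i"] by (auto simp: comp_def)
  then show ?thesis by blast
qed

text \<open>Doubling all variables frees the odd ones for witnesses. Halving undoes it, so
  consistency survives, and the model is read back along \<open>?f\<close>.\<close>

lemma completeness:
  assumes "\<not> T \<turnstile> p"
  shows "\<exists>(D :: nat set) E e. (\<forall>i. e i \<in> D) \<and> (\<forall>q\<in>T. sat D E e q) \<and> \<not> sat D E e p"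
proof -
  let ?f = "\<lambda>i::nat. 2 * i"
  let ?g = "\<lambda>i::nat. i div 2"
  let ?T = "insert (neg p) T"
  have gf: "?g \<circ> ?f = (\<lambda>i. i)" by auto
  have "consistent (ren ?f ` ?T)" unfolding consistent_def
  proof
    assume "ren ?f ` ?T \<turnstile> Bot"
    from proves_ren[OF this, of ?g] have "?T \<turnstile> Bot" by (simp add: image_image ren_ren gf)
    with assms show False by (metis proves.raa)
  qed
  moreover have "fv q \<subseteq> {i. even i}" if q: "q \<in> ren ?f ` ?T" for q
  proof -
    from q obtain r where "q = ren ?f r" by blast
    then have "fv q \<subseteq> ?f ` fv r" by (simp only: fv_ren)
    also have "\<dots> \<subseteq> {i. even i}" by auto
    finally show ?thesis .
  qed
  ultimately have "\<exists>(D :: nat set) E e. (\<forall>i. e i \<in> D) \<and> (\<forall>q\<in>ren ?f ` ?T. sat D E e q)"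
    by (rule model_existence)
  then obtain D :: "nat set" and E e
    where "\<forall>i. e i \<in> D" "\<forall>q\<in>ren ?f ` ?T. sat D E e q" by blast
  then show ?thesis by (intro exI[of _ D] exI[of _ E] exI[of _ "e \<circ> ?f"]) (auto simp: sat_ren)
qed

section \<open>Transfer to models whose domain is the whole type \<open>nat\<close>\<close>

lemma sat_bij:
  assumes "bij_betw h D' D"
  shows "(\<And>i. e i \<in> D') \<Longrightarrow> sat D E (h \<circ> e) p \<longleftrightarrow> sat D' (\<lambda>x y. E (h x) (h y)) e p"
proof (induction p arbitrary: e)
  case (All p)
  have D: "(\<forall>u\<in>D. P u) \<longleftrightarrow> (\<forall>u\<in>D'. P (h u))" for P
    using assms by (auto simp: bij_betw_def)
  have comp: "case_nat (h u) (h \<circ> e) = h \<circ> case_nat u e" for u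
    by (rule ext) (simp split: nat.split)
  have "sat D E (h \<circ> case_nat u e) p \<longleftrightarrow> sat D' (\<lambda>x y. E (h x) (h y)) (case_nat u e) p"
    if "u \<in> D'" for u
    using that All.prems by (intro All.IH) (simp split: nat.split)
  then show ?case unfolding sat.simps D comp by simp
next
  case (Eq i j)
  then show ?case using assms by (auto simp: bij_betw_def inj_on_eq_iff)
qed auto

lemma sat_bld [simp]:
  "sat D E e ((x \<^bold>\<in> y) n) \<longleftrightarrow> E (e (n - 1 - x)) (e (n - 1 - y))"
  "sat D E e ((x \<^bold>= y) n) \<longleftrightarrow> e (n - 1 - x) = e (n - 1 - y)"
  "sat D E e ((P \<^bold>\<longrightarrow> Q) n) \<longleftrightarrow> (sat D E e (P n) \<longrightarrow> sat D E e (Q n))"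
  "sat D E e ((\<^bold>\<not> P) n) \<longleftrightarrow> \<not> sat D E e (P n)"
  "sat D E e ((P \<^bold>\<and> Q) n) \<longleftrightarrow> sat D E e (P n) \<and> sat D E e (Q n)"
  "sat D E e ((P \<^bold>\<or> Q) n) \<longleftrightarrow> sat D E e (P n) \<or> sat D E e (Q n)"
  "sat D E e ((P \<^bold>\<longleftrightarrow> Q) n) \<longleftrightarrow> (sat D E e (P n) \<longleftrightarrow> sat D E e (Q n))"
  "sat D E e (b_all F n) \<longleftrightarrow> (\<forall>u\<in>D. sat D E (case_nat u e) (F n (Suc n)))"
  "sat D E e (b_ex F n) \<longleftrightarrow> (\<exists>u\<in>D. sat D E (case_nat u e) (F n (Suc n)))"
  by (auto simp: b_mem_def b_eq_def b_imp_def b_not_def b_and_def b_or_def b_iff_def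
      b_all_def b_ex_def)

text \<open>A model of pairing, union and Russell's instance of separation is infinite: otherwise
  finitely many adjunctions would yield a universal set.\<close>

lemma russell_infinite:
  assumes e: "\<And>i. e i \<in> D"
    and "sat D E e (ax_pair 0)" "sat D E e (ax_union 0)" "sat D E e (separation 0 (neg (Mem 0 0)))"
  shows "infinite D"
proof
  assume fin: "finite D"
  have pair: "\<exists>p\<in>D. \<forall>z\<in>D. E z p \<longleftrightarrow> z = x \<or> z = y" if "x \<in> D" "y \<in> D" for x y
    using assms(2) that by (simp add: ax_pair_def is_upair_def)
  have union: "\<exists>u\<in>D. \<forall>z\<in>D. E z u \<longleftrightarrow> (\<exists>y\<in>D. E y x \<and> E z y)" if "x \<in> D" for x
    using assms(3) that by (simp add: ax_union_def ex_in_def)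
  have russell: "\<exists>b\<in>D. \<forall>x\<in>D. E x b \<longleftrightarrow> E x a \<and> \<not> E x x" if "a \<in> D" for a
    using assms(4) that by (simp add: separation_def closure_def plug_def)
  have "\<exists>a\<in>D. \<forall>x\<in>F. E x a" if "F \<subseteq> D" for F
    using finite_subset[OF that fin] that
  proof (induction F)
    case empty
    then show ?case using e by blast
  next
    case (insert x F)
    then obtain a where a: "a \<in> D" "\<forall>x\<in>F. E x a" by blast
    have x: "x \<in> D" using insert by blast
    obtain s where s: "s \<in> D" "\<forall>z\<in>D. E z s \<longleftrightarrow> z = x" using pair[OF x x] by blast
    obtain p where p: "p \<in> D" "\<forall>z\<in>D. E z p \<longleftrightarrow> z = a \<or> z = s" using pair[OF a(1) s(1)] by blast
    obtain u where "u \<in> D" "\<forall>z\<in>D. E z u \<longleftrightarrow> (\<exists>y\<in>D. E y p \<and> E z y)" using union[OF p(1)] by blast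
    with s p a x insert.prems show ?case by blast
  qed
  then obtain a where "a \<in> D" "\<forall>x\<in>D. E x a" by blast
  with russell[of a] show False by blast
qed

text \<open>A countermodel from completeness has a domain \<open>D\<close> inside
  \<open>nat\<close>; being infinite, it is enumerated bijectively by \<open>nat\<close>. The three
  axioms are demanded of both theories to exclude finite domains, which have no such
  enumeration.\<close>

theorem theorems_eqI:
  assumes eq: "\<And>E (e :: nat \<Rightarrow> nat).
      (\<forall>q\<in>A. sat UNIV E e q) \<longleftrightarrow> (\<forall>q\<in>B. sat UNIV E e q)"
    and A: "{ax_pair 0, ax_union 0, separation 0 (neg (Mem 0 0))} \<subseteq> A"
    and B: "{ax_pair 0, ax_union 0, separation 0 (neg (Mem 0 0))} \<subseteq> B"
  shows "theorems A = theorems B"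
proof -
  have sub: "S \<turnstile> p" if T: "T \<turnstile> p" and S: "{ax_pair 0, ax_union 0, separation 0 (neg (Mem 0 0))} \<subseteq> S"
    and ST: "\<And>E (e :: nat \<Rightarrow> nat). (\<forall>q\<in>S. sat UNIV E e q) \<Longrightarrow> (\<forall>q\<in>T. sat UNIV E e q)" for S T p
  proof (rule ccontr)
    assume "\<not> S \<turnstile> p"
    then obtain D :: "nat set" and E e
      where e: "\<And>i. e i \<in> D" and D: "\<forall>q\<in>S. sat D E e q" "\<not> sat D E e p"
      using completeness by blast
    have inf: "infinite D" by (rule russell_infinite[of e D E]) (use e D(1) S in auto)
    define h where "h = from_nat_into D"
    have h: "bij_betw h UNIV D" unfolding h_def using bij_betw_from_nat_into[OF _ inf] by simp
    define e' where "e' i = inv h (e i)" for i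
    have "h (e' i) = e i" for i
      using h e unfolding e'_def by (metis bij_betw_imp_surj_on f_inv_into_f)
    then have e': "e = h \<circ> e'" by auto
    let ?E = "\<lambda>x y. E (h x) (h y)"
    have "sat D E e q \<longleftrightarrow> sat UNIV ?E e' q" for q unfolding e' using sat_bij[OF h] by simp
    then have "\<forall>q\<in>S. sat UNIV ?E e' q" "\<not> sat UNIV ?E e' p" using D by auto
    with ST[of ?E e'] soundness[OF T, of e' UNIV ?E] show False by simp
  qed
  have "A \<turnstile> p \<longleftrightarrow> B \<turnstile> p" for p
  proof
    show "B \<turnstile> p" if "A \<turnstile> p" using that B by (rule sub) (simp only: eq)
    show "A \<turnstile> p" if "B \<turnstile> p" using that A by (rule sub) (simp only: eq)
  qed
  then show ?thesis by (simp only: theorems_def)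
qed

section \<open>Evaluating formulas in a structure\<close>

locale str =
  fixes E :: "'u \<Rightarrow> 'u \<Rightarrow> bool" (infix "\<epsilon>" 50) and d :: "nat \<Rightarrow> 'u"
begin

text \<open>\<open>e\<close> gives the values of the levels below \<open>n\<close>, \<open>d\<close> those of the variables
  that are free in the whole formula.\<close>

definition bs :: "'u set \<Rightarrow> nat \<Rightarrow> (nat \<Rightarrow> 'u) \<Rightarrow> bld \<Rightarrow> bool" where
  "bs D n e B \<longleftrightarrow> sat D E (\<lambda>i. if i < n then e (n - 1 - i) else d (i - n)) (B n)"

lemma bs_0: "bs D 0 e B \<longleftrightarrow> sat D E d (B 0)"
  by (simp add: bs_def)

lemma upd_less [simp]: "(x :: nat) < n \<Longrightarrow> (e(n := u)) x = e x"
  by auto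

lemma bs_env: "case_nat u (\<lambda>i. if i < n then e (n - 1 - i) else d (i - n)) =
    (\<lambda>i. if i < Suc n then (e(n := u)) (Suc n - 1 - i) else d (i - Suc n))"
  by (rule ext) (auto split: nat.split)

lemma bs_base [simp]:
  "x < n \<Longrightarrow> y < n \<Longrightarrow> bs D n e (x \<^bold>\<in> y) \<longleftrightarrow> e x \<epsilon> e y"
  "x < n \<Longrightarrow> y < n \<Longrightarrow> bs D n e (x \<^bold>= y) \<longleftrightarrow> e x = e y"
  "bs D n e (P \<^bold>\<longrightarrow> Q) \<longleftrightarrow> (bs D n e P \<longrightarrow> bs D n e Q)"
  "bs D n e (\<^bold>\<not> P) \<longleftrightarrow> \<not> bs D n e P"
  "bs D n e (P \<^bold>\<and> Q) \<longleftrightarrow> bs D n e P \<and> bs D n e Q"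
  "bs D n e (P \<^bold>\<or> Q) \<longleftrightarrow> bs D n e P \<or> bs D n e Q"
  "bs D n e (P \<^bold>\<longleftrightarrow> Q) \<longleftrightarrow> (bs D n e P \<longleftrightarrow> bs D n e Q)"
  by (simp_all add: bs_def)

lemma bs_quant [simp]:
  "bs D n e (b_all F) \<longleftrightarrow> (\<forall>u\<in>D. bs D (Suc n) (e(n := u)) (F n))"
  "bs D n e (b_ex F) \<longleftrightarrow> (\<exists>u\<in>D. bs D (Suc n) (e(n := u)) (F n))"
  unfolding bs_def sat_bld bs_env by simp_all

declare fun_upd_apply [simp del]

lemma upd_same [simp]: "(e(n := u)) n = u"
  by (simp add: fun_upd_apply)

lemma bs_bounded [simp]:
  "a < n \<Longrightarrow> bs D n e (all_in a F) \<longleftrightarrow> (\<forall>u\<in>D. u \<epsilon> e a \<longrightarrow> bs D (Suc n) (e(n := u)) (F n))"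
  "a < n \<Longrightarrow> bs D n e (ex_in a F) \<longleftrightarrow> (\<exists>u\<in>D. u \<epsilon> e a \<and> bs D (Suc n) (e(n := u)) (F n))"
  by (simp_all add: all_in_def ex_in_def)

lemma bs_ex1 [simp]:
  "bs D n e (b_ex1 F) \<longleftrightarrow>
    (\<exists>x\<in>D. bs D (Suc n) (e(n := x)) (F n) \<and>
      (\<forall>y\<in>D. bs D (Suc (Suc n)) (e(n := x, Suc n := y)) (F (Suc n)) \<longrightarrow> y = x))"
  by (simp add: b_ex1_def)

lemma sat_relat: "sat UNIV E e (relat m p) \<longleftrightarrow> sat {u. u \<epsilon> e m} E e p"
  by (induction p arbitrary: e m) auto

lemma bs_relativized [simp]:
  "M < n \<Longrightarrow> bs UNIV n e (relativized M P) \<longleftrightarrow> bs {u. u \<epsilon> e M} n e P"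
  by (simp add: bs_def relativized_def sat_relat)

lemma bs_conjs [simp]: "bs D n e (conjs Ps) \<longleftrightarrow> (\<forall>P\<in>set Ps. bs D n e P)"
  by (induction Ps) (auto simp: bs_def)

lemma sat_closure: "sat UNIV E d (closure k P) \<longleftrightarrow> (\<forall>e. bs UNIV k e P)"
proof -
  \<comment> \<open>For the induction on the remaining quantifiers, the \<open>n\<close> levels
    already bound keep their values \<open>e\<close>; \<open>closure\<close> is the case
    \<open>n = 0\<close>.\<close>
  have "sat UNIV E (\<lambda>i. if i < n then e (n - 1 - i) else d (i - n)) ((All ^^ m) (P (n + m))) \<longleftrightarrow>
      (\<forall>e'. (\<forall>i<n. e' i = e i) \<longrightarrow> bs UNIV (n + m) e' P)" for n m e
  proof (induction m arbitrary: n e)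
    case 0
    have "bs UNIV n e' P \<longleftrightarrow> bs UNIV n e P" if "\<forall>i<n. e' i = e i" for e'
    proof -
      have "(\<lambda>i. if i < n then e' (n - 1 - i) else d (i - n)) =
          (\<lambda>i. if i < n then e (n - 1 - i) else d (i - n))" using that by auto
      then show ?thesis by (simp only: bs_def)
    qed
    then show ?case unfolding funpow.simps id_apply add_0_right bs_def[symmetric] by blast
  next
    case (Suc m)
    have upd: "(\<forall>i<Suc n. e' i = (e(n := u)) i) \<longleftrightarrow> (\<forall>i<n. e' i = e i) \<and> e' n = u" for e' u
      by (auto simp: less_Suc_eq)
    show ?case
      unfolding funpow.simps comp_apply sat.simps bs_env add_Suc_right add_Suc[symmetric] Suc.IH upd
      by blast
  qed
  from this[of 0 _ k] show ?thesis by (simp add: closure_def)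
qed

lemma bs_plug1:
  assumes "scoped (Suc k) p" "k \<le> n" "x < n" "\<forall>i<k. e' i = e i"
  shows "bs D n e' (plug p [x]) \<longleftrightarrow> sat D E (case_nat (e' x) e) p"
  unfolding bs_def plug_def sat_ren
  by (rule sat_scoped[OF assms(1)]) (use assms(2-) in \<open>auto split: nat.split\<close>)

lemma bs_plug2:
  assumes "scoped (Suc (Suc k)) p" "k \<le> n" "x < n" "y < n" "\<forall>i<k. e' i = e i"
  shows "bs D n e' (plug p [x, y]) \<longleftrightarrow> sat D E (case_nat (e' x) (case_nat (e' y) e)) p"
  unfolding bs_def plug_def sat_ren
  by (rule sat_scoped[OF assms(1)]) (use assms(2-) in \<open>auto split: nat.split simp: nth_Cons\<close>)

subsection \<open>Set-theoretic notions, relative to a class \<open>D\<close>\<close>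

text \<open>Relativizing a formula to \<open>M\<close> only changes the range of its quantifiers, so
  each notion is read relative to a class \<open>D\<close>: the universe, or the elements of a
  model.\<close>

definition "sSub D x y \<longleftrightarrow> (\<forall>z\<in>D. z \<epsilon> x \<longrightarrow> z \<epsilon> y)"
definition "sEmpty D x \<longleftrightarrow> (\<forall>z\<in>D. \<not> z \<epsilon> x)"
definition "sUp D p x y \<longleftrightarrow> (\<forall>z\<in>D. z \<epsilon> p \<longleftrightarrow> z = x \<or> z = y)"
definition "sOp D p x y \<longleftrightarrow> (\<exists>u\<in>D. \<exists>v\<in>D. sUp D u x x \<and> sUp D v x y \<and> sUp D p u v)"
definition "sBun D c a b \<longleftrightarrow> (\<forall>z\<in>D. z \<epsilon> c \<longleftrightarrow> z \<epsilon> a \<or> z \<epsilon> b)"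
definition "sSucc D y x \<longleftrightarrow> (\<forall>z\<in>D. z \<epsilon> y \<longleftrightarrow> z \<epsilon> x \<or> z = x)"
definition "sTrans D x \<longleftrightarrow> (\<forall>y\<in>D. y \<epsilon> x \<longrightarrow> sSub D y x)"
definition "sOrd D x \<longleftrightarrow> sTrans D x \<and>
  (\<forall>y\<in>D. y \<epsilon> x \<longrightarrow> (\<forall>z\<in>D. z \<epsilon> x \<longrightarrow> y \<epsilon> z \<or> y = z \<or> z \<epsilon> y)) \<and>
  (\<forall>u\<in>D. sSub D u x \<and> \<not> sEmpty D u \<longrightarrow> (\<exists>y\<in>D. y \<epsilon> u \<and> (\<forall>z\<in>D. z \<epsilon> u \<longrightarrow> \<not> z \<epsilon> y)))"
definition "sLim D x \<longleftrightarrow> sOrd D x \<and> \<not> sEmpty D x \<and> (\<forall>y\<in>D. y \<epsilon> x \<longrightarrow> (\<exists>z\<in>D. z \<epsilon> x \<and> y \<epsilon> z))"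
definition "sOmega D w \<longleftrightarrow> sLim D w \<and> (\<forall>y\<in>D. y \<epsilon> w \<longrightarrow> \<not> sLim D y)"
definition "sNat D n \<longleftrightarrow> (\<exists>w\<in>D. sOmega D w \<and> n \<epsilon> w)"
definition "sApp D f x y \<longleftrightarrow> (\<exists>p\<in>D. sOp D p x y \<and> p \<epsilon> f)"
definition "sFunOn D f a \<longleftrightarrow>
  (\<forall>p\<in>D. p \<epsilon> f \<longrightarrow> (\<exists>x\<in>D. x \<epsilon> a \<and> (\<exists>y\<in>D. sOp D p x y))) \<and>
  (\<forall>x\<in>D. x \<epsilon> a \<longrightarrow> (\<exists>y\<in>D. sApp D f x y \<and> (\<forall>z\<in>D. sApp D f x z \<longrightarrow> z = y)))"
definition "sFun D f a b \<longleftrightarrow> sFunOn D f a \<and> (\<forall>x\<in>D. \<forall>y\<in>D. sApp D f x y \<longrightarrow> y \<epsilon> b)"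
definition "sCofm D b a \<longleftrightarrow> (\<exists>f\<in>D. sFun D f b a \<and>
  (\<forall>x\<in>D. x \<epsilon> a \<longrightarrow> (\<exists>i\<in>D. i \<epsilon> b \<and> (\<exists>y\<in>D. sApp D f i y \<and> (x \<epsilon> y \<or> x = y)))))"
definition "sCf D a b \<longleftrightarrow> sOrd D b \<and> sCofm D b a \<and> (\<forall>c\<in>D. c \<epsilon> b \<longrightarrow> \<not> sCofm D c a)"
definition "sCfOm D a \<longleftrightarrow> (\<exists>w\<in>D. sOmega D w \<and> sCf D a w)"

lemma bs_sets [simp]:
  "x < n \<Longrightarrow> y < n \<Longrightarrow> bs D n e (sub x y) \<longleftrightarrow> sSub D (e x) (e y)"
  "x < n \<Longrightarrow> bs D n e (is_empty x) \<longleftrightarrow> sEmpty D (e x)"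
  "p < n \<Longrightarrow> x < n \<Longrightarrow> y < n \<Longrightarrow> bs D n e (is_upair p x y) \<longleftrightarrow> sUp D (e p) (e x) (e y)"
  "p < n \<Longrightarrow> x < n \<Longrightarrow> y < n \<Longrightarrow> bs D n e (is_bunion p x y) \<longleftrightarrow> sBun D (e p) (e x) (e y)"
  "x < n \<Longrightarrow> y < n \<Longrightarrow> bs D n e (is_succ y x) \<longleftrightarrow> sSucc D (e y) (e x)"
  by (simp_all add: sub_def sSub_def is_empty_def sEmpty_def is_upair_def sUp_def is_bunion_def
      sBun_def is_succ_def sSucc_def)

lemma bs_opair [simp]:
  "p < n \<Longrightarrow> x < n \<Longrightarrow> y < n \<Longrightarrow> bs D n e (is_opair p x y) \<longleftrightarrow> sOp D (e p) (e x) (e y)"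
  by (simp add: is_opair_def sOp_def)

lemma bs_ordinals [simp]:
  "x < n \<Longrightarrow> bs D n e (transitive x) \<longleftrightarrow> sTrans D (e x)"
  "x < n \<Longrightarrow> bs D n e (ordinal x) \<longleftrightarrow> sOrd D (e x)"
  "x < n \<Longrightarrow> bs D n e (limit x) \<longleftrightarrow> sLim D (e x)"
  "x < n \<Longrightarrow> bs D n e (is_omega x) \<longleftrightarrow> sOmega D (e x)"
  "x < n \<Longrightarrow> bs D n e (natural x) \<longleftrightarrow> sNat D (e x)"
proof -
  show t: "x < n \<Longrightarrow> bs D n e (transitive x) \<longleftrightarrow> sTrans D (e x)" for x n e
    by (simp add: transitive_def sTrans_def)
  show o: "x < n \<Longrightarrow> bs D n e (ordinal x) \<longleftrightarrow> sOrd D (e x)" for x n e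
    by (simp add: ordinal_def sOrd_def t)
  show l: "x < n \<Longrightarrow> bs D n e (limit x) \<longleftrightarrow> sLim D (e x)" for x n e
    by (simp add: limit_def sLim_def o)
  show w: "x < n \<Longrightarrow> bs D n e (is_omega x) \<longleftrightarrow> sOmega D (e x)" for x n e
    by (simp add: is_omega_def sOmega_def l)
  show "x < n \<Longrightarrow> bs D n e (natural x) \<longleftrightarrow> sNat D (e x)"
    by (simp add: natural_def sNat_def w)
qed

lemma bs_app [simp]:
  "f < n \<Longrightarrow> x < n \<Longrightarrow> y < n \<Longrightarrow> bs D n e (app f x y) \<longleftrightarrow> sApp D (e f) (e x) (e y)"
  by (simp add: app_def sApp_def)

lemma bs_fun_on [simp]: "f < n \<Longrightarrow> x < n \<Longrightarrow> bs D n e (is_fun_on f x) \<longleftrightarrow> sFunOn D (e f) (e x)"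
  by (simp add: is_fun_on_def sFunOn_def)

lemma bs_fun [simp]:
  "f < n \<Longrightarrow> x < n \<Longrightarrow> y < n \<Longrightarrow> bs D n e (is_fun f x y) \<longleftrightarrow> sFun D (e f) (e x) (e y)"
  by (simp add: is_fun_def sFun_def)

lemma bs_cofinal [simp]:
  "x < n \<Longrightarrow> y < n \<Longrightarrow> bs D n e (cofinal_map x y) \<longleftrightarrow> sCofm D (e x) (e y)"
  by (simp add: cofinal_map_def sCofm_def)

lemma bs_cf [simp]: "x < n \<Longrightarrow> y < n \<Longrightarrow> bs D n e (is_cf x y) \<longleftrightarrow> sCf D (e x) (e y)"
  by (simp add: is_cf_def sCf_def)

lemma bs_cf_omega [simp]: "x < n \<Longrightarrow> bs D n e (cf_omega x) \<longleftrightarrow> sCfOm D (e x)"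
  by (simp add: cf_omega_def sCfOm_def)

subsection \<open>Languages, structures and satisfaction\<close>

abbreviation "Empty \<equiv> sEmpty UNIV"
abbreviation "Up \<equiv> sUp UNIV"
abbreviation "Op \<equiv> sOp UNIV"
abbreviation "Bun \<equiv> sBun UNIV"
abbreviation "Succ \<equiv> sSucc UNIV"
abbreviation "Trans \<equiv> sTrans UNIV"
abbreviation "Ord \<equiv> sOrd UNIV"
abbreviation "Omega \<equiv> sOmega UNIV"
abbreviation "Natl \<equiv> sNat UNIV"
abbreviation "App \<equiv> sApp UNIV"
abbreviation "FunOn \<equiv> sFunOn UNIV"
abbreviation "Fun \<equiv> sFun UNIV"
abbreviation "Sub \<equiv> sSub UNIV"

primrec Num :: "nat \<Rightarrow> 'u \<Rightarrow> bool" where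
  "Num 0 x \<longleftrightarrow> Empty x"
| "Num (Suc k) x \<longleftrightarrow> (\<exists>y. Num k y \<and> Succ x y)"

lemma bs_num [simp]: "x < n \<Longrightarrow> bs UNIV n e (is_num k x) \<longleftrightarrow> Num k (e x)"
  by (induction k arbitrary: n e x) simp_all

definition "Upd n t s i x \<longleftrightarrow> FunOn t n \<and> App t i x \<and>
  (\<forall>j. j \<epsilon> n \<longrightarrow> j \<noteq> i \<longrightarrow> (\<forall>y. App s j y \<longrightarrow> App t j y))"
definition "IsLang R F a \<longleftrightarrow> (\<forall>x. x \<epsilon> R \<longrightarrow> \<not> x \<epsilon> F) \<and> (\<exists>d w. Bun d R F \<and> Omega w \<and> Fun a d w)"
definition "IsStruct R F a X \<longleftrightarrow>
  (\<exists>A I d. Op X A I \<and> \<not> Empty A \<and> Bun d R F \<and> FunOn I d \<and>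
    (\<forall>r. r \<epsilon> R \<longrightarrow> (\<exists>k e. App a r k \<and> App I r e \<and> (\<forall>u. u \<epsilon> e \<longrightarrow> Fun u k A))) \<and>
    (\<forall>f. f \<epsilon> F \<longrightarrow> (\<exists>k g. App a f k \<and> App I f g \<and>
      (\<forall>p. p \<epsilon> g \<longrightarrow> (\<exists>u y. Op p u y \<and> Fun u k A \<and> y \<epsilon> A)) \<and>
      (\<forall>u. Fun u k A \<longrightarrow> (\<exists>y. App g u y \<and> (\<forall>z. App g u z \<longrightarrow> z = y))))))"

definition Gen :: "(('u \<Rightarrow> bool) \<Rightarrow> 'u \<Rightarrow> bool) \<Rightarrow> 'u \<Rightarrow> bool" where
  "Gen Q x \<longleftrightarrow> (\<exists>m k f. Natl m \<and> Succ k m \<and> FunOn f k \<and> App f m x \<and>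
    (\<forall>i. i \<epsilon> k \<longrightarrow> (\<exists>y. App f i y \<and> Q (\<lambda>z. \<exists>j. j \<epsilon> i \<and> App f j z) y)))"

definition "Node k c x \<longleftrightarrow> (\<exists>t. Num k t \<and> Op c t x)"
definition "Node2 k c x y \<longleftrightarrow> (\<exists>p. Op p x y \<and> Node k c p)"
definition "CBot c \<longleftrightarrow> (\<exists>e. Empty e \<and> Node 2 c e)"
definition "CNot c p \<longleftrightarrow> (\<exists>b. CBot b \<and> Node2 3 c p b)"
definition "CEx c i p \<longleftrightarrow> (\<exists>q r. CNot q p \<and> Node2 4 r i q \<and> CNot c r)"

lemma bs_upd [simp]: "m < n \<Longrightarrow> t < n \<Longrightarrow> s < n \<Longrightarrow> i < n \<Longrightarrow> x < n \<Longrightarrow>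
    bs UNIV n e (is_upd m t s i x) \<longleftrightarrow> Upd (e m) (e t) (e s) (e i) (e x)"
  by (simp add: is_upd_def Upd_def)

lemma bs_lang [simp]:
  "R < n \<Longrightarrow> F < n \<Longrightarrow> a < n \<Longrightarrow> bs UNIV n e (is_lang R F a) \<longleftrightarrow> IsLang (e R) (e F) (e a)"
  by (simp add: is_lang_def IsLang_def)

lemma bs_struct [simp]: "R < n \<Longrightarrow> F < n \<Longrightarrow> a < n \<Longrightarrow> X < n \<Longrightarrow>
    bs UNIV n e (is_struct R F a X) \<longleftrightarrow> IsStruct (e R) (e F) (e a) (e X)"
  by (simp add: is_struct_def IsStruct_def)

lemma bs_node [simp]:
  "c < n \<Longrightarrow> x < n \<Longrightarrow> bs UNIV n e (node k c x) \<longleftrightarrow> Node k (e c) (e x)"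
  by (simp add: node_def Node_def)

lemma bs_node2 [simp]:
  "c < n \<Longrightarrow> x < n \<Longrightarrow> y < n \<Longrightarrow> bs UNIV n e (node2 k c x y) \<longleftrightarrow> Node2 k (e c) (e x) (e y)"
  by (simp add: node2_def Node2_def)

lemmas code_defs = c_var_def c_fun_def c_eq_def c_rel_def c_imp_def c_all_def

lemma bs_codes [simp]:
  "c < n \<Longrightarrow> bs UNIV n e (c_bot c) \<longleftrightarrow> CBot (e c)"
  "c < n \<Longrightarrow> p < n \<Longrightarrow> bs UNIV n e (c_not c p) \<longleftrightarrow> CNot (e c) (e p)"
  "c < n \<Longrightarrow> p < n \<Longrightarrow> i < n \<Longrightarrow> bs UNIV n e (c_ex c i p) \<longleftrightarrow> CEx (e c) (e i) (e p)"
proof -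
  show b: "c < n \<Longrightarrow> bs UNIV n e (c_bot c) \<longleftrightarrow> CBot (e c)" for c n e
    by (simp add: c_bot_def CBot_def)
  show t: "c < n \<Longrightarrow> p < n \<Longrightarrow> bs UNIV n e (c_not c p) \<longleftrightarrow> CNot (e c) (e p)" for c p n e
    by (simp add: c_not_def CNot_def b code_defs)
  show "c < n \<Longrightarrow> p < n \<Longrightarrow> i < n \<Longrightarrow> bs UNIV n e (c_ex c i p) \<longleftrightarrow> CEx (e c) (e i) (e p)"
    by (simp add: c_ex_def CEx_def t code_defs)
qed

definition "IsTerm F a n = Gen (\<lambda>prev t.
  (\<exists>i. i \<epsilon> n \<and> Node 0 t i) \<or>
  (\<exists>f. f \<epsilon> F \<and> (\<exists>k u. App a f k \<and> FunOn u k \<and> (\<forall>i z. App u i z \<longrightarrow> prev z) \<and> Node2 1 t f u)))"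
definition "TermTuple F a n k u \<longleftrightarrow> FunOn u k \<and> (\<forall>i z. App u i z \<longrightarrow> IsTerm F a n z)"
definition "IsForm R F a n = Gen (\<lambda>prev c.
  (\<exists>t t'. IsTerm F a n t \<and> IsTerm F a n t' \<and> Node2 0 c t t') \<or>
  (\<exists>r. r \<epsilon> R \<and> (\<exists>k u. App a r k \<and> TermTuple F a n k u \<and> Node2 1 c r u)) \<or>
  CBot c \<or>
  (\<exists>p q. prev p \<and> prev q \<and> Node2 3 c p q) \<or>
  (\<exists>i. i \<epsilon> n \<and> (\<exists>p. prev p \<and> Node2 4 c i p)))"
definition "ValueIs V t s x \<longleftrightarrow> (\<exists>q. Op q t s \<and> App V q x)"
definition "ValuesAre V A k u s w \<longleftrightarrow>
  Fun w k A \<and> (\<forall>i. i \<epsilon> k \<longrightarrow> (\<exists>t x. App u i t \<and> App w i x \<and> ValueIs V t s x))"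
definition "TermValues F a A I n V \<longleftrightarrow> (\<forall>s. Fun s n A \<longrightarrow>
  (\<forall>i t x. i \<epsilon> n \<and> Node 0 t i \<longrightarrow> (ValueIs V t s x \<longleftrightarrow> App s i x)) \<and>
  (\<forall>f k u t x. f \<epsilon> F \<and> App a f k \<and> TermTuple F a n k u \<and> Node2 1 t f u \<longrightarrow>
    (ValueIs V t s x \<longleftrightarrow> (\<exists>w g. ValuesAre V A k u s w \<and> App I f g \<and> App g w x))))"
definition "SatRel R F a A I n S \<longleftrightarrow> (\<exists>V. TermValues F a A I n V \<and> (\<forall>s. Fun s n A \<longrightarrow>
  (\<forall>t t' c. IsTerm F a n t \<and> IsTerm F a n t' \<and> Node2 0 c t t' \<longrightarrow>
    (App S c s \<longleftrightarrow> (\<exists>x. ValueIs V t s x \<and> ValueIs V t' s x))) \<and>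
  (\<forall>r k u c. r \<epsilon> R \<and> App a r k \<and> TermTuple F a n k u \<and> Node2 1 c r u \<longrightarrow>
    (App S c s \<longleftrightarrow> (\<exists>w e. ValuesAre V A k u s w \<and> App I r e \<and> w \<epsilon> e))) \<and>
  (\<forall>c. CBot c \<longrightarrow> \<not> App S c s) \<and>
  (\<forall>p q c. IsForm R F a n p \<and> IsForm R F a n q \<and> Node2 3 c p q \<longrightarrow>
    (App S c s \<longleftrightarrow> (App S p s \<longrightarrow> App S q s))) \<and>
  (\<forall>i p c. i \<epsilon> n \<and> IsForm R F a n p \<and> Node2 4 c i p \<longrightarrow>
    (App S c s \<longleftrightarrow> (\<forall>x s'. x \<epsilon> A \<and> Upd n s' s i x \<longrightarrow> App S p s')))))"
definition "Sats R F a A I n p s \<longleftrightarrow> (\<exists>S. SatRel R F a A I n S \<and> App S p s)"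
definition "ElemEmb R F a j X Y \<longleftrightarrow>
  (\<exists>A I B J. Op X A I \<and> Op Y B J \<and> Fun j A B \<and>
    (\<forall>n p s t. Natl n \<and> IsForm R F a n p \<and> Fun s n A \<and> Fun t n B \<and>
        (\<forall>i. i \<epsilon> n \<longrightarrow> (\<exists>x y. App s i x \<and> App j x y \<and> App t i y)) \<longrightarrow>
      (Sats R F a A I n p s \<longleftrightarrow> Sats R F a B J n p t)))"

lemma bs_term [simp]: "F < n \<Longrightarrow> a < n \<Longrightarrow> m < n \<Longrightarrow> t < n \<Longrightarrow>
    bs UNIV n e (is_term F a m t) \<longleftrightarrow> IsTerm (e F) (e a) (e m) (e t)"
  by (simp add: is_term_def IsTerm_def generated_def Gen_def code_defs)

lemma bs_term_tuple [simp]: "F < n \<Longrightarrow> a < n \<Longrightarrow> m < n \<Longrightarrow> k < n \<Longrightarrow> u < n \<Longrightarrow>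
    bs UNIV n e (term_tuple F a m k u) \<longleftrightarrow> TermTuple (e F) (e a) (e m) (e k) (e u)"
  by (simp add: term_tuple_def TermTuple_def)

lemma bs_form [simp]: "R < n \<Longrightarrow> F < n \<Longrightarrow> a < n \<Longrightarrow> m < n \<Longrightarrow> c < n \<Longrightarrow>
    bs UNIV n e (is_form R F a m c) \<longleftrightarrow> IsForm (e R) (e F) (e a) (e m) (e c)"
  by (simp add: is_form_def IsForm_def generated_def Gen_def code_defs)

lemma bs_value [simp]: "V < n \<Longrightarrow> t < n \<Longrightarrow> s < n \<Longrightarrow> x < n \<Longrightarrow>
    bs UNIV n e (value_is V t s x) \<longleftrightarrow> ValueIs (e V) (e t) (e s) (e x)"
  by (simp add: value_is_def ValueIs_def)

lemma bs_values [simp]: "V < n \<Longrightarrow> A < n \<Longrightarrow> k < n \<Longrightarrow> u < n \<Longrightarrow> s < n \<Longrightarrow> w < n \<Longrightarrow>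
    bs UNIV n e (values_are V A k u s w) \<longleftrightarrow> ValuesAre (e V) (e A) (e k) (e u) (e s) (e w)"
  by (simp add: values_are_def ValuesAre_def)

lemma bs_term_values [simp]: "F < n \<Longrightarrow> a < n \<Longrightarrow> A < n \<Longrightarrow> I < n \<Longrightarrow> m < n \<Longrightarrow> V < n \<Longrightarrow>
    bs UNIV n e (term_values F a A I m V) \<longleftrightarrow> TermValues (e F) (e a) (e A) (e I) (e m) (e V)"
  by (simp add: term_values_def TermValues_def code_defs)

lemma bs_sat_rel [simp]: "R < n \<Longrightarrow> F < n \<Longrightarrow> a < n \<Longrightarrow> A < n \<Longrightarrow> I < n \<Longrightarrow> m < n \<Longrightarrow> S < n \<Longrightarrow>
    bs UNIV n e (sat_rel R F a A I m S) \<longleftrightarrow> SatRel (e R) (e F) (e a) (e A) (e I) (e m) (e S)"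
  by (simp add: sat_rel_def SatRel_def code_defs)

lemma bs_sats [simp]:
  "R < n \<Longrightarrow> F < n \<Longrightarrow> a < n \<Longrightarrow> A < n \<Longrightarrow> I < n \<Longrightarrow> m < n \<Longrightarrow> p < n \<Longrightarrow> s < n \<Longrightarrow>
    bs UNIV n e (sats R F a A I m p s) \<longleftrightarrow>
    Sats (e R) (e F) (e a) (e A) (e I) (e m) (e p) (e s)"
  by (simp add: sats_def Sats_def)

lemma bs_elem_emb [simp]: "R < n \<Longrightarrow> F < n \<Longrightarrow> a < n \<Longrightarrow> j < n \<Longrightarrow> X < n \<Longrightarrow> Y < n \<Longrightarrow>
    bs UNIV n e (elementary_embedding R F a j X Y) \<longleftrightarrow>
    ElemEmb (e R) (e F) (e a) (e j) (e X) (e Y)"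
  by (simp add: elementary_embedding_def ElemEmb_def)

subsection \<open>Models of set theory\<close>

definition "MemLang R F a \<longleftrightarrow>
  (\<exists>z k p. Num 0 z \<and> Num 2 k \<and> Op p z k \<and> Up R z z \<and> Empty F \<and> Up a p p)"
definition "MemInterp M I \<longleftrightarrow>
  (\<exists>z l k E' p. Num 0 z \<and> Num 1 l \<and> Num 2 k \<and> Op p z E' \<and> Up I p p \<and>
    (\<forall>u. u \<epsilon> E' \<longleftrightarrow> Fun u k M \<and> (\<exists>x y. App u z x \<and> App u l y \<and> x \<epsilon> y)))"
definition "MemForm n p \<longleftrightarrow> (\<exists>R F a. MemLang R F a \<and> IsForm R F a n p)"
definition "MemSatRel M n S \<longleftrightarrow>
  (\<exists>R F a I. MemLang R F a \<and> MemInterp M I \<and> SatRel R F a M I n S)"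
definition "MemSats M n p s \<longleftrightarrow> (\<exists>S. MemSatRel M n S \<and> App S p s)"
definition "CVarEq c i j \<longleftrightarrow> (\<exists>t t'. Node 0 t i \<and> Node 0 t' j \<and> Node2 0 c t t')"
definition "CVarMem c i j \<longleftrightarrow>
  (\<exists>t t' z l k u. Node 0 t i \<and> Node 0 t' j \<and> Num 0 z \<and> Num 1 l \<and> Num 2 k \<and>
    FunOn u k \<and> App u z t \<and> App u l t' \<and> Node2 1 c z u)"
definition "Delta0Form n = Gen (\<lambda>prev c.
  (\<exists>i. i \<epsilon> n \<and> (\<exists>j. j \<epsilon> n \<and> (CVarEq c i j \<or> CVarMem c i j))) \<or>
  CBot c \<or>
  (\<exists>p q. prev p \<and> prev q \<and> Node2 3 c p q) \<or>
  (\<exists>i. i \<epsilon> n \<and> (\<exists>j. j \<epsilon> n \<and> i \<noteq> j \<and>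
    (\<exists>p m q. prev p \<and> CVarMem m i j \<and> Node2 3 q m p \<and> Node2 4 c i q))))"
definition "Sigma1Form n = Gen (\<lambda>prev c.
  Delta0Form n c \<or> (\<exists>i. i \<epsilon> n \<and> (\<exists>p. prev p \<and> CEx c i p)))"
definition "ElemSub M N \<longleftrightarrow> Sub M N \<and>
  (\<forall>n p s. Natl n \<and> MemForm n p \<and> Fun s n M \<longrightarrow> (MemSats M n p s \<longleftrightarrow> MemSats N n p s))"
definition "ElemSub1 M N \<longleftrightarrow> Sub M N \<and>
  (\<forall>n p s. Natl n \<and> Sigma1Form n p \<and> Fun s n M \<longrightarrow> (MemSats M n p s \<longleftrightarrow> MemSats N n p s))"
definition "SatAt M n p s x \<longleftrightarrow> (\<exists>i s'. Num 0 i \<and> Upd n s' s i x \<and> MemSats M n p s')"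
definition "SatAt2 M n p s x y \<longleftrightarrow>
  (\<exists>i j s' s''. Num 0 i \<and> Num 1 j \<and> Upd n s' s i x \<and> Upd n s'' s' j y \<and> MemSats M n p s'')"
definition "SatSep M \<longleftrightarrow>
  (\<forall>z n p s. Num 0 z \<and> Natl n \<and> z \<epsilon> n \<and> MemForm n p \<and> Fun s n M \<longrightarrow>
    (\<forall>a. a \<epsilon> M \<longrightarrow> (\<exists>b. b \<epsilon> M \<and> (\<forall>x. x \<epsilon> M \<longrightarrow> (x \<epsilon> b \<longleftrightarrow> x \<epsilon> a \<and> SatAt M n p s x)))))"
definition "SatRepl M \<longleftrightarrow>
  (\<forall>l n p s. Num 1 l \<and> Natl n \<and> l \<epsilon> n \<and> MemForm n p \<and> Fun s n M \<longrightarrow>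
    (\<forall>a. a \<epsilon> M \<longrightarrow>
      (\<forall>x. x \<epsilon> M \<longrightarrow> x \<epsilon> a \<longrightarrow> (\<forall>y. y \<epsilon> M \<longrightarrow> (\<forall>z. z \<epsilon> M \<longrightarrow>
        SatAt2 M n p s x y \<and> SatAt2 M n p s x z \<longrightarrow> y = z))) \<longrightarrow>
      (\<exists>b. b \<epsilon> M \<and> (\<forall>y. y \<epsilon> M \<longrightarrow>
        (y \<epsilon> b \<longleftrightarrow> (\<exists>x. x \<epsilon> M \<and> x \<epsilon> a \<and> SatAt2 M n p s x y))))))"

lemma bs_mem_struct [simp]:
  "R < n \<Longrightarrow> F < n \<Longrightarrow> a < n \<Longrightarrow> bs UNIV n e (mem_lang R F a) \<longleftrightarrow> MemLang (e R) (e F) (e a)"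
  "M < n \<Longrightarrow> I < n \<Longrightarrow> bs UNIV n e (mem_interp M I) \<longleftrightarrow> MemInterp (e M) (e I)"
  by (simp_all add: mem_lang_def MemLang_def mem_interp_def MemInterp_def)

lemma bs_mem_form [simp]:
  "m < n \<Longrightarrow> p < n \<Longrightarrow> bs UNIV n e (mem_form m p) \<longleftrightarrow> MemForm (e m) (e p)"
  by (simp add: mem_form_def MemForm_def)

lemma bs_mem_sat_rel [simp]: "M < n \<Longrightarrow> m < n \<Longrightarrow> S < n \<Longrightarrow>
    bs UNIV n e (mem_sat_rel M m S) \<longleftrightarrow> MemSatRel (e M) (e m) (e S)"
  by (simp add: mem_sat_rel_def MemSatRel_def)

lemma bs_mem_sats [simp]: "M < n \<Longrightarrow> m < n \<Longrightarrow> p < n \<Longrightarrow> s < n \<Longrightarrow>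
    bs UNIV n e (mem_sats M m p s) \<longleftrightarrow> MemSats (e M) (e m) (e p) (e s)"
  by (simp add: mem_sats_def MemSats_def)

lemma bs_var_codes [simp]:
  "c < n \<Longrightarrow> i < n \<Longrightarrow> j < n \<Longrightarrow> bs UNIV n e (c_var_eq c i j) \<longleftrightarrow> CVarEq (e c) (e i) (e j)"
  "c < n \<Longrightarrow> i < n \<Longrightarrow> j < n \<Longrightarrow> bs UNIV n e (c_var_mem c i j) \<longleftrightarrow> CVarMem (e c) (e i) (e j)"
  by (simp_all add: c_var_eq_def CVarEq_def c_var_mem_def CVarMem_def code_defs)

lemma bs_delta0_form [simp]:
  "m < n \<Longrightarrow> c < n \<Longrightarrow> bs UNIV n e (delta0_form m c) \<longleftrightarrow> Delta0Form (e m) (e c)"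
  by (simp add: delta0_form_def Delta0Form_def generated_def Gen_def code_defs)

lemma bs_sigma1_form [simp]:
  "m < n \<Longrightarrow> c < n \<Longrightarrow> bs UNIV n e (sigma1_form m c) \<longleftrightarrow> Sigma1Form (e m) (e c)"
  by (simp add: sigma1_form_def Sigma1Form_def generated_def Gen_def)

lemma bs_elem_sub [simp]:
  "M < n \<Longrightarrow> N < n \<Longrightarrow> bs UNIV n e (elem_sub M N) \<longleftrightarrow> ElemSub (e M) (e N)"
  "M < n \<Longrightarrow> N < n \<Longrightarrow> bs UNIV n e (elem_sub_sigma1 M N) \<longleftrightarrow> ElemSub1 (e M) (e N)"
  by (simp_all add: elem_sub_def ElemSub_def elem_sub_sigma1_def ElemSub1_def)

lemma bs_sat_at [simp]:
  "M < n \<Longrightarrow> m < n \<Longrightarrow> p < n \<Longrightarrow> s < n \<Longrightarrow> x < n \<Longrightarrow>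
    bs UNIV n e (sat_at M m p s x) \<longleftrightarrow> SatAt (e M) (e m) (e p) (e s) (e x)"
  "M < n \<Longrightarrow> m < n \<Longrightarrow> p < n \<Longrightarrow> s < n \<Longrightarrow> x < n \<Longrightarrow> y < n \<Longrightarrow>
    bs UNIV n e (sat_at2 M m p s x y) \<longleftrightarrow> SatAt2 (e M) (e m) (e p) (e s) (e x) (e y)"
  by (simp_all add: sat_at_def SatAt_def sat_at2_def SatAt2_def)

lemma bs_sat_schemes [simp]:
  "M < n \<Longrightarrow> bs UNIV n e (sat_separation M) \<longleftrightarrow> SatSep (e M)"
  "M < n \<Longrightarrow> bs UNIV n e (sat_replacement M) \<longleftrightarrow> SatRepl (e M)"
  by (simp_all add: sat_separation_def SatSep_def sat_replacement_def SatRepl_def)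

definition "Single D \<longleftrightarrow>
  (\<forall>x\<in>D. \<forall>y\<in>D. (\<forall>z\<in>D. z \<epsilon> x \<longleftrightarrow> z \<epsilon> y) \<longrightarrow> x = y) \<and>
  (\<forall>x\<in>D. \<not> sEmpty D x \<longrightarrow> (\<exists>y\<in>D. y \<epsilon> x \<and> (\<forall>z\<in>D. z \<epsilon> x \<longrightarrow> \<not> z \<epsilon> y))) \<and>
  (\<forall>x\<in>D. \<forall>y\<in>D. \<exists>p\<in>D. sUp D p x y) \<and>
  (\<forall>x\<in>D. \<exists>u\<in>D. \<forall>z\<in>D. z \<epsilon> u \<longleftrightarrow> (\<exists>y\<in>D. y \<epsilon> x \<and> z \<epsilon> y)) \<and>
  (\<forall>x\<in>D. \<exists>p\<in>D. \<forall>z\<in>D. z \<epsilon> p \<longleftrightarrow> sSub D z x) \<and>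
  (\<exists>w\<in>D. (\<exists>u\<in>D. u \<epsilon> w \<and> sEmpty D u) \<and> (\<forall>x\<in>D. x \<epsilon> w \<longrightarrow> (\<exists>y\<in>D. y \<epsilon> w \<and> sSucc D y x))) \<and>
  (\<forall>x\<in>D. (\<forall>y\<in>D. y \<epsilon> x \<longrightarrow> \<not> sEmpty D y) \<and>
    (\<forall>y\<in>D. y \<epsilon> x \<longrightarrow> (\<forall>z\<in>D. z \<epsilon> x \<longrightarrow> (\<exists>v\<in>D. v \<epsilon> y \<and> v \<epsilon> z) \<longrightarrow> y = z)) \<longrightarrow>
    (\<exists>c\<in>D. \<forall>y\<in>D. y \<epsilon> x \<longrightarrow> (\<exists>v\<in>D. (v \<epsilon> y \<and> v \<epsilon> c) \<and> (\<forall>w\<in>D. w \<epsilon> y \<and> w \<epsilon> c \<longrightarrow> w = v))))"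

lemma bs_single: "(\<forall>P\<in>set zfc_single_axioms. bs D n e P) \<longleftrightarrow> Single D"
  by (simp add: zfc_single_axioms_def Single_def ax_extensionality_def ax_foundation_def
      ax_pair_def ax_union_def ax_power_def ax_infinity_def ax_choice_def)

definition "Model M \<longleftrightarrow> Trans M \<and> (\<forall>n. Natl n \<longrightarrow> (\<exists>S. MemSatRel M n S)) \<and>
  Single {u. u \<epsilon> M} \<and> SatSep M \<and> SatRepl M"
definition "Special M \<longleftrightarrow> (\<forall>a. a \<epsilon> M \<longrightarrow> Ord a \<longrightarrow> (sCfOm {u. u \<epsilon> M} a \<longleftrightarrow> sCfOm UNIV a))"

lemma bs_model [simp]: "M < n \<Longrightarrow> bs UNIV n e (model M) \<longleftrightarrow> Model (e M)"
  by (simp add: model_def Model_def bs_single)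

lemma bs_extendible [simp]:
  "M < n \<Longrightarrow> bs UNIV n e (strongly_extendible M) \<longleftrightarrow> (\<forall>x. \<exists>N. Model N \<and> x \<epsilon> N \<and> ElemSub (e M) N)"
  "M < n \<Longrightarrow> bs UNIV n e (sigma1_strongly_extendible M) \<longleftrightarrow>
    (\<forall>x. \<exists>N. Model N \<and> x \<epsilon> N \<and> ElemSub1 (e M) N)"
  "M < n \<Longrightarrow> bs UNIV n e (special M) \<longleftrightarrow> Special (e M)"
  by (simp_all add: strongly_extendible_def sigma1_strongly_extendible_def special_def Special_def)

section \<open>Truth of the localization axioms and of the schemes\<close>

lemma sat_bs: "sat UNIV E d (B 0) \<longleftrightarrow> bs UNIV 0 (\<lambda>_. undefined) B"
  by (simp add: bs_0)

lemma sat_Loc: "sat UNIV E d Loc \<longleftrightarrow> (\<forall>x. \<exists>M. x \<epsilon> M \<and> Model M)"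
  unfolding Loc_def sat_bs by simp

lemma sat_Loc_prop:
  "sat UNIV E d (Loc_prop P) \<longleftrightarrow>
    (\<forall>x. \<exists>M. x \<epsilon> M \<and> Model M \<and> bs UNIV 2 ((\<lambda>_. undefined)(0 := x, 1 := M)) (P 1))"
  unfolding Loc_prop_def sat_bs by (simp add: numeral_2_eq_2)

lemma sat_separation_scheme:
  assumes "scoped (k + 1) p"
  shows "sat UNIV E d (separation k p) \<longleftrightarrow>
    (\<forall>e a. \<exists>b. \<forall>x. x \<epsilon> b \<longleftrightarrow> x \<epsilon> a \<and> sat UNIV E (case_nat x e) p)"
proof -
  have "bs UNIV k e (\<^bold>\<forall>a. \<^bold>\<exists>b. \<^bold>\<forall>x. x \<^bold>\<in> b \<^bold>\<longleftrightarrow> x \<^bold>\<in> a \<^bold>\<and> plug p [x]) \<longleftrightarrow>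
      (\<forall>a. \<exists>b. \<forall>x. x \<epsilon> b \<longleftrightarrow> x \<epsilon> a \<and> sat UNIV E (case_nat x e) p)" for e
    using assms by (simp add: bs_plug1[of k p _ _ _ e])
  then show ?thesis unfolding separation_def sat_closure by simp
qed

lemma sat_replacement_scheme:
  assumes "scoped (k + 2) p"
  shows "sat UNIV E d (replacement k p) \<longleftrightarrow>
    (\<forall>e a. (\<forall>x. x \<epsilon> a \<longrightarrow> (\<forall>y z. sat UNIV E (case_nat x (case_nat y e)) p \<and>
        sat UNIV E (case_nat x (case_nat z e)) p \<longrightarrow> y = z)) \<longrightarrow>
      (\<exists>b. \<forall>y. y \<epsilon> b \<longleftrightarrow> (\<exists>x. x \<epsilon> a \<and> sat UNIV E (case_nat x (case_nat y e)) p)))"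
proof -
  have "bs UNIV k e (\<^bold>\<forall>a.
      all_in a (\<lambda>x. \<^bold>\<forall>y z. plug p [x, y] \<^bold>\<and> plug p [x, z] \<^bold>\<longrightarrow> y \<^bold>= z) \<^bold>\<longrightarrow>
      (\<^bold>\<exists>b. \<^bold>\<forall>y. y \<^bold>\<in> b \<^bold>\<longleftrightarrow> ex_in a (\<lambda>x. plug p [x, y]))) \<longleftrightarrow>
    (\<forall>a. (\<forall>x. x \<epsilon> a \<longrightarrow> (\<forall>y z. sat UNIV E (case_nat x (case_nat y e)) p \<and>
        sat UNIV E (case_nat x (case_nat z e)) p \<longrightarrow> y = z)) \<longrightarrow>
      (\<exists>b. \<forall>y. y \<epsilon> b \<longleftrightarrow> (\<exists>x. x \<epsilon> a \<and> sat UNIV E (case_nat x (case_nat y e)) p)))" for e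
    using assms by (simp add: bs_plug2[of k p _ _ _ _ e])
  then show ?thesis unfolding replacement_def sat_closure by simp
qed

lemma sat_vopenka_scheme:
  assumes "scoped (k + 1) p"
  shows "sat UNIV E d (vopenka k p) \<longleftrightarrow>
    (\<forall>e. let X = (\<lambda>x. sat UNIV E (case_nat x e) p) in
      \<forall>R F a. IsLang R F a \<and> (\<forall>x. X x \<longrightarrow> IsStruct R F a x) \<and>
        \<not> (\<exists>c. \<forall>x. x \<epsilon> c \<longleftrightarrow> X x) \<longrightarrow>
      (\<exists>x y. X x \<and> X y \<and> x \<noteq> y \<and> (\<exists>j. ElemEmb R F a j x y)))"
proof -
  have "bs UNIV k e (\<^bold>\<forall>R F a.
      is_lang R F a \<^bold>\<and>
      (\<^bold>\<forall>x. plug p [x] \<^bold>\<longrightarrow> is_struct R F a x) \<^bold>\<and>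
      \<^bold>\<not> (\<^bold>\<exists>c. \<^bold>\<forall>x. x \<^bold>\<in> c \<^bold>\<longleftrightarrow> plug p [x]) \<^bold>\<longrightarrow>
      (\<^bold>\<exists>x y. plug p [x] \<^bold>\<and> plug p [y] \<^bold>\<and> \<^bold>\<not> x \<^bold>= y \<^bold>\<and>
        (\<^bold>\<exists>j. elementary_embedding R F a j x y))) \<longleftrightarrow>
    (let X = (\<lambda>x. sat UNIV E (case_nat x e) p) in
      \<forall>R F a. IsLang R F a \<and> (\<forall>x. X x \<longrightarrow> IsStruct R F a x) \<and>
        \<not> (\<exists>c. \<forall>x. x \<epsilon> c \<longleftrightarrow> X x) \<longrightarrow>
      (\<exists>x y. X x \<and> X y \<and> x \<noteq> y \<and> (\<exists>j. ElemEmb R F a j x y)))" for e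
    using assms unfolding Let_def by (simp add: bs_plug1[of k p _ _ _ e])
  then show ?thesis unfolding vopenka_def sat_closure by (simp only:)
qed

end

section \<open>Definable predicates and terms\<close>

lemma delta0_ren: "delta0 p \<Longrightarrow> delta0 (ren f p)"
proof (induction arbitrary: f rule: delta0.induct)
  case (5 p j)
  then show ?case using delta0.intros(5)[of "ren (case_nat 0 (\<lambda>i. Suc (f i))) p" "f j"] by simp
qed (auto intro: delta0.intros)

lemma scoped_mono: "scoped m p \<Longrightarrow> m \<le> n \<Longrightarrow> scoped n p"
proof (induction p arbitrary: m n)
  case (Imp p q)
  then show ?case by (metis scoped.simps(4))
next
  case (All p)
  then show ?case by (metis scoped.simps(5) Suc_le_mono)
qed auto

lemma scoped_exists: "\<exists>k. scoped k p"
proof (induction p)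
  case (Mem i j)
  show ?case by (rule exI[of _ "Suc (max i j)"]) auto
next
  case (Eq i j)
  show ?case by (rule exI[of _ "Suc (max i j)"]) auto
next
  case (Imp p q)
  then obtain k l where "scoped k p" "scoped l q" by blast
  then have "scoped (max k l) (Imp p q)"
    using scoped_mono[of k p "max k l"] scoped_mono[of l q "max k l"] by simp
  then show ?case by blast
next
  case (All p)
  then obtain k where "scoped k p" by blast
  then have "scoped (Suc k) p" by (rule scoped_mono) simp
  then show ?case by (intro exI[of _ k]) simp
qed auto

context str
begin

text \<open>Predicates are formed in a context \<open>e\<close> listing the values of the bound variables,
  innermost first; \<open>isv\<close> are the variables and the parameters.\<close>

definition isv :: "((nat \<Rightarrow> 'u) \<Rightarrow> 'u) \<Rightarrow> bool" where
  "isv t \<longleftrightarrow> (\<exists>i. t = (\<lambda>e. e i)) \<or> (\<exists>a. t = (\<lambda>_. a))"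

text \<open>The parameter \<open>C\<close> selects all formulas or the \<open>delta0\<close> ones.
  Each free variable stands for a variable of the context or for a parameter, which makes parameters
  available everywhere without listing them.\<close>

definition Dfn :: "(fm \<Rightarrow> bool) \<Rightarrow> ((nat \<Rightarrow> 'u) \<Rightarrow> bool) \<Rightarrow> bool" where
  "Dfn C P \<longleftrightarrow> (\<exists>p v. C p \<and> (\<forall>i. isv (v i)) \<and> (\<forall>e. P e \<longleftrightarrow> sat UNIV E (\<lambda>i. v i e) p))"

abbreviation "Df \<equiv> Dfn (\<lambda>_. True)"
abbreviation "Df0 \<equiv> Dfn delta0"

named_theorems Dfi
named_theorems Df0i

lemma isv_var [Df0i]: "isv (\<lambda>e. e i)" and isv_const [Df0i]: "isv (\<lambda>e. a)"
  by (auto simp: isv_def)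

lemma isv_subst:
  assumes "isv t" "\<And>i. isv (s i)"
  shows "isv (\<lambda>e. t (\<lambda>i. s i e))"
  using assms(1) unfolding isv_def[of t]
proof
  assume "\<exists>i. t = (\<lambda>e. e i)"
  then obtain i where "t = (\<lambda>e. e i)" by blast
  then show ?thesis using assms(2)[of i] by simp
next
  assume "\<exists>a. t = (\<lambda>_. a)"
  then show ?thesis by (auto simp: isv_def)
qed

lemma Dfn_subst: "Dfn C P \<Longrightarrow> (\<And>i. isv (s i)) \<Longrightarrow> Dfn C (\<lambda>e. P (\<lambda>i. s i e))"
proof -
  assume "Dfn C P" and s: "\<And>i. isv (s i)"
  then obtain p v where p: "C p" "\<And>i. isv (v i)" and P: "\<And>e. P e \<longleftrightarrow> sat UNIV E (\<lambda>i. v i e) p"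
    unfolding Dfn_def by blast
  have "isv (\<lambda>e. v i (\<lambda>j. s j e))" for i using p(2) s by (rule isv_subst)
  with p(1) P show ?thesis unfolding Dfn_def
    by (intro exI[of _ p] exI[of _ "\<lambda>i e. v i (\<lambda>j. s j e)"]) simp
qed

lemma Dfn_imp:
  assumes C: "\<And>p f. C p \<Longrightarrow> C (ren f p)" "\<And>p q. C p \<Longrightarrow> C q \<Longrightarrow> C (Imp p q)"
    and P: "Dfn C P" and Q: "Dfn C Q"
  shows "Dfn C (\<lambda>e. P e \<longrightarrow> Q e)"
proof -
  obtain p v where p: "C p" "\<And>i. isv (v i)" "\<And>e. P e \<longleftrightarrow> sat UNIV E (\<lambda>i. v i e) p"
    using P unfolding Dfn_def by blast
  obtain q w where q: "C q" "\<And>i. isv (w i)" "\<And>e. Q e \<longleftrightarrow> sat UNIV E (\<lambda>i. w i e) q"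
    using Q unfolding Dfn_def by blast
  \<comment> \<open>Even and odd indices keep the environments of the two formulas apart.\<close>
  let ?r = "Imp (ren (\<lambda>i. 2 * i) p) (ren (\<lambda>i. 2 * i + 1) q)"
  let ?u = "\<lambda>i. if even i then v (i div 2) else w (i div 2)"
  have "C ?r" by (intro C p q)
  moreover have "isv (?u i)" for i using p(2) q(2) by simp
  moreover have "(P e \<longrightarrow> Q e) \<longleftrightarrow> sat UNIV E (\<lambda>i. ?u i e) ?r" for e
    by (simp add: p(3) q(3) sat_ren comp_def)
  ultimately show ?thesis unfolding Dfn_def by (intro exI[of _ ?r] exI[of _ ?u]) simp
qed

lemma Dfn_false: "C Bot \<Longrightarrow> Dfn C (\<lambda>e. False)"
  unfolding Dfn_def by (intro exI[of _ Bot] exI[of _ "\<lambda>i e. e i"]) (simp add: isv_var)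

lemma Df_imp [Dfi]: "Df P \<Longrightarrow> Df Q \<Longrightarrow> Df (\<lambda>e. P e \<longrightarrow> Q e)"
  and Df0_imp [Df0i]: "Df0 P \<Longrightarrow> Df0 Q \<Longrightarrow> Df0 (\<lambda>e. P e \<longrightarrow> Q e)"
  by (rule Dfn_imp; auto intro: delta0_ren delta0.intros)+

lemma Df_false [Dfi]: "Df (\<lambda>e. False)" and Df0_false [Df0i]: "Df0 (\<lambda>e. False)"
  by (rule Dfn_false; auto intro: delta0.intros)+

lemma Df_not [Dfi]: "Df P \<Longrightarrow> Df (\<lambda>e. \<not> P e)" and Df0_not [Df0i]: "Df0 Q \<Longrightarrow> Df0 (\<lambda>e. \<not> Q e)"
  using Df_imp[OF _ Df_false, of P] Df0_imp[OF _ Df0_false, of Q] by simp_all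

lemma Df_true [Dfi]: "Df (\<lambda>e. True)" and Df0_true [Df0i]: "Df0 (\<lambda>e. True)"
  using Df_not[OF Df_false] Df0_not[OF Df0_false] by simp_all

lemma Df_or [Dfi]: "Df P \<Longrightarrow> Df Q \<Longrightarrow> Df (\<lambda>e. P e \<or> Q e)"
  and Df0_or [Df0i]: "Df0 P \<Longrightarrow> Df0 Q \<Longrightarrow> Df0 (\<lambda>e. P e \<or> Q e)"
  unfolding disj_imp by (intro Dfi Df0i; assumption)+

lemma Df_and [Dfi]: "Df P \<Longrightarrow> Df Q \<Longrightarrow> Df (\<lambda>e. P e \<and> Q e)"
  and Df0_and [Df0i]: "Df0 P \<Longrightarrow> Df0 Q \<Longrightarrow> Df0 (\<lambda>e. P e \<and> Q e)"
  using Df_not[OF Df_imp[OF _ Df_not, of P Q]] Df0_not[OF Df0_imp[OF _ Df0_not, of P Q]]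
  by simp_all

lemma Df_iff [Dfi]: "Df P \<Longrightarrow> Df Q \<Longrightarrow> Df (\<lambda>e. P e \<longleftrightarrow> Q e)"
  and Df0_iff [Df0i]: "Df0 P \<Longrightarrow> Df0 Q \<Longrightarrow> Df0 (\<lambda>e. P e \<longleftrightarrow> Q e)"
  unfolding iff_conv_conj_imp by (intro Dfi Df0i; assumption)+

lemma Dfn_atom:
  assumes "isv t" "isv u"
  shows "C (Mem 0 1) \<Longrightarrow> Dfn C (\<lambda>e. t e \<epsilon> u e)" "C (Eq 0 1) \<Longrightarrow> Dfn C (\<lambda>e. t e = u e)"
  unfolding Dfn_def
  by (rule exI[of _ "Mem 0 1"], rule exI[of _ "\<lambda>i. if i = 0 then t else u"], simp add: assms)
    (rule exI[of _ "Eq 0 1"], rule exI[of _ "\<lambda>i. if i = 0 then t else u"], simp add: assms)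

lemma Df0_mem [Df0i]: "isv t \<Longrightarrow> isv u \<Longrightarrow> Df0 (\<lambda>e. t e \<epsilon> u e)"
  and Df0_eq: "isv t \<Longrightarrow> isv u \<Longrightarrow> Df0 (\<lambda>e. t e = u e)"
  by (auto intro!: Dfn_atom delta0.intros)

lemma Df0_eq_var [Df0i]: "Df0 (\<lambda>e. e i = e j)" "Df0 (\<lambda>e. e i = b)" "Df0 (\<lambda>e. b = e i)"
  by (auto intro: Df0_eq isv_var isv_const)

text \<open>Passing a quantifier: the bound variable becomes the new variable 0 of the formula.\<close>

lemma Dfn_unbind:
  assumes "Dfn C (\<lambda>e. P (e 0) (\<lambda>i. e (Suc i)))"
  shows "\<exists>p f w. C p \<and> (\<forall>i. isv (w i)) \<and> (\<forall>x e. P x e \<longleftrightarrow>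
    sat UNIV E (\<lambda>i. if f i then x else w i e) p)"
proof -
  obtain p v where p: "C p" "\<And>i. isv (v i)"
    and P: "\<And>e. P (e 0) (\<lambda>i. e (Suc i)) \<longleftrightarrow> sat UNIV E (\<lambda>i. v i e) p"
    using assms unfolding Dfn_def by blast
  define f where "f i \<longleftrightarrow> v i = (\<lambda>e. e 0)" for i
  define w where "w i = (\<lambda>e. v i (case_nat undefined e))" for i
  have w: "isv (w i)" for i unfolding w_def
  proof (rule isv_subst[of "v i" "\<lambda>k e. case_nat undefined e k", OF p(2)])
    show "isv (\<lambda>e. case_nat undefined e k)" for k by (cases k) (auto simp: isv_def)
  qed
  have vw: "v i (case_nat x e) = (if f i then x else w i e)" for i x e
    using p(2)[of i] unfolding isv_def f_def w_def
  proof (elim disjE exE)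
    fix k assume k: "v i = (\<lambda>e. e k)"
    show "v i (case_nat x e) =
        (if v i = (\<lambda>e. e 0) then x else v i (case_nat undefined e))"
      using k by (cases k) (auto dest: fun_cong[of _ _ "case_nat x e"])
  next
    fix a assume a: "v i = (\<lambda>_. a)"
    show "v i (case_nat x e) =
        (if v i = (\<lambda>e. e 0) then x else v i (case_nat undefined e))"
      using a by (auto dest: fun_cong[of _ _ "case_nat x e"])
  qed
  have "P x e \<longleftrightarrow> sat UNIV E (\<lambda>i. if f i then x else w i e) p" for x e
    using P[of "case_nat x e"] by (simp add: vw)
  with p(1) w show ?thesis by blast
qed

lemma Df_all [Dfi]:
  assumes "Df (\<lambda>e. P (e 0) (\<lambda>i. e (Suc i)))"
  shows "Df (\<lambda>e. \<forall>x. P x e)"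
proof -
  obtain p f w where w: "\<And>i. isv (w i)"
    and P: "\<And>x e. P x e \<longleftrightarrow> sat UNIV E (\<lambda>i. if f i then x else w i e) p"
    using Dfn_unbind[OF assms] by blast
  have "(\<lambda>i. if f i then x else w i e) = case_nat x (\<lambda>i. w i e) \<circ> (\<lambda>i. if f i then 0 else Suc i)"
    for x e by auto
  then have "(\<forall>x. P x e) \<longleftrightarrow>
      sat UNIV E (\<lambda>i. w i e) (All (ren (\<lambda>i. if f i then 0 else Suc i) p))" for e
    by (simp add: P sat_ren)
  with w show ?thesis unfolding Dfn_def by blast
qed

lemma Df_ex [Dfi]:
  assumes "Df (\<lambda>e. P (e 0) (\<lambda>i. e (Suc i)))"
  shows "Df (\<lambda>e. \<exists>x. P x e)"
  using Df_not[OF Df_all[of "\<lambda>x e. \<not> P x e"], OF Df_not[OF assms]] by simp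

lemma Df0_all [Df0i]:
  assumes a: "isv a" and "Df0 (\<lambda>e. P (e 0) (\<lambda>i. e (Suc i)))"
  shows "Df0 (\<lambda>e. \<forall>x. x \<epsilon> a e \<longrightarrow> P x e)"
proof -
  obtain p f w where p: "delta0 p" and w: "\<And>i. isv (w i)"
    and P: "\<And>x e. P x e \<longleftrightarrow> sat UNIV E (\<lambda>i. if f i then x else w i e) p"
    using Dfn_unbind[OF assms(2)] by blast
  \<comment> \<open>Next to the new variable 0, index 1 is reserved for the bound \<open>a\<close>;
    hence the double shift.\<close>
  let ?f = "\<lambda>i. if f i then 0 else Suc (Suc i)"
  let ?w = "\<lambda>i. case i of 0 \<Rightarrow> a | Suc i \<Rightarrow> w i"
  let ?q = "All (Imp (Mem 0 (Suc 0)) (ren ?f p))"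
  have "(\<lambda>i. if f i then x else w i e) = case_nat x (\<lambda>i. ?w i e) \<circ> ?f" for x e by auto
  then have "(\<forall>x. x \<epsilon> a e \<longrightarrow> P x e) \<longleftrightarrow> sat UNIV E (\<lambda>i. ?w i e) ?q" for e
    by (simp add: P sat_ren)
  moreover have "isv (?w i)" for i using a w by (cases i) auto
  moreover have "delta0 ?q" using p by (intro delta0.intros delta0_ren)
  ultimately show ?thesis unfolding Dfn_def by (intro exI[of _ ?q] exI[of _ ?w]) simp
qed

lemma Df0_ex [Df0i]:
  assumes a: "isv a" and "Df0 (\<lambda>e. P (e 0) (\<lambda>i. e (Suc i)))"
  shows "Df0 (\<lambda>e. \<exists>x. x \<epsilon> a e \<and> P x e)"
  using Df0_not[OF Df0_all[of a "\<lambda>x e. \<not> P x e"], OF a Df0_not[OF assms(2)]] by simp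

lemma Df0_Df: "Df0 P \<Longrightarrow> Df P"
  unfolding Dfn_def by blast

section \<open>Definable terms and their substitution\<close>

definition Dt :: "((nat \<Rightarrow> 'u) \<Rightarrow> 'u) \<Rightarrow> bool" where
  "Dt t \<longleftrightarrow> Df (\<lambda>e. e 0 = t (\<lambda>i. e (Suc i)))"

lemma Dt_isv: "isv t \<Longrightarrow> Dt t"
  unfolding Dt_def
  by (rule Df0_Df, rule Df0_eq) (auto intro: isv_var isv_subst[of t "\<lambda>i e. e (Suc i)"])

lemma Dt_var [Dfi]: "Dt (\<lambda>e. e i)" and Dt_const [Dfi]: "Dt (\<lambda>e. a)"
  by (auto intro: Dt_isv isv_var isv_const)

lemma Dt_shift:
  assumes "Dt t"
  shows "Dt (\<lambda>e. t (\<lambda>i. e (Suc i)))"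
  unfolding Dt_def
  using Dfn_subst[OF assms[unfolded Dt_def], of "\<lambda>i e. e (if i = 0 then 0 else Suc i)"]
  by (simp add: isv_var)

lemma Df_subst1:
  assumes "Df (\<lambda>e. P (e 0) (\<lambda>i. e (Suc i)))" "Dt t"
  shows "Df (\<lambda>e. P (t e) e)"
proof -
  have "Df (\<lambda>e. \<exists>x. x = t e \<and> P x e)"
    by (intro Df_ex Df_and assms(1) assms(2)[unfolded Dt_def])
  then show ?thesis by simp
qed

lemma Df_substn:
  "Df P \<Longrightarrow> (\<And>i. i < k \<Longrightarrow> Dt (s i)) \<Longrightarrow> (\<And>i. i \<ge> k \<Longrightarrow> isv (s i)) \<Longrightarrow> Df (\<lambda>e. P (\<lambda>i. s i e))"
proof (induction k arbitrary: P s)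
  case 0
  show ?case by (rule Dfn_subst) (use 0 in auto)
next
  case (Suc k)
  \<comment> \<open>Term number \<open>k\<close> is turned into variable 0, which leaves only
    \<open>k\<close> proper terms for the induction hypothesis; \<open>Df_subst1\<close> puts it
    back.\<close>
  let ?s = "\<lambda>i e. if i = k then e 0 else s i (\<lambda>j. e (Suc j))"
  have "Df (\<lambda>e. P (\<lambda>i. ?s i e))"
  proof (rule Suc.IH[of P ?s, OF Suc.prems(1)])
    show "Dt (?s i)" if "i < k" for i
      using that Suc.prems(2)[of i] by (simp add: Dt_shift)
    show "isv (?s i)" if "k \<le> i" for i
    proof (cases "i = k")
      case False
      with that have "isv (s i)" by (intro Suc.prems) simp
      with False show ?thesis using isv_subst[of "s i" "\<lambda>j e. e (Suc j)"] by (simp add: isv_var)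
    qed (simp add: isv_var)
  qed
  from Df_subst1[of "\<lambda>x e. P (\<lambda>i. if i = k then x else s i e)", OF this Suc.prems(2)[of k]]
  have "Df (\<lambda>e. P (\<lambda>i. if i = k then s k e else s i e))" by simp
  moreover have "(\<lambda>i. if i = k then s k e else s i e) = (\<lambda>i. s i e)" for e by auto
  ultimately show ?case by simp
qed

text \<open>Reduces a predicate applied to terms to the same predicate at distinct variables, the
  only case in which a formula has to be exhibited. Indices beyond the list receive the dummy value
  \<open>e 0\<close>.\<close>

lemma Df_list:
  assumes "Df P" "\<And>t. t \<in> set ts \<Longrightarrow> Dt t"
  shows "Df (\<lambda>e. P (\<lambda>i. if i < length ts then (ts ! i) e else e 0))"
proof -
  have "Df (\<lambda>e. P (\<lambda>i. (if i < length ts then ts ! i else (\<lambda>e. e 0)) e))"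
    by (rule Df_substn[OF assms(1), of "length ts"]) (auto simp: assms(2) isv_var)
  moreover have "(\<lambda>i. (if i < length ts then ts ! i else (\<lambda>e. e 0)) e) =
      (\<lambda>i. if i < length ts then (ts ! i) e else e 0)" for e :: "nat \<Rightarrow> 'u" by auto
  ultimately show ?thesis by simp
qed

lemma Df1: "Df (\<lambda>e. R (e 0)) \<Longrightarrow> Dt t \<Longrightarrow> Df (\<lambda>e. R (t e))"
  using Df_list[of "\<lambda>e. R (e 0)" "[t]"] by simp

lemma Df2: "Df (\<lambda>e. R (e 0) (e 1)) \<Longrightarrow> Dt t \<Longrightarrow> Dt u \<Longrightarrow> Df (\<lambda>e. R (t e) (u e))"
  using Df_list[of "\<lambda>e. R (e 0) (e 1)" "[t, u]"] by auto

lemma Df3: "Df (\<lambda>e. R (e 0) (e 1) (e 2)) \<Longrightarrow> Dt t \<Longrightarrow> Dt u \<Longrightarrow> Dt v \<Longrightarrow> Df (\<lambda>e. R (t e) (u e) (v e))"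
  using Df_list[of "\<lambda>e. R (e 0) (e 1) (e 2)" "[t, u, v]"] by (auto simp: numeral_eq_Suc)

lemma Df4: "Df (\<lambda>e. R (e 0) (e 1) (e 2) (e 3)) \<Longrightarrow> Dt t \<Longrightarrow> Dt u \<Longrightarrow> Dt v \<Longrightarrow> Dt w \<Longrightarrow>
    Df (\<lambda>e. R (t e) (u e) (v e) (w e))"
  using Df_list[of "\<lambda>e. R (e 0) (e 1) (e 2) (e 3)" "[t, u, v, w]"]
  by (auto simp: numeral_eq_Suc)

lemma Df5: "Df (\<lambda>e. R (e 0) (e 1) (e 2) (e 3) (e 4)) \<Longrightarrow> Dt t \<Longrightarrow> Dt u \<Longrightarrow> Dt v \<Longrightarrow> Dt w \<Longrightarrow> Dt x \<Longrightarrow>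
    Df (\<lambda>e. R (t e) (u e) (v e) (w e) (x e))"
  using Df_list[of "\<lambda>e. R (e 0) (e 1) (e 2) (e 3) (e 4)" "[t, u, v, w, x]"]
  by (auto simp: numeral_eq_Suc)

lemma Df6: "Df (\<lambda>e. R (e 0) (e 1) (e 2) (e 3) (e 4) (e 5)) \<Longrightarrow>
    Dt t \<Longrightarrow> Dt u \<Longrightarrow> Dt v \<Longrightarrow> Dt w \<Longrightarrow> Dt x \<Longrightarrow> Dt y \<Longrightarrow> Df (\<lambda>e. R (t e) (u e) (v e) (w e) (x e) (y e))"
  using Df_list[of "\<lambda>e. R (e 0) (e 1) (e 2) (e 3) (e 4) (e 5)" "[t, u, v, w, x, y]"]
  by (auto simp: numeral_eq_Suc)

lemma Dt1: "Dt (\<lambda>e. f (e 0)) \<Longrightarrow> Dt t \<Longrightarrow> Dt (\<lambda>e. f (t e))"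
  unfolding Dt_def[of "\<lambda>e. f (t e)"] Dt_def[of "\<lambda>e. f (e 0)"]
  using Df2[of "\<lambda>y x. y = f x", OF _ Dt_var Dt_shift[of t]] by simp

lemma Dt2: "Dt (\<lambda>e. f (e 0) (e 1)) \<Longrightarrow> Dt t \<Longrightarrow> Dt u \<Longrightarrow> Dt (\<lambda>e. f (t e) (u e))"
  unfolding Dt_def[of "\<lambda>e. f (t e) (u e)"] Dt_def[of "\<lambda>e. f (e 0) (e 1)"]
  using Df3[of "\<lambda>y x z. y = f x z", OF _ Dt_var Dt_shift[of t] Dt_shift[of u]]
  by (simp add: numeral_2_eq_2)

lemma Df_mem [Dfi]: "Dt t \<Longrightarrow> Dt u \<Longrightarrow> Df (\<lambda>e. t e \<epsilon> u e)"
  by (rule Df2) (auto intro!: Dfn_atom isv_var)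

lemma Df_eq [Dfi]: "Dt t \<Longrightarrow> Dt u \<Longrightarrow> Df (\<lambda>e. t e = u e)"
  by (rule Df2) (auto intro!: Dfn_atom isv_var)

text \<open>Links the two ways of writing formulas: a notion already spelled out with binders is
  definable because \<open>bs\<close> evaluates it.\<close>

lemma Df_bs:
  assumes "\<And>e. bs UNIV n e B \<longleftrightarrow> P e"
  shows "Df P"
proof -
  let ?v = "\<lambda>i. if i < n then (\<lambda>e. e (n - 1 - i)) else (\<lambda>e. d (i - n))"
  have "P e \<longleftrightarrow> sat UNIV E (\<lambda>i. ?v i e) (B n)" for e
    unfolding assms[symmetric] bs_def by (simp add: if_distrib[of "\<lambda>f. f e"])
  moreover have "isv (?v i)" for i by (simp add: isv_var isv_const)
  ultimately show ?thesis unfolding Dfn_def by (intro exI[of _ "B n"] exI[of _ ?v]) simp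
qed

lemma Df_Empty [Dfi]: "Dt t \<Longrightarrow> Df (\<lambda>e. Empty (t e))"
  by (rule Df1, rule Df_bs[of 1 "is_empty 0"]) simp_all

lemma Df_Succ [Dfi]: "Dt t \<Longrightarrow> Dt u \<Longrightarrow> Df (\<lambda>e. Succ (t e) (u e))"
  by (rule Df2, rule Df_bs[of 2 "is_succ 0 1"]) simp_all

lemma Df_Trans [Dfi]: "Dt t \<Longrightarrow> Df (\<lambda>e. Trans (t e))"
  by (rule Df1, rule Df_bs[of 1 "transitive 0"]) simp_all

lemma Df_Omega [Dfi]: "Dt t \<Longrightarrow> Df (\<lambda>e. Omega (t e))"
  by (rule Df1, rule Df_bs[of 1 "is_omega 0"]) simp_all

lemma Df_Natl [Dfi]: "Dt t \<Longrightarrow> Df (\<lambda>e. Natl (t e))"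
  by (rule Df1, rule Df_bs[of 1 "natural 0"]) simp_all

lemma Df_Op [Dfi]: "Dt t \<Longrightarrow> Dt u \<Longrightarrow> Dt v \<Longrightarrow> Df (\<lambda>e. Op (t e) (u e) (v e))"
  by (rule Df3, rule Df_bs[of 3 "is_opair 0 1 2"]) simp_all

lemma Df_App [Dfi]: "Dt t \<Longrightarrow> Dt u \<Longrightarrow> Dt v \<Longrightarrow> Df (\<lambda>e. App (t e) (u e) (v e))"
  by (rule Df3, rule Df_bs[of 3 "app 0 1 2"]) simp_all

lemma Df_FunOn [Dfi]: "Dt t \<Longrightarrow> Dt u \<Longrightarrow> Df (\<lambda>e. FunOn (t e) (u e))"
  by (rule Df2, rule Df_bs[of 2 "is_fun_on 0 1"]) simp_all

lemma Df_Fun [Dfi]: "Dt t \<Longrightarrow> Dt u \<Longrightarrow> Dt v \<Longrightarrow> Df (\<lambda>e. Fun (t e) (u e) (v e))"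
  by (rule Df3, rule Df_bs[of 3 "is_fun 0 1 2"]) simp_all

lemma Df_MemSats [Dfi]:
  "Dt t \<Longrightarrow> Dt u \<Longrightarrow> Dt v \<Longrightarrow> Dt w \<Longrightarrow> Df (\<lambda>e. MemSats (t e) (u e) (v e) (w e))"
  by (rule Df4, rule Df_bs[of 4 "mem_sats 0 1 2 3"]) simp_all

lemma Df_SatAt [Dfi]:
  "Dt t \<Longrightarrow> Dt u \<Longrightarrow> Dt v \<Longrightarrow> Dt w \<Longrightarrow> Dt x \<Longrightarrow> Df (\<lambda>e. SatAt (t e) (u e) (v e) (w e) (x e))"
  by (rule Df5, rule Df_bs[of 5 "sat_at 0 1 2 3 4"]) simp_all

lemma Df_SatAt2 [Dfi]:
  "Dt t \<Longrightarrow> Dt u \<Longrightarrow> Dt v \<Longrightarrow> Dt w \<Longrightarrow> Dt x \<Longrightarrow> Dt y \<Longrightarrow>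
    Df (\<lambda>e. SatAt2 (t e) (u e) (v e) (w e) (x e) (y e))"
  by (rule Df6, rule Df_bs[of 6 "sat_at2 0 1 2 3 4 5"]) simp_all

text \<open>Schemes quantify over formulas with parameters; here over definable predicates.\<close>

lemma Df_formula1:
  assumes "Df (\<lambda>e. P (e 0))"
  obtains p e where "\<And>x. P x \<longleftrightarrow> sat UNIV E (case_nat x e) p"
proof -
  obtain p f w where P: "\<And>x e. P x \<longleftrightarrow> sat UNIV E (\<lambda>i. if f i then x else w i e) p"
    using Dfn_unbind[of "\<lambda>_. True" "\<lambda>x e. P x", OF assms] by blast
  have "P x \<longleftrightarrow> sat UNIV E (case_nat x (\<lambda>i. w i undefined)) (ren (\<lambda>i. if f i then 0 else Suc i) p)" for x
  proof -
    have "(\<lambda>i. if f i then x else w i undefined) =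
        case_nat x (\<lambda>i. w i undefined) \<circ> (\<lambda>i. if f i then 0 else Suc i)" by auto
    then show ?thesis by (simp add: P[of x undefined] sat_ren)
  qed
  then show thesis by (rule that)
qed

lemma Df0_formula1:
  assumes "Df0 (\<lambda>e. P (e 0))"
  obtains p e where "delta0 p" "\<And>x. P x \<longleftrightarrow> sat UNIV E (case_nat x e) p"
proof -
  obtain p f w where "delta0 p" and P: "\<And>x e. P x \<longleftrightarrow> sat UNIV E (\<lambda>i. if f i then x else w i e) p"
    using Dfn_unbind[of delta0 "\<lambda>x e. P x", OF assms] by blast
  have "P x \<longleftrightarrow> sat UNIV E (case_nat x (\<lambda>i. w i undefined)) (ren (\<lambda>i. if f i then 0 else Suc i) p)" for x
  proof -
    have "(\<lambda>i. if f i then x else w i undefined) =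
        case_nat x (\<lambda>i. w i undefined) \<circ> (\<lambda>i. if f i then 0 else Suc i)" by auto
    then show ?thesis by (simp add: P[of x undefined] sat_ren)
  qed
  with delta0_ren[OF \<open>delta0 p\<close>] show thesis by (rule that)
qed

lemma Df_formula2:
  assumes "Df (\<lambda>e. P (e 0) (e 1))"
  obtains p e where "\<And>x y. P x y \<longleftrightarrow> sat UNIV E (case_nat x (case_nat y e)) p"
proof -
  obtain p v where v: "\<And>i. isv (v i)" and P: "\<And>e. P (e 0) (e 1) \<longleftrightarrow> sat UNIV E (\<lambda>i. v i e) p"
    using assms unfolding Dfn_def by blast
  let ?f = "\<lambda>i. if v i = (\<lambda>e. e 0) then 0 else if v i = (\<lambda>e. e 1) then 1 else Suc (Suc i)"
  let ?e = "\<lambda>i. v i (\<lambda>_. undefined)"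
  have "P x y \<longleftrightarrow> sat UNIV E (case_nat x (case_nat y ?e)) (ren ?f p)" for x y
  proof -
    let ?xy = "case_nat x (case_nat y (\<lambda>_. undefined))"
    have "v i ?xy = case_nat x (case_nat y ?e) (?f i)" for i
    proof (cases "v i = (\<lambda>e. e 0) \<or> v i = (\<lambda>e. e 1)")
      case True
      then show ?thesis by auto
    next
      case False
      then have f: "case_nat x (case_nat y ?e) (?f i) = v i (\<lambda>_. undefined)" by simp
      from v[of i] consider k where "v i = (\<lambda>e. e k)" | a where "v i = (\<lambda>_. a)"
        unfolding isv_def by blast
      then show ?thesis
      proof cases
        case (1 k)
        with False have "k \<noteq> 0" "k \<noteq> 1" by auto
        then obtain m where "k = Suc (Suc m)" by (metis One_nat_def not0_implies_Suc)
        with 1 show ?thesis unfolding f by simp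
      next
        case (2 a)
        then show ?thesis unfolding f by simp
      qed
    qed
    then show ?thesis using P[of ?xy] by (simp add: sat_ren comp_def)
  qed
  then show thesis by (rule that)
qed

end

section \<open>Basic set theory\<close>

text \<open>The ground shared by both directions. Foundation is included since ZFC has it as an
  axiom and LZFC inherits it from a model containing the given set; \<omega> is left out because ZFC
  first has to extract it from an inductive set.\<close>

locale bst_pre = str +
  assumes ext: "(\<And>z. z \<epsilon> x \<longleftrightarrow> z \<epsilon> y) \<Longrightarrow> x = y"
    and ex_empty: "\<exists>x. \<forall>z. \<not> z \<epsilon> x"
    and ex_pair: "\<exists>p. \<forall>z. z \<epsilon> p \<longleftrightarrow> z = x \<or> z = y"
    and ex_union: "\<exists>u. \<forall>z. z \<epsilon> u \<longleftrightarrow> (\<exists>y. y \<epsilon> x \<and> z \<epsilon> y)"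
    and ex_product: "\<exists>c. \<forall>z. z \<epsilon> c \<longleftrightarrow> (\<exists>x. x \<epsilon> a \<and> (\<exists>y. y \<epsilon> b \<and> Op z x y))"
    and sep0: "Df0 (\<lambda>e. P (e 0)) \<Longrightarrow> \<exists>b. \<forall>x. x \<epsilon> b \<longleftrightarrow> x \<epsilon> a \<and> P x"
    and foundation: "x \<epsilon> a \<Longrightarrow> \<exists>y. y \<epsilon> a \<and> (\<forall>z. z \<epsilon> a \<longrightarrow> \<not> z \<epsilon> y)"
begin

definition "isset P \<longleftrightarrow> (\<exists>b. \<forall>x. x \<epsilon> b \<longleftrightarrow> P x)"
definition "the_set P = (THE b. \<forall>x. x \<epsilon> b \<longleftrightarrow> P x)"

lemma the_set_eqI:
  assumes "\<And>x. x \<epsilon> b \<longleftrightarrow> P x"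
  shows "the_set P = b"
  unfolding the_set_def
proof (rule the_equality)
  show "\<forall>x. x \<epsilon> b \<longleftrightarrow> P x" using assms by blast
  show "c = b" if "\<forall>x. x \<epsilon> c \<longleftrightarrow> P x" for c
    by (rule ext) (simp add: that assms)
qed

lemma the_set_iff: "isset P \<Longrightarrow> x \<epsilon> the_set P \<longleftrightarrow> P x"
  using the_set_eqI[of _ P] unfolding isset_def by blast

text \<open>Set terms are total: where no set with the required elements exists, the value is the
  one fixed object \<open>THE b. False\<close>. As a parameter it may occur in the formula defining
  the graph.\<close>

lemma Dt_the_set [Dfi]:
  assumes "Df (\<lambda>e. P (e 0) (\<lambda>i. e (Suc i)))"
  shows "Dt (\<lambda>e. the_set (\<lambda>x. P x e))"
proof -
  have the: "y = the_set Q \<longleftrightarrow> (\<forall>x. x \<epsilon> y \<longleftrightarrow> Q x) \<or> \<not> isset Q \<and> y = (THE b. False)" for y Q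
  proof (cases "isset Q")
    case True
    have "y = the_set Q \<longleftrightarrow> (\<forall>x. x \<epsilon> y \<longleftrightarrow> Q x)"
    proof
      show "\<forall>x. x \<epsilon> y \<longleftrightarrow> Q x" if "y = the_set Q" using the_set_iff[OF True] that by simp
      show "y = the_set Q" if "\<forall>x. x \<epsilon> y \<longleftrightarrow> Q x" using the_set_eqI[of y Q] that by simp
    qed
    with True show ?thesis by simp
  next
    case False
    then have no: "\<not> (\<forall>x. x \<epsilon> b \<longleftrightarrow> Q x)" for b by (simp add: isset_def)
    then have "the_set Q = (THE b. False)" by (simp only: the_set_def)
    then show ?thesis by (simp only: False no simp_thms)
  qed
  have 1: "Df (\<lambda>e. P (e 0) (\<lambda>i. e (Suc (Suc i))))"
    using Dfn_subst[OF assms, of "\<lambda>i e. e (if i = 0 then 0 else Suc i)"] by (simp add: isv_var)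
  have 2: "Df (\<lambda>e. P (e 0) (\<lambda>i. e (Suc (Suc (Suc i)))))"
    using Dfn_subst[OF assms, of "\<lambda>i e. e (if i = 0 then 0 else Suc (Suc i))"]
    by (simp add: isv_var)
  show ?thesis unfolding Dt_def the isset_def by (intro Dfi 1 2)
qed

definition "emp = the_set (\<lambda>z. False)"
definition "up x y = the_set (\<lambda>z. z = x \<or> z = y)"
definition "uni x = the_set (\<lambda>z. \<exists>y. y \<epsilon> x \<and> z \<epsilon> y)"
definition "un x y = uni (up x y)"
definition "sg x = up x x"
definition "op x y = up (sg x) (up x y)"
definition "prd a b = the_set (\<lambda>z. \<exists>x. x \<epsilon> a \<and> (\<exists>y. y \<epsilon> b \<and> Op z x y))"
definition "suc x = un x (sg x)"
text \<open>The union of all values of \<open>f\<close> at \<open>x\<close>, hence the value itself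
  for a function; in this form application is a definable term for arbitrary
  \<open>f\<close>.\<close>

definition "ap f x = the_set (\<lambda>z. \<exists>y. op x y \<epsilon> f \<and> z \<epsilon> y)"

lemma mem_basic [simp]:
  "\<not> z \<epsilon> emp" "z \<epsilon> up x y \<longleftrightarrow> z = x \<or> z = y" "z \<epsilon> uni x \<longleftrightarrow> (\<exists>y. y \<epsilon> x \<and> z \<epsilon> y)"
  unfolding emp_def up_def uni_def
  by (subst the_set_iff; simp add: isset_def ex_empty ex_pair ex_union)+

lemma mem_derived [simp]:
  "z \<epsilon> un x y \<longleftrightarrow> z \<epsilon> x \<or> z \<epsilon> y" "z \<epsilon> sg x \<longleftrightarrow> z = x" "z \<epsilon> suc x \<longleftrightarrow> z \<epsilon> x \<or> z = x"
  by (auto simp: un_def sg_def suc_def)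

lemma ext_iff: "x = y \<longleftrightarrow> (\<forall>z. z \<epsilon> x \<longleftrightarrow> z \<epsilon> y)"
  using ext by blast

lemma rels [simp]:
  "Empty x \<longleftrightarrow> x = emp" "Up p x y \<longleftrightarrow> p = up x y" "Succ y x \<longleftrightarrow> y = suc x" "Bun c x y \<longleftrightarrow> c = un x y"
  unfolding sEmpty_def sUp_def sSucc_def sBun_def by (auto simp: ext_iff)

lemma Op_iff [simp]: "Op p x y \<longleftrightarrow> p = op x y"
  unfolding sOp_def by (simp add: op_def sg_def)

lemma mem_prd [simp]: "z \<epsilon> prd a b \<longleftrightarrow> (\<exists>x. x \<epsilon> a \<and> (\<exists>y. y \<epsilon> b \<and> z = op x y))"
  unfolding prd_def using ex_product by (subst the_set_iff) (auto simp: isset_def)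

lemma App_iff [simp]: "App f x y \<longleftrightarrow> op x y \<epsilon> f"
  by (simp add: sApp_def)

lemma Sub_iff [simp]: "Sub x y \<longleftrightarrow> (\<forall>z. z \<epsilon> x \<longrightarrow> z \<epsilon> y)"
  by (simp add: sSub_def)

lemma up_eq: "up x y = up x' y' \<longleftrightarrow> x = x' \<and> y = y' \<or> x = y' \<and> y = x'"
proof
  assume "up x y = up x' y'"
  then have "z \<epsilon> up x y \<longleftrightarrow> z \<epsilon> up x' y'" for z by simp
  then have "z = x \<or> z = y \<longleftrightarrow> z = x' \<or> z = y'" for z by simp
  then show "x = x' \<and> y = y' \<or> x = y' \<and> y = x'" by metis
qed (auto simp: ext_iff)

lemma op_eq [simp]: "op x y = op x' y' \<longleftrightarrow> x = x' \<and> y = y'"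
  by (auto simp: op_def up_eq sg_def)

lemma op_parts: "up x y \<epsilon> op x y" "x \<epsilon> up x y" "y \<epsilon> up x y"
  by (simp_all add: op_def)

lemma Dt_terms [Dfi]:
  "Dt t \<Longrightarrow> Dt u \<Longrightarrow> Dt (\<lambda>e. up (t e) (u e))" "Dt t \<Longrightarrow> Dt (\<lambda>e. uni (t e))"
  "Dt t \<Longrightarrow> Dt u \<Longrightarrow> Dt (\<lambda>e. un (t e) (u e))" "Dt t \<Longrightarrow> Dt (\<lambda>e. sg (t e))"
  "Dt t \<Longrightarrow> Dt u \<Longrightarrow> Dt (\<lambda>e. op (t e) (u e))" "Dt t \<Longrightarrow> Dt (\<lambda>e. suc (t e))"
  "Dt t \<Longrightarrow> Dt u \<Longrightarrow> Dt (\<lambda>e. prd (t e) (u e))" "Dt t \<Longrightarrow> Dt u \<Longrightarrow> Dt (\<lambda>e. ap (t e) (u e))"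
proof -
  show up: "Dt t \<Longrightarrow> Dt u \<Longrightarrow> Dt (\<lambda>e. up (t e) (u e))" for t u
    by (rule Dt2) (auto simp: up_def intro!: Dfi)
  show uni: "Dt t \<Longrightarrow> Dt (\<lambda>e. uni (t e))" for t
    by (rule Dt1) (auto simp: uni_def intro!: Dfi)
  show un: "Dt t \<Longrightarrow> Dt u \<Longrightarrow> Dt (\<lambda>e. un (t e) (u e))" for t u
    unfolding un_def by (intro up uni)
  show sg: "Dt t \<Longrightarrow> Dt (\<lambda>e. sg (t e))" for t
    unfolding sg_def by (intro up)
  show op: "Dt t \<Longrightarrow> Dt u \<Longrightarrow> Dt (\<lambda>e. op (t e) (u e))" for t u
    unfolding op_def by (intro up sg)
  show "Dt t \<Longrightarrow> Dt (\<lambda>e. suc (t e))"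
    unfolding suc_def by (intro un sg)
  show "Dt t \<Longrightarrow> Dt u \<Longrightarrow> Dt (\<lambda>e. prd (t e) (u e))"
    by (rule Dt2) (auto simp: prd_def intro!: Dfi op)
  show "Dt t \<Longrightarrow> Dt u \<Longrightarrow> Dt (\<lambda>e. ap (t e) (u e))"
    by (rule Dt2) (auto simp: ap_def intro!: Dfi op)
qed

text \<open>Extensionality compares with all sets; here the quantifiers are bounded by
  \<open>p\<close>. This makes pairing, and then ordered pairs and application, available in
  \<open>delta0\<close> separation.\<close>

lemma up_char: "p = up x y \<longleftrightarrow> x \<epsilon> p \<and> y \<epsilon> p \<and> (\<forall>z. z \<epsilon> p \<longrightarrow> z = x \<or> z = y)"
  by (rule iffI, simp, rule ext, auto)

lemma Df0_isv3:
  assumes "Df0 (\<lambda>e. R (e 0) (e 1) (e 2))" "isv t" "isv u" "isv v"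
  shows "Df0 (\<lambda>e. R (t e) (u e) (v e))"
  using Dfn_subst[OF assms(1), of "\<lambda>i. if i = 0 then t else if i = 1 then u else v"] assms(2-)
  by simp

lemma Df0_up [Df0i]: "isv p \<Longrightarrow> isv x \<Longrightarrow> isv y \<Longrightarrow> Df0 (\<lambda>e. p e = up (x e) (y e))"
  by (rule Df0_isv3) (unfold up_char, intro Df0i)

lemma Df0_op [Df0i]:
  assumes "isv p" "isv x" "isv y"
  shows "Df0 (\<lambda>e. p e = op (x e) (y e))"
proof (rule Df0_isv3[OF _ assms])
  have "p = op x y \<longleftrightarrow> (\<exists>u. u \<epsilon> p \<and> u = up x x) \<and> (\<exists>u. u \<epsilon> p \<and> u = up x y) \<and>
      (\<forall>u. u \<epsilon> p \<longrightarrow> u = up x x \<or> u = up x y)" for p x y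
    unfolding op_def sg_def up_char[of p] by auto
  note op = this
  show "Df0 (\<lambda>e. e 0 = op (e 1) (e 2))" unfolding op by (intro Df0i)
qed

lemma Df0_app [Df0i]:
  assumes "isv f" "isv x" "isv y"
  shows "Df0 (\<lambda>e. op (x e) (y e) \<epsilon> f e)"
proof (rule Df0_isv3[OF _ assms(2,3,1)])
  have "Df0 (\<lambda>e. \<exists>p. p \<epsilon> e 2 \<and> p = op (e 0) (e 1))" by (intro Df0i)
  then show "Df0 (\<lambda>e. op (e 0) (e 1) \<epsilon> e 2)" by simp
qed

lemma FunOn_iff: "FunOn f a \<longleftrightarrow> (\<forall>p. p \<epsilon> f \<longrightarrow> (\<exists>x. x \<epsilon> a \<and> (\<exists>y. p = op x y))) \<and>
    (\<forall>x. x \<epsilon> a \<longrightarrow> (\<exists>!y. op x y \<epsilon> f))"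
  unfolding sFunOn_def by (simp add: Ex1_def)

lemma Fun_iff: "Fun f a b \<longleftrightarrow> FunOn f a \<and> (\<forall>x y. op x y \<epsilon> f \<longrightarrow> y \<epsilon> b)"
  unfolding sFun_def by simp

lemma ap_eq:
  assumes f: "FunOn f a" and xy: "op x y \<epsilon> f"
  shows "ap f x = y"
proof -
  from f xy have "x \<epsilon> a" unfolding FunOn_iff by force
  with f have "\<exists>!y. op x y \<epsilon> f" unfolding FunOn_iff by blast
  with xy have "op x z \<epsilon> f \<longleftrightarrow> z = y" for z by blast
  then show ?thesis unfolding ap_def by (intro the_set_eqI) simp
qed

lemma ap_mem: "FunOn f a \<Longrightarrow> x \<epsilon> a \<Longrightarrow> op x (ap f x) \<epsilon> f"
proof -
  assume f: "FunOn f a" and "x \<epsilon> a"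
  then obtain y where "op x y \<epsilon> f" unfolding FunOn_iff by blast
  with ap_eq[OF f this] show ?thesis by simp
qed

lemma FunOn_app: "FunOn f a \<Longrightarrow> op x y \<epsilon> f \<longleftrightarrow> x \<epsilon> a \<and> ap f x = y"
proof -
  assume f: "FunOn f a"
  then have "x \<epsilon> a" if "op x y \<epsilon> f" using that unfolding FunOn_iff by force
  with ap_eq[OF f, of x y] ap_mem[OF f, of x] show ?thesis by blast
qed

lemma Fun_ap: "Fun f a b \<Longrightarrow> x \<epsilon> a \<Longrightarrow> ap f x \<epsilon> b"
  using ap_mem[of f a x] unfolding Fun_iff by blast

lemma FunOn_ext:
  assumes "FunOn f a" "FunOn g a" "\<And>x. x \<epsilon> a \<Longrightarrow> ap f x = ap g x"
  shows "f = g"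
proof (rule ext)
  fix p
  have "p \<epsilon> h \<longleftrightarrow> (\<exists>x. x \<epsilon> a \<and> p = op x (ap h x))" if "FunOn h a" for h
  proof
    assume p: "p \<epsilon> h"
    with that obtain x y where "p = op x y" unfolding FunOn_iff by blast
    with p show "\<exists>x. x \<epsilon> a \<and> p = op x (ap h x)" using FunOn_app[OF that, of x y] by auto
  qed (use ap_mem[OF that] in auto)
  then show "p \<epsilon> f \<longleftrightarrow> p \<epsilon> g" using assms by auto
qed

lemma no_cycles: "\<not> x \<epsilon> x" "x \<epsilon> y \<Longrightarrow> \<not> y \<epsilon> x" "x \<epsilon> y \<Longrightarrow> y \<epsilon> z \<Longrightarrow> \<not> z \<epsilon> x"
  using foundation[of x "sg x"] foundation[of x "up x y"] foundation[of x "un (up x y) (sg z)"]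
  by auto

text \<open>A set each of whose elements lies four \<open>\<in>\<close>-steps above another one is empty; Kuratowski
  coding puts formulas exactly that far above their immediate subformulas.\<close>

lemma foundation4:
  assumes H: "\<And>x y. x \<epsilon> y \<Longrightarrow> y \<epsilon> H \<Longrightarrow> x \<epsilon> H" "\<And>b. b \<epsilon> B \<Longrightarrow> b \<epsilon> H"
    and desc: "\<And>b. b \<epsilon> B \<Longrightarrow> \<exists>c x y z. c \<epsilon> B \<and> c \<epsilon> x \<and> x \<epsilon> y \<and> y \<epsilon> z \<and> z \<epsilon> b"
  shows "\<not> b \<epsilon> B"
proof
  assume b: "b \<epsilon> B"
  \<comment> \<open>\<open>?P y\<close> says that \<open>y\<close> lies at most three steps above a
    member of \<open>B\<close>. An \<in>-minimal such \<open>y\<close> nevertheless has one among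
    its elements: the next link of its chain or, if \<open>y\<close> itself is in \<open>B\<close>,
    the top link of the chain given by \<open>desc\<close>.\<close>
  let ?P = "\<lambda>y. \<exists>p. p \<epsilon> B \<and> (y = p \<or> p \<epsilon> y \<or> (\<exists>t. t \<epsilon> y \<and> p \<epsilon> t) \<or> (\<exists>t. t \<epsilon> y \<and> (\<exists>s. s \<epsilon> t \<and> p \<epsilon> s)))"
  have "Df0 (\<lambda>e. ?P (e 0))" by (intro Df0i)
  from sep0[OF this, of H] obtain Y where Y: "y \<epsilon> Y \<longleftrightarrow> y \<epsilon> H \<and> ?P y" for y by blast
  from b H(2) have "b \<epsilon> Y" unfolding Y by blast
  then obtain y where y: "y \<epsilon> Y" and min: "\<And>z. z \<epsilon> Y \<Longrightarrow> \<not> z \<epsilon> y" using foundation by blast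
  from y have yH: "y \<epsilon> H" unfolding Y by blast
  have below: False if "z \<epsilon> y" "?P z" for z
  proof -
    have "z \<epsilon> H" using that(1) yH by (rule H(1))
    with that(2) have "z \<epsilon> Y" unfolding Y by blast
    with that(1) min show False by blast
  qed
  from y obtain p where "p \<epsilon> B"
    "y = p \<or> p \<epsilon> y \<or> (\<exists>t. t \<epsilon> y \<and> p \<epsilon> t) \<or> (\<exists>t. t \<epsilon> y \<and> (\<exists>s. s \<epsilon> t \<and> p \<epsilon> s))" unfolding Y by blast
  then show False
  proof (elim disjE exE conjE)
    assume "p \<epsilon> B" "y = p"
    then obtain c x t z where "c \<epsilon> B" "c \<epsilon> x" "x \<epsilon> t" "t \<epsilon> z" "z \<epsilon> y" using desc by blast
    then show False using below[of z] by blast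
  next
    assume "p \<epsilon> B" "p \<epsilon> y"
    then show False using below[of p] by blast
  next
    fix t assume "p \<epsilon> B" "t \<epsilon> y" "p \<epsilon> t"
    then show False using below[of t] by blast
  next
    fix t s assume "p \<epsilon> B" "t \<epsilon> y" "s \<epsilon> t" "p \<epsilon> s"
    then show False using below[of t] by blast
  qed
qed

subsection \<open>The natural numbers\<close>

lemma ind_set: "Df0 (\<lambda>e. P (e 0)) \<Longrightarrow> x \<epsilon> a \<Longrightarrow> \<not> P x \<Longrightarrow>
    \<exists>y. y \<epsilon> a \<and> \<not> P y \<and> (\<forall>z. z \<epsilon> a \<longrightarrow> z \<epsilon> y \<longrightarrow> P z)"
proof -
  assume "Df0 (\<lambda>e. P (e 0))" and x: "x \<epsilon> a" "\<not> P x"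
  from sep0[OF Df0_not[OF this(1)], of a] obtain b where b: "z \<epsilon> b \<longleftrightarrow> z \<epsilon> a \<and> \<not> P z" for z by blast
  with x foundation[of x b] show ?thesis by blast
qed

lemma Ord_iff: "Ord x \<longleftrightarrow> (\<forall>y. y \<epsilon> x \<longrightarrow> (\<forall>z. z \<epsilon> y \<longrightarrow> z \<epsilon> x)) \<and>
    (\<forall>y. y \<epsilon> x \<longrightarrow> (\<forall>z. z \<epsilon> x \<longrightarrow> y \<epsilon> z \<or> y = z \<or> z \<epsilon> y))"
proof -
  have "\<exists>y. y \<epsilon> u \<and> (\<forall>z. z \<epsilon> u \<longrightarrow> \<not> z \<epsilon> y)" if "\<not> Empty u" for u
    using that foundation unfolding sEmpty_def by blast
  then show ?thesis unfolding sOrd_def sTrans_def Sub_iff by simp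
qed

lemma Ord_elem:
  assumes x: "Ord x" and y: "y \<epsilon> x"
  shows "Ord y"
proof -
  have "t \<epsilon> y" if z: "z \<epsilon> y" "t \<epsilon> z" for z t
  proof -
    have "t \<epsilon> x" using x y z unfolding Ord_iff by blast
    then have "t \<epsilon> y \<or> t = y \<or> y \<epsilon> t" using x y unfolding Ord_iff by blast
    with z no_cycles(2)[of z y] no_cycles(3)[of t z y] show ?thesis by blast
  qed
  moreover have "z \<epsilon> t \<or> z = t \<or> t \<epsilon> z" if "z \<epsilon> y" "t \<epsilon> y" for z t
    using that x y unfolding Ord_iff by blast
  ultimately show ?thesis unfolding Ord_iff by blast
qed

lemma Lim_iff: "sLim UNIV x \<longleftrightarrow> Ord x \<and> x \<noteq> emp \<and> (\<forall>y. y \<epsilon> x \<longrightarrow> (\<exists>z. z \<epsilon> x \<and> y \<epsilon> z))"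
  unfolding sLim_def by simp

lemma Omega_iff: "Omega w \<longleftrightarrow> sLim UNIV w \<and> (\<forall>y. y \<epsilon> w \<longrightarrow> \<not> sLim UNIV y)"
  unfolding sOmega_def by simp

lemma nonempty: "x \<noteq> emp \<Longrightarrow> \<exists>y. y \<epsilon> x"
  using ext_iff[of x emp] by simp

text \<open>The intersection \<open>z\<close> is an initial segment of both ordinals, hence equal to
  or an element of each. It cannot be an element of both, as it would then be an element of
  itself.\<close>

lemma Ord_linear:
  assumes "Ord x" "Ord y"
  shows "x \<epsilon> y \<or> x = y \<or> y \<epsilon> x"
proof -
  have "Df0 (\<lambda>e. e 0 \<epsilon> y)" by (intro Df0i)
  from sep0[OF this, of x] obtain z where z: "u \<epsilon> z \<longleftrightarrow> u \<epsilon> x \<and> u \<epsilon> y" for u by blast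
  have init: "z = a \<or> z \<epsilon> a" if a: "Ord a" and za: "\<And>u. u \<epsilon> z \<Longrightarrow> u \<epsilon> a"
    and zt: "\<And>u v. u \<epsilon> z \<Longrightarrow> v \<epsilon> u \<Longrightarrow> v \<epsilon> z" for a
  proof (cases "\<exists>m. m \<epsilon> a \<and> \<not> m \<epsilon> z")
    case False
    then have "z = a" using za by (intro ext) blast
    then show ?thesis ..
  next
    case True
    have "Df0 (\<lambda>e. e 0 \<epsilon> z)" by (intro Df0i)
    from ind_set[OF this] True obtain m where m: "m \<epsilon> a" "\<not> m \<epsilon> z" and l: "\<And>v. v \<epsilon> a \<Longrightarrow> v \<epsilon> m \<Longrightarrow> v \<epsilon> z"
      by blast
    have "v \<epsilon> z \<longleftrightarrow> v \<epsilon> m" for v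
    proof
      assume v: "v \<epsilon> z"
      then have "v \<epsilon> m \<or> v = m \<or> m \<epsilon> v" using za a m(1) unfolding Ord_iff by blast
      then show "v \<epsilon> m" using v m(2) zt by blast
    next
      assume v: "v \<epsilon> m"
      then have "v \<epsilon> a" using a m(1) unfolding Ord_iff by blast
      then show "v \<epsilon> z" using l v by blast
    qed
    then have "z = m" by (rule ext)
    with m(1) show ?thesis by blast
  qed
  have zt: "v \<epsilon> z" if "u \<epsilon> z" "v \<epsilon> u" for u v
    using that assms unfolding z Ord_iff by blast
  have "z = x \<or> z \<epsilon> x" by (rule init[OF assms(1)]) (use z zt in blast)+
  moreover have "z = y \<or> z \<epsilon> y" by (rule init[OF assms(2)]) (use z zt in blast)+
  moreover have "\<not> (z \<epsilon> x \<and> z \<epsilon> y)" using z[of z] no_cycles(1)[of z] by blast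
  ultimately show ?thesis by blast
qed

text \<open>The inductive set is a bound from which separation cuts out the natural numbers,
  described by \<open>nt\<close> as the ordinals with no limit among themselves and their elements.
  The least one missing from \<open>I\<close> would be 0 or the successor of a member of
  \<open>I\<close>.\<close>

lemma omega_exists:
  assumes I: "emp \<epsilon> I" "\<And>x. x \<epsilon> I \<Longrightarrow> suc x \<epsilon> I"
  shows "\<exists>w. Omega w"
proof -
  \<comment> \<open>The conjunct \<open>u = u\<close> casts nonemptiness as a bounded quantifier of
    the shape expected by \<open>Df0_ex\<close>.\<close>
  define lim where "lim x \<longleftrightarrow> (\<exists>u. u \<epsilon> x \<and> u = u) \<and> (\<forall>y. y \<epsilon> x \<longrightarrow> (\<exists>z. z \<epsilon> x \<and> y \<epsilon> z))" for x
  define ordl where "ordl x \<longleftrightarrow> (\<forall>y. y \<epsilon> x \<longrightarrow> (\<forall>z. z \<epsilon> y \<longrightarrow> z \<epsilon> x)) \<and>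
    (\<forall>y. y \<epsilon> x \<longrightarrow> (\<forall>z. z \<epsilon> x \<longrightarrow> y \<epsilon> z \<or> y = z \<or> z \<epsilon> y))" for x
  have L: "sLim UNIV x \<longleftrightarrow> Ord x \<and> lim x" for x
    unfolding Lim_iff lim_def using nonempty by auto
  define nt where "nt x \<longleftrightarrow> ordl x \<and> \<not> lim x \<and> (\<forall>y. y \<epsilon> x \<longrightarrow> \<not> lim y)" for x
  have O: "ordl x \<longleftrightarrow> Ord x" for x unfolding ordl_def Ord_iff ..
  have "Df0 (\<lambda>e. nt (e 0))" unfolding nt_def ordl_def lim_def by (intro Df0i)
  from sep0[OF this, of I] obtain w where w0: "x \<epsilon> w \<longleftrightarrow> x \<epsilon> I \<and> nt x" for x by blast
  have ntD: "nt y" if "nt x" "y \<epsilon> x" for x y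
    using that Ord_elem[of x y] unfolding nt_def O Ord_iff[of x] by blast
  have w: "x \<epsilon> w \<longleftrightarrow> nt x" for x
  proof -
    have "x \<epsilon> I" if x: "nt x"
    proof (rule ccontr)
      assume "\<not> x \<epsilon> I"
      have "Df0 (\<lambda>e. e 0 \<epsilon> I)" by (intro Df0i)
      from ind_set[OF this, of x "suc x"] \<open>\<not> x \<epsilon> I\<close> obtain y where y: "y \<epsilon> suc x" "\<not> y \<epsilon> I"
        and l: "\<And>z. z \<epsilon> suc x \<Longrightarrow> z \<epsilon> y \<Longrightarrow> z \<epsilon> I" by auto
      have ny: "nt y" using y(1) ntD[OF x] x by auto
      have oy: "Ord y" using ny unfolding nt_def O by blast
      have sub: "z \<epsilon> suc x" if "z \<epsilon> y" for z
        using that y(1) x unfolding nt_def O Ord_iff by auto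
      have "y \<noteq> emp" using I(1) y(2) by blast
      from nonempty[OF this] obtain z where z: "z \<epsilon> y" "\<And>u. u \<epsilon> y \<Longrightarrow> \<not> z \<epsilon> u"
        using ny unfolding nt_def lim_def by blast
      have "u \<epsilon> suc z \<longleftrightarrow> u \<epsilon> z \<or> u = z" for u by simp
      moreover have "u \<epsilon> z \<or> u = z \<longleftrightarrow> u \<epsilon> y" for u
        using oy z unfolding Ord_iff by blast
      ultimately have "u \<epsilon> suc z \<longleftrightarrow> u \<epsilon> y" for u by blast
      then have "suc z = y" by (rule ext)
      moreover have "z \<epsilon> I" using l[OF sub[OF z(1)] z(1)] .
      ultimately show False using I(2) y(2) by blast
    qed
    then show ?thesis unfolding w0 by blast
  qed
  have wO: "Ord x" if "x \<epsilon> w" for x using that unfolding w nt_def O by blast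
  have Ow: "Ord w"
    unfolding Ord_iff using ntD Ord_linear wO w by blast
  have "emp \<epsilon> w" unfolding w nt_def ordl_def lim_def by simp
  moreover have "suc x \<epsilon> w" if x: "x \<epsilon> w" for x
  proof -
    have "Ord (suc x)" using wO[OF x] unfolding Ord_iff by auto
    moreover have "\<not> lim (suc x)"
    proof
      assume "lim (suc x)"
      then obtain z where "z \<epsilon> suc x" "x \<epsilon> z" unfolding lim_def by auto
      then show False using no_cycles(1)[of x] no_cycles(2)[of x z] by auto
    qed
    moreover have "\<not> lim y" if "y \<epsilon> suc x" for y
      using that x unfolding w nt_def by auto
    ultimately show ?thesis unfolding w nt_def O by blast
  qed
  moreover have "x \<epsilon> suc x" for x by simp
  ultimately have "lim w" unfolding lim_def by blast
  then have "Omega w" unfolding Omega_iff L using Ow w unfolding nt_def by blast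
  then show ?thesis ..
qed

end

locale bst = bst_pre E d for E :: "'a \<Rightarrow> 'a \<Rightarrow> bool" (infix "\<epsilon>" 50) and d +
  assumes ex_omega: "\<exists>w. Omega w"
begin

definition "om = (SOME w. Omega w)"

lemma Omega_om: "Omega om"
  unfolding om_def using ex_omega by (rule someI_ex)

lemma Omega_emp:
  assumes "Omega w"
  shows "emp \<epsilon> w"
proof -
  have w: "w \<noteq> emp" "Ord w" using assms unfolding Omega_iff Lim_iff by blast+
  then obtain y where y: "y \<epsilon> w" "\<forall>z. z \<epsilon> w \<longrightarrow> \<not> z \<epsilon> y" using nonempty foundation by blast
  then have "y = emp" using nonempty[of y] w(2) unfolding Ord_iff by blast
  with y show ?thesis by simp
qed

lemma Ord_succ_eq:
  assumes "Ord y" "m \<epsilon> y" "\<forall>z. z \<epsilon> y \<longrightarrow> \<not> m \<epsilon> z"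
  shows "y = suc m"
proof (rule ext)
  fix z show "z \<epsilon> y \<longleftrightarrow> z \<epsilon> suc m"
    using assms unfolding Ord_iff mem_derived by metis
qed

lemma Omega_suc:
  assumes w: "Omega w" and n: "n \<epsilon> w"
  shows "suc n \<epsilon> w"
proof -
  have o: "Ord w" and "\<exists>z. z \<epsilon> w \<and> n \<epsilon> z" using w n unfolding Omega_iff Lim_iff by blast+
  then obtain x where "x \<epsilon> w" "\<not> \<not> n \<epsilon> x" by blast
  moreover have "Df0 (\<lambda>e. \<not> n \<epsilon> e 0)" by (intro Df0i)
  ultimately obtain y where y: "y \<epsilon> w" "n \<epsilon> y" "\<forall>z. z \<epsilon> w \<longrightarrow> z \<epsilon> y \<longrightarrow> \<not> n \<epsilon> z"
    using ind_set[of "\<lambda>x. \<not> n \<epsilon> x" x w] by blast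
  then have "y = suc n" using Ord_elem[OF o y(1)] o unfolding Ord_iff[of w]
    by (intro Ord_succ_eq) blast+
  with y show ?thesis by simp
qed

lemma Omega_induct:
  assumes w: "Omega w" and P: "Df0 (\<lambda>e. P (e 0))" "P emp" "\<And>n. n \<epsilon> w \<Longrightarrow> P n \<Longrightarrow> P (suc n)"
    and n: "n \<epsilon> w"
  shows "P n"
proof (rule ccontr)
  assume "\<not> P n"
  from ind_set[OF P(1) n this]
  obtain y where y: "y \<epsilon> w" "\<not> P y" "\<forall>z. z \<epsilon> w \<longrightarrow> z \<epsilon> y \<longrightarrow> P z" by blast
  have o: "Ord w" and "\<not> sLim UNIV y" using w y(1) unfolding Omega_iff Lim_iff by blast+
  moreover have "y \<noteq> emp" using y P(2) by blast
  ultimately obtain m where "m \<epsilon> y" "\<forall>z. z \<epsilon> y \<longrightarrow> \<not> m \<epsilon> z"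
    using Ord_elem[OF o y(1)] unfolding Lim_iff by blast
  then have "y = suc m" "m \<epsilon> y" using Ord_elem[OF o y(1)] Ord_succ_eq by blast+
  moreover then have "m \<epsilon> w" using o y(1) unfolding Ord_iff by blast
  ultimately show False using y P(3) by blast
qed

lemma Omega_unique: "Omega w \<longleftrightarrow> w = om"
proof
  have "n \<epsilon> v" if "Omega w" "Omega v" "n \<epsilon> w" for w v n
    by (rule Omega_induct[OF that(1) _ _ _ that(3)])
      (auto intro: Df0i Omega_emp[OF that(2)] Omega_suc[OF that(2)])
  then show "w = om" if "Omega w" using that Omega_om by (intro ext) blast
qed (simp add: Omega_om)

lemma Natl_iff [simp]: "Natl n \<longleftrightarrow> n \<epsilon> om"
  unfolding sNat_def by (simp add: Omega_unique)

lemmas om_emp = Omega_emp[OF Omega_om]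
lemmas om_suc = Omega_suc[OF Omega_om]
lemma om_induct: "n \<epsilon> om \<Longrightarrow> Df0 (\<lambda>e. P (e 0)) \<Longrightarrow> P emp \<Longrightarrow> (\<And>n. n \<epsilon> om \<Longrightarrow> P n \<Longrightarrow> P (suc n)) \<Longrightarrow> P n"
  by (rule Omega_induct[OF Omega_om])

lemma om_trans: "x \<epsilon> n \<Longrightarrow> n \<epsilon> om \<Longrightarrow> x \<epsilon> om"
  using Omega_om unfolding Omega_iff Lim_iff Ord_iff by blast

lemma om_elem_trans: "n \<epsilon> om \<Longrightarrow> x \<epsilon> y \<Longrightarrow> y \<epsilon> n \<Longrightarrow> x \<epsilon> n"
  using Omega_om Ord_elem[of om n] unfolding Omega_iff Lim_iff Ord_iff[of n] by blast

primrec N :: "nat \<Rightarrow> 'a" where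
  "N 0 = emp"
| "N (Suc k) = suc (N k)"

lemma Num_iff [simp]: "Num k x \<longleftrightarrow> x = N k"
  by (induction k arbitrary: x) auto

lemma N_om [simp]: "N k \<epsilon> om"
  by (induction k) (auto intro: om_emp om_suc)

lemma N_less: "i < k \<Longrightarrow> N i \<epsilon> N k"
  by (induction k) (auto simp: less_Suc_eq)

lemma N_eq [simp]: "N i = N k \<longleftrightarrow> i = k"
  using N_less[of i k] N_less[of k i] no_cycles(1) by (metis linorder_neqE_nat)

lemma mem_N: "x \<epsilon> N k \<longleftrightarrow> (\<exists>i<k. x = N i)"
  by (induction k) (auto simp: less_Suc_eq)

lemma Node_iff [simp]: "Node k c x \<longleftrightarrow> c = op (N k) x" "Node2 k c x y \<longleftrightarrow> c = op (N k) (op x y)"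
  "CBot c \<longleftrightarrow> c = op (N 2) emp"
  by (auto simp: Node_def Node2_def CBot_def simp del: N.simps)

lemma Upd_iff: "Upd n t s i x \<longleftrightarrow> FunOn t n \<and> op i x \<epsilon> t \<and>
    (\<forall>j. j \<epsilon> n \<longrightarrow> j \<noteq> i \<longrightarrow> (\<forall>y. op j y \<epsilon> s \<longrightarrow> op j y \<epsilon> t))"
  by (simp add: Upd_def)

lemma Gen_induct:
  assumes gen: "Gen Q x" and P: "Df0 (\<lambda>e. P (e 0))"
    and step: "\<And>prev c. Q prev c \<Longrightarrow> (\<And>z. prev z \<Longrightarrow> P z) \<Longrightarrow> P c"
  shows "P x"
proof -
  from gen obtain m k f where m: "m \<epsilon> om" "k = suc m" "FunOn f k" "op m x \<epsilon> f"
    and f: "\<And>i. i \<epsilon> k \<Longrightarrow> \<exists>y. op i y \<epsilon> f \<and> Q (\<lambda>z. \<exists>j. j \<epsilon> i \<and> op j z \<epsilon> f) y"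
    unfolding Gen_def rels Natl_iff App_iff by blast
  \<comment> \<open>Values are sought in \<open>uni (uni f)\<close>, which contains them by
    Kuratowski coding; an unbounded quantifier would take the statement out of
    \<open>delta0\<close>.\<close>
  let ?P = "\<lambda>i. \<forall>p. p \<epsilon> f \<longrightarrow> (\<forall>y. y \<epsilon> uni (uni f) \<longrightarrow> p = op i y \<longrightarrow> P y)"
  have dom: "y \<epsilon> uni (uni f)" if "op i y \<epsilon> f" for i y
    using that op_parts(1)[of i y] unfolding mem_basic(3) by (intro exI[of _ "up i y"]) auto
  have D: "Df0 (\<lambda>e. P (e i))" for i using Dfn_subst[OF P, of "\<lambda>_ e. e i"] by (simp add: isv_var)
  have all: "?P i" if i: "i \<epsilon> k" for i
  proof (rule ccontr)
    assume "\<not> ?P i"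
    moreover have "Df0 (\<lambda>e. ?P (e 0))" by (intro Df0i D)
    ultimately obtain i where i: "i \<epsilon> k" "\<not> ?P i" "\<forall>j. j \<epsilon> k \<longrightarrow> j \<epsilon> i \<longrightarrow> ?P j"
      using ind_set[of ?P i k] i by blast
    from f[OF i(1)] obtain y where y: "op i y \<epsilon> f" "Q (\<lambda>z. \<exists>j. j \<epsilon> i \<and> op j z \<epsilon> f) y" by blast
    have "k \<epsilon> om" using m om_suc by simp
    then have "P z" if "\<exists>j. j \<epsilon> i \<and> op j z \<epsilon> f" for z
      using that i(1,3) dom om_elem_trans[of k _ i] by blast
    with y(2) step have "P y" by blast
    moreover have "z = y" if "op i z \<epsilon> f" for z using that y(1) m(3) by (auto simp: FunOn_app)
    ultimately show False using i(2) by blast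
  qed
  have "m \<epsilon> k" using m(2) by simp
  from all[OF this] m(4) dom[OF m(4)] show ?thesis by blast
qed

lemma Gen_base:
  assumes "\<And>prev. Q prev x"
  shows "Gen Q x"
proof -
  let ?f = "sg (op emp x)"
  have "FunOn ?f (N 1)" by (auto simp: FunOn_iff mem_N)
  moreover have "\<exists>y. op i y \<epsilon> ?f \<and> Q (\<lambda>z. \<exists>j. j \<epsilon> i \<and> op j z \<epsilon> ?f) y" if "i \<epsilon> N 1" for i
    using that assms by (auto simp: mem_N)
  ultimately show ?thesis unfolding Gen_def
    by (intro exI[of _ emp] exI[of _ "N 1"] exI[of _ ?f]) (simp add: om_emp)
qed

subsection \<open>Closed sets\<close>

text \<open>What a transitive set needs in order to contain all numbers, codes of formulas and
  finite sequences of its elements. Transitive models have it by their single axioms, so it is at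
  hand inside LZFC.\<close>

definition "closed H \<longleftrightarrow> (\<forall>x y. x \<epsilon> y \<longrightarrow> y \<epsilon> H \<longrightarrow> x \<epsilon> H) \<and> emp \<epsilon> H \<and>
  (\<forall>x y. x \<epsilon> H \<longrightarrow> y \<epsilon> H \<longrightarrow> up x y \<epsilon> H \<and> un x y \<epsilon> H)"

context
  fixes H
  assumes H: "closed H"
begin

lemma closed_trans: "x \<epsilon> y \<Longrightarrow> y \<epsilon> H \<Longrightarrow> x \<epsilon> H" and closed_emp: "emp \<epsilon> H"
  and closed_up: "x \<epsilon> H \<Longrightarrow> y \<epsilon> H \<Longrightarrow> up x y \<epsilon> H" and closed_un: "x \<epsilon> H \<Longrightarrow> y \<epsilon> H \<Longrightarrow> un x y \<epsilon> H"
  using H unfolding closed_def by blast+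

lemma closed_sg: "x \<epsilon> H \<Longrightarrow> sg x \<epsilon> H"
  unfolding sg_def by (rule closed_up)

lemma closed_op: "x \<epsilon> H \<Longrightarrow> y \<epsilon> H \<Longrightarrow> op x y \<epsilon> H"
  unfolding op_def by (intro closed_up closed_sg)

lemma closed_suc: "x \<epsilon> H \<Longrightarrow> suc x \<epsilon> H"
  unfolding suc_def by (intro closed_un closed_sg)

lemma closed_fst: "op x y \<epsilon> H \<Longrightarrow> x \<epsilon> H" and closed_snd: "op x y \<epsilon> H \<Longrightarrow> y \<epsilon> H"
  using closed_trans[OF op_parts(1)[of x y]] closed_trans[OF op_parts(2)[of x y]]
    closed_trans[OF op_parts(3)[of y x]] by blast+

end

lemma closed_om: "closed H \<Longrightarrow> n \<epsilon> om \<Longrightarrow> n \<epsilon> H"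
  by (rule om_induct[of n "\<lambda>n. n \<epsilon> H"]) (auto intro: closed_emp closed_suc Df0i)

lemma closed_N: "closed H \<Longrightarrow> N k \<epsilon> H"
  by (rule closed_om) simp_all

text \<open>A finite function is reached by adding one pair at a time. The induction asserts that
  the restriction to \<open>i\<close> is an element of \<open>H\<close>, with every quantifier
  bounded, since the induction at hand is for \<open>delta0\<close> predicates.\<close>

lemma closed_fun:
  assumes H: "closed H" and u: "FunOn u m" and m: "m \<epsilon> om" and v: "\<And>i. i \<epsilon> m \<Longrightarrow> ap u i \<epsilon> H"
  shows "u \<epsilon> H"
proof -
  let ?P = "\<lambda>i. (\<forall>k. k \<epsilon> i \<longrightarrow> k \<epsilon> m) \<longrightarrow> (\<exists>v. v \<epsilon> H \<and>
    (\<forall>p. p \<epsilon> v \<longrightarrow> p \<epsilon> u) \<and> (\<forall>p. p \<epsilon> v \<longrightarrow> (\<exists>k. k \<epsilon> i \<and> (\<exists>y. y \<epsilon> H \<and> p = op k y))) \<and>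
    (\<forall>p. p \<epsilon> u \<longrightarrow> (\<forall>k. k \<epsilon> i \<longrightarrow> (\<forall>y. y \<epsilon> H \<longrightarrow> p = op k y \<longrightarrow> p \<epsilon> v))))"
  have "?P m"
  proof (rule om_induct[of m ?P, OF m])
    show "Df0 (\<lambda>e. ?P (e 0))" by (intro Df0i)
    show "?P emp" by (rule HOL.impI, rule exI[of _ emp]) (simp add: closed_emp[OF H])
    fix i assume i: "i \<epsilon> om" "?P i"
    show "?P (suc i)"
    proof
      assume s: "\<forall>k. k \<epsilon> suc i \<longrightarrow> k \<epsilon> m"
      then obtain w where w: "w \<epsilon> H" "\<forall>p. p \<epsilon> w \<longrightarrow> p \<epsilon> u"
        "\<forall>p. p \<epsilon> w \<longrightarrow> (\<exists>k. k \<epsilon> i \<and> (\<exists>y. y \<epsilon> H \<and> p = op k y))"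
        "\<forall>p. p \<epsilon> u \<longrightarrow> (\<forall>k. k \<epsilon> i \<longrightarrow> (\<forall>y. y \<epsilon> H \<longrightarrow> p = op k y \<longrightarrow> p \<epsilon> w))"
        using i(2) by auto
      have im: "i \<epsilon> m" using s by simp
      let ?w = "un w (sg (op i (ap u i)))"
      have "?w \<epsilon> H" by (intro closed_un[OF H] closed_sg[OF H] closed_op[OF H] w v im closed_om[OF H] i)
      moreover have "\<forall>p. p \<epsilon> ?w \<longrightarrow> p \<epsilon> u" using w(2) ap_mem[OF u im] by auto
      moreover have "\<forall>p. p \<epsilon> ?w \<longrightarrow> (\<exists>k. k \<epsilon> suc i \<and> (\<exists>y. y \<epsilon> H \<and> p = op k y))"
        using w(3) v[OF im] by auto
      moreover have "\<forall>p. p \<epsilon> u \<longrightarrow> (\<forall>k. k \<epsilon> suc i \<longrightarrow> (\<forall>y. y \<epsilon> H \<longrightarrow> p = op k y \<longrightarrow> p \<epsilon> ?w))"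
        using w(4) ap_eq[OF u] by auto
      ultimately show "\<exists>v. v \<epsilon> H \<and> (\<forall>p. p \<epsilon> v \<longrightarrow> p \<epsilon> u) \<and>
          (\<forall>p. p \<epsilon> v \<longrightarrow> (\<exists>k. k \<epsilon> suc i \<and> (\<exists>y. y \<epsilon> H \<and> p = op k y))) \<and>
          (\<forall>p. p \<epsilon> u \<longrightarrow> (\<forall>k. k \<epsilon> suc i \<longrightarrow> (\<forall>y. y \<epsilon> H \<longrightarrow> p = op k y \<longrightarrow> p \<epsilon> v)))" by blast
    qed
  qed
  then obtain w where w: "w \<epsilon> H" "\<forall>p. p \<epsilon> w \<longrightarrow> p \<epsilon> u"
    "\<forall>p. p \<epsilon> u \<longrightarrow> (\<forall>k. k \<epsilon> m \<longrightarrow> (\<forall>y. y \<epsilon> H \<longrightarrow> p = op k y \<longrightarrow> p \<epsilon> w))" by blast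
  have "w = u"
  proof (rule ext, rule iffI)
    fix p assume p: "p \<epsilon> u"
    then obtain k y where k: "p = op k y" "k \<epsilon> m" using u unfolding FunOn_iff by blast
    then have "y \<epsilon> H" using p v[OF k(2)] ap_eq[OF u] by blast
    with k p w(3) show "p \<epsilon> w" by blast
  qed (use w(2) in blast)
  with w(1) show ?thesis by simp
qed

end

section \<open>Existence of satisfaction relations\<close>

text \<open>Satisfaction is glued together from evaluations \<open>g\<close> of sets \<open>P\<close> of formulas closed under
  immediate subformulas. Everything is bounded by a closed set \<open>H\<close>, so that \<open>\<Delta>\<^sub>0\<close>-separation
  suffices; in LZFC, \<open>H\<close> will be a model.\<close>

locale satx = bst E d for E :: "'a \<Rightarrow> 'a \<Rightarrow> bool" (infix "\<epsilon>" 50) and d +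
  fixes H Q R F a A I n
  assumes H: "closed H" and RH: "\<And>r. r \<epsilon> R \<Longrightarrow> r \<epsilon> H" and F: "F = emp" and n: "n \<epsilon> om"
    and Q: "\<And>s. s \<epsilon> Q \<longleftrightarrow> Fun s n A" and QH: "\<And>Y. (\<And>s. s \<epsilon> Y \<Longrightarrow> s \<epsilon> Q) \<Longrightarrow> Y \<epsilon> H"
    and ar: "\<And>r k. r \<epsilon> R \<Longrightarrow> op r k \<epsilon> a \<Longrightarrow> k \<epsilon> om"
    and ar_unique: "\<And>r k k'. r \<epsilon> R \<Longrightarrow> op r k \<epsilon> a \<Longrightarrow> op r k' \<epsilon> a \<Longrightarrow> k = k'"
    and int: "\<And>r e k w. r \<epsilon> R \<Longrightarrow> op r e \<epsilon> I \<Longrightarrow> op r k \<epsilon> a \<Longrightarrow> w \<epsilon> e \<Longrightarrow> Fun w k A"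
begin

definition "cd k c p q \<longleftrightarrow> (\<exists>x. x \<epsilon> H \<and> x = op p q \<and> c = op (N k) x)"
definition "sb c p \<longleftrightarrow> (\<exists>q. q \<epsilon> H \<and> (cd 3 c p q \<or> cd 3 c q p)) \<or> (\<exists>i. i \<epsilon> n \<and> cd 4 c i p)"
text \<open>An evaluation \<open>g\<close> relates a formula to the set \<open>Y\<close> of
  assignments satisfying it. As subsets of \<open>Q\<close> these sets are elements of
  \<open>H\<close>, so evaluations can be built up within \<open>H\<close> one formula at a
  time.\<close>

definition "inn g p s \<longleftrightarrow> (\<exists>Y. Y \<epsilon> H \<and> op p Y \<epsilon> g \<and> s \<epsilon> Y)"
definition "agr i s s' \<longleftrightarrow> (\<forall>j. j \<epsilon> n \<longrightarrow> j \<noteq> i \<longrightarrow> (\<forall>y. y \<epsilon> A \<longrightarrow> op j y \<epsilon> s \<longrightarrow> op j y \<epsilon> s'))"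
text \<open>Tarski's clauses with all quantifiers bounded. Since \<open>F\<close> is empty the terms
  are variables, whose values are read directly from the assignment.\<close>

definition "tr_eq c s \<longleftrightarrow> (\<exists>i. i \<epsilon> n \<and> (\<exists>j. j \<epsilon> n \<and>
  (\<exists>t. t \<epsilon> H \<and> (\<exists>t'. t' \<epsilon> H \<and> t = op (N 0) i \<and> t' = op (N 0) j \<and> cd 0 c t t')) \<and>
  (\<exists>x. x \<epsilon> A \<and> op i x \<epsilon> s \<and> op j x \<epsilon> s)))"
definition "tr_rel c s \<longleftrightarrow> (\<exists>r. r \<epsilon> R \<and> (\<exists>u. u \<epsilon> H \<and> cd 1 c r u \<and>
  (\<exists>e. e \<epsilon> uni (uni I) \<and> op r e \<epsilon> I \<and> (\<exists>w. w \<epsilon> e \<and> (\<exists>k. k \<epsilon> om \<and> op r k \<epsilon> a \<and>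
    (\<forall>i. i \<epsilon> k \<longrightarrow> (\<exists>l. l \<epsilon> n \<and> (\<exists>t. t \<epsilon> H \<and> t = op (N 0) l \<and> op i t \<epsilon> u) \<and>
      (\<exists>x. x \<epsilon> A \<and> op i x \<epsilon> w \<and> op l x \<epsilon> s))))))))"
definition "tr_imp g c s \<longleftrightarrow> (\<exists>p. p \<epsilon> H \<and> (\<exists>q. q \<epsilon> H \<and> cd 3 c p q \<and> (inn g p s \<longrightarrow> inn g q s)))"
definition "tr_all g c s \<longleftrightarrow> (\<exists>i. i \<epsilon> n \<and> (\<exists>p. p \<epsilon> H \<and> cd 4 c i p \<and>
  (\<forall>s'. s' \<epsilon> Q \<longrightarrow> agr i s s' \<longrightarrow> inn g p s')))"
definition "tr g c s \<longleftrightarrow> tr_eq c s \<or> tr_rel c s \<or> tr_imp g c s \<or> tr_all g c s"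
definition "val P g \<longleftrightarrow> (\<forall>z. z \<epsilon> g \<longrightarrow> (\<exists>c. c \<epsilon> P \<and> (\<exists>Y. Y \<epsilon> H \<and> z = op c Y))) \<and>
  (\<forall>c. c \<epsilon> P \<longrightarrow> c \<epsilon> H \<and> (\<forall>s. s \<epsilon> Q \<longrightarrow> (inn g c s \<longleftrightarrow> tr g c s)) \<and> (\<forall>p. p \<epsilon> H \<longrightarrow> sb c p \<longrightarrow> p \<epsilon> P))"
definition "VV c \<longleftrightarrow> (\<exists>P. P \<epsilon> H \<and> (\<exists>g. g \<epsilon> H \<and> val P g \<and> c \<epsilon> P))"

lemma Df0_cd [Df0i]: "isv c \<Longrightarrow> isv p \<Longrightarrow> isv q \<Longrightarrow> Df0 (\<lambda>e. cd k (c e) (p e) (q e))"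
  by (rule Df0_isv3) (unfold cd_def, intro Df0i)

lemma Df0_inn [Df0i]: "isv c \<Longrightarrow> isv p \<Longrightarrow> isv q \<Longrightarrow> Df0 (\<lambda>e. inn (c e) (p e) (q e))"
  by (rule Df0_isv3) (unfold inn_def, intro Df0i)

lemma Df0_agr [Df0i]: "isv c \<Longrightarrow> isv p \<Longrightarrow> isv q \<Longrightarrow> Df0 (\<lambda>e. agr (c e) (p e) (q e))"
  by (rule Df0_isv3) (unfold agr_def, intro Df0i)

lemma Df0_tr [Df0i]: "isv c \<Longrightarrow> isv p \<Longrightarrow> isv q \<Longrightarrow> Df0 (\<lambda>e. tr (c e) (p e) (q e))"
  by (rule Df0_isv3) (unfold tr_def tr_eq_def tr_rel_def tr_imp_def tr_all_def, intro Df0i)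

lemma Df0_sb [Df0i]: "isv c \<Longrightarrow> isv p \<Longrightarrow> Df0 (\<lambda>e. sb (c e) (p e))"
  by (rule Df0_isv3[of "\<lambda>c p _. sb c p" c p "\<lambda>_. emp", OF _ _ _ isv_const]) (unfold sb_def, intro Df0i)

lemma Df0_val [Df0i]: "isv c \<Longrightarrow> isv p \<Longrightarrow> Df0 (\<lambda>e. val (c e) (p e))"
  by (rule Df0_isv3[of "\<lambda>c p _. val c p" c p "\<lambda>_. emp", OF _ _ _ isv_const]) (unfold val_def, intro Df0i)

lemma cd_iff: "p \<epsilon> H \<Longrightarrow> q \<epsilon> H \<Longrightarrow> cd k c p q \<longleftrightarrow> c = op (N k) (op p q)"
  unfolding cd_def using closed_op[OF H] by blast

lemma n_H: "i \<epsilon> n \<Longrightarrow> i \<epsilon> H"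
  using om_trans[OF _ n] closed_om[OF H] by blast

lemma sb_simps:
  "p \<epsilon> H \<Longrightarrow> q \<epsilon> H \<Longrightarrow> r \<epsilon> H \<Longrightarrow> sb (op (N k) (op p q)) r \<longleftrightarrow> k = 3 \<and> (r = p \<or> r = q) \<or> k = 4 \<and> r = q \<and> p \<epsilon> n"
  "r \<epsilon> H \<Longrightarrow> \<not> sb (op (N 2) emp) r"
  unfolding sb_def using n_H by (auto simp: cd_iff simp del: N.simps cong: conj_cong)

lemma sb_deep: "sb c p \<Longrightarrow> \<exists>x y z. p \<epsilon> x \<and> x \<epsilon> y \<and> y \<epsilon> z \<and> z \<epsilon> c"
proof -
  assume "sb c p"
  then obtain k q where "c = op (N k) (op p q) \<or> c = op (N k) (op q p)"
    unfolding sb_def cd_def by blast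
  moreover have "p \<epsilon> up p q \<and> up p q \<epsilon> op p q \<and> op p q \<epsilon> up (N k) (op p q) \<and>
      up (N k) (op p q) \<epsilon> op (N k) (op p q)"
    "p \<epsilon> up q p \<and> up q p \<epsilon> op q p \<and> op q p \<epsilon> up (N k) (op q p) \<and>
      up (N k) (op q p) \<epsilon> op (N k) (op q p)"
    by (simp_all add: op_def)
  ultimately show ?thesis by blast
qed

lemma tr_cong:
  assumes "\<And>p s. p \<epsilon> H \<Longrightarrow> sb c p \<Longrightarrow> s \<epsilon> Q \<Longrightarrow> inn g p s \<longleftrightarrow> inn g' p s" "s \<epsilon> Q"
  shows "tr g c s \<longleftrightarrow> tr g' c s"
proof -
  have "tr_imp g c s \<longleftrightarrow> tr_imp g' c s"
  proof -
    have "(inn g p s \<longrightarrow> inn g q s) \<longleftrightarrow> (inn g' p s \<longrightarrow> inn g' q s)"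
      if "p \<epsilon> H" "q \<epsilon> H" "cd 3 c p q" for p q
      using that assms by (metis sb_def)
    then show ?thesis unfolding tr_imp_def by blast
  qed
  moreover have "tr_all g c s \<longleftrightarrow> tr_all g' c s"
  proof -
    have "(\<forall>s'. s' \<epsilon> Q \<longrightarrow> agr i s s' \<longrightarrow> inn g p s') \<longleftrightarrow> (\<forall>s'. s' \<epsilon> Q \<longrightarrow> agr i s s' \<longrightarrow> inn g' p s')"
      if "p \<epsilon> H" "i \<epsilon> n" "cd 4 c i p" for i p
      using that assms by (metis sb_def)
    then show ?thesis unfolding tr_all_def by blast
  qed
  ultimately show ?thesis unfolding tr_def by blast
qed

lemma val_tr: "val P g \<Longrightarrow> c \<epsilon> P \<Longrightarrow> s \<epsilon> Q \<Longrightarrow> inn g c s \<longleftrightarrow> tr g c s"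
  and val_sb: "val P g \<Longrightarrow> c \<epsilon> P \<Longrightarrow> p \<epsilon> H \<Longrightarrow> sb c p \<Longrightarrow> p \<epsilon> P"
  and val_H: "val P g \<Longrightarrow> c \<epsilon> P \<Longrightarrow> c \<epsilon> H"
  unfolding val_def by blast+

lemma val_dom: "val P g \<Longrightarrow> op c Y \<epsilon> g \<Longrightarrow> c \<epsilon> P"
  unfolding val_def by force

text \<open>Two evaluations that disagree at a formula disagree at one of its immediate subformulas,
  which lies four \<in>-steps below and again in both \<open>P\<close> and \<open>P'\<close>. By
  \<open>foundation4\<close> the set of disagreements is empty.\<close>

lemma coherence:
  assumes v: "val P g" "val P' g'" and c: "c \<epsilon> P" "c \<epsilon> P'" and s: "s \<epsilon> Q"
  shows "inn g c s \<longleftrightarrow> inn g' c s"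
proof -
  let ?bad = "\<lambda>c. c \<epsilon> P' \<and> \<not> (\<forall>s. s \<epsilon> Q \<longrightarrow> (inn g c s \<longleftrightarrow> inn g' c s))"
  have "Df0 (\<lambda>e. ?bad (e 0))" by (intro Df0i)
  from sep0[OF this, of P] obtain B where B: "x \<epsilon> B \<longleftrightarrow> x \<epsilon> P \<and> ?bad x" for x by blast
  have "\<not> c \<epsilon> B"
  proof (rule foundation4[of H])
    show "x \<epsilon> H" if "x \<epsilon> y" "y \<epsilon> H" for x y using closed_trans[OF H] that by blast
    show "b \<epsilon> H" if "b \<epsilon> B" for b using that B val_H[OF v(1)] by blast
    fix b assume "b \<epsilon> B"
    then obtain s where b: "b \<epsilon> P" "b \<epsilon> P'" and s: "s \<epsilon> Q" "\<not> (inn g b s \<longleftrightarrow> inn g' b s)"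
      unfolding B by blast
    then have "\<not> (tr g b s \<longleftrightarrow> tr g' b s)" using val_tr[OF v(1)] val_tr[OF v(2)] by blast
    then obtain p t where p: "p \<epsilon> H" "sb b p" "t \<epsilon> Q" "\<not> (inn g p t \<longleftrightarrow> inn g' p t)"
      using tr_cong[of b g g' s] s(1) by blast
    then have "p \<epsilon> B" unfolding B using val_sb[OF v(1) b(1)] val_sb[OF v(2) b(2)] by blast
    with sb_deep[OF p(2)] show "\<exists>c x y z. c \<epsilon> B \<and> c \<epsilon> x \<and> x \<epsilon> y \<and> y \<epsilon> z \<and> z \<epsilon> b" by blast
  qed
  with c s show ?thesis unfolding B by blast
qed

lemma inn_un: "inn (un g g') c s \<longleftrightarrow> inn g c s \<or> inn g' c s"
  unfolding inn_def by auto

lemma val_un: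
  assumes v: "val P g" "val P' g'"
  shows "val (un P P') (un g g')"
proof -
  have inn: "inn (un g g') c s \<longleftrightarrow> inn h c s"
    if "(W, h) = (P, g) \<or> (W, h) = (P', g')" "c \<epsilon> W" "s \<epsilon> Q" for W h c s
  proof -
    have "c \<epsilon> P" if "inn g c s" using that val_dom[OF v(1)] unfolding inn_def by blast
    moreover have "c \<epsilon> P'" if "inn g' c s" using that val_dom[OF v(2)] unfolding inn_def by blast
    ultimately show ?thesis using that coherence[OF v, of c s] unfolding inn_un by blast
  qed
  have "c \<epsilon> H \<and> (\<forall>s. s \<epsilon> Q \<longrightarrow> (inn (un g g') c s \<longleftrightarrow> tr (un g g') c s)) \<and>
      (\<forall>p. p \<epsilon> H \<longrightarrow> sb c p \<longrightarrow> p \<epsilon> un P P')"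
    if W: "(W, h) = (P, g) \<or> (W, h) = (P', g')" and c: "c \<epsilon> W" for W h c
  proof (intro conjI HOL.allI HOL.impI)
    have vW: "val W h" using W v by auto
    show "c \<epsilon> H" using val_H[OF vW c] .
    show "p \<epsilon> un P P'" if "p \<epsilon> H" "sb c p" for p using val_sb[OF vW c that] W by auto
    fix s assume s: "s \<epsilon> Q"
    have "tr h c s \<longleftrightarrow> tr (un g g') c s"
      by (rule tr_cong[OF _ s]) (use inn[OF W] val_sb[OF vW c] in blast)
    with inn[OF W c s] val_tr[OF vW c s] show "inn (un g g') c s \<longleftrightarrow> tr (un g g') c s" by simp
  qed
  from this[of P g] this[of P' g'] have "c \<epsilon> H \<and>
      (\<forall>s. s \<epsilon> Q \<longrightarrow> (inn (un g g') c s \<longleftrightarrow> tr (un g g') c s)) \<and>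
      (\<forall>p. p \<epsilon> H \<longrightarrow> sb c p \<longrightarrow> p \<epsilon> un P P')" if "c \<epsilon> un P P'" for c
    using that unfolding mem_derived(1) by blast
  moreover have "\<exists>c. c \<epsilon> un P P' \<and> (\<exists>Y. Y \<epsilon> H \<and> z = op c Y)" if "z \<epsilon> un g g'" for z
    using that v unfolding val_def mem_derived by blast
  ultimately show ?thesis unfolding val_def by blast
qed

text \<open>Tarski's clause for \<open>c\<close> consults only immediate subformulas, where
  \<open>g\<close> is already correct, and so determines the value \<open>Y\<close>. Older formulas
  do not notice the new entry because their subformulas lie in \<open>P\<close> and \<open>c\<close>
  does not.\<close>

lemma val_extend:
  assumes v: "val P g" and c: "c \<epsilon> H" "\<not> c \<epsilon> P" and sub: "\<And>p. p \<epsilon> H \<Longrightarrow> sb c p \<Longrightarrow> p \<epsilon> P"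
  shows "\<exists>Y. Y \<epsilon> H \<and> val (un P (sg c)) (un g (sg (op c Y)))"
proof -
  have "Df0 (\<lambda>e. tr g c (e 0))" by (intro Df0i)
  from sep0[OF this, of Q] obtain Y where Y: "s \<epsilon> Y \<longleftrightarrow> s \<epsilon> Q \<and> tr g c s" for s by blast
  then have YH: "Y \<epsilon> H" using QH by blast
  let ?g = "un g (sg (op c Y))"
  have inn: "inn ?g p s \<longleftrightarrow> inn g p s" if "p \<noteq> c" for p s
    using that unfolding inn_def by auto
  have "\<not> inn g c s" for s using c(2) val_dom[OF v] unfolding inn_def by blast
  then have inn_c: "inn ?g c s \<longleftrightarrow> s \<epsilon> Y" for s
    unfolding inn_un using YH by (auto simp: inn_def)
  have tr: "tr g q s \<longleftrightarrow> tr ?g q s" if "s \<epsilon> Q" "\<And>p. p \<epsilon> H \<Longrightarrow> sb q p \<Longrightarrow> p \<epsilon> P" for q s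
    by (rule tr_cong[OF _ that(1)]) (use inn that(2) c(2) in metis)
  have "inn ?g q s \<longleftrightarrow> tr ?g q s" if "q \<epsilon> un P (sg c)" "s \<epsilon> Q" for q s
  proof (cases "q = c")
    case True
    then show ?thesis using tr[OF that(2) sub] Y that(2) inn_c by simp
  next
    case False
    then have q: "q \<epsilon> P" using that(1) by simp
    show ?thesis using tr[OF that(2) val_sb[OF v q]] inn[OF False] val_tr[OF v q that(2)] by simp
  qed
  moreover have "q \<epsilon> H \<and> (\<forall>p. p \<epsilon> H \<longrightarrow> sb q p \<longrightarrow> p \<epsilon> un P (sg c))" if "q \<epsilon> un P (sg c)" for q
  proof (cases "q = c")
    case True
    then show ?thesis using c(1) sub by simp
  next
    case False
    then have q: "q \<epsilon> P" using that by simp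
    show ?thesis using val_sb[OF v q] val_H[OF v q] by simp
  qed
  moreover have "\<exists>q. q \<epsilon> un P (sg c) \<and> (\<exists>Y. Y \<epsilon> H \<and> z = op q Y)" if "z \<epsilon> ?g" for z
  proof (cases "z = op c Y")
    case True
    then show ?thesis using YH by auto
  next
    case False
    then have "z \<epsilon> g" using that by simp
    then show ?thesis using v unfolding val_def mem_derived by blast
  qed
  ultimately have "val (un P (sg c)) ?g" unfolding val_def by blast
  with YH show ?thesis by blast
qed

lemma VV_extend:
  assumes P: "P \<epsilon> H" "g \<epsilon> H" "val P g" and c: "c \<epsilon> H" and sub: "\<And>p. p \<epsilon> H \<Longrightarrow> sb c p \<Longrightarrow> p \<epsilon> P"
  shows "VV c"
proof (cases "c \<epsilon> P")
  case True
  with P show ?thesis unfolding VV_def by blast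
next
  case False
  from val_extend[OF P(3) c False sub] obtain Y
    where Y: "Y \<epsilon> H" "val (un P (sg c)) (un g (sg (op c Y)))" by blast
  moreover have "un P (sg c) \<epsilon> H" "un g (sg (op c Y)) \<epsilon> H"
    by (intro closed_un[OF H] closed_sg[OF H] closed_op[OF H] P c Y)+
  ultimately show ?thesis unfolding VV_def by (metis mem_derived(1,2))
qed

lemma VV_H: "VV c \<Longrightarrow> c \<epsilon> H"
  unfolding VV_def using val_H by blast

lemma VV_atom: "c \<epsilon> H \<Longrightarrow> (\<And>p. p \<epsilon> H \<Longrightarrow> \<not> sb c p) \<Longrightarrow> VV c"
  by (rule VV_extend[of emp emp]) (auto simp: val_def closed_emp[OF H])

lemma VV_imp:
  assumes "VV p" "VV q"
  shows "VV (op (N 3) (op p q))"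
proof -
  obtain P g where P: "P \<epsilon> H" "g \<epsilon> H" "val P g" "p \<epsilon> P" using assms(1) unfolding VV_def by blast
  obtain P' g' where P': "P' \<epsilon> H" "g' \<epsilon> H" "val P' g'" "q \<epsilon> P'"
    using assms(2) unfolding VV_def by blast
  have pq: "p \<epsilon> H" "q \<epsilon> H" using assms VV_H by blast+
  show ?thesis
  proof (rule VV_extend[OF _ _ val_un[OF P(3) P'(3)]])
    show "un P P' \<epsilon> H" "un g g' \<epsilon> H" by (intro closed_un[OF H] P P')+
    show "op (N 3) (op p q) \<epsilon> H" by (intro closed_op[OF H] closed_N[OF H] pq)
    show "r \<epsilon> un P P'" if "r \<epsilon> H" "sb (op (N 3) (op p q)) r" for r
      using that pq P P' by (simp add: sb_simps del: N.simps) blast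
  qed
qed

lemma VV_all:
  assumes "VV p" "i \<epsilon> n"
  shows "VV (op (N 4) (op i p))"
proof -
  obtain P g where P: "P \<epsilon> H" "g \<epsilon> H" "val P g" "p \<epsilon> P" using assms(1) unfolding VV_def by blast
  have pi: "p \<epsilon> H" "i \<epsilon> H" using assms VV_H n_H by blast+
  show ?thesis
  proof (rule VV_extend[OF P(1-3)])
    show "op (N 4) (op i p) \<epsilon> H" by (intro closed_op[OF H] closed_N[OF H] pi)
    show "r \<epsilon> P" if "r \<epsilon> H" "sb (op (N 4) (op i p)) r" for r
      using that pi P by (simp add: sb_simps del: N.simps)
  qed
qed

lemma ValueIs_iff: "ValueIs V t s x \<longleftrightarrow> op (op t s) x \<epsilon> V"
  unfolding ValueIs_def by simp

lemma IsTerm_iff: "IsTerm F a n t \<longleftrightarrow> (\<exists>i. i \<epsilon> n \<and> t = op (N 0) i)"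
proof
  assume "IsTerm F a n t"
  moreover have "Df0 (\<lambda>e. \<exists>i. i \<epsilon> n \<and> e 0 = op (N 0) i)" by (intro Df0i)
  ultimately show "\<exists>i. i \<epsilon> n \<and> t = op (N 0) i" unfolding IsTerm_def
    by (rule Gen_induct) (simp add: F)
next
  assume "\<exists>i. i \<epsilon> n \<and> t = op (N 0) i"
  then show "IsTerm F a n t" unfolding IsTerm_def by (intro Gen_base) simp
qed

lemma term_H: "IsTerm F a n t \<Longrightarrow> t \<epsilon> H"
  unfolding IsTerm_iff using closed_op[OF H closed_N[OF H] n_H] by blast

lemma tuple_H:
  assumes "r \<epsilon> R" "op r k \<epsilon> a" "TermTuple F a n k u"
  shows "u \<epsilon> H"
proof -
  from assms(3) have u: "FunOn u k" "\<And>i z. op i z \<epsilon> u \<Longrightarrow> IsTerm F a n z"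
    unfolding TermTuple_def by auto
  show ?thesis
    using ar[OF assms(1,2)] ap_mem[OF u(1)] u(2) term_H by (intro closed_fun[OF H u(1)]) blast+
qed

lemma VV_eq: "IsTerm F a n t \<Longrightarrow> IsTerm F a n t' \<Longrightarrow> VV (op (N 0) (op t t'))"
  by (rule VV_atom)
    (use term_H in \<open>auto simp: sb_simps simp del: N.simps intro!: closed_op[OF H] closed_N[OF H]\<close>)

lemma VV_rel: "r \<epsilon> R \<Longrightarrow> op r k \<epsilon> a \<Longrightarrow> TermTuple F a n k u \<Longrightarrow> VV (op (N 1) (op r u))"
  by (rule VV_atom)
    (use tuple_H RH in \<open>auto simp: sb_simps simp del: N.simps intro!: closed_op[OF H] closed_N[OF H]\<close>)

text \<open>Here the bound \<open>H\<close> pays off: the existence of an evaluation is a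
  \<open>delta0\<close> statement, as induction along generating sequences requires.\<close>

lemma VV_form: "IsForm R F a n c \<Longrightarrow> VV c"
  unfolding IsForm_def
proof (erule Gen_induct)
  show "Df0 (\<lambda>e. VV (e 0))" unfolding VV_def by (intro Df0i)
  fix prev c
  assume c: "(\<exists>t t'. IsTerm F a n t \<and> IsTerm F a n t' \<and> Node2 0 c t t') \<or>
      (\<exists>r. r \<epsilon> R \<and> (\<exists>k u. App a r k \<and> TermTuple F a n k u \<and> Node2 1 c r u)) \<or> CBot c \<or>
      (\<exists>p q. prev p \<and> prev q \<and> Node2 3 c p q) \<or> (\<exists>i. i \<epsilon> n \<and> (\<exists>p. prev p \<and> Node2 4 c i p))"
    and prev: "\<And>z. prev z \<Longrightarrow> VV z"
  have "VV (op (N 2) emp)"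
    by (rule VV_atom)
      (simp_all add: sb_simps closed_op[OF H closed_N[OF H] closed_emp[OF H]] del: N.simps)
  then show "VV c"
    using c prev VV_eq VV_rel VV_imp VV_all unfolding Node_iff App_iff by blast
qed

lemma sat_rel_exists: "\<exists>S. SatRel R F a A I n S"
proof -
  let ?V = "\<lambda>z. \<exists>q. q \<epsilon> prd H Q \<and> (\<exists>x. x \<epsilon> A \<and> z = op q x \<and> (\<exists>t. t \<epsilon> H \<and> (\<exists>s. s \<epsilon> Q \<and> q = op t s \<and>
    (\<exists>i. i \<epsilon> n \<and> t = op (N 0) i \<and> op i x \<epsilon> s))))"
  have "Df0 (\<lambda>e. ?V (e 0))" by (intro Df0i)
  from sep0[OF this, of "prd (prd H Q) A"]
  obtain V where "z \<epsilon> V \<longleftrightarrow> z \<epsilon> prd (prd H Q) A \<and> ?V z" for z by blast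
  then have V: "op (op t s) x \<epsilon> V \<longleftrightarrow> (\<exists>i. i \<epsilon> n \<and> t = op (N 0) i \<and> op i x \<epsilon> s)" if "s \<epsilon> Q" for t s x
    using that Q[of s] closed_op[OF H closed_N[OF H, of 0] n_H] unfolding Fun_iff by fastforce
  \<comment> \<open>The satisfaction relation is the union of all evaluations in \<open>H\<close>;
    \<open>coherence\<close> makes it agree with each of them.\<close>
  let ?S = "\<lambda>z. \<exists>c. c \<epsilon> H \<and> (\<exists>s. s \<epsilon> Q \<and> z = op c s \<and> (\<exists>P. P \<epsilon> H \<and> (\<exists>g. g \<epsilon> H \<and> val P g \<and> c \<epsilon> P \<and> inn g c s)))"
  have "Df0 (\<lambda>e. ?S (e 0))" by (intro Df0i)
  from sep0[OF this, of "prd H Q"] obtain S where "z \<epsilon> S \<longleftrightarrow> z \<epsilon> prd H Q \<and> ?S z" for z by blast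
  then have S: "op c s \<epsilon> S \<longleftrightarrow> (\<exists>P. P \<epsilon> H \<and> (\<exists>g. g \<epsilon> H \<and> val P g \<and> c \<epsilon> P \<and> inn g c s))"
    if "s \<epsilon> Q" for c s
    using that val_H by auto
  have S_inn: "op c s \<epsilon> S \<longleftrightarrow> inn g c s" if "P \<epsilon> H" "g \<epsilon> H" "val P g" "c \<epsilon> P" "s \<epsilon> Q" for P g c s
    unfolding S[OF that(5)] using that coherence by blast
  have S_tr: "\<exists>g. (op c s \<epsilon> S \<longleftrightarrow> tr g c s) \<and> (\<forall>p t. p \<epsilon> H \<longrightarrow> sb c p \<longrightarrow> t \<epsilon> Q \<longrightarrow> (op p t \<epsilon> S \<longleftrightarrow> inn g p t))"
    if c: "VV c" and s: "s \<epsilon> Q" for c s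
  proof -
    obtain P g where P: "P \<epsilon> H" "g \<epsilon> H" "val P g" "c \<epsilon> P" using c unfolding VV_def by blast
    show ?thesis
      using S_inn[OF P(1-3)] val_sb[OF P(3,4)] val_tr[OF P(3,4) s] P(4) s by (intro exI[of _ g]) blast
  qed
  have eq: "op (op (N 0) (op t t')) s \<epsilon> S \<longleftrightarrow> (\<exists>x. op (op t s) x \<epsilon> V \<and> op (op t' s) x \<epsilon> V)"
    if t: "IsTerm F a n t" "IsTerm F a n t'" and s: "s \<epsilon> Q" for t t' s
  proof -
    obtain i j where ij: "i \<epsilon> n" "t = op (N 0) i" "j \<epsilon> n" "t' = op (N 0) j"
      using t IsTerm_iff by blast
    note H0 = term_H[OF t(1)] term_H[OF t(2)]
    have "tr g (op (N 0) (op t t')) s \<longleftrightarrow> (\<exists>x. x \<epsilon> A \<and> op i x \<epsilon> s \<and> op j x \<epsilon> s)" for g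
      unfolding tr_def tr_eq_def tr_rel_def tr_imp_def tr_all_def
      using H0 ij RH n_H by (auto simp: cd_iff simp del: N.simps cong: conj_cong)
    moreover have "x \<epsilon> A" if "op i x \<epsilon> s" for x using that s Q unfolding Fun_iff by blast
    ultimately show ?thesis using S_tr[OF VV_eq[OF t] s] V[OF s] ij by auto
  qed
  have rel: "op (op (N 1) (op r u)) s \<epsilon> S \<longleftrightarrow> (\<exists>w e. ValuesAre V A k u s w \<and> App I r e \<and> w \<epsilon> e)"
    if r: "r \<epsilon> R" "op r k \<epsilon> a" "TermTuple F a n k u" and s: "s \<epsilon> Q" for r k u s
  proof -
    note uH = tuple_H[OF r]
    have "tr g (op (N 1) (op r u)) s \<longleftrightarrow> tr_rel (op (N 1) (op r u)) s" for g
      unfolding tr_def tr_eq_def tr_imp_def tr_all_def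
      using uH RH[OF r(1)] n_H by (auto simp: cd_iff simp del: N.simps cong: conj_cong)
    moreover have "tr_rel (op (N 1) (op r u)) s \<longleftrightarrow>
        (\<exists>e w. op r e \<epsilon> I \<and> w \<epsilon> e \<and> (\<forall>i. i \<epsilon> k \<longrightarrow> (\<exists>l. l \<epsilon> n \<and> op i (op (N 0) l) \<epsilon> u \<and>
          (\<exists>x. op i x \<epsilon> w \<and> op l x \<epsilon> s))))"
    proof -
      have J: "e \<epsilon> uni (uni I)" if "op r e \<epsilon> I" for e
        using that op_parts(1)[of r e] unfolding mem_basic(3) by (intro exI[of _ "up r e"]) auto
      have xA: "x \<epsilon> A" if "op l x \<epsilon> s" for l x using that s Q unfolding Fun_iff by blast
      have tH: "op (N 0) l \<epsilon> H" if "l \<epsilon> n" for l using closed_op[OF H closed_N[OF H] n_H[OF that]] .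
      have cd: "cd 1 (op (N 1) (op r u)) r' u' \<longleftrightarrow> r' = r \<and> u' = u" if "r' \<epsilon> R" "u' \<epsilon> H" for r' u'
        using that RH by (auto simp: cd_iff simp del: N.simps)
      show ?thesis
      proof
        assume "tr_rel (op (N 1) (op r u)) s"
        then obtain r' u' e w k' where *: "r' \<epsilon> R" "u' \<epsilon> H" "cd 1 (op (N 1) (op r u)) r' u'"
          "op r' e \<epsilon> I" "w \<epsilon> e" "op r' k' \<epsilon> a"
          "\<forall>i. i \<epsilon> k' \<longrightarrow> (\<exists>l. l \<epsilon> n \<and> (\<exists>t. t \<epsilon> H \<and> t = op (N 0) l \<and> op i t \<epsilon> u') \<and>
            (\<exists>x. x \<epsilon> A \<and> op i x \<epsilon> w \<and> op l x \<epsilon> s))"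
          unfolding tr_rel_def by blast
        from cd[OF *(1,2)] *(3) have "r' = r" "u' = u" by blast+
        moreover from this(1) have "k' = k" using ar_unique[OF r(1) _ r(2)] *(6) by blast
        ultimately show "\<exists>e w. op r e \<epsilon> I \<and> w \<epsilon> e \<and> (\<forall>i. i \<epsilon> k \<longrightarrow> (\<exists>l. l \<epsilon> n \<and>
            op i (op (N 0) l) \<epsilon> u \<and> (\<exists>x. op i x \<epsilon> w \<and> op l x \<epsilon> s)))"
          using *(4,5,7) by blast
      next
        assume "\<exists>e w. op r e \<epsilon> I \<and> w \<epsilon> e \<and> (\<forall>i. i \<epsilon> k \<longrightarrow> (\<exists>l. l \<epsilon> n \<and>
            op i (op (N 0) l) \<epsilon> u \<and> (\<exists>x. op i x \<epsilon> w \<and> op l x \<epsilon> s)))"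
        then obtain e w where e: "op r e \<epsilon> I" "w \<epsilon> e" "\<forall>i. i \<epsilon> k \<longrightarrow> (\<exists>l. l \<epsilon> n \<and>
            op i (op (N 0) l) \<epsilon> u \<and> (\<exists>x. op i x \<epsilon> w \<and> op l x \<epsilon> s))" by blast
        from e(3) have "\<forall>i. i \<epsilon> k \<longrightarrow> (\<exists>l. l \<epsilon> n \<and> (\<exists>t. t \<epsilon> H \<and> t = op (N 0) l \<and> op i t \<epsilon> u) \<and>
            (\<exists>x. x \<epsilon> A \<and> op i x \<epsilon> w \<and> op l x \<epsilon> s))"
          using xA tH by blast
        with e(2) r(2) ar[OF r(1,2)] have "\<exists>w. w \<epsilon> e \<and> (\<exists>k. k \<epsilon> om \<and> op r k \<epsilon> a \<and>
            (\<forall>i. i \<epsilon> k \<longrightarrow> (\<exists>l. l \<epsilon> n \<and> (\<exists>t. t \<epsilon> H \<and> t = op (N 0) l \<and> op i t \<epsilon> u) \<and>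
            (\<exists>x. x \<epsilon> A \<and> op i x \<epsilon> w \<and> op l x \<epsilon> s))))" by blast
        with e(1) J have "\<exists>e. e \<epsilon> uni (uni I) \<and> op r e \<epsilon> I \<and> (\<exists>w. w \<epsilon> e \<and> (\<exists>k. k \<epsilon> om \<and> op r k \<epsilon> a \<and>
            (\<forall>i. i \<epsilon> k \<longrightarrow> (\<exists>l. l \<epsilon> n \<and> (\<exists>t. t \<epsilon> H \<and> t = op (N 0) l \<and> op i t \<epsilon> u) \<and>
            (\<exists>x. x \<epsilon> A \<and> op i x \<epsilon> w \<and> op l x \<epsilon> s)))))" by blast
        with r(1) uH cd show "tr_rel (op (N 1) (op r u)) s" unfolding tr_rel_def by blast
      qed
    qed
    moreover have "ValuesAre V A k u s w \<longleftrightarrow> (\<forall>i. i \<epsilon> k \<longrightarrow> (\<exists>l. l \<epsilon> n \<and> op i (op (N 0) l) \<epsilon> u \<and>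
          (\<exists>x. op i x \<epsilon> w \<and> op l x \<epsilon> s)))" if "op r e \<epsilon> I" "w \<epsilon> e" for e w
      unfolding ValuesAre_def ValueIs_iff App_iff V[OF s]
      using int[OF r(1) that(1) r(2) that(2)] by blast
    ultimately have "op (op (N 1) (op r u)) s \<epsilon> S \<longleftrightarrow> (\<exists>e w. op r e \<epsilon> I \<and> w \<epsilon> e \<and>
        (\<forall>i. i \<epsilon> k \<longrightarrow> (\<exists>l. l \<epsilon> n \<and> op i (op (N 0) l) \<epsilon> u \<and> (\<exists>x. op i x \<epsilon> w \<and> op l x \<epsilon> s))))"
      and "\<And>e w. op r e \<epsilon> I \<Longrightarrow> w \<epsilon> e \<Longrightarrow> ValuesAre V A k u s w \<longleftrightarrow>
        (\<forall>i. i \<epsilon> k \<longrightarrow> (\<exists>l. l \<epsilon> n \<and> op i (op (N 0) l) \<epsilon> u \<and> (\<exists>x. op i x \<epsilon> w \<and> op l x \<epsilon> s)))"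
      using S_tr[OF VV_rel[OF r] s] by (simp_all del: N.simps)
    then show ?thesis unfolding App_iff by blast
  qed
  have bot: "\<not> op (op (N 2) emp) s \<epsilon> S" if s: "s \<epsilon> Q" for s
  proof
    assume "op (op (N 2) emp) s \<epsilon> S"
    then obtain P g where P: "val P g" "op (N 2) emp \<epsilon> P" "inn g (op (N 2) emp) s"
      unfolding S[OF s] by blast
    then have "tr g (op (N 2) emp) s" using val_tr s by blast
    then show False unfolding tr_def tr_eq_def tr_rel_def tr_imp_def tr_all_def cd_def
      by (auto simp del: N.simps)
  qed
  have imp: "op (op (N 3) (op p q)) s \<epsilon> S \<longleftrightarrow> (op p s \<epsilon> S \<longrightarrow> op q s \<epsilon> S)"
    if pq: "IsForm R F a n p" "IsForm R F a n q" and s: "s \<epsilon> Q" for p q s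
  proof -
    note v = VV_form[OF pq(1)] VV_form[OF pq(2)]
    note H0 = VV_H[OF v(1)] VV_H[OF v(2)]
    have "tr g (op (N 3) (op p q)) s \<longleftrightarrow> (inn g p s \<longrightarrow> inn g q s)" for g
      unfolding tr_def tr_eq_def tr_rel_def tr_imp_def tr_all_def
      using H0 RH n_H by (auto simp: cd_iff simp del: N.simps cong: conj_cong)
    then show ?thesis using S_tr[OF VV_imp[OF v] s] s H0 by (auto simp: sb_simps simp del: N.simps)
  qed
  have all: "op (op (N 4) (op i p)) s \<epsilon> S \<longleftrightarrow> (\<forall>x s'. x \<epsilon> A \<and> Upd n s' s i x \<longrightarrow> op p s' \<epsilon> S)"
    if i: "i \<epsilon> n" and p: "IsForm R F a n p" and s: "s \<epsilon> Q" for i p s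
  proof -
    note v = VV_form[OF p]
    note H0 = VV_H[OF v] n_H[OF i]
    have sF: "Fun s n A" using s Q by blast
    have tr: "tr g (op (N 4) (op i p)) s \<longleftrightarrow> (\<forall>s'. s' \<epsilon> Q \<longrightarrow> agr i s s' \<longrightarrow> inn g p s')" for g
      unfolding tr_def tr_eq_def tr_rel_def tr_imp_def tr_all_def
      using H0 RH n_H i by (auto simp: cd_iff simp del: N.simps cong: conj_cong)
    \<comment> \<open>Inside \<open>Q\<close>, agreement with \<open>s\<close> off \<open>i\<close>
      is the same as being an update of \<open>s\<close> at \<open>i\<close>: the new value is
      \<open>ap s' i\<close>.\<close>
    have upd: "s' \<epsilon> Q \<and> agr i s s' \<longleftrightarrow> (\<exists>x. x \<epsilon> A \<and> Upd n s' s i x)" for s'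
    proof
      assume s': "s' \<epsilon> Q \<and> agr i s s'"
      then have F: "Fun s' n A" using Q by blast
      then have "op i (ap s' i) \<epsilon> s'" "ap s' i \<epsilon> A" "FunOn s' n"
        using ap_mem[of s' n i] Fun_ap[of s' n A i] i unfolding Fun_iff by blast+
      moreover have "op j y \<epsilon> s'" if "j \<epsilon> n" "j \<noteq> i" "op j y \<epsilon> s" for j y
        using s' that sF unfolding agr_def Fun_iff by blast
      ultimately show "\<exists>x. x \<epsilon> A \<and> Upd n s' s i x" unfolding Upd_iff by blast
    next
      assume "\<exists>x. x \<epsilon> A \<and> Upd n s' s i x"
      then obtain x where x: "x \<epsilon> A" "FunOn s' n" "op i x \<epsilon> s'"
        "\<forall>j. j \<epsilon> n \<longrightarrow> j \<noteq> i \<longrightarrow> (\<forall>y. op j y \<epsilon> s \<longrightarrow> op j y \<epsilon> s')" unfolding Upd_iff by blast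
      have "y \<epsilon> A" if jy: "op j y \<epsilon> s'" for j y
      proof (cases "j = i")
        case True
        then show ?thesis using jy x by (auto simp: FunOn_app)
      next
        case False
        have "j \<epsilon> n" using jy x(2) by (simp add: FunOn_app)
        then have "op j (ap s j) \<epsilon> s" "ap s j \<epsilon> A"
          using sF ap_mem[of s n j] Fun_ap[of s n A j] unfolding Fun_iff by blast+
        with x False \<open>j \<epsilon> n\<close> have "op j (ap s j) \<epsilon> s'" by blast
        with jy x(2) have "y = ap s j" by (auto simp: FunOn_app)
        then show ?thesis using \<open>ap s j \<epsilon> A\<close> by simp
      qed
      then have "s' \<epsilon> Q" using x(2) unfolding Q Fun_iff by blast
      with x(4) show "s' \<epsilon> Q \<and> agr i s s'" unfolding agr_def by blast
    qed
    have sub: "sb (op (N 4) (op i p)) p" using H0 i by (simp add: sb_simps del: N.simps)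
    obtain g where g: "op (op (N 4) (op i p)) s \<epsilon> S \<longleftrightarrow> tr g (op (N 4) (op i p)) s"
      "\<And>t. t \<epsilon> Q \<Longrightarrow> op p t \<epsilon> S \<longleftrightarrow> inn g p t"
      using S_tr[OF VV_all[OF v i] s] H0(1) sub by blast
    have "op (op (N 4) (op i p)) s \<epsilon> S \<longleftrightarrow> (\<forall>s'. s' \<epsilon> Q \<and> agr i s s' \<longrightarrow> op p s' \<epsilon> S)"
      unfolding g(1) tr using g(2) by blast
    then show ?thesis unfolding upd by blast
  qed
  have "TermValues F a A I n V"
    unfolding TermValues_def ValueIs_iff Node_iff App_iff Q[symmetric] using V F by auto
  then show ?thesis
    unfolding SatRel_def ValueIs_iff Node_iff App_iff Q[symmetric]
    using eq rel bot imp all by (intro exI[of _ S] exI[of _ V]) simp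
qed

end

section \<open>Structures with prescribed relations\<close>

locale vp = bst E d for E :: "'a \<Rightarrow> 'a \<Rightarrow> bool" (infix "\<epsilon>" 50) and d +
  assumes vopenka: "Df (\<lambda>e. X (e 0)) \<Longrightarrow> IsLang R F a \<Longrightarrow> (\<And>x. X x \<Longrightarrow> IsStruct R F a x) \<Longrightarrow>
    \<not> isset X \<Longrightarrow> \<exists>x y. X x \<and> X y \<and> x \<noteq> y \<and> (\<exists>j. ElemEmb R F a j x y)"
begin

text \<open>The argument tuple of the atomic formula \<open>r(v_0, ..., v_(k-1))\<close>.\<close>

lemma var_tuple:
  assumes "k \<epsilon> om"
  obtains v where "FunOn v k" "\<And>i z. op i z \<epsilon> v \<longleftrightarrow> i \<epsilon> k \<and> z = op (N 0) i"
proof -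
  let ?P = "\<lambda>z. \<exists>i. i \<epsilon> k \<and> (\<exists>t. t \<epsilon> prd (sg (N 0)) k \<and> t = op (N 0) i \<and> z = op i t)"
  have "Df0 (\<lambda>e. ?P (e 0))" by (intro Df0i)
  from sep0[OF this, of "prd k (prd (sg (N 0)) k)"]
  obtain v where "z \<epsilon> v \<longleftrightarrow> z \<epsilon> prd k (prd (sg (N 0)) k) \<and> ?P z" for z by blast
  then have v: "z \<epsilon> v \<longleftrightarrow> (\<exists>i. i \<epsilon> k \<and> z = op i (op (N 0) i))" for z by auto
  then have "FunOn v k" unfolding FunOn_iff by auto
  with v show thesis by (intro that[of v]) auto
qed

lemma term_var: "i \<epsilon> n \<Longrightarrow> IsTerm F a n (op (N 0) i)"
  unfolding IsTerm_def by (intro Gen_base) simp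

lemma SatRel_rel:
  assumes "SatRel R F a A I n S" "Fun s n A"
  obtains V where "TermValues F a A I n V"
    "\<And>r k u c. r \<epsilon> R \<Longrightarrow> App a r k \<Longrightarrow> TermTuple F a n k u \<Longrightarrow> Node2 1 c r u \<Longrightarrow>
      App S c s \<longleftrightarrow> (\<exists>w e. ValuesAre V A k u s w \<and> App I r e \<and> w \<epsilon> e)"
  using assms unfolding SatRel_def by (elim exE conjE) (erule_tac x = s in HOL.allE, simp)

text \<open>Assignments in \<open>k\<close> variables and \<open>k\<close>-tuples are both functions
  on \<open>k\<close>, so \<open>r\<close> applied to the variables in order holds at
  \<open>s\<close> exactly when \<open>s\<close> itself belongs to the interpretation. A
  satisfaction relation must exist, since \<open>Sats\<close> is false without one.\<close>

lemma Sats_atom: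
  assumes S: "\<exists>S. SatRel R F (prd R (sg k)) A I k S" and k: "k \<epsilon> om" and r: "r \<epsilon> R"
    and I: "FunOn I R" and s: "Fun s k A"
    and v: "FunOn v k" "\<And>i z. op i z \<epsilon> v \<longleftrightarrow> i \<epsilon> k \<and> z = op (N 0) i"
  shows "Sats R F (prd R (sg k)) A I k (op (N 1) (op r v)) s \<longleftrightarrow> s \<epsilon> ap I r"
proof -
  have tup: "TermTuple F (prd R (sg k)) k k v"
    unfolding TermTuple_def using v term_var by auto
  have "App S (op (N 1) (op r v)) s \<longleftrightarrow> s \<epsilon> ap I r"
    if "SatRel R F (prd R (sg k)) A I k S" for S
  proof -
    from SatRel_rel[OF that s] obtain V where V: "TermValues F (prd R (sg k)) A I k V"
      and "\<And>r l u c. r \<epsilon> R \<Longrightarrow> App (prd R (sg k)) r l \<Longrightarrow>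
        TermTuple F (prd R (sg k)) k l u \<Longrightarrow> Node2 1 c r u \<Longrightarrow>
        App S c s \<longleftrightarrow> (\<exists>w e. ValuesAre V A l u s w \<and> App I r e \<and> w \<epsilon> e)" by blast
    from this(2)[OF r _ tup] r have S: "App S (op (N 1) (op r v)) s \<longleftrightarrow>
        (\<exists>w e. ValuesAre V A k v s w \<and> App I r e \<and> w \<epsilon> e)" by simp
    have val: "ValueIs V (op (N 0) i) s x \<longleftrightarrow> op i x \<epsilon> s" if "i \<epsilon> k" for i x
      using V s that unfolding TermValues_def by simp
    have "ValuesAre V A k v s w \<longleftrightarrow> w = s" for w
    proof
      assume "ValuesAre V A k v s w"
      then have w: "Fun w k A" "\<And>i. i \<epsilon> k \<Longrightarrow> \<exists>x. op i x \<epsilon> w \<and> op i x \<epsilon> s"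
        unfolding ValuesAre_def using v(2) val by auto
      show "w = s"
      proof (rule FunOn_ext)
        show wf: "FunOn w k" and sf: "FunOn s k" using w s unfolding Fun_iff by blast+
        show "ap w i = ap s i" if "i \<epsilon> k" for i
          using w(2)[OF that] ap_eq[OF wf] ap_eq[OF sf] by metis
      qed
    next
      assume "w = s"
      moreover have "op i (ap s i) \<epsilon> s" if "i \<epsilon> k" for i
        using ap_mem that s unfolding Fun_iff by blast
      ultimately show "ValuesAre V A k v s w"
        unfolding ValuesAre_def using s v(2) val by auto
    qed
    then show ?thesis unfolding S using FunOn_app[OF I] r by auto
  qed
  with S show ?thesis unfolding Sats_def by blast
qed

lemma IsForm_atom:
  assumes "r \<epsilon> R" "FunOn v k" "\<And>i z. op i z \<epsilon> v \<longleftrightarrow> i \<epsilon> k \<and> z = op (N 0) i"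
  shows "IsForm R F (prd R (sg k)) k (op (N 1) (op r v))"
proof -
  have "TermTuple F (prd R (sg k)) k k v"
    unfolding TermTuple_def using assms(2,3) term_var by auto
  then show ?thesis unfolding IsForm_def using assms(1) by (intro Gen_base) auto
qed

text \<open>All symbols in \<open>R\<close> have the same arity \<open>k\<close>. A symbol
  \<open>t\<close> is interpreted by the tuples satisfying \<open>Q c t\<close> in the universe, so
  \<open>c\<close> may enter the structure as a hidden parameter.\<close>

definition SI :: "('a \<Rightarrow> bool) \<Rightarrow> ('a \<Rightarrow> 'a \<Rightarrow> bool) \<Rightarrow> ('a \<Rightarrow> 'a \<Rightarrow> 'a \<Rightarrow> bool) \<Rightarrow>
    'a \<Rightarrow> 'a \<Rightarrow> 'a \<Rightarrow> 'a \<Rightarrow> 'a \<Rightarrow> bool" where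
  "SI C U Q R k c A I \<longleftrightarrow> C c \<and> U c A \<and> FunOn I R \<and>
    (\<forall>t e. op t e \<epsilon> I \<longrightarrow> (\<forall>u. u \<epsilon> e \<longleftrightarrow> Fun u k A \<and> Q c t u))"

text \<open>The form in which VP is applied: elementarity is exploited for atomic formulas, where it
  says that the definable relations \<open>Q c t\<close> and \<open>Q c' t\<close> correspond under
  \<open>j\<close>.\<close>

lemma vopenka_relations:
  assumes defs: "Df (\<lambda>e. C (e 0))" "Df (\<lambda>e. U (e 0) (e 1))" "Df (\<lambda>e. Q (e 0) (e 1) (e 2))"
    and k: "k \<epsilon> om"
    and ne: "\<And>c A. C c \<Longrightarrow> U c A \<Longrightarrow> A \<noteq> emp"
    and sat: "\<And>c A I. SI C U Q R k c A I \<Longrightarrow> \<exists>S. SatRel R emp (prd R (sg k)) A I k S"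
    and proper: "\<not> isset (\<lambda>x. \<exists>c A I. x = op A I \<and> SI C U Q R k c A I)"
  obtains c A I c' A' I' j where "SI C U Q R k c A I" "SI C U Q R k c' A' I'"
    "op A I \<noteq> op A' I'" "Fun j A A'"
    "\<And>t u u'. t \<epsilon> R \<Longrightarrow> Fun u k A \<Longrightarrow> Fun u' k A' \<Longrightarrow> (\<And>i. i \<epsilon> k \<Longrightarrow> ap u' i = ap j (ap u i)) \<Longrightarrow>
      Q c t u \<longleftrightarrow> Q c' t u'"
proof -
  let ?X = "\<lambda>x. \<exists>c A I. x = op A I \<and> SI C U Q R k c A I"
  let ?a = "prd R (sg k)"
  have "Df (\<lambda>e. ?X (e 0))"
    unfolding SI_def
    by (intro Dfi Df1[OF defs(1)] Df2[OF defs(2)] Df3[OF defs(3)])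
  moreover have "IsLang R emp ?a"
    unfolding IsLang_def using k Omega_om
    by (intro conjI exI[of _ R] exI[of _ om]) (auto simp: Fun_iff FunOn_iff ext_iff[of R])
  moreover have "IsStruct R emp ?a x" if "?X x" for x
  proof -
    from that obtain c A I where x: "x = op A I" and s: "SI C U Q R k c A I" by blast
    then have I: "FunOn I R" "A \<noteq> emp" using ne unfolding SI_def by blast+
    have "\<exists>l e. App ?a r l \<and> App I r e \<and> (\<forall>u. u \<epsilon> e \<longrightarrow> Fun u l A)" if "r \<epsilon> R" for r
      using that s ap_mem[OF I(1) that] unfolding SI_def
      by (intro exI[of _ k] exI[of _ "ap I r"]) auto
    moreover have "un R emp = R" by (simp add: ext_iff[of _ R])
    ultimately show ?thesis unfolding IsStruct_def x
      using I by (intro exI[of _ A] exI[of _ I] exI[of _ R]) simp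
  qed
  ultimately obtain x y j where xy: "?X x" "?X y" "x \<noteq> y" and j: "ElemEmb R emp ?a j x y"
    using vopenka[of ?X R emp ?a] proper by blast
  from xy(1,2) obtain c A I c' A' I' where x: "x = op A I" "SI C U Q R k c A I"
    and y: "y = op A' I'" "SI C U Q R k c' A' I'" by blast
  from j have jf: "Fun j A A'" and emb: "\<And>n p s t. n \<epsilon> om \<Longrightarrow> IsForm R emp ?a n p \<Longrightarrow> Fun s n A \<Longrightarrow>
      Fun t n A' \<Longrightarrow> (\<forall>i. i \<epsilon> n \<longrightarrow> (\<exists>x y. op i x \<epsilon> s \<and> op x y \<epsilon> j \<and> op i y \<epsilon> t)) \<Longrightarrow>
      Sats R emp ?a A I n p s \<longleftrightarrow> Sats R emp ?a A' I' n p t"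
    unfolding ElemEmb_def x(1) y(1) by auto
  obtain v where v: "FunOn v k" "\<And>i z. op i z \<epsilon> v \<longleftrightarrow> i \<epsilon> k \<and> z = op (N 0) i"
    using var_tuple[OF k] by blast
  have "Q c t u \<longleftrightarrow> Q c' t u'" if t: "t \<epsilon> R" and u: "Fun u k A" "Fun u' k A'"
    and uu: "\<And>i. i \<epsilon> k \<Longrightarrow> ap u' i = ap j (ap u i)" for t u u'
  proof -
    have "\<exists>x y. op i x \<epsilon> u \<and> op x y \<epsilon> j \<and> op i y \<epsilon> u'" if i: "i \<epsilon> k" for i
    proof -
      have "op i (ap u i) \<epsilon> u" "op i (ap u' i) \<epsilon> u'"
        using u ap_mem[OF _ i] unfolding Fun_iff by blast+
      moreover have "op (ap u i) (ap j (ap u i)) \<epsilon> j"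
        using Fun_ap[OF u(1) i] jf ap_mem unfolding Fun_iff by blast
      ultimately show ?thesis using uu[OF i] by auto
    qed
    then have "Sats R emp ?a A I k (op (N 1) (op t v)) u \<longleftrightarrow>
        Sats R emp ?a A' I' k (op (N 1) (op t v)) u'"
      using emb[OF k IsForm_atom[OF t v] u] by blast
    moreover have I: "FunOn I R" "FunOn I' R" using x y unfolding SI_def by blast+
    ultimately have "u \<epsilon> ap I t \<longleftrightarrow> u' \<epsilon> ap I' t"
      using Sats_atom[OF sat[OF x(2)] k t I(1) u(1) v] Sats_atom[OF sat[OF y(2)] k t I(2) u(2) v]
      by blast
    then show ?thesis
      using x(2) y(2) u ap_mem[OF I(1) t] ap_mem[OF I(2) t] unfolding SI_def by blast
  qed
  then show thesis using that[OF x(2) y(2) _ jf] xy(3) x(1) y(1) by blast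
qed

end

section \<open>Vopenka's Principle over local ZFC\<close>

text \<open>A class whose members are told apart by subsets of a fixed set \<open>w\<close> is a set: otherwise
  the one-element structures with a nullary relation symbol for each \<open>t \<in> w\<close>, interpreted by
  whether \<open>t\<close> belongs to the code, would violate VP. This yields Separation,
  Power Set and Replacement.\<close>

locale lz = vp E d for E :: "'a \<Rightarrow> 'a \<Rightarrow> bool" (infix "\<epsilon>" 50) and d +
  assumes loc: "\<exists>M. x \<epsilon> M \<and> closed M"
begin

lemma Fun_emp: "Fun u emp A \<longleftrightarrow> u = emp"
  unfolding Fun_iff FunOn_iff by (auto simp: ext_iff[of u])

lemma isset_coded:
  assumes defs: "Df (\<lambda>e. C (e 0))" "Df (\<lambda>e. Q (e 0) (e 1))"
    and code: "\<And>c. C c \<Longrightarrow> isset (\<lambda>t. t \<epsilon> w \<and> Q c t)"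
    and inj: "\<And>c c'. C c \<Longrightarrow> C c' \<Longrightarrow> (\<And>t. t \<epsilon> w \<Longrightarrow> Q c t \<longleftrightarrow> Q c' t) \<Longrightarrow> c = c'"
  shows "isset C"
proof (rule ccontr)
  assume no: "\<not> isset C"
  \<comment> \<open>With arity \<open>emp\<close> the only tuple is \<open>emp\<close>, so a symbol
    \<open>t\<close> is a truth value, interpreted by \<open>sg emp\<close> or \<open>emp\<close>.
    The universe \<open>sg c\<close> keeps different members of the class apart as
    structures.\<close>
  let ?U = "\<lambda>c A. A = sg c" and ?Q = "\<lambda>c t u. Q c t"
  let ?SI = "SI C ?U ?Q w emp"
  have ex: "\<exists>I. ?SI c (sg c) I" if c: "C c" for c
  proof -
    obtain y where y: "t \<epsilon> y \<longleftrightarrow> t \<epsilon> w \<and> Q c t" for t using code[OF c] unfolding isset_def by blast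
    let ?P = "\<lambda>z. \<exists>t. t \<epsilon> w \<and> (\<exists>e. e \<epsilon> up emp (sg emp) \<and> z = op t e \<and> (e = sg emp \<longleftrightarrow> t \<epsilon> y))"
    have "Df0 (\<lambda>e. ?P (e 0))" by (intro Df0i)
    from sep0[OF this, of "prd w (up emp (sg emp))"] obtain I
      where I0: "z \<epsilon> I \<longleftrightarrow> z \<epsilon> prd w (up emp (sg emp)) \<and> ?P z" for z by blast
    have ne: "emp \<noteq> sg emp" using ext_iff[of emp "sg emp"] by simp
    have "op t e \<epsilon> I \<longleftrightarrow> t \<epsilon> w \<and> (e = emp \<or> e = sg emp) \<and> (e = sg emp \<longleftrightarrow> t \<epsilon> y)" for t e
      unfolding I0 mem_prd op_eq by auto
    then have I: "op t e \<epsilon> I \<longleftrightarrow> t \<epsilon> w \<and> e = (if t \<epsilon> y then sg emp else emp)" for t e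
      using ne by auto
    have I': "\<exists>t e. z = op t e \<and> t \<epsilon> w" if "z \<epsilon> I" for z
      using that unfolding I0 by blast
    have "FunOn I w" unfolding FunOn_iff
    proof (intro conjI HOL.allI HOL.impI)
      show "\<exists>t. t \<epsilon> w \<and> (\<exists>e. z = op t e)" if "z \<epsilon> I" for z using I'[OF that] by blast
      show "\<exists>!e. op t e \<epsilon> I" if "t \<epsilon> w" for t using that unfolding I by simp
    qed
    moreover have "u \<epsilon> e \<longleftrightarrow> u = emp \<and> Q c t" if "op t e \<epsilon> I" for t e u
      using that y unfolding I by auto
    ultimately show ?thesis using c unfolding SI_def Fun_emp by blast
  qed
  have proper: "\<not> isset (\<lambda>x. \<exists>c A I. x = op A I \<and> ?SI c A I)"
  proof
    assume "isset (\<lambda>x. \<exists>c A I. x = op A I \<and> ?SI c A I)"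
    then obtain K where K: "x \<epsilon> K \<longleftrightarrow> (\<exists>c A I. x = op A I \<and> ?SI c A I)" for x
      unfolding isset_def by blast
    \<comment> \<open>From a set of these structures the class is recovered with bounded
      quantifiers: Kuratowski's pair \<open>op (sg c) I\<close> has \<open>sg (sg c)\<close> as an
      element.\<close>
    let ?P = "\<lambda>c. \<exists>S. S \<epsilon> K \<and> (\<exists>v. v \<epsilon> S \<and> (\<exists>u. u \<epsilon> v \<and> u = up c c \<and> v = up u u))"
    have "Df0 (\<lambda>e. ?P (e 0))" by (intro Df0i)
    from sep0[OF this, of "uni (uni (uni K))"] obtain b
      where b: "c \<epsilon> b \<longleftrightarrow> c \<epsilon> uni (uni (uni K)) \<and> ?P c" for c by blast
    have P: "?P c \<longleftrightarrow> C c" for c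
    proof
      assume "?P c"
      then obtain S where S: "S \<epsilon> K" "sg (sg c) \<epsilon> S" unfolding sg_def by blast
      then obtain c' I where c': "S = op (sg c') I" "C c'" unfolding K SI_def by blast
      from S(2) have "c = c'"
        unfolding c'(1) op_def mem_basic sg_def up_eq by auto
      with c' show "C c" by simp
    next
      assume "C c"
      then obtain I where "?SI c (sg c) I" using ex by blast
      then have "op (sg c) I \<epsilon> K" unfolding K by blast
      moreover have "up (sg c) (sg c) \<epsilon> op (sg c) I" by (simp add: op_def sg_def)
      ultimately show "?P c" unfolding sg_def using mem_basic(2) by blast
    qed
    have "c \<epsilon> uni (uni (uni K))" if c: "?P c" for c
    proof -
      from c obtain S v u where "S \<epsilon> K" "v \<epsilon> S" "u \<epsilon> v" "u = up c c" by blast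
      moreover from this(4) have "c \<epsilon> u" by simp
      ultimately show ?thesis unfolding mem_basic(3) by blast
    qed
    with b P have "c \<epsilon> b \<longleftrightarrow> C c" for c by blast
    with no show False unfolding isset_def by blast
  qed
  have sat: "\<exists>S. SatRel w emp (prd w (sg emp)) A I emp S" if s: "?SI c A I" for c A I
  proof -
    obtain H where H: "w \<epsilon> H" "closed H" using loc by blast
    interpret satx E d H "sg emp" w emp "prd w (sg emp)" A I emp
    proof unfold_locales
      show "closed H" by fact
      show "r \<epsilon> H" if "r \<epsilon> w" for r using closed_trans[OF H(2) that H(1)] .
      show "s \<epsilon> sg emp \<longleftrightarrow> Fun s emp A" for s by (simp add: Fun_emp)
      show "Y \<epsilon> H" if "\<And>s. s \<epsilon> Y \<Longrightarrow> s \<epsilon> sg emp" for Y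
      proof (cases "emp \<epsilon> Y")
        case True
        have "z \<epsilon> Y \<longleftrightarrow> z \<epsilon> sg emp" for z using that[of z] True by auto
        then have "Y = sg emp" by (rule ext)
        then show ?thesis using closed_sg[OF H(2) closed_emp[OF H(2)]] by simp
      next
        case False
        have "z \<epsilon> Y \<longleftrightarrow> z \<epsilon> emp" for z using that[of z] False by auto
        then have "Y = emp" by (rule ext)
        then show ?thesis using closed_emp[OF H(2)] by simp
      qed
      show "Fun w' k A" if "r \<epsilon> w" "op r e \<epsilon> I" "op r k \<epsilon> prd w (sg emp)" "w' \<epsilon> e" for r e k w'
        using that s unfolding SI_def by auto
    qed (auto simp: om_emp)
    show ?thesis by (rule sat_rel_exists)
  qed
  have defs': "Df (\<lambda>e. ?U (e 0) (e 1))" "Df (\<lambda>e. ?Q (e 0) (e 1) (e 2))"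
    by (intro Dfi Df2[OF defs(2)])+
  have ne: "A \<noteq> emp" if "?U c A" for c A using that ext_iff[of "sg c" emp] by simp
  obtain c A I c' A' I' where s: "?SI c A I" "?SI c' A' I'" "op A I \<noteq> op A' I'"
    and Q: "\<exists>j. \<forall>t u u'. t \<epsilon> w \<longrightarrow> Fun u emp A \<longrightarrow> Fun u' emp A' \<longrightarrow>
      (\<forall>i. i \<epsilon> emp \<longrightarrow> ap u' i = ap j (ap u i)) \<longrightarrow> (Q c t \<longleftrightarrow> Q c' t)"
    by (rule vopenka_relations[of C ?U ?Q emp w, OF defs(1) defs' om_emp])
      (erule ne, erule sat, rule proper, rule that, assumption+, blast)
  from Q obtain j where "\<forall>t u u'. t \<epsilon> w \<longrightarrow> Fun u emp A \<longrightarrow> Fun u' emp A' \<longrightarrow>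
      (\<forall>i. i \<epsilon> emp \<longrightarrow> ap u' i = ap j (ap u i)) \<longrightarrow> (Q c t \<longleftrightarrow> Q c' t)" by blast
  then have Q': "Q c t \<longleftrightarrow> Q c' t" if "t \<epsilon> w" for t
    using that by (simp add: Fun_emp)
  \<comment> \<open>The truth values of all symbols agree, so \<open>c\<close> and \<open>c'\<close>
    have the same code. The two structures then coincide, although they were chosen
    distinct.\<close>
  then have c: "c = c'" using inj s unfolding SI_def by blast
  have "I = I'"
  proof (rule FunOn_ext)
    show I: "FunOn I w" "FunOn I' w" using s unfolding SI_def by blast+
    show "ap I t = ap I' t" if "t \<epsilon> w" for t
      using s(1,2) ap_mem[OF I(1) that] ap_mem[OF I(2) that] c unfolding SI_def Fun_emp
      by (intro ext) blast
  qed
  with s c show False unfolding SI_def by simp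
qed

text \<open>Members of \<open>a\<close> are coded by their singletons, which are subsets of
  \<open>a\<close>.\<close>

lemma separation_full:
  assumes "Df (\<lambda>e. P (e 0))"
  shows "isset (\<lambda>x. x \<epsilon> a \<and> P x)"
proof (rule isset_coded[of _ "\<lambda>c t. t = c" a])
  show "Df (\<lambda>e. e 0 \<epsilon> a \<and> P (e 0))" by (intro Dfi assms)
  show "Df (\<lambda>e. e 1 = e 0)" by (intro Dfi)
  show "isset (\<lambda>t. t \<epsilon> a \<and> t = c)" for c
    unfolding isset_def by (rule sep0) (intro Df0i)
qed auto

lemma power_set: "isset (\<lambda>z. \<forall>y. y \<epsilon> z \<longrightarrow> y \<epsilon> x)"
proof (rule isset_coded[of _ "\<lambda>c t. t \<epsilon> c" x])
  show "Df (\<lambda>e. \<forall>y. y \<epsilon> e 0 \<longrightarrow> y \<epsilon> x)" by (intro Dfi)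
  show "Df (\<lambda>e. e 1 \<epsilon> e 0)" by (intro Dfi)
  show "isset (\<lambda>t. t \<epsilon> x \<and> t \<epsilon> c)" for c
    unfolding isset_def by (rule sep0) (intro Df0i)
qed (auto intro: ext)

text \<open>A value is coded by the set of its preimages in \<open>a\<close>, which exists by
  \<open>separation_full\<close>. This set is nonempty, and it determines the value because
  \<open>P\<close> is functional on \<open>a\<close>.\<close>

lemma replacement_full:
  assumes "Df (\<lambda>e. P (e 0) (e 1))"
    and fn: "\<And>x y z. x \<epsilon> a \<Longrightarrow> P x y \<Longrightarrow> P x z \<Longrightarrow> y = z"
  shows "isset (\<lambda>y. \<exists>x. x \<epsilon> a \<and> P x y)"
proof (rule isset_coded[of _ "\<lambda>y x. P x y" a])
  show "Df (\<lambda>e. \<exists>x. x \<epsilon> a \<and> P x (e 0))" by (intro Dfi Df2[OF assms(1)])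
  show "Df (\<lambda>e. P (e 1) (e 0))" by (intro Dfi Df2[OF assms(1)])
  show "isset (\<lambda>t. t \<epsilon> a \<and> P t c)" for c
    by (rule separation_full) (intro Dfi Df2[OF assms(1)])
qed (use fn in blast)

end

section \<open>ZFC: iteration and the levels of the cumulative hierarchy\<close>

locale zfc = bst E d for E :: "'a \<Rightarrow> 'a \<Rightarrow> bool" (infix "\<epsilon>" 50) and d +
  assumes sep: "Df (\<lambda>e. P (e 0)) \<Longrightarrow> isset (\<lambda>x. x \<epsilon> a \<and> P x)"
    and repl: "Df (\<lambda>e. R (e 0) (e 1)) \<Longrightarrow> (\<And>x y z. x \<epsilon> a \<Longrightarrow> R x y \<Longrightarrow> R x z \<Longrightarrow> y = z) \<Longrightarrow>
      isset (\<lambda>y. \<exists>x. x \<epsilon> a \<and> R x y)"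
    and pow: "isset (\<lambda>z. \<forall>y. y \<epsilon> z \<longrightarrow> y \<epsilon> x)"
    and choice: "(\<And>y. y \<epsilon> x \<Longrightarrow> \<exists>v. v \<epsilon> y) \<Longrightarrow>
      (\<And>y z v. y \<epsilon> x \<Longrightarrow> z \<epsilon> x \<Longrightarrow> v \<epsilon> y \<Longrightarrow> v \<epsilon> z \<Longrightarrow> y = z) \<Longrightarrow>
      \<exists>c. \<forall>y. y \<epsilon> x \<longrightarrow> (\<exists>!v. v \<epsilon> y \<and> v \<epsilon> c)"
begin

abbreviation subs (infix "\<sqsubseteq>" 50) where "x \<sqsubseteq> y \<equiv> \<forall>z. z \<epsilon> x \<longrightarrow> z \<epsilon> y"

lemma sub_antisym: "x \<sqsubseteq> y \<Longrightarrow> y \<sqsubseteq> x \<Longrightarrow> x = y"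
  by (rule ext) blast

lemma separate:
  assumes "Df (\<lambda>e. P (e 0))"
  obtains b where "\<And>x. x \<epsilon> b \<longleftrightarrow> x \<epsilon> a \<and> P x"
  using sep[OF assms, of a] unfolding isset_def by blast

lemma mem_the_set: "(\<And>x. x \<epsilon> b \<longleftrightarrow> P x) \<Longrightarrow> z \<epsilon> the_set P \<longleftrightarrow> P z"
  using the_set_eqI[of b P] by simp

section \<open>Power sets, images and functions given by definable terms\<close>

definition "Pw x = the_set (\<lambda>z. z \<sqsubseteq> x)"
definition "img t a = the_set (\<lambda>y. \<exists>x. x \<epsilon> a \<and> y = t x)"
definition "lam a t = the_set (\<lambda>z. \<exists>x. x \<epsilon> a \<and> z = op x (t x))"

lemma mem_Pw [simp]: "z \<epsilon> Pw x \<longleftrightarrow> z \<sqsubseteq> x"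
  unfolding Pw_def by (rule the_set_iff[OF pow])

lemma Dt_Pw [Dfi]: "Dt t \<Longrightarrow> Dt (\<lambda>e. Pw (t e))"
  by (rule Dt1) (unfold Pw_def, intro Dfi)

lemma mem_img: "Dt (\<lambda>e. t (e 0)) \<Longrightarrow> y \<epsilon> img t a \<longleftrightarrow> (\<exists>x. x \<epsilon> a \<and> y = t x)"
  unfolding img_def
  by (rule the_set_iff, rule repl) (auto intro!: Dfi Dt1[of t])

lemma mem_lam: "Dt (\<lambda>e. t (e 0)) \<Longrightarrow> z \<epsilon> lam a t \<longleftrightarrow> (\<exists>x. x \<epsilon> a \<and> z = op x (t x))"
  unfolding lam_def
  by (rule the_set_iff, rule repl) (auto intro!: Dfi Dt1[of t])

lemma op_lam: "Dt (\<lambda>e. t (e 0)) \<Longrightarrow> op x y \<epsilon> lam a t \<longleftrightarrow> x \<epsilon> a \<and> y = t x"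
  by (auto simp: mem_lam)

lemma FunOn_lam: "Dt (\<lambda>e. t (e 0)) \<Longrightarrow> FunOn (lam a t) a"
  unfolding FunOn_iff by (auto simp: mem_lam)

lemma ap_lam: "Dt (\<lambda>e. t (e 0)) \<Longrightarrow> x \<epsilon> a \<Longrightarrow> ap (lam a t) x = t x"
  by (rule ap_eq[OF FunOn_lam]) (simp_all add: op_lam)

lemma Fun_lam: "Dt (\<lambda>e. t (e 0)) \<Longrightarrow> (\<And>x. x \<epsilon> a \<Longrightarrow> t x \<epsilon> b) \<Longrightarrow> Fun (lam a t) a b"
  unfolding Fun_iff by (auto simp: FunOn_lam op_lam)

lemma om_ind:
  assumes "n \<epsilon> om" and P: "Df (\<lambda>e. P (e 0))" "P emp" "\<And>n. n \<epsilon> om \<Longrightarrow> P n \<Longrightarrow> P (suc n)"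
  shows "P n"
proof -
  obtain b where b: "\<And>x. x \<epsilon> b \<longleftrightarrow> x \<epsilon> om \<and> P x" using separate[OF P(1)] by blast
  have "n \<epsilon> b"
    by (rule om_induct[OF assms(1), of "\<lambda>n. n \<epsilon> b"])
      (intro Df0i, auto simp: b P om_emp om_suc)
  then show ?thesis by (simp add: b)
qed

section \<open>Iteration of a definable operation along \<omega>\<close>

definition IT :: "('a \<Rightarrow> 'a) \<Rightarrow> 'a \<Rightarrow> 'a \<Rightarrow> 'a \<Rightarrow> bool" where
  "IT G x n y \<longleftrightarrow> (\<exists>f. FunOn f (suc n) \<and> ap f emp = x \<and>
    (\<forall>i. i \<epsilon> n \<longrightarrow> ap f (suc i) = G (ap f i)) \<and> ap f n = y)"

text \<open>Written as the union of the unique value, which makes iteration a definable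
  term.\<close>

definition "it G x n = the_set (\<lambda>z. \<exists>y. IT G x n y \<and> z \<epsilon> y)"

lemma suc_mem: "n \<epsilon> om \<Longrightarrow> m \<epsilon> n \<Longrightarrow> suc m \<epsilon> suc n"
proof (rule om_ind[of n "\<lambda>n. \<forall>m. m \<epsilon> n \<longrightarrow> suc m \<epsilon> suc n", THEN spec, THEN mp])
  show "Df (\<lambda>e. \<forall>m. m \<epsilon> e 0 \<longrightarrow> suc m \<epsilon> suc (e 0))" by (intro Dfi)
qed auto

context
  fixes G
  assumes G: "Dt (\<lambda>e. G (e 0))"
begin

lemma Df_IT: "Dt t \<Longrightarrow> Dt u \<Longrightarrow> Dt v \<Longrightarrow> Df (\<lambda>e. IT G (t e) (u e) (v e))"
  by (rule Df3) (unfold IT_def, intro Dfi Dt1[OF G])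

lemma Dt_it: "Dt t \<Longrightarrow> Dt u \<Longrightarrow> Dt (\<lambda>e. it G (t e) (u e))"
  by (rule Dt2) (unfold it_def, intro Dfi Df_IT)

lemma IT_emp: "IT G x emp y \<longleftrightarrow> y = x"
proof
  show "IT G x emp y" if "y = x"
  proof -
    have "FunOn (lam (suc emp) (\<lambda>_. x)) (suc emp)" by (intro FunOn_lam Dfi)
    moreover have "ap (lam (suc emp) (\<lambda>_. x)) emp = x" by (rule ap_lam) (intro Dfi, simp)
    ultimately show ?thesis unfolding IT_def using that by auto
  qed
qed (auto simp: IT_def)

lemma IT_suc:
  assumes n: "n \<epsilon> om" and u: "\<And>y y'. IT G x n y \<Longrightarrow> IT G x n y' \<Longrightarrow> y = y'" and y: "IT G x n y"
  shows "IT G x (suc n) z \<longleftrightarrow> z = G y"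
proof
  assume "IT G x (suc n) z"
  then obtain f where f: "FunOn f (suc (suc n))" "ap f emp = x"
    "\<And>i. i \<epsilon> suc n \<Longrightarrow> ap f (suc i) = G (ap f i)" "ap f (suc n) = z" unfolding IT_def by blast
  have g: "ap (lam (suc n) (ap f)) i = ap f i" if "i \<epsilon> suc n" for i
    by (rule ap_lam) (intro Dfi, rule that)
  have "emp \<epsilon> suc n"
    by (rule om_ind[OF n, of "\<lambda>n. emp \<epsilon> suc n"]) (intro Dfi, auto)
  moreover have "suc i \<epsilon> suc n" if "i \<epsilon> n" for i using suc_mem[OF n that] .
  ultimately have "IT G x n (ap f n)" unfolding IT_def
    using f g by (intro exI[of _ "lam (suc n) (ap f)"]) (auto intro!: FunOn_lam Dfi)
  then have "ap f n = y" using u y by blast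
  with f show "z = G y" by auto
next
  assume z: "z = G y"
  from y obtain f where f: "FunOn f (suc n)" "ap f emp = x"
    "\<And>i. i \<epsilon> n \<Longrightarrow> ap f (suc i) = G (ap f i)" "ap f n = y" unfolding IT_def by blast
  let ?f = "un f (sg (op (suc n) z))"
  have no: "\<not> suc n \<epsilon> suc n" by (rule no_cycles)
  have op: "op i v \<epsilon> ?f \<longleftrightarrow> (i \<epsilon> suc n \<and> ap f i = v) \<or> (i = suc n \<and> v = z)" for i v
    using FunOn_app[OF f(1)] by auto
  have F: "FunOn ?f (suc (suc n))" unfolding FunOn_iff
  proof (intro conjI HOL.allI HOL.impI)
    show "\<exists>i. i \<epsilon> suc (suc n) \<and> (\<exists>v. p = op i v)" if "p \<epsilon> ?f" for p
      using that f(1) unfolding FunOn_iff mem_derived by blast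
    show "\<exists>!v. op i v \<epsilon> ?f" if "i \<epsilon> suc (suc n)" for i
      using that no unfolding op mem_derived(3)[of _ "suc n"] by auto
  qed
  have old: "ap ?f i = ap f i" if "i \<epsilon> suc n" for i
    by (rule ap_eq[OF F]) (use that in \<open>simp add: op del: mem_derived\<close>)
  have new: "ap ?f (suc n) = z" by (rule ap_eq[OF F]) (simp add: op)
  have "emp \<epsilon> suc n"
    by (rule om_ind[OF n, of "\<lambda>n. emp \<epsilon> suc n"]) (intro Dfi, auto)
  moreover have "ap ?f (suc i) = G (ap ?f i)" if "i \<epsilon> suc n" for i
  proof (cases "i = n")
    case True
    then show ?thesis using new old[of n] f(4) z by simp
  next
    case False
    then have "i \<epsilon> n" using that by simp
    then show ?thesis using old[of i] old[OF suc_mem[OF n]] f(3) that by simp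
  qed
  ultimately show "IT G x (suc n) z" unfolding IT_def using F old f(2) new by auto
qed

lemma IT_ex1: "n \<epsilon> om \<Longrightarrow> \<exists>y. \<forall>z. IT G x n z \<longleftrightarrow> z = y"
proof (rule om_ind[of n "\<lambda>n. \<exists>y. \<forall>z. IT G x n z \<longleftrightarrow> z = y"])
  show "Df (\<lambda>e. \<exists>y. \<forall>z. IT G x (e 0) z \<longleftrightarrow> z = y)" by (intro Dfi Df_IT)
  show "\<exists>y. \<forall>z. IT G x emp z \<longleftrightarrow> z = y" using IT_emp by blast
  show "\<exists>y. \<forall>z. IT G x (suc n) z \<longleftrightarrow> z = y" if "n \<epsilon> om" "\<exists>y. \<forall>z. IT G x n z \<longleftrightarrow> z = y" for n
    using IT_suc[OF that(1)] that(2) by metis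
qed

lemma IT_it: "n \<epsilon> om \<Longrightarrow> IT G x n z \<longleftrightarrow> z = it G x n"
proof -
  assume "n \<epsilon> om"
  then obtain y where y: "\<And>z. IT G x n z \<longleftrightarrow> z = y" using IT_ex1[of n x] by blast
  then have "it G x n = y" unfolding it_def by (intro the_set_eqI) simp
  with y show ?thesis by simp
qed

lemma it_emp [simp]: "it G x emp = x"
  using IT_it[OF om_emp] IT_emp by metis

lemma it_suc: "n \<epsilon> om \<Longrightarrow> it G x (suc n) = G (it G x n)"
  using IT_suc[of n x "it G x n"] IT_it[of n x] IT_it[OF om_suc, of n x] by metis

definition "Uit x = the_set (\<lambda>z. \<exists>n. n \<epsilon> om \<and> z \<epsilon> it G x n)"

lemma mem_Uit: "z \<epsilon> Uit x \<longleftrightarrow> (\<exists>n. n \<epsilon> om \<and> z \<epsilon> it G x n)"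
proof -
  have "Dt (\<lambda>e. it G x (e 0))" by (intro Dt_it Dfi)
  note img = mem_img[OF this]
  have "z \<epsilon> uni (img (it G x) om) \<longleftrightarrow> (\<exists>n. n \<epsilon> om \<and> z \<epsilon> it G x n)" for z
    by (auto simp: img)
  then show ?thesis unfolding Uit_def by (rule mem_the_set)
qed

lemma Dt_Uit: "Dt t \<Longrightarrow> Dt (\<lambda>e. Uit (t e))"
  by (rule Dt1) (unfold Uit_def, intro Dfi Dt_it)

end

lemma Dt_uni_var: "Dt (\<lambda>e. uni (e 0))" and Dt_Pw_var: "Dt (\<lambda>e. Pw (e 0))"
  by (intro Dfi)+

text \<open>Foundation speaks of sets, so the counterexamples are collected inside the transitive
  closure \<open>Uit uni x\<close>, which contains all elements of a minimal one.\<close>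

lemma eps_induct:
  assumes P: "Df (\<lambda>e. P (e 0))" "\<And>x. (\<And>y. y \<epsilon> x \<Longrightarrow> P y) \<Longrightarrow> P x"
  shows "P x"
proof (rule ccontr)
  assume "\<not> P x"
  then obtain y where y: "y \<epsilon> x" "\<not> P y" using P(2) by blast
  note mem = mem_Uit[OF Dt_uni_var]
  obtain b where b: "\<And>z. z \<epsilon> b \<longleftrightarrow> z \<epsilon> Uit uni x \<and> \<not> P z"
    by (rule separate[OF Df_not[OF P(1)], of "Uit uni x"]) (rule that)
  have "y \<epsilon> Uit uni x" unfolding mem using y(1) om_emp it_emp[OF Dt_uni_var] by metis
  with y b obtain m where m: "m \<epsilon> b" "\<forall>z. z \<epsilon> b \<longrightarrow> \<not> z \<epsilon> m" using foundation by blast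
  then obtain n where n: "n \<epsilon> om" "m \<epsilon> it uni x n" using b mem by blast
  have "P z" if "z \<epsilon> m" for z
  proof -
    have "z \<epsilon> it uni x (suc n)" using it_suc[OF Dt_uni_var n(1)] n(2) that by auto
    then have "z \<epsilon> Uit uni x" unfolding mem using n(1) om_suc by blast
    then show ?thesis using m(2) that b by blast
  qed
  then have "P m" by (rule P(2))
  with m b show False by blast
qed

lemma eps_least:
  assumes "Df (\<lambda>e. P (e 0))" "P x"
  obtains y where "P y" "\<And>z. z \<epsilon> y \<Longrightarrow> \<not> P z"
  using eps_induct[of "\<lambda>x. \<not> P x" x] assms Df_not[OF assms(1)] by blast

subsection \<open>Levels\<close>

text \<open>The accumulation step in the theory of levels of Scott and Potter: from a set of stages
  V_\<alpha> it forms the union of the V_(\<alpha>+1).\<close>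

definition "acc h = the_set (\<lambda>x. \<exists>s. s \<epsilon> h \<and> x \<sqsubseteq> s)"

lemma mem_acc: "x \<epsilon> acc h \<longleftrightarrow> (\<exists>s. s \<epsilon> h \<and> x \<sqsubseteq> s)"
proof -
  have "x \<epsilon> uni (img Pw h) \<longleftrightarrow> (\<exists>s. s \<epsilon> h \<and> x \<sqsubseteq> s)" for x
    by (auto simp: mem_img[OF Dt_Pw_var])
  then show ?thesis unfolding acc_def by (rule mem_the_set)
qed

text \<open>Levels are defined from their histories, so that no ordinals are needed.\<close>

definition "hist h \<longleftrightarrow> (\<forall>s. s \<epsilon> h \<longrightarrow> (\<forall>x. x \<epsilon> s \<longleftrightarrow> (\<exists>r. r \<epsilon> h \<and> r \<epsilon> s \<and> x \<sqsubseteq> r)))"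
definition "Lev t \<longleftrightarrow> (\<exists>h. hist h \<and> (\<forall>x. x \<epsilon> t \<longleftrightarrow> (\<exists>r. r \<epsilon> h \<and> x \<sqsubseteq> r)))"

lemma Df_Lev [Dfi]: "Dt t \<Longrightarrow> Df (\<lambda>e. Lev (t e))"
  by (rule Df1) (unfold Lev_def hist_def, intro Dfi)

lemma hist_trans:
  assumes h: "hist h"
  shows "s \<epsilon> h \<longrightarrow> (\<forall>x y. x \<epsilon> s \<longrightarrow> y \<epsilon> x \<longrightarrow> y \<epsilon> s)"
proof (rule eps_induct[of "\<lambda>s. s \<epsilon> h \<longrightarrow> (\<forall>x y. x \<epsilon> s \<longrightarrow> y \<epsilon> x \<longrightarrow> y \<epsilon> s)"])
  show "Df (\<lambda>e. e 0 \<epsilon> h \<longrightarrow> (\<forall>x y. x \<epsilon> e 0 \<longrightarrow> y \<epsilon> x \<longrightarrow> y \<epsilon> e 0))" by (intro Dfi)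
  fix s
  assume IH: "\<And>r. r \<epsilon> s \<Longrightarrow> r \<epsilon> h \<longrightarrow> (\<forall>x y. x \<epsilon> r \<longrightarrow> y \<epsilon> x \<longrightarrow> y \<epsilon> r)"
  have s: "x \<epsilon> s \<longleftrightarrow> (\<exists>r. r \<epsilon> h \<and> r \<epsilon> s \<and> x \<sqsubseteq> r)" if "s \<epsilon> h" for x
    using h that unfolding hist_def by blast
  show "s \<epsilon> h \<longrightarrow> (\<forall>x y. x \<epsilon> s \<longrightarrow> y \<epsilon> x \<longrightarrow> y \<epsilon> s)"
  proof (intro HOL.impI HOL.allI)
    fix x y assume sh: "s \<epsilon> h" and xy: "x \<epsilon> s" "y \<epsilon> x"
    then obtain r where r: "r \<epsilon> h" "r \<epsilon> s" "x \<sqsubseteq> r" using s by blast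
    then have "y \<epsilon> r" using xy by blast
    then have "y \<sqsubseteq> r" using IH[OF r(2)] r(1) by blast
    with r s[OF sh] show "y \<epsilon> s" by blast
  qed
qed

text \<open>The part of \<open>h\<close> that belongs to \<open>s\<close> is a history of
  \<open>s\<close>.\<close>

lemma hist_Lev:
  assumes h: "hist h" and s: "s \<epsilon> h"
  shows "Lev s"
proof -
  obtain k where k: "\<And>x. x \<epsilon> k \<longleftrightarrow> x \<epsilon> h \<and> x \<epsilon> s"
    by (rule separate[of "\<lambda>x. x \<epsilon> s" h]) (intro Dfi, rule that)
  have "x \<epsilon> r \<longleftrightarrow> (\<exists>q. q \<epsilon> k \<and> q \<epsilon> r \<and> x \<sqsubseteq> q)" if r: "r \<epsilon> k" for r x
  proof -
    have "x \<epsilon> r \<longleftrightarrow> (\<exists>q. q \<epsilon> h \<and> q \<epsilon> r \<and> x \<sqsubseteq> q)" using h r unfolding hist_def k by blast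
    moreover have "q \<epsilon> k \<longleftrightarrow> q \<epsilon> h" if "q \<epsilon> r" for q
      using hist_trans[OF h, of s] s r that unfolding k by blast
    ultimately show ?thesis by blast
  qed
  then have "hist k" unfolding hist_def by blast
  moreover have "x \<epsilon> s \<longleftrightarrow> (\<exists>r. r \<epsilon> k \<and> x \<sqsubseteq> r)" for x using h s unfolding hist_def k by blast
  ultimately show ?thesis unfolding Lev_def by blast
qed

lemma lev_super: "Lev t \<Longrightarrow> x \<epsilon> t \<Longrightarrow> y \<sqsubseteq> x \<Longrightarrow> y \<epsilon> t"
  unfolding Lev_def by blast

lemma lev_trans:
  assumes "Lev t" "x \<epsilon> t" "y \<epsilon> x"
  shows "y \<epsilon> t"
proof -
  from assms(1) obtain h where h: "hist h" "\<And>x. x \<epsilon> t \<longleftrightarrow> (\<exists>r. r \<epsilon> h \<and> x \<sqsubseteq> r)"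
    unfolding Lev_def by blast
  with assms obtain r where r: "r \<epsilon> h" "x \<sqsubseteq> r" by blast
  then have "y \<sqsubseteq> r" using hist_trans[OF h(1), of r] assms(3) by blast
  with r h show ?thesis by blast
qed

lemma lev_char: "Lev t \<Longrightarrow> x \<epsilon> t \<longleftrightarrow> (\<exists>s. s \<epsilon> t \<and> Lev s \<and> x \<sqsubseteq> s)"
proof
  assume t: "Lev t" and "x \<epsilon> t"
  then obtain h r where "hist h" "\<And>x. x \<epsilon> t \<longleftrightarrow> (\<exists>r. r \<epsilon> h \<and> x \<sqsubseteq> r)" "r \<epsilon> h" "x \<sqsubseteq> r"
    unfolding Lev_def by blast
  then show "\<exists>s. s \<epsilon> t \<and> Lev s \<and> x \<sqsubseteq> s" using hist_Lev by blast
qed (blast intro: lev_super)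

text \<open>The levels in \<open>h\<close> together with those below them serve as a
  history.\<close>

lemma Lev_acc:
  assumes h: "\<And>s. s \<epsilon> h \<Longrightarrow> Lev s"
  shows "Lev (acc h)"
proof -
  obtain k where k: "\<And>r. r \<epsilon> k \<longleftrightarrow> r \<epsilon> un h (uni h) \<and> Lev r"
    by (rule separate[of Lev "un h (uni h)"]) (intro Dfi, rule that)
  have up: "q \<epsilon> k" if "q \<epsilon> r" "r \<epsilon> k" "Lev q" for q r
  proof -
    from that(2) consider "r \<epsilon> h" | s where "s \<epsilon> h" "r \<epsilon> s" unfolding k by auto
    then have "\<exists>s. s \<epsilon> h \<and> q \<epsilon> s" using lev_trans h that(1) by cases blast+
    then show ?thesis unfolding k using that(3) by simp
  qed
  have "x \<epsilon> r \<longleftrightarrow> (\<exists>q. q \<epsilon> k \<and> q \<epsilon> r \<and> x \<sqsubseteq> q)" if r: "r \<epsilon> k" for r x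
  proof -
    have "Lev r" using r unfolding k by blast
    then have "x \<epsilon> r \<longleftrightarrow> (\<exists>q. q \<epsilon> r \<and> Lev q \<and> x \<sqsubseteq> q)" by (rule lev_char)
    also have "\<dots> \<longleftrightarrow> (\<exists>q. q \<epsilon> k \<and> q \<epsilon> r \<and> x \<sqsubseteq> q)" using up[OF _ r] k by blast
    finally show ?thesis .
  qed
  then have "hist k" unfolding hist_def by blast
  moreover have "x \<epsilon> acc h \<longleftrightarrow> (\<exists>r. r \<epsilon> k \<and> x \<sqsubseteq> r)" for x
  proof
    assume "x \<epsilon> acc h"
    then obtain s where "s \<epsilon> h" "x \<sqsubseteq> s" unfolding mem_acc by blast
    then show "\<exists>r. r \<epsilon> k \<and> x \<sqsubseteq> r" using h unfolding k by auto
  next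
    assume "\<exists>r. r \<epsilon> k \<and> x \<sqsubseteq> r"
    then obtain r where r: "r \<epsilon> k" "x \<sqsubseteq> r" by blast
    then consider "r \<epsilon> h" | s where "s \<epsilon> h" "r \<epsilon> s" unfolding k by auto
    then show "x \<epsilon> acc h" unfolding mem_acc using r(2) h lev_trans by cases blast+
  qed
  ultimately show ?thesis unfolding Lev_def by blast
qed

text \<open>Double \<in>-induction: if \<open>s\<close> and \<open>t\<close> were incomparable,
  every level in one would belong to the other, and by \<open>lev_char\<close> a level is determined
  by the levels in it.\<close>

lemma lev_linear: "Lev s \<Longrightarrow> Lev t \<Longrightarrow> s \<epsilon> t \<or> s = t \<or> t \<epsilon> s"
proof -
  let ?cmp = "\<lambda>s t. s \<epsilon> t \<or> s = t \<or> t \<epsilon> s"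
  have "\<forall>t. Lev s \<longrightarrow> Lev t \<longrightarrow> ?cmp s t"
  proof (rule eps_induct[of "\<lambda>s. \<forall>t. Lev s \<longrightarrow> Lev t \<longrightarrow> ?cmp s t"])
    show "Df (\<lambda>e. \<forall>t. Lev (e 0) \<longrightarrow> Lev t \<longrightarrow> ?cmp (e 0) t)" by (intro Dfi)
    fix s assume IHs: "\<And>r. r \<epsilon> s \<Longrightarrow> \<forall>t. Lev r \<longrightarrow> Lev t \<longrightarrow> ?cmp r t"
    have "Lev s \<longrightarrow> Lev t \<longrightarrow> ?cmp s t" for t
    proof (rule eps_induct[of "\<lambda>t. Lev s \<longrightarrow> Lev t \<longrightarrow> ?cmp s t"])
      show "Df (\<lambda>e. Lev s \<longrightarrow> Lev (e 0) \<longrightarrow> ?cmp s (e 0))" by (intro Dfi)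
      fix t assume IHt: "\<And>r. r \<epsilon> t \<Longrightarrow> Lev s \<longrightarrow> Lev r \<longrightarrow> ?cmp s r"
      show "Lev s \<longrightarrow> Lev t \<longrightarrow> ?cmp s t"
      proof (intro HOL.impI)
        assume s: "Lev s" and t: "Lev t"
        show "?cmp s t"
        proof (rule ccontr)
          assume no: "\<not> ?cmp s t"
          have "x \<epsilon> t" if x: "x \<epsilon> s" for x
          proof -
            obtain r where r: "r \<epsilon> s" "Lev r" "x \<sqsubseteq> r" using lev_char[OF s, of x] x by blast
            have "?cmp r t" using IHs[OF r(1)] r(2) t by blast
            then have "r \<epsilon> t" using no lev_trans[OF s r(1), of t] r(1) by blast
            from lev_super[OF t this r(3)] show ?thesis .
          qed
          moreover have "x \<epsilon> s" if x: "x \<epsilon> t" for x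
          proof -
            obtain r where r: "r \<epsilon> t" "Lev r" "x \<sqsubseteq> r" using lev_char[OF t, of x] x by blast
            have "?cmp s r" using IHt[OF r(1)] r(2) s by blast
            then have "r \<epsilon> s" using no lev_trans[OF t r(1), of s] r(1) by blast
            from lev_super[OF s this r(3)] show ?thesis .
          qed
          ultimately have "s = t" by (intro sub_antisym) blast+
          with no show False by blast
        qed
      qed
    qed
    then show "\<forall>t. Lev s \<longrightarrow> Lev t \<longrightarrow> ?cmp s t" by blast
  qed
  then show "Lev s \<Longrightarrow> Lev t \<Longrightarrow> ?cmp s t" by blast
qed

definition "lv x = the_set (\<lambda>z. \<exists>t. (Lev t \<and> x \<sqsubseteq> t \<and> (\<forall>r. Lev r \<longrightarrow> x \<sqsubseteq> r \<longrightarrow> \<not> r \<epsilon> t)) \<and> z \<epsilon> t)"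

lemma Dt_lv [Dfi]: "Dt t \<Longrightarrow> Dt (\<lambda>e. lv (t e))"
  by (rule Dt1) (unfold lv_def, intro Dfi)

lemma least_level:
  assumes P: "Df (\<lambda>e. P (e 0))" "P t" "\<And>t. P t \<Longrightarrow> Lev t"
  obtains s where "P s" "\<And>r. P r \<Longrightarrow> \<not> r \<epsilon> s" "\<And>r. P r \<Longrightarrow> r = s \<or> s \<epsilon> r"
    "the_set (\<lambda>z. \<exists>t. (P t \<and> (\<forall>r. P r \<longrightarrow> \<not> r \<epsilon> t)) \<and> z \<epsilon> t) = s"
proof -
  obtain s where s: "P s" "\<And>r. r \<epsilon> s \<Longrightarrow> \<not> P r" using eps_least[of P t] P(1,2) by blast
  have lin: "r = s \<or> s \<epsilon> r" if "P r" for r using lev_linear[OF P(3) P(3)] s that by blast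
  have "P t \<and> (\<forall>r. P r \<longrightarrow> \<not> r \<epsilon> t) \<longleftrightarrow> t = s" for t using s lin by blast
  then have "the_set (\<lambda>z. \<exists>t. (P t \<and> (\<forall>r. P r \<longrightarrow> \<not> r \<epsilon> t)) \<and> z \<epsilon> t) = s"
    by (intro the_set_eqI) simp
  with s lin that show thesis by blast
qed

lemma lv_if:
  assumes "Lev t" "x \<sqsubseteq> t"
  shows "Lev (lv x) \<and> x \<sqsubseteq> lv x \<and> (\<forall>r. Lev r \<longrightarrow> x \<sqsubseteq> r \<longrightarrow> lv x = r \<or> lv x \<epsilon> r)"
proof -
  have "Df (\<lambda>e. Lev (e 0) \<and> x \<sqsubseteq> e 0)" by (intro Dfi)
  then obtain s where s: "Lev s \<and> x \<sqsubseteq> s" "\<And>r. Lev r \<and> x \<sqsubseteq> r \<Longrightarrow> r = s \<or> s \<epsilon> r"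
    and the: "the_set (\<lambda>z. \<exists>t. ((Lev t \<and> x \<sqsubseteq> t) \<and> (\<forall>r. Lev r \<and> x \<sqsubseteq> r \<longrightarrow> \<not> r \<epsilon> t)) \<and> z \<epsilon> t) = s"
    using least_level[of "\<lambda>t. Lev t \<and> x \<sqsubseteq> t" t] assms by blast
  have "lv x = s" using the unfolding lv_def by (simp add: conj_ac imp_conjL)
  with s show ?thesis by blast
qed

text \<open>Replacement collects the least levels including the members of \<open>x\<close>;
  accumulating them gives a level including \<open>x\<close>.\<close>

lemma level_exists: "\<exists>t. Lev t \<and> x \<sqsubseteq> t"
proof (rule eps_induct[of "\<lambda>x. \<exists>t. Lev t \<and> x \<sqsubseteq> t"])
  show "Df (\<lambda>e. \<exists>t. Lev t \<and> e 0 \<sqsubseteq> t)" by (intro Dfi)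
  fix x assume IH: "\<And>y. y \<epsilon> x \<Longrightarrow> \<exists>t. Lev t \<and> y \<sqsubseteq> t"
  have lv: "Lev (lv y) \<and> y \<sqsubseteq> lv y" if "y \<epsilon> x" for y using IH[OF that] lv_if by blast
  have D: "Dt (\<lambda>e. lv (e 0))" by (intro Dfi)
  have "Lev (acc (img lv x))" by (rule Lev_acc) (use lv in \<open>auto simp: mem_img[OF D]\<close>)
  moreover have "x \<sqsubseteq> acc (img lv x)" using lv by (auto simp: mem_acc mem_img[OF D])
  ultimately show "\<exists>t. Lev t \<and> x \<sqsubseteq> t" by blast
qed

lemma Lev_lv: "Lev (lv x)" and sub_lv: "x \<sqsubseteq> lv x"
  and lv_least: "Lev r \<Longrightarrow> x \<sqsubseteq> r \<Longrightarrow> lv x = r \<or> lv x \<epsilon> r"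
  using level_exists[of x] lv_if by blast+

lemma Lev_Pw: "Lev t \<Longrightarrow> Lev (Pw t)"
proof -
  assume t: "Lev t"
  have "acc (sg t) = Pw t" by (rule ext) (simp add: mem_acc)
  with Lev_acc[of "sg t"] t show ?thesis by simp
qed

subsection \<open>Super-transitive closed sets\<close>

text \<open>Such a set contains every function between its members. It thus bounds the assignments
  needed for satisfaction, and it computes cofinalities correctly once it contains \<omega>.\<close>

definition "super D \<longleftrightarrow> closed D \<and> (\<forall>x. x \<epsilon> D \<longrightarrow> Pw x \<epsilon> D \<and> (\<forall>y. y \<sqsubseteq> x \<longrightarrow> y \<epsilon> D))"

text \<open>For a stage V_\<alpha> this is V_(\<alpha>+\<omega>), the next stage of limit
  height.\<close>

definition "Bof s = Uit Pw s"

lemmas mem_Bof = mem_Uit[OF Dt_Pw_var, folded Bof_def]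
lemmas it_Pw_suc = it_suc[OF Dt_Pw_var]
lemmas it_Pw_emp [simp] = it_emp[OF Dt_Pw_var]

lemma Dt_Bof [Dfi]: "Dt t \<Longrightarrow> Dt (\<lambda>e. Bof (t e))"
  unfolding Bof_def by (rule Dt_Uit[OF Dt_Pw_var])

definition "transset s \<longleftrightarrow> (\<forall>x y. x \<epsilon> s \<longrightarrow> y \<epsilon> x \<longrightarrow> y \<epsilon> s)"

lemma lev_transset: "Lev t \<Longrightarrow> transset t"
  unfolding transset_def using lev_trans by blast

context
  fixes s
  assumes ts: "transset s"
begin

lemmas transD = ts[unfolded transset_def, rule_format]

lemma it_Pw_trans: "n \<epsilon> om \<Longrightarrow> x \<epsilon> it Pw s n \<Longrightarrow> y \<epsilon> x \<Longrightarrow> y \<epsilon> it Pw s n"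
proof -
  assume n: "n \<epsilon> om"
  have "\<forall>x y. x \<epsilon> it Pw s n \<longrightarrow> y \<epsilon> x \<longrightarrow> y \<epsilon> it Pw s n"
  proof (rule om_ind[OF n, of "\<lambda>n. \<forall>x y. x \<epsilon> it Pw s n \<longrightarrow> y \<epsilon> x \<longrightarrow> y \<epsilon> it Pw s n"])
    show "Df (\<lambda>e. \<forall>x y. x \<epsilon> it Pw s (e 0) \<longrightarrow> y \<epsilon> x \<longrightarrow> y \<epsilon> it Pw s (e 0))"
      by (intro Dfi Dt_it[OF Dt_Pw_var])
  qed (use transD in \<open>auto simp: it_Pw_suc\<close>)
  then show "x \<epsilon> it Pw s n \<Longrightarrow> y \<epsilon> x \<Longrightarrow> y \<epsilon> it Pw s n" by blast
qed

lemma it_Pw_step: "n \<epsilon> om \<Longrightarrow> it Pw s n \<sqsubseteq> it Pw s (suc n)"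
  using it_Pw_trans by (auto simp: it_Pw_suc)

lemma it_Pw_mono: "n \<epsilon> om \<Longrightarrow> m \<epsilon> n \<Longrightarrow> it Pw s m \<sqsubseteq> it Pw s n"
proof -
  assume n: "n \<epsilon> om"
  have "\<forall>m. m \<epsilon> n \<longrightarrow> it Pw s m \<sqsubseteq> it Pw s n"
  proof (rule om_ind[OF n, of "\<lambda>n. \<forall>m. m \<epsilon> n \<longrightarrow> it Pw s m \<sqsubseteq> it Pw s n"])
    show "Df (\<lambda>e. \<forall>m. m \<epsilon> e 0 \<longrightarrow> it Pw s m \<sqsubseteq> it Pw s (e 0))"
      by (intro Dfi Dt_it[OF Dt_Pw_var])
  qed (use it_Pw_step in auto)
  then show "m \<epsilon> n \<Longrightarrow> it Pw s m \<sqsubseteq> it Pw s n" by blast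
qed

lemma it_Pw_common:
  assumes "n \<epsilon> om" "m \<epsilon> om"
  obtains k where "k \<epsilon> om" "it Pw s n \<sqsubseteq> it Pw s k" "it Pw s m \<sqsubseteq> it Pw s k"
proof -
  have "n \<epsilon> m \<or> n = m \<or> m \<epsilon> n"
    using assms Omega_om unfolding Omega_iff Lim_iff Ord_iff[of om] by blast
  then show thesis using assms it_Pw_mono that by metis
qed

lemma Bof_I: "n \<epsilon> om \<Longrightarrow> x \<sqsubseteq> it Pw s n \<Longrightarrow> x \<epsilon> Bof s"
  unfolding mem_Bof using om_suc[of n] it_Pw_suc[of n s] by (intro exI[of _ "suc n"]) simp

lemma Bof_E:
  assumes "x \<epsilon> Bof s"
  obtains n where "n \<epsilon> om" "x \<epsilon> it Pw s n" "x \<sqsubseteq> it Pw s n"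
  using assms it_Pw_trans unfolding mem_Bof by blast

lemma sub_Bof: "s \<sqsubseteq> Bof s" and Pw_Bof: "Pw s \<sqsubseteq> Bof s"
  using Bof_I[OF om_emp] om_emp unfolding mem_Bof by auto

lemma super_Bof: "super (Bof s)"
  unfolding super_def closed_def
proof (intro conjI HOL.allI HOL.impI)
  show "x \<epsilon> Bof s" if "x \<epsilon> y" "y \<epsilon> Bof s" for x y
    using that it_Pw_trans unfolding mem_Bof by blast
  show "emp \<epsilon> Bof s" by (rule Bof_I[OF om_emp]) simp
  fix x assume x: "x \<epsilon> Bof s"
  then obtain n where n: "n \<epsilon> om" "x \<epsilon> it Pw s n" "x \<sqsubseteq> it Pw s n" by (rule Bof_E)
  show "y \<epsilon> Bof s" if "y \<sqsubseteq> x" for y using Bof_I[OF n(1), of y] n(3) that by blast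
  have "Pw x \<sqsubseteq> it Pw s (suc n)" using n by (simp add: it_Pw_suc)
  then show "Pw x \<epsilon> Bof s" using Bof_I[OF om_suc[OF n(1)]] by blast
  fix y assume "y \<epsilon> Bof s"
  then obtain m where m: "m \<epsilon> om" "y \<epsilon> it Pw s m" "y \<sqsubseteq> it Pw s m" by (rule Bof_E)
  obtain k where k: "k \<epsilon> om" "it Pw s n \<sqsubseteq> it Pw s k" "it Pw s m \<sqsubseteq> it Pw s k"
    using it_Pw_common n m by blast
  show "up x y \<epsilon> Bof s" by (rule Bof_I[OF k(1)]) (use k n m in auto)
  show "un x y \<epsilon> Bof s" by (rule Bof_I[OF k(1)]) (use k n m in auto)
qed

end

lemma
  assumes "super D"
  shows super_closed: "closed D" and super_Pw: "x \<epsilon> D \<Longrightarrow> Pw x \<epsilon> D"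
    and super_sub: "x \<epsilon> D \<Longrightarrow> y \<sqsubseteq> x \<Longrightarrow> y \<epsilon> D"
  using assms unfolding super_def by blast+

lemma super_prd:
  assumes D: "super D" and "a \<epsilon> D" "b \<epsilon> D"
  shows "prd a b \<epsilon> D"
proof -
  have u: "un a b \<epsilon> D" by (rule closed_un[OF super_closed[OF D]]) (use assms in auto)
  have "prd a b \<sqsubseteq> Pw (Pw (un a b))" by (auto simp: op_def)
  with super_Pw[OF D super_Pw[OF D super_Pw[OF D u]]] show ?thesis
    using super_sub[OF D super_Pw[OF D super_Pw[OF D u]]] by blast
qed

lemma super_ex: "\<exists>D. x \<epsilon> D \<and> super D"
proof -
  note t = lev_transset[OF Lev_lv[of x]]
  have "x \<epsilon> Pw (lv x)" using sub_lv by simp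
  with super_Bof[OF t] Pw_Bof[OF t] show ?thesis by blast
qed

section \<open>Choice: towers, distinct representatives and a Jonsson-type function\<close>

definition "injf g a b \<longleftrightarrow> Fun g a b \<and> (\<forall>x y z. op x z \<epsilon> g \<longrightarrow> op y z \<epsilon> g \<longrightarrow> x = y)"

lemma Df_injf [Dfi]: "Dt t \<Longrightarrow> Dt u \<Longrightarrow> Dt v \<Longrightarrow> Df (\<lambda>e. injf (t e) (u e) (v e))"
  by (rule Df3) (unfold injf_def, intro Dfi)

lemma injfI:
  assumes t: "Dt (\<lambda>e. t (e 0))" and "\<And>x. x \<epsilon> a \<Longrightarrow> t x \<epsilon> b"
    and "\<And>x y. x \<epsilon> a \<Longrightarrow> y \<epsilon> a \<Longrightarrow> t x = t y \<Longrightarrow> x = y"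
  shows "injf (lam a t) a b"
  unfolding injf_def using Fun_lam[OF t assms(2)] assms(3) by (auto simp: op_lam[OF t])

lemma injf_ap: "injf g a b \<Longrightarrow> x \<epsilon> a \<Longrightarrow> ap g x \<epsilon> b"
  unfolding injf_def using Fun_ap by blast

lemma injf_eq: "injf g a b \<Longrightarrow> x \<epsilon> a \<Longrightarrow> y \<epsilon> a \<Longrightarrow> ap g x = ap g y \<Longrightarrow> x = y"
  unfolding injf_def Fun_iff using ap_mem by metis

lemma injf_comp:
  assumes g: "injf g a b" and h: "injf h b' c" and b: "b \<sqsubseteq> b'" and c: "\<And>x. x \<epsilon> b \<Longrightarrow> ap h x \<epsilon> c'"
  shows "\<exists>f. injf f a c'"
proof (rule exI, rule injfI[of "\<lambda>x. ap h (ap g x)"])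
  show "Dt (\<lambda>e. ap h (ap g (e 0)))" by (intro Dfi)
  show "ap h (ap g x) \<epsilon> c'" if "x \<epsilon> a" for x using c injf_ap[OF g that] by blast
  show "x = y" if "x \<epsilon> a" "y \<epsilon> a" "ap h (ap g x) = ap h (ap g y)" for x y
    using injf_eq[OF h _ _ that(3)] injf_eq[OF g that(1,2)] injf_ap[OF g] that(1,2) b by blast
qed

lemma choice_fun: "\<exists>c. \<forall>x. x \<epsilon> F \<longrightarrow> (\<exists>v. v \<epsilon> x) \<longrightarrow> ap c x \<epsilon> x"
proof -
  obtain G where G: "\<And>x. x \<epsilon> G \<longleftrightarrow> x \<epsilon> F \<and> (\<exists>v. v \<epsilon> x)"
    by (rule separate[of "\<lambda>x. \<exists>v. v \<epsilon> x" F]) (intro Dfi, rule that)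
  have D: "Dt (\<lambda>e. prd (sg (e 0)) (e 0))" by (intro Dfi)
  \<comment> \<open>Replacing \<open>x\<close> by \<open>{x} \<times> x\<close> makes the family
    disjoint, as the axiom requires, and records which set a chosen element came from.\<close>
  let ?G = "img (\<lambda>x. prd (sg x) x) G"
  have "\<exists>c. \<forall>y. y \<epsilon> ?G \<longrightarrow> (\<exists>!v. v \<epsilon> y \<and> v \<epsilon> c)"
  proof (rule choice)
    fix y assume "y \<epsilon> ?G"
    then obtain x where x: "x \<epsilon> G" and y: "y = prd (sg x) x" unfolding mem_img[OF D] by blast
    from x G obtain v where "v \<epsilon> x" by blast
    then have "op x v \<epsilon> y" unfolding y by simp
    then show "\<exists>v. v \<epsilon> y" by blast
  next
    fix y z v assume "y \<epsilon> ?G" "z \<epsilon> ?G" and v: "v \<epsilon> y" "v \<epsilon> z"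
    then obtain x x' where y: "y = prd (sg x) x" "z = prd (sg x') x'" unfolding mem_img[OF D] by blast
    from v show "y = z" unfolding y by auto
  qed
  then obtain c where c0: "\<forall>y. y \<epsilon> ?G \<longrightarrow> (\<exists>!v. v \<epsilon> y \<and> v \<epsilon> c)" by blast
  have c: "\<exists>!v. v \<epsilon> prd (sg x) x \<and> v \<epsilon> c" if "x \<epsilon> G" for x
    using c0 that unfolding mem_img[OF D] by blast
  let ?t = "\<lambda>x. the_set (\<lambda>z. \<exists>v. v \<epsilon> x \<and> op x v \<epsilon> c \<and> z \<epsilon> v)"
  have T: "Dt (\<lambda>e. ?t (e 0))" by (intro Dfi)
  have "ap (lam G ?t) x \<epsilon> x" if x: "x \<epsilon> G" for x
  proof -
    from c[OF x] obtain p where p: "p \<epsilon> prd (sg x) x" "p \<epsilon> c"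
      and up: "\<And>q. q \<epsilon> prd (sg x) x \<Longrightarrow> q \<epsilon> c \<Longrightarrow> q = p" by blast
    from p(1) obtain v where pv: "p = op x v" and "v \<epsilon> x" by auto
    with p have v: "v \<epsilon> x" "op x v \<epsilon> c" by blast+
    have u: "w = v" if "w \<epsilon> x" "op x w \<epsilon> c" for w
      using up[of "op x w"] that unfolding pv by simp
    have "?t x = v" by (rule the_set_eqI) (use v u in blast)
    then show ?thesis using ap_lam[OF T x] v(1) by simp
  qed
  then show ?thesis using G by blast
qed

text \<open>Zermelo's towers: the least family of subsets of \<open>Om\<close> closed under unions and \<open>nx\<close>,
  where \<open>nx\<close> adds at most one point.\<close>

definition "tower Om nx \<longleftrightarrow> Dt (\<lambda>e. nx (e 0)) \<and> (\<forall>x. x \<sqsubseteq> Om \<longrightarrow> x \<sqsubseteq> nx x \<and> nx x \<sqsubseteq> Om \<and>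
  (\<forall>y. x \<sqsubseteq> y \<longrightarrow> y \<sqsubseteq> nx x \<longrightarrow> y = x \<or> y = nx x))"

context
  fixes Om nx
  assumes tower: "tower Om nx"
begin

lemma nxD: "Dt (\<lambda>e. nx (e 0))"
    and nx1: "x \<sqsubseteq> Om \<Longrightarrow> x \<sqsubseteq> nx x" and nx2: "x \<sqsubseteq> Om \<Longrightarrow> nx x \<sqsubseteq> Om"
    and nx3: "x \<sqsubseteq> Om \<Longrightarrow> x \<sqsubseteq> y \<Longrightarrow> y \<sqsubseteq> nx x \<Longrightarrow> y = x \<or> y = nx x"
  using tower unfolding tower_def by blast+

definition "clos C \<longleftrightarrow> (\<forall>x. x \<epsilon> C \<longrightarrow> x \<sqsubseteq> Om) \<and> (\<forall>S. S \<sqsubseteq> C \<longrightarrow> uni S \<epsilon> C) \<and> (\<forall>x. x \<epsilon> C \<longrightarrow> nx x \<epsilon> C)"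
definition "Tw = the_set (\<lambda>x. x \<epsilon> Pw Om \<and> (\<forall>C. clos C \<longrightarrow> x \<epsilon> C))"

lemma Df_clos: "Dt t \<Longrightarrow> Df (\<lambda>e. clos (t e))"
  by (rule Df1) (unfold clos_def, intro Dfi Dt1[OF nxD])

lemma mem_Tw: "x \<epsilon> Tw \<longleftrightarrow> x \<sqsubseteq> Om \<and> (\<forall>C. clos C \<longrightarrow> x \<epsilon> C)"
proof -
  have "Df (\<lambda>e. \<forall>C. clos C \<longrightarrow> e 0 \<epsilon> C)" by (intro Dfi Df_clos)
  from the_set_iff[OF sep[OF this, of "Pw Om"]] show ?thesis unfolding Tw_def by simp
qed

lemma Tw_uni: "S \<sqsubseteq> Tw \<Longrightarrow> uni S \<epsilon> Tw"
proof -
  assume S: "S \<sqsubseteq> Tw"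
  have "uni S \<epsilon> C" if "clos C" for C
  proof -
    have "S \<sqsubseteq> C" using S that unfolding mem_Tw by blast
    with that show ?thesis unfolding clos_def by blast
  qed
  moreover have "uni S \<sqsubseteq> Om" using S mem_Tw by auto
  ultimately show ?thesis unfolding mem_Tw by blast
qed

lemma Tw_nx: "x \<epsilon> Tw \<Longrightarrow> nx x \<epsilon> Tw"
  unfolding mem_Tw using nx2 unfolding clos_def by blast

lemma Tw_sub: "x \<epsilon> Tw \<Longrightarrow> x \<sqsubseteq> Om"
  unfolding mem_Tw by blast

lemma Tw_induct:
  assumes P: "Df (\<lambda>e. P (e 0))" and u: "\<And>S. S \<sqsubseteq> Tw \<Longrightarrow> (\<And>x. x \<epsilon> S \<Longrightarrow> P x) \<Longrightarrow> P (uni S)"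
    and n: "\<And>x. x \<epsilon> Tw \<Longrightarrow> P x \<Longrightarrow> P (nx x)" and x: "x \<epsilon> Tw"
  shows "P x"
proof -
  obtain C where C: "\<And>x. x \<epsilon> C \<longleftrightarrow> x \<epsilon> Tw \<and> P x" using separate[OF P] by blast
  have "uni S \<epsilon> C" if "S \<sqsubseteq> C" for S
  proof -
    have S: "S \<sqsubseteq> Tw" "\<And>x. x \<epsilon> S \<Longrightarrow> P x" using that C by blast+
    show ?thesis unfolding C using Tw_uni[OF S(1)] u[OF S] ..
  qed
  moreover have "nx x \<epsilon> C" if "x \<epsilon> C" for x
    using that Tw_nx n unfolding C by metis
  moreover have "x \<sqsubseteq> Om" if "x \<epsilon> C" for x
    using that Tw_sub unfolding C by metis
  ultimately have "clos C" unfolding clos_def by (intro conjI HOL.allI HOL.impI) simp_all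
  then have "x \<epsilon> C" using x unfolding mem_Tw by simp
  then show ?thesis unfolding C by simp
qed

text \<open>Zermelo's argument in two rounds. If \<open>y\<close> is comparable with all stages,
  nothing lies strictly between \<open>y\<close> and \<open>nx y\<close> (\<open>A\<close>); tower
  induction then shows that every \<open>y\<close> is comparable with all stages
  (\<open>B\<close>).\<close>

lemma Tw_cmp: "x \<epsilon> Tw \<Longrightarrow> y \<epsilon> Tw \<Longrightarrow> x \<sqsubseteq> y \<or> nx y \<sqsubseteq> x"
proof -
  have A: "x \<sqsubseteq> y \<or> nx y \<sqsubseteq> x" if y: "y \<epsilon> Tw" and c: "\<forall>x. x \<epsilon> Tw \<longrightarrow> x \<sqsubseteq> y \<or> y \<sqsubseteq> x" and "x \<epsilon> Tw" for x y
  proof (rule Tw_induct[of "\<lambda>x. x \<sqsubseteq> y \<or> nx y \<sqsubseteq> x", OF _ _ _ \<open>x \<epsilon> Tw\<close>])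
    show "Df (\<lambda>e. e 0 \<sqsubseteq> y \<or> nx y \<sqsubseteq> e 0)" by (intro Dfi)
    show "uni S \<sqsubseteq> y \<or> nx y \<sqsubseteq> uni S" if "\<And>x. x \<epsilon> S \<Longrightarrow> x \<sqsubseteq> y \<or> nx y \<sqsubseteq> x" for S
    proof (cases "\<exists>x. x \<epsilon> S \<and> nx y \<sqsubseteq> x")
      case True
      then show ?thesis by auto
    next
      case False
      then have "x \<sqsubseteq> y" if "x \<epsilon> S" for x using that \<open>\<And>x. x \<epsilon> S \<Longrightarrow> x \<sqsubseteq> y \<or> nx y \<sqsubseteq> x\<close> by blast
      then show ?thesis by auto
    qed
    fix x assume x: "x \<epsilon> Tw" "x \<sqsubseteq> y \<or> nx y \<sqsubseteq> x"
    show "nx x \<sqsubseteq> y \<or> nx y \<sqsubseteq> nx x"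
    proof (cases "nx y \<sqsubseteq> x")
      case True
      then show ?thesis using nx1[OF Tw_sub[OF x(1)]] by blast
    next
      case False
      then have xy: "x \<sqsubseteq> y" using x(2) by blast
      from c Tw_nx[OF x(1)] have "nx x \<sqsubseteq> y \<or> y \<sqsubseteq> nx x" by blast
      then show ?thesis
      proof
        assume "y \<sqsubseteq> nx x"
        from nx3[OF Tw_sub[OF x(1)] xy this] show ?thesis by blast
      qed blast
    qed
  qed
  have B: "\<forall>x. x \<epsilon> Tw \<longrightarrow> x \<sqsubseteq> y \<or> y \<sqsubseteq> x" if "y \<epsilon> Tw" for y
  proof (rule Tw_induct[of "\<lambda>y. \<forall>x. x \<epsilon> Tw \<longrightarrow> x \<sqsubseteq> y \<or> y \<sqsubseteq> x", OF _ _ _ that])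
    show "Df (\<lambda>e. \<forall>x. x \<epsilon> Tw \<longrightarrow> x \<sqsubseteq> e 0 \<or> e 0 \<sqsubseteq> x)" by (intro Dfi)
    fix S assume S: "\<And>y. y \<epsilon> S \<Longrightarrow> \<forall>x. x \<epsilon> Tw \<longrightarrow> x \<sqsubseteq> y \<or> y \<sqsubseteq> x"
    show "\<forall>x. x \<epsilon> Tw \<longrightarrow> x \<sqsubseteq> uni S \<or> uni S \<sqsubseteq> x"
    proof (intro HOL.allI HOL.impI)
      fix x assume x: "x \<epsilon> Tw"
      show "x \<sqsubseteq> uni S \<or> uni S \<sqsubseteq> x"
      proof (cases "\<exists>y. y \<epsilon> S \<and> x \<sqsubseteq> y")
        case True
        then show ?thesis by auto
      next
        case False
        then have "y \<sqsubseteq> x" if "y \<epsilon> S" for y using S[OF that] x that by blast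
        then show ?thesis by auto
      qed
    qed
  next
    fix y assume y: "y \<epsilon> Tw" "\<forall>x. x \<epsilon> Tw \<longrightarrow> x \<sqsubseteq> y \<or> y \<sqsubseteq> x"
    show "\<forall>x. x \<epsilon> Tw \<longrightarrow> x \<sqsubseteq> nx y \<or> nx y \<sqsubseteq> x"
      using A[OF y] nx1[OF Tw_sub[OF y(1)]] by blast
  qed
  show "x \<sqsubseteq> y \<or> nx y \<sqsubseteq> x" if x: "x \<epsilon> Tw" and y: "y \<epsilon> Tw" using A[OF y B[OF y] x] .
qed

lemma Tw_fix:
  assumes m: "m \<epsilon> Tw" "nx m = m" and x: "x \<epsilon> Tw"
  shows "x \<sqsubseteq> m"
proof (rule Tw_induct[of "\<lambda>x. x \<sqsubseteq> m", OF _ _ _ x])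
  show "Df (\<lambda>e. e 0 \<sqsubseteq> m)" by (intro Dfi)
  fix x assume x: "x \<epsilon> Tw" "x \<sqsubseteq> m"
  from Tw_cmp[OF m(1) x(1)] show "nx x \<sqsubseteq> m"
  proof
    assume "m \<sqsubseteq> x"
    with x(2) have "x = m" by (rule sub_antisym)
    with m(2) show ?thesis by simp
  qed
qed auto

lemma Tw_top: "uni Tw \<epsilon> Tw" "nx (uni Tw) = uni Tw"
proof -
  show T: "uni Tw \<epsilon> Tw" by (rule Tw_uni) blast
  have "nx (uni Tw) \<sqsubseteq> uni Tw" using Tw_nx[OF T] by auto
  with nx1[OF Tw_sub[OF T]] show "nx (uni Tw) = uni Tw" by (intro sub_antisym)
qed

text \<open>The union \<open>?m\<close> of the common lower bounds is itself one. If it failed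
  \<open>P\<close>, then \<open>nx ?m\<close> would be another, so \<open>?m\<close> would be a
  fixed point, hence the largest stage, and equal to \<open>x\<close>.\<close>

lemma Tw_least:
  assumes P: "Df (\<lambda>e. P (e 0))" and x: "x \<epsilon> Tw" "P x"
  obtains m where "m \<epsilon> Tw" "P m" "\<And>y. y \<epsilon> Tw \<Longrightarrow> P y \<Longrightarrow> m \<sqsubseteq> y"
proof -
  obtain L where L: "\<And>z. z \<epsilon> L \<longleftrightarrow> z \<epsilon> Tw \<and> (\<forall>y. y \<epsilon> Tw \<longrightarrow> P y \<longrightarrow> z \<sqsubseteq> y)"
    by (rule separate[of "\<lambda>z. \<forall>y. y \<epsilon> Tw \<longrightarrow> P y \<longrightarrow> z \<sqsubseteq> y" Tw]) (intro Dfi Df1[OF P], rule that)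
  let ?m = "uni L"
  have m: "?m \<epsilon> Tw" using L by (intro Tw_uni) blast
  have below: "?m \<sqsubseteq> y" if "y \<epsilon> Tw" "P y" for y using that L by auto
  have "P ?m"
  proof (rule ccontr)
    assume no: "\<not> P ?m"
    have "nx ?m \<sqsubseteq> y" if y: "y \<epsilon> Tw" "P y" for y
      using Tw_cmp[OF y(1) m] sub_antisym[OF below[OF y]] y(2) no by blast
    then have "nx ?m \<epsilon> L" using L Tw_nx[OF m] by blast
    then have "nx ?m \<sqsubseteq> ?m" by auto
    then have "nx ?m = ?m" using nx1[OF Tw_sub[OF m]] by (rule sub_antisym)
    from Tw_fix[OF m this x(1)] below[OF x] have "x = ?m" by (rule sub_antisym)
    with no x(2) show False by simp
  qed
  with m below show thesis by (intro that)
qed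

end

text \<open>The tower enumerates \<open>I\<close> only until the enumerated part \<open>J\<close>
  admits an injection \<open>\<psi>\<close> from \<open>I\<close>; the order of \<open>J\<close> is
  pulled back along \<open>\<psi>\<close>. Stopping that early makes the type the least possible, so
  that the order plays the part of an initial ordinal.\<close>

lemma min_wellorder:
  obtains W where
    "\<And>i k. i \<epsilon> I \<Longrightarrow> k \<epsilon> I \<Longrightarrow> i = k \<or> op i k \<epsilon> W \<or> op k i \<epsilon> W"
    "\<And>u i. u \<sqsubseteq> I \<Longrightarrow> i \<epsilon> u \<Longrightarrow> \<exists>i. i \<epsilon> u \<and> (\<forall>k. k \<epsilon> u \<longrightarrow> \<not> op k i \<epsilon> W)"
    "\<And>k b g. k \<epsilon> I \<Longrightarrow> (\<And>i. i \<epsilon> b \<Longrightarrow> i \<epsilon> I \<and> op i k \<epsilon> W) \<Longrightarrow> \<not> injf g I b"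
proof -
  obtain c where c: "\<And>x. x \<epsilon> Pw I \<Longrightarrow> \<exists>v. v \<epsilon> x \<Longrightarrow> ap c x \<epsilon> x" using choice_fun[of "Pw I"] by blast
  define small where "small x \<longleftrightarrow> \<not> (\<exists>g. injf g I x)" for x
  define dif where "dif x = the_set (\<lambda>v. v \<epsilon> I \<and> \<not> v \<epsilon> x)" for x
  define nx where "nx x = the_set (\<lambda>z. z \<epsilon> x \<or> small x \<and> z = ap c (dif x))" for x
  have Ds: "Df (\<lambda>e. small (t e))" if "Dt t" for t
    by (rule Df1[OF _ that]) (unfold small_def, intro Dfi)
  have Dd: "Dt (\<lambda>e. dif (t e))" if "Dt t" for t
    by (rule Dt1[OF _ that]) (unfold dif_def, intro Dfi)
  have dif: "v \<epsilon> dif x \<longleftrightarrow> v \<epsilon> I \<and> \<not> v \<epsilon> x" for v x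
    unfolding dif_def by (rule the_set_iff[OF sep]) (intro Dfi)
  have nx: "z \<epsilon> nx x \<longleftrightarrow> z \<epsilon> x \<or> small x \<and> z = ap c (dif x)" for z x
  proof (cases "small x")
    case True
    then show ?thesis unfolding nx_def by (intro mem_the_set[of "un x (sg (ap c (dif x)))"]) simp
  next
    case False
    then show ?thesis unfolding nx_def by (intro mem_the_set[of x]) simp
  qed
  have id: "injf (lam I (\<lambda>x. x)) I I" by (rule injfI) (intro Dfi)
  have new: "ap c (dif x) \<epsilon> I \<and> \<not> ap c (dif x) \<epsilon> x" if x: "small x" "x \<sqsubseteq> I" for x
  proof -
    have "x \<noteq> I" using id x(1) unfolding small_def by blast
    then have "\<exists>v. v \<epsilon> dif x" using sub_antisym[OF x(2)] dif by blast
    then have "ap c (dif x) \<epsilon> dif x" using dif by (intro c) simp_all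
    then show ?thesis by (simp add: dif)
  qed
  have "y = x \<or> y = nx x" if "x \<sqsubseteq> y" "y \<sqsubseteq> nx x" for x y
  proof (cases "nx x \<sqsubseteq> y")
    case True
    then show ?thesis using that(2) by (intro disjI2 sub_antisym)
  next
    case False
    then have "y \<sqsubseteq> x" using that nx by metis
    then show ?thesis using that(1) by (intro disjI1 sub_antisym)
  qed
  moreover have "nx x \<sqsubseteq> I" if "x \<sqsubseteq> I" for x using that new by (auto simp: nx)
  moreover have "Dt (\<lambda>e. nx (e 0))" unfolding nx_def by (intro Dfi Ds Dd)
  ultimately have tw: "tower I nx" unfolding tower_def by (simp add: nx)
  let ?Tw = "Tw I nx"
  note cmp = Tw_cmp[OF tw] and fx = Tw_fix[OF tw]
  define J where "J = uni ?Tw"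
  have J: "J \<epsilon> ?Tw" "nx J = J" unfolding J_def using Tw_top[OF tw] by blast+
  have JI: "J \<sqsubseteq> I" using Tw_sub[OF tw J(1)] .
  have "\<not> small J" using new[OF _ JI] J(2) nx by metis
  then obtain \<psi> where \<psi>: "injf \<psi> I J" unfolding small_def by blast
  \<comment> \<open>The largest stage omitting \<open>a\<close>: for \<open>a\<close> in
    \<open>J\<close> these are the predecessors of \<open>a\<close> in the enumeration, and
    \<open>a\<close> is the point added next.\<close>
  define seg where "seg a = the_set (\<lambda>z. \<exists>x. x \<epsilon> ?Tw \<and> \<not> a \<epsilon> x \<and> z \<epsilon> x)" for a
  have seg: "seg a \<epsilon> ?Tw" "\<not> a \<epsilon> seg a" "\<And>x. x \<epsilon> ?Tw \<Longrightarrow> \<not> a \<epsilon> x \<Longrightarrow> x \<sqsubseteq> seg a" for a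
  proof -
    obtain L where L: "\<And>x. x \<epsilon> L \<longleftrightarrow> x \<epsilon> ?Tw \<and> \<not> a \<epsilon> x"
      by (rule separate[of "\<lambda>x. \<not> a \<epsilon> x" ?Tw]) (intro Dfi, rule that)
    have "z \<epsilon> uni L \<longleftrightarrow> (\<exists>x. x \<epsilon> ?Tw \<and> \<not> a \<epsilon> x \<and> z \<epsilon> x)" for z using L by auto
    then have "seg a = uni L" unfolding seg_def by (rule the_set_eqI)
    moreover have "uni L \<epsilon> ?Tw" by (rule Tw_uni[OF tw]) (simp_all add: L)
    ultimately show "seg a \<epsilon> ?Tw" "\<not> a \<epsilon> seg a" "\<And>x. x \<epsilon> ?Tw \<Longrightarrow> \<not> a \<epsilon> x \<Longrightarrow> x \<sqsubseteq> seg a"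
      using L by auto
  qed
  have a_nx: "a \<epsilon> nx (seg a)" and seg_small: "small (seg a)" if a: "a \<epsilon> J" for a
  proof -
    show "a \<epsilon> nx (seg a)"
    proof (rule ccontr)
      assume "\<not> a \<epsilon> nx (seg a)"
      then have "nx (seg a) \<sqsubseteq> seg a" using seg(3) Tw_nx[OF tw seg(1)] by blast
      then have "nx (seg a) = seg a" using nx by (intro sub_antisym) blast+
      from fx[OF seg(1) this J(1)] a seg(2) show False by blast
    qed
    then show "small (seg a)" using seg(2) nx by blast
  qed
  define lt where "lt i k \<longleftrightarrow> ap \<psi> i \<epsilon> seg (ap \<psi> k)" for i k
  have lin: "a = b \<or> a \<epsilon> seg b \<or> b \<epsilon> seg a" if ab: "a \<epsilon> J" "b \<epsilon> J" for a b
  proof -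
    have "a = b" if "seg a \<sqsubseteq> seg b" "seg b \<sqsubseteq> seg a"
    proof -
      have "seg a = seg b" using that by (rule sub_antisym)
      then have "b = ap c (dif (seg a))" "a = ap c (dif (seg a))"
        using a_nx ab seg(2) nx by metis+
      then show ?thesis by simp
    qed
    then show ?thesis
      using cmp[OF seg(1) seg(1), of a b] cmp[OF seg(1) seg(1), of b a] a_nx ab by blast
  qed
  obtain W where W: "\<And>z. z \<epsilon> W \<longleftrightarrow> z \<epsilon> prd I I \<and> (\<exists>i k. z = op i k \<and> lt i k)"
  proof (rule separate[of "\<lambda>z. \<exists>i k. z = op i k \<and> lt i k" "prd I I"])
    show "Df (\<lambda>e. \<exists>i k. e 0 = op i k \<and> lt i k)" unfolding lt_def seg_def by (intro Dfi)
  qed (rule that)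
  have op_W: "op i k \<epsilon> W \<longleftrightarrow> i \<epsilon> I \<and> k \<epsilon> I \<and> lt i k" for i k unfolding W by auto
  show thesis
  proof (rule that[of W])
    fix i k assume ik: "i \<epsilon> I" "k \<epsilon> I"
    then show "i = k \<or> op i k \<epsilon> W \<or> op k i \<epsilon> W"
      unfolding op_W lt_def using lin injf_ap[OF \<psi>] injf_eq[OF \<psi>] by blast
  next
    fix u i assume u: "u \<sqsubseteq> I" "i \<epsilon> u"
    let ?P = "\<lambda>m. \<exists>i. i \<epsilon> u \<and> m = seg (ap \<psi> i)"
    have "Df (\<lambda>e. ?P (e 0))" unfolding seg_def by (intro Dfi)
    moreover have "?P (seg (ap \<psi> i))" using u by blast
    ultimately obtain m where "m \<epsilon> ?Tw" and m: "?P m" "\<And>y. y \<epsilon> ?Tw \<Longrightarrow> ?P y \<Longrightarrow> m \<sqsubseteq> y"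
      by (rule Tw_least[OF tw, of ?P, OF _ seg(1)]) (rule that)
    from m(1) obtain i where i: "i \<epsilon> u" "m = seg (ap \<psi> i)" by blast
    have i2: "seg (ap \<psi> i) \<sqsubseteq> seg (ap \<psi> k)" if "k \<epsilon> u" for k
      using m(2)[OF seg(1), of "ap \<psi> k"] that unfolding i(2) by blast
    have "\<not> op k i \<epsilon> W" if "k \<epsilon> u" for k
      unfolding op_W lt_def using i2[OF that] seg(2)[of "ap \<psi> i"] seg(2)[of "ap \<psi> k"] by blast
    with i(1) show "\<exists>i. i \<epsilon> u \<and> (\<forall>k. k \<epsilon> u \<longrightarrow> \<not> op k i \<epsilon> W)" by blast
  next
    fix k b g assume k: "k \<epsilon> I" and b: "\<And>i. i \<epsilon> b \<Longrightarrow> i \<epsilon> I \<and> op i k \<epsilon> W"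
    show "\<not> injf g I b"
    proof
      assume "injf g I b"
      from injf_comp[OF this \<psi>, of "seg (ap \<psi> k)"] b
      have "\<exists>f. injf f I (seg (ap \<psi> k))" unfolding op_W lt_def by blast
      with seg_small[OF injf_ap[OF \<psi> k]] show False unfolding small_def by blast
    qed
  qed
qed

text \<open>Representatives are chosen along a well-order of least type: before \<open>i\<close>
  fewer than \<open>I\<close> many elements are used up, whereas \<open>Am i\<close> is at least as
  large as \<open>I\<close>, so one is free. The recursion is a tower of partial choice
  relations.\<close>

lemma distinct_representatives:
  assumes AD: "Dt (\<lambda>e. Am (e 0))" and inj: "\<And>i. i \<epsilon> I \<Longrightarrow> \<exists>g. injf g I (Am i)"
  obtains T where "\<And>i. i \<epsilon> I \<Longrightarrow> \<exists>v. op i v \<epsilon> T"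
    and "\<And>i v. op i v \<epsilon> T \<Longrightarrow> i \<epsilon> I \<and> v \<epsilon> Am i"
    and "\<And>i k v. op i v \<epsilon> T \<Longrightarrow> op k v \<epsilon> T \<Longrightarrow> i = k"
    and "\<And>i v w. op i v \<epsilon> T \<Longrightarrow> op i w \<epsilon> T \<Longrightarrow> v = w"
proof -
  obtain W where
    lin: "\<And>i k. i \<epsilon> I \<Longrightarrow> k \<epsilon> I \<Longrightarrow> i = k \<or> op i k \<epsilon> W \<or> op k i \<epsilon> W" and
    least: "\<And>u i. u \<sqsubseteq> I \<Longrightarrow> i \<epsilon> u \<Longrightarrow> \<exists>i. i \<epsilon> u \<and> (\<forall>k. k \<epsilon> u \<longrightarrow> \<not> op k i \<epsilon> W)" and
    card: "\<And>k b g. k \<epsilon> I \<Longrightarrow> (\<And>i. i \<epsilon> b \<Longrightarrow> i \<epsilon> I \<and> op i k \<epsilon> W) \<Longrightarrow> \<not> injf g I b"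
    using min_wellorder[of I] by blast
  define V where "V = uni (img Am I)"
  define Om where "Om = prd I V"
  have V: "v \<epsilon> V" if "i \<epsilon> I" "v \<epsilon> Am i" for i v
    using that unfolding V_def by (auto simp: mem_img[OF AD])
  obtain c where c: "\<And>x. x \<epsilon> Pw V \<Longrightarrow> \<exists>v. v \<epsilon> x \<Longrightarrow> ap c x \<epsilon> x" using choice_fun[of "Pw V"] by blast
  define miss where "miss x i \<longleftrightarrow> i \<epsilon> I \<and> (\<forall>v. \<not> op i v \<epsilon> x)" for x i
  \<comment> \<open>The next index served is the least one without a representative; if no member of
    its \<open>Am i\<close> is free, the tower stops.\<close>
  define lm where "lm x i \<longleftrightarrow> miss x i \<and> (\<forall>k. miss x k \<longrightarrow> \<not> op k i \<epsilon> W)" for x i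
  define av where "av x i = the_set (\<lambda>v. v \<epsilon> Am i \<and> (\<forall>k. \<not> op k v \<epsilon> x))" for x i
  define new where "new x z \<longleftrightarrow> (\<exists>i. lm x i \<and> (\<exists>w. w \<epsilon> av x i) \<and> z = op i (ap c (av x i)))" for x z
  define nx where "nx x = the_set (\<lambda>z. z \<epsilon> x \<or> new x z)" for x
  have D1: "Df (\<lambda>e. miss (t e) (u e))" if "Dt t" "Dt u" for t u
    by (rule Df2[OF _ that]) (unfold miss_def, intro Dfi)
  have D2: "Df (\<lambda>e. lm (t e) (u e))" if "Dt t" "Dt u" for t u
    by (rule Df2[OF _ that]) (unfold lm_def, intro Dfi D1)
  have D3: "Dt (\<lambda>e. av (t e) (u e))" if "Dt t" "Dt u" for t u
    by (rule Dt2[OF _ that]) (unfold av_def, intro Dfi Dt1[OF AD])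
  have D4: "Df (\<lambda>e. new (t e) (u e))" if "Dt t" "Dt u" for t u
    by (rule Df2[OF _ that]) (unfold new_def, intro Dfi D2 D3)
  have nxD: "Dt (\<lambda>e. nx (e 0))" unfolding nx_def by (intro Dfi D4)
  have lm_uniq: "i = k" if "lm x i" "lm x k" for x i k
    using that lin[of i k] unfolding lm_def miss_def by blast
  have new_uniq: "y = z" if "new x y" "new x z" for x y z
    using that lm_uniq unfolding new_def by metis
  have nx: "z \<epsilon> nx x \<longleftrightarrow> z \<epsilon> x \<or> new x z" for z x
  proof (cases "\<exists>y. new x y")
    case True
    then obtain y where "new x y" by blast
    then have "new x z \<longleftrightarrow> z = y" for z using new_uniq by metis
    then show ?thesis unfolding nx_def by (intro mem_the_set[of "un x (sg y)"]) simp
  next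
    case False
    then show ?thesis unfolding nx_def by (intro mem_the_set[of x]) simp
  qed
  have av: "v \<epsilon> av x i \<longleftrightarrow> v \<epsilon> Am i \<and> (\<forall>k. \<not> op k v \<epsilon> x)" for v x i
    unfolding av_def by (rule the_set_iff[OF sep]) (intro Dfi)
  have newE: "\<exists>i v. z = op i v \<and> lm x i \<and> i \<epsilon> I \<and> v \<epsilon> Am i \<and> (\<forall>k. \<not> op k v \<epsilon> x)" if "new x z" for x z
  proof -
    from that obtain i where i: "lm x i" "\<exists>w. w \<epsilon> av x i" "z = op i (ap c (av x i))"
      unfolding new_def by blast
    then have iI: "i \<epsilon> I" unfolding lm_def miss_def by blast
    have "av x i \<sqsubseteq> V" using V[OF iI] av by simp
    then have "ap c (av x i) \<epsilon> av x i" using i(2) c by simp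
    with i iI show ?thesis unfolding av by blast
  qed
  have "y = x \<or> y = nx x" if "x \<sqsubseteq> y" "y \<sqsubseteq> nx x" for x y
  proof (cases "nx x \<sqsubseteq> y")
    case True
    then show ?thesis using that(2) by (intro disjI2 sub_antisym)
  next
    case False
    then have "y \<sqsubseteq> x" using that nx new_uniq by metis
    then show ?thesis using that(1) by (intro disjI1 sub_antisym)
  qed
  moreover have "nx x \<sqsubseteq> Om" if "x \<sqsubseteq> Om" for x
  proof (intro HOL.allI HOL.impI)
    fix z assume "z \<epsilon> nx x"
    then consider "z \<epsilon> x" | "new x z" unfolding nx by blast
    then show "z \<epsilon> Om"
    proof cases
      case 2
      from newE[OF this] V show ?thesis unfolding Om_def by auto
    qed (use that in blast)
  qed
  ultimately have tw: "tower Om nx" unfolding tower_def using nxD by (simp add: nx)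
  let ?Tw = "Tw Om nx"
  define T where "T = uni ?Tw"
  have T: "T \<epsilon> ?Tw" "nx T = T" unfolding T_def using Tw_top[OF tw] by blast+
  define inv where "inv x \<longleftrightarrow> (\<forall>i v w. op i v \<epsilon> x \<longrightarrow> op i w \<epsilon> x \<longrightarrow> v = w) \<and>
    (\<forall>i k v. op i v \<epsilon> x \<longrightarrow> op k v \<epsilon> x \<longrightarrow> i = k) \<and> (\<forall>i v. op i v \<epsilon> x \<longrightarrow> v \<epsilon> Am i) \<and>
    (\<forall>i v k. op i v \<epsilon> x \<longrightarrow> k \<epsilon> I \<longrightarrow> op k i \<epsilon> W \<longrightarrow> (\<exists>w. op k w \<epsilon> x))" for x
  have common: "\<exists>z. z \<epsilon> S \<and> x \<sqsubseteq> z \<and> y \<sqsubseteq> z" if "S \<sqsubseteq> ?Tw" "x \<epsilon> S" "y \<epsilon> S" for S x y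
  proof -
    have "x \<epsilon> ?Tw" "y \<epsilon> ?Tw" using that by blast+
    from Tw_cmp[OF tw this] have "x \<sqsubseteq> y \<or> y \<sqsubseteq> x" unfolding nx by blast
    then show ?thesis using that by blast
  qed
  have "inv T"
  proof (rule Tw_induct[OF tw, of inv, OF _ _ _ T(1)])
    show "Df (\<lambda>e. inv (e 0))" unfolding inv_def by (intro Dfi Dt1[OF AD])
  next
    fix S assume S: "S \<sqsubseteq> ?Tw" and IH: "\<And>x. x \<epsilon> S \<Longrightarrow> inv x"
    have two: "\<exists>x. x \<epsilon> S \<and> p \<epsilon> x \<and> q \<epsilon> x" if p: "p \<epsilon> uni S" and q: "q \<epsilon> uni S" for p q
    proof -
      from p obtain x where x: "x \<epsilon> S" "p \<epsilon> x" by auto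
      from q obtain y where y: "y \<epsilon> S" "q \<epsilon> y" by auto
      from common[OF S x(1) y(1)] x y show ?thesis by blast
    qed
    show "inv (uni S)" unfolding inv_def
    proof (intro conjI HOL.allI HOL.impI)
      fix i v w assume "op i v \<epsilon> uni S" "op i w \<epsilon> uni S"
      from two[OF this] IH show "v = w" unfolding inv_def by blast
    next
      fix i k v assume "op i v \<epsilon> uni S" "op k v \<epsilon> uni S"
      from two[OF this] IH show "i = k" unfolding inv_def by blast
    next
      fix i v assume "op i v \<epsilon> uni S"
      from two[OF this this] IH show "v \<epsilon> Am i" unfolding inv_def by blast
    next
      fix i v k assume "op i v \<epsilon> uni S" and k: "k \<epsilon> I" "op k i \<epsilon> W"
      from two[OF this(1,1)] obtain x where x: "x \<epsilon> S" "op i v \<epsilon> x" by blast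
      from IH[OF x(1)] x(2) k obtain w where "op k w \<epsilon> x" unfolding inv_def by blast
      with x(1) show "\<exists>w. op k w \<epsilon> uni S" by auto
    qed
  next
    fix x assume "x \<epsilon> ?Tw" and x: "inv x"
    show "inv (nx x)"
    proof (cases "\<exists>z. new x z")
      case False
      then have "nx x = x" using nx by (intro ext) blast
      with x show ?thesis by simp
    next
      case True
      then obtain z where z: "new x z" by blast
      from newE[OF z] obtain i0 v0 where n: "z = op i0 v0" "lm x i0" "v0 \<epsilon> Am i0" "\<forall>k. \<not> op k v0 \<epsilon> x"
        by blast
      have n1: "\<not> op i0 v \<epsilon> x" for v using n(2) unfolding lm_def miss_def by blast
      have n2: "\<exists>w. op k w \<epsilon> x" if "k \<epsilon> I" "op k i0 \<epsilon> W" for k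
        using n(2) that unfolding lm_def miss_def by blast
      have m: "op i v \<epsilon> nx x \<longleftrightarrow> op i v \<epsilon> x \<or> i = i0 \<and> v = v0" for i v
        unfolding nx using new_uniq[OF _ z] z n(1) op_eq by metis
      note x' = x[unfolded inv_def]
      note i1 = x'[THEN conjunct1, rule_format]
        and i2 = x'[THEN conjunct2, THEN conjunct1, rule_format]
        and i3 = x'[THEN conjunct2, THEN conjunct2, THEN conjunct1, rule_format]
        and i4 = x'[THEN conjunct2, THEN conjunct2, THEN conjunct2, rule_format]
      show ?thesis unfolding inv_def m
      proof (intro conjI HOL.allI HOL.impI)
        fix i v w assume "op i v \<epsilon> x \<or> i = i0 \<and> v = v0" "op i w \<epsilon> x \<or> i = i0 \<and> w = v0"
        then show "v = w" using n1 i1 by blast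
      next
        fix i k v assume "op i v \<epsilon> x \<or> i = i0 \<and> v = v0" "op k v \<epsilon> x \<or> k = i0 \<and> v = v0"
        then show "i = k" using n(4) i2 by blast
      next
        fix i v assume "op i v \<epsilon> x \<or> i = i0 \<and> v = v0"
        then show "v \<epsilon> Am i" using n(3) i3 by blast
      next
        fix i v k assume "op i v \<epsilon> x \<or> i = i0 \<and> v = v0" "k \<epsilon> I" "op k i \<epsilon> W"
        then show "\<exists>w. op k w \<epsilon> x \<or> k = i0 \<and> w = v0" using n2 i4 by blast
      qed
    qed
  qed
  note T' = this[unfolded inv_def]
  note i1 = T'[THEN conjunct1, rule_format]
    and i2 = T'[THEN conjunct2, THEN conjunct1, rule_format]
    and i3 = T'[THEN conjunct2, THEN conjunct2, THEN conjunct1, rule_format]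
    and i4 = T'[THEN conjunct2, THEN conjunct2, THEN conjunct2, rule_format]
  have TI: "i \<epsilon> I" if "op i v \<epsilon> T" for i v
    using Tw_sub[OF tw T(1)] that unfolding Om_def by auto
  \<comment> \<open>At the least unserved \<open>i\<close> all of \<open>Am i\<close> is used up, by
    indices before \<open>i\<close>. Sending \<open>j\<close> to the user of \<open>ap g j\<close>
    injects \<open>I\<close> into the predecessors of \<open>i\<close>, against the choice of
    \<open>W\<close>.\<close>
  have nomiss: "\<not> miss T i" for i
  proof
    assume i: "miss T i"
    obtain u where u: "\<And>i. i \<epsilon> u \<longleftrightarrow> i \<epsilon> I \<and> miss T i"
      by (rule separate[of "miss T" I]) (intro Dfi D1, rule that)
    have "u \<sqsubseteq> I" "i \<epsilon> u" using u i unfolding miss_def by simp_all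
    from least[OF this] obtain i where i: "miss T i" "\<forall>k. k \<epsilon> u \<longrightarrow> \<not> op k i \<epsilon> W" unfolding u by blast
    have iI: "i \<epsilon> I" using i(1) unfolding miss_def by blast
    have lm: "lm T i" unfolding lm_def using i u unfolding miss_def by simp
    have "\<not> w \<epsilon> av T i" for w
    proof
      assume "w \<epsilon> av T i"
      then have "new T (op i (ap c (av T i)))" unfolding new_def using lm by blast
      then have "op i (ap c (av T i)) \<epsilon> nx T" unfolding nx by blast
      with T(2) i(1) show False unfolding miss_def by simp
    qed
    then have all: "\<exists>k. op k v \<epsilon> T" if "v \<epsilon> Am i" for v using that unfolding av by blast
    from inj[OF iI] obtain g where g: "injf g I (Am i)" by blast
    define f where "f j = the_set (\<lambda>z. \<exists>k. op k (ap g j) \<epsilon> T \<and> z \<epsilon> k)" for j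
    have f: "op (f j) (ap g j) \<epsilon> T" if j: "j \<epsilon> I" for j
    proof -
      from all[OF injf_ap[OF g j]] obtain k where k: "op k (ap g j) \<epsilon> T" by blast
      have "f j = k" unfolding f_def
        by (rule the_set_eqI) (use k i2[OF k] in blast)
      with k show ?thesis by simp
    qed
    obtain b where b: "\<And>k. k \<epsilon> b \<longleftrightarrow> k \<epsilon> I \<and> op k i \<epsilon> W"
      by (rule separate[of "\<lambda>k. op k i \<epsilon> W" I]) (intro Dfi, rule that)
    have "injf (lam I f) I b"
    proof (rule injfI)
      show "Dt (\<lambda>e. f (e 0))" unfolding f_def by (intro Dfi)
      show "f j \<epsilon> b" if "j \<epsilon> I" for j
      proof -
        from f[OF that] have fj: "op (f j) (ap g j) \<epsilon> T" .
        then have "f j \<epsilon> I" "f j \<noteq> i" using TI i(1) unfolding miss_def by blast+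
        moreover have "\<not> op i (f j) \<epsilon> W" using i4[OF fj iI] i(1) unfolding miss_def by blast
        ultimately show ?thesis using lin[OF iI] unfolding b by metis
      qed
      show "j = j'" if "j \<epsilon> I" "j' \<epsilon> I" "f j = f j'" for j j'
      proof -
        have "ap g j = ap g j'" using i1[OF f[OF that(1)]] f[OF that(2)] that(3) by simp
        then show ?thesis by (rule injf_eq[OF g that(1,2)])
      qed
    qed
    with card[OF iI, of b] b show False by blast
  qed
  show thesis
  proof (rule that[of T])
    show "\<exists>v. op i v \<epsilon> T" if "i \<epsilon> I" for i using nomiss[of i] that unfolding miss_def by blast
    show "i \<epsilon> I \<and> v \<epsilon> Am i" if "op i v \<epsilon> T" for i v using TI[OF that] i3[OF that] ..
    show "i = k" if "op i v \<epsilon> T" "op k v \<epsilon> T" for i k v using i2[OF that] .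
    show "v = w" if "op i v \<epsilon> T" "op i w \<epsilon> T" for i v w using i1[OF that] .
  qed
qed

text \<open>An \<omega>-Jonsson function in the sense of Erdos and Hajnal: on the \<omega>-sequences
  from any subset as large as \<open>B\<close> it already takes every value in
  \<open>B\<close>.\<close>

definition "Jon B F \<longleftrightarrow> (\<forall>t. Fun t om B \<longrightarrow> (\<exists>b. b \<epsilon> B \<and> op t b \<epsilon> F)) \<and>
  (\<forall>t b b'. op t b \<epsilon> F \<longrightarrow> op t b' \<epsilon> F \<longrightarrow> b = b') \<and>
  (\<forall>A i b. A \<sqsubseteq> B \<longrightarrow> injf i B A \<longrightarrow> b \<epsilon> B \<longrightarrow> (\<exists>t. Fun t om A \<and> op t b \<epsilon> F))"

lemma Df_Jon [Dfi]: "Dt t \<Longrightarrow> Dt u \<Longrightarrow> Df (\<lambda>e. Jon (t e) (u e))"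
  by (rule Df2) (unfold Jon_def, intro Dfi)

lemma Fun_sub: "Fun f a b \<Longrightarrow> b \<sqsubseteq> c \<Longrightarrow> Fun f a c"
  unfolding Fun_iff by blast

lemma Fun_prd: "Fun f a b \<Longrightarrow> f \<sqsubseteq> prd a b"
  unfolding Fun_iff FunOn_iff mem_prd by metis

text \<open>It suffices to give the pairs \<open>(A, b)\<close> distinct \<omega>-sequences from
  \<open>A\<close> and to let \<open>F\<close> send each of these to its \<open>b\<close>. There are
  enough sequences, since \<open>Bof s\<close> is an increasing union of \<omega> many of its
  elements: a pair is coded by its slices, all in \<open>Bof s\<close>, and the injection
  \<open>i\<close> moves the code into \<open>A\<close>.\<close>

lemma Jon_exists:
  assumes s: "transset s"
  shows "\<exists>F. F \<sqsubseteq> prd (Pw (prd om (Bof s))) (Bof s) \<and> Jon (Bof s) F"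
proof -
  let ?B = "Bof s"
  note cl = super_closed[OF super_Bof[OF s]]
  obtain I where I: "\<And>z. z \<epsilon> I \<longleftrightarrow> z \<epsilon> prd (Pw ?B) ?B \<and> (\<exists>A b i. z = op A b \<and> injf i ?B A)"
    by (rule separate[of "\<lambda>z. \<exists>A b i. z = op A b \<and> injf i ?B A" "prd (Pw ?B) ?B"]) (intro Dfi, rule that)
  have opI: "op A b \<epsilon> I \<longleftrightarrow> A \<sqsubseteq> ?B \<and> b \<epsilon> ?B \<and> (\<exists>i. injf i ?B A)" for A b unfolding I by auto
  define Am where "Am z = the_set (\<lambda>t. t \<epsilon> Pw (prd om ?B) \<and> (\<exists>A b. z = op A b \<and> Fun t om A))" for z
  have Am: "t \<epsilon> Am (op A b) \<longleftrightarrow> Fun t om A" if A: "A \<sqsubseteq> ?B" for t A b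
  proof -
    have "t \<epsilon> Am (op A b) \<longleftrightarrow> t \<epsilon> Pw (prd om ?B) \<and> (\<exists>A' b'. op A b = op A' b' \<and> Fun t om A')"
      unfolding Am_def by (rule the_set_iff[OF sep]) (intro Dfi)
    moreover have "t \<epsilon> Pw (prd om ?B)" if "Fun t om A"
      using Fun_prd[OF Fun_sub[OF that A]] by simp
    ultimately show ?thesis by auto
  qed
  \<comment> \<open>Slice number \<open>n\<close> of \<open>(A, b)\<close>: the part of
    \<open>A\<close> in the \<open>n\<close>-th iterate, paired with \<open>b\<close>. For
    \<open>A\<close> inside \<open>Bof s\<close> the slices together determine the pair.\<close>
  define sl where "sl z n = the_set (\<lambda>y. \<exists>A b. z = op A b \<and> (\<exists>w. (\<forall>x. x \<epsilon> w \<longleftrightarrow> x \<epsilon> A \<and> x \<epsilon> it Pw s n) \<and> y \<epsilon> op w b))" for z n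
  have D1: "Dt (\<lambda>e. sl (t e) (u e))" if "Dt t" "Dt u" for t u
    by (rule Dt2[OF _ that]) (unfold sl_def, intro Dfi Dt_it[OF Dt_Pw_var])
  have sl: "\<exists>w. sl (op A b) n = op w b \<and> (\<forall>x. x \<epsilon> w \<longleftrightarrow> x \<epsilon> A \<and> x \<epsilon> it Pw s n)" for A b n
  proof -
    obtain w where w: "\<And>x. x \<epsilon> w \<longleftrightarrow> x \<epsilon> A \<and> x \<epsilon> it Pw s n"
      by (rule separate[of "\<lambda>x. x \<epsilon> it Pw s n" A]) (intro Dfi Dt_it[OF Dt_Pw_var], rule that)
    have u: "w' = w" if "\<forall>x. x \<epsilon> w' \<longleftrightarrow> x \<epsilon> A \<and> x \<epsilon> it Pw s n" for w'
      by (rule ext) (simp add: w that)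
    have "sl (op A b) n = op w b" unfolding sl_def
    proof (rule the_set_eqI, rule iffI)
      fix y
      show "\<exists>A' b'. op A b = op A' b' \<and> (\<exists>w'. (\<forall>x. x \<epsilon> w' \<longleftrightarrow> x \<epsilon> A' \<and> x \<epsilon> it Pw s n) \<and> y \<epsilon> op w' b')"
        if "y \<epsilon> op w b" by (rule exI[of _ A], rule exI[of _ b]) (use w that in blast)
      assume "\<exists>A' b'. op A b = op A' b' \<and> (\<exists>w'. (\<forall>x. x \<epsilon> w' \<longleftrightarrow> x \<epsilon> A' \<and> x \<epsilon> it Pw s n) \<and> y \<epsilon> op w' b')"
      then obtain w' where "\<forall>x. x \<epsilon> w' \<longleftrightarrow> x \<epsilon> A \<and> x \<epsilon> it Pw s n" "y \<epsilon> op w' b" unfolding op_eq by blast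
      with u show "y \<epsilon> op w b" by simp
    qed
    with w show ?thesis by blast
  qed
  have slB: "sl (op A b) n \<epsilon> ?B" if "n \<epsilon> om" "b \<epsilon> ?B" for A b n
  proof -
    obtain w where w: "sl (op A b) n = op w b" "\<forall>x. x \<epsilon> w \<longleftrightarrow> x \<epsilon> A \<and> x \<epsilon> it Pw s n" using sl by blast
    have "w \<epsilon> ?B" by (rule Bof_I[OF s that(1)]) (simp add: w)
    then show ?thesis unfolding w(1) using closed_op[OF cl] that(2) by blast
  qed
  have D2: "Dt (\<lambda>e. Am (e 0))" unfolding Am_def by (intro Dfi)
  have "\<exists>g. injf g I (Am z)" if z: "z \<epsilon> I" for z
  proof -
    from z obtain A b i where zA: "z = op A b" and i: "injf i ?B A" unfolding I by blast
    from z have A: "A \<sqsubseteq> ?B" unfolding zA opI by blast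
    define G where "G z = lam om (\<lambda>n. ap i (sl z n))" for z
    have DG: "Dt (\<lambda>e. ap i (sl z (e 0)))" for z by (intro Dfi D1)
    have slI: "sl y n \<epsilon> ?B" if "y \<epsilon> I" "n \<epsilon> om" for y n
      using that(1) slB[OF that(2)] unfolding I by auto
    have "injf (lam I G) I (Am z)"
    proof (rule injfI)
      show "Dt (\<lambda>e. G (e 0))" unfolding G_def lam_def by (intro Dfi D1)
      show "G y \<epsilon> Am z" if y: "y \<epsilon> I" for y unfolding zA Am[OF A] G_def
        by (rule Fun_lam[OF DG], rule injf_ap[OF i], rule slI[OF y])
      show "y = y'" if y: "y \<epsilon> I" "y' \<epsilon> I" "G y = G y'" for y y'
      proof -
        have eq: "sl y n = sl y' n" if n: "n \<epsilon> om" for n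
          using injf_eq[OF i slI[OF y(1) n] slI[OF y(2) n]] ap_lam[OF DG n] y(3)
          unfolding G_def by metis
        from y obtain A1 b1 A2 b2 where yy: "y = op A1 b1" "y' = op A2 b2" unfolding I by blast
        have sub: "A1 \<sqsubseteq> ?B" "A2 \<sqsubseteq> ?B" using y unfolding yy opI by blast+
        have eq2: "b1 = b2 \<and> (\<forall>x. x \<epsilon> it Pw s n \<longrightarrow> (x \<epsilon> A1 \<longleftrightarrow> x \<epsilon> A2))" if n: "n \<epsilon> om" for n
        proof -
          obtain w where w: "sl y n = op w b1" "\<forall>x. x \<epsilon> w \<longleftrightarrow> x \<epsilon> A1 \<and> x \<epsilon> it Pw s n"
            using sl unfolding yy by blast
          obtain w' where w': "sl y' n = op w' b2" "\<forall>x. x \<epsilon> w' \<longleftrightarrow> x \<epsilon> A2 \<and> x \<epsilon> it Pw s n"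
            using sl unfolding yy by blast
          have "w = w'" "b1 = b2" using eq[OF n] unfolding w(1) w'(1) by simp_all
          with w(2) w'(2) show ?thesis by blast
        qed
        have "x \<epsilon> A1 \<longleftrightarrow> x \<epsilon> A2" for x
        proof (cases "x \<epsilon> ?B")
          case True
          then obtain n where "n \<epsilon> om" "x \<epsilon> it Pw s n" unfolding mem_Bof by blast
          with eq2 show ?thesis by blast
        qed (use sub in blast)
        then have "A1 = A2" by (rule ext)
        with eq2[OF om_emp] yy show ?thesis by simp
      qed
    qed
    then show ?thesis by blast
  qed
  then obtain T where
    T1: "\<And>i. i \<epsilon> I \<Longrightarrow> \<exists>v. op i v \<epsilon> T" and T2: "\<And>i v. op i v \<epsilon> T \<Longrightarrow> i \<epsilon> I \<and> v \<epsilon> Am i"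
    and T3: "\<And>i k v. op i v \<epsilon> T \<Longrightarrow> op k v \<epsilon> T \<Longrightarrow> i = k"
    and "\<And>i v w. op i v \<epsilon> T \<Longrightarrow> op i w \<epsilon> T \<Longrightarrow> v = w"
    by (rule distinct_representatives[of Am I, OF D2]) (assumption, rule that)
  \<comment> \<open>Sequences that represent no pair receive the default value \<open>emp\<close>,
    which makes \<open>F\<close> total.\<close>
  let ?Q = "\<lambda>t b. (\<exists>A. op (op A b) t \<epsilon> T) \<or> (\<forall>A b'. \<not> op (op A b') t \<epsilon> T) \<and> b = emp"
  obtain F where F: "\<And>z. z \<epsilon> F \<longleftrightarrow> z \<epsilon> prd (Pw (prd om ?B)) ?B \<and> (\<exists>t b. z = op t b \<and> ?Q t b)"
    by (rule separate[of "\<lambda>z. \<exists>t b. z = op t b \<and> ?Q t b" "prd (Pw (prd om ?B)) ?B"]) (intro Dfi, rule that)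
  have opF: "op t b \<epsilon> F \<longleftrightarrow> t \<sqsubseteq> prd om ?B \<and> b \<epsilon> ?B \<and> ?Q t b" for t b unfolding F by auto
  have "Jon ?B F" unfolding Jon_def
  proof (intro conjI HOL.allI HOL.impI)
    fix t assume "Fun t om ?B"
    note t = Fun_prd[OF this]
    show "\<exists>b. b \<epsilon> ?B \<and> op t b \<epsilon> F"
    proof (cases "\<exists>A b. op (op A b) t \<epsilon> T")
      case True
      then obtain A b where Ab: "op (op A b) t \<epsilon> T" by blast
      with T2[OF Ab] t show ?thesis unfolding opF opI by blast
    next
      case False
      then show ?thesis unfolding opF using t closed_emp[OF cl] by blast
    qed
  next
    fix t b b' assume "op t b \<epsilon> F" "op t b' \<epsilon> F"
    then show "b = b'" unfolding opF using T3 op_eq by metis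
  next
    fix A i b assume A: "A \<sqsubseteq> ?B" "injf i ?B A" "b \<epsilon> ?B"
    then have "op A b \<epsilon> I" unfolding opI by blast
    from T1[OF this] obtain t where t: "op (op A b) t \<epsilon> T" by blast
    with T2[OF t] have f: "Fun t om A" unfolding Am[OF A(1)] by blast
    from Fun_prd[OF Fun_sub[OF f A(1)]] A(3) t have "op t b \<epsilon> F" unfolding opF by blast
    with f show "\<exists>t. Fun t om A \<and> op t b \<epsilon> F" by blast
  qed
  with F show ?thesis by blast
qed

end

section \<open>Strongly extendible levels from Vopenka's principle\<close>

locale zv = zfc + vp
begin

text \<open>The symbols will be all elements of \<open>om\<close>: the number \<open>N k\<close>
  names the \<open>k\<close>-th relation of the list, every other element of \<open>om\<close> the
  empty relation. Arities are padded to three so that one tuple length serves the whole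
  language.\<close>

primrec rel_of :: "('a \<Rightarrow> 'a \<Rightarrow> 'a \<Rightarrow> 'a \<Rightarrow> bool) list \<Rightarrow> nat \<Rightarrow> 'a \<Rightarrow> 'a \<Rightarrow> 'a \<Rightarrow> bool" where
  "rel_of [] i c t u \<longleftrightarrow> False"
| "rel_of (r # rs) i c t u \<longleftrightarrow>
    t = N i \<and> r c (ap u (N 0)) (ap u (N 1)) (ap u (N 2)) \<or> rel_of rs (Suc i) c t u"

lemma rel_of_nth:
  "rel_of rs i c (N (i + k)) u \<longleftrightarrow> k < length rs \<and> (rs ! k) c (ap u (N 0)) (ap u (N 1)) (ap u (N 2))"
proof (induction rs arbitrary: i k)
  case (Cons r rs)
  show ?case
  proof (cases k)
    case 0
    have "\<not> rel_of rs (i + Suc m) c (N i) u" for m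
    proof (induction rs arbitrary: m)
      case (Cons r rs)
      then show ?case using Cons[of "Suc m"] by (simp del: N.simps)
    qed simp
    from this[of 0] 0 show ?thesis by (simp del: N.simps)
  next
    case (Suc l)
    then show ?thesis using Cons[of "Suc i" l] by (simp del: N.simps)
  qed
qed simp

lemma Df_rel_of:
  assumes "\<forall>r\<in>set rs. Df (\<lambda>e. r (e 0) (e 1) (e 2) (e 3))"
  shows "Df (\<lambda>e. rel_of rs i (e 0) (e 1) (e 2))"
  using assms
proof (induction rs arbitrary: i)
  case Nil
  show ?case by (simp only: rel_of.simps) (intro Dfi)
next
  case (Cons r rs)
  have r: "Df (\<lambda>e. r (e 0) (e 1) (e 2) (e 3))" using Cons.prems by simp
  have "Df (\<lambda>e. rel_of rs (Suc i) (e 0) (e 1) (e 2))" using Cons by simp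
  then show ?case by (simp only: rel_of.simps) (intro Dfi Df4[OF r])
qed

definition "triple x y z = un (up (op (N 0) x) (op (N 1) y)) (sg (op (N 2) z))"

lemma triple:
  assumes "x \<epsilon> A" "y \<epsilon> A" "z \<epsilon> A"
  shows "Fun (triple x y z) (N 3) A" "ap (triple x y z) (N 0) = x" "ap (triple x y z) (N 1) = y"
    "ap (triple x y z) (N 2) = z"
proof -
  have op: "op i w \<epsilon> triple x y z \<longleftrightarrow> i = N 0 \<and> w = x \<or> i = N 1 \<and> w = y \<or> i = N 2 \<and> w = z" for i w
    unfolding triple_def by (auto simp del: N.simps)
  have *: "i \<epsilon> N 3 \<longleftrightarrow> i = N 0 \<or> i = N 1 \<or> i = N 2" for i
    unfolding mem_N by (auto simp: numeral_3_eq_3 numeral_2_eq_2 less_Suc_eq simp del: N.simps)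
  have F: "FunOn (triple x y z) (N 3)" unfolding FunOn_iff *
    by (auto simp: op triple_def simp del: N.simps)
  show "ap (triple x y z) (N 0) = x" "ap (triple x y z) (N 1) = y" "ap (triple x y z) (N 2) = z"
    by (rule ap_eq[OF F], simp add: op * del: N.simps)+
  show "Fun (triple x y z) (N 3) A" unfolding Fun_iff using F assms by (auto simp: op simp del: N.simps)
qed

text \<open>Since \<open>c\<close> is an element of the universe \<open>t c\<close>, it is recovered
  from the structure by unions; hence the structures form a proper class as soon as the
  \<open>c\<close> do. Distinct structures come from distinct \<open>c\<close>, as \<open>c\<close>
  determines universe and interpretation.\<close>

lemma vopenka_list:
  assumes rs: "\<forall>r\<in>set rs. Df (\<lambda>e. r (e 0) (e 1) (e 2) (e 3))"
    and C: "Df (\<lambda>e. C (e 0))" and t: "Dt (\<lambda>e. t (e 0))"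
    and sup: "\<And>c. C c \<Longrightarrow> super (t c) \<and> c \<epsilon> t c" and pr: "\<not> isset C"
  obtains c c' j where "C c" "C c'" "c \<noteq> c'" "Fun j (t c) (t c')"
    "\<And>r x y z. r \<in> set rs \<Longrightarrow> x \<epsilon> t c \<Longrightarrow> y \<epsilon> t c \<Longrightarrow> z \<epsilon> t c \<Longrightarrow>
      r c x y z \<longleftrightarrow> r c' (ap j x) (ap j y) (ap j z)"
proof -
  let ?U = "\<lambda>c A. A = t c" and ?Q = "rel_of rs 0" and ?k = "N 3"
  let ?SI = "SI C ?U ?Q om ?k"
  have dU: "Df (\<lambda>e. e 1 = t (e 0))" by (intro Dfi Dt1[OF t])
  have ne: "A \<noteq> emp" if "C c" "A = t c" for c A using sup[OF that(1)] that(2) by auto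
  have sat: "\<exists>S. SatRel om emp (prd om (sg ?k)) A I n S" if n: "n = ?k" and s: "?SI c A I" for c A I n
  proof -
    obtain H where H: "un (sg A) (sg om) \<epsilon> H" "super H" using super_ex by blast
    note cl = super_closed[OF H(2)]
    have AH: "A \<epsilon> H" "om \<epsilon> H" using closed_trans[OF cl _ H(1)] by simp_all
    obtain Q where Q: "s \<epsilon> Q \<longleftrightarrow> s \<epsilon> Pw (prd ?k A) \<and> Fun s ?k A" for s
      by (rule separate[of "\<lambda>s. Fun s ?k A" "Pw (prd ?k A)"]) (intro Dfi, rule that)
    have Q': "s \<epsilon> Q \<longleftrightarrow> Fun s ?k A" for s unfolding Q using Fun_prd by auto
    interpret satx E d H Q om emp "prd om (sg ?k)" A I n
    proof unfold_locales
      show "closed H" by fact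
      show "r \<epsilon> H" if "r \<epsilon> om" for r by (rule closed_om[OF cl that])
      show "s \<epsilon> Q \<longleftrightarrow> Fun s n A" for s unfolding n by (rule Q')
      show "Y \<epsilon> H" if "\<And>s. s \<epsilon> Y \<Longrightarrow> s \<epsilon> Q" for Y
      proof -
        have "Pw (prd ?k A) \<epsilon> H"
          by (intro super_Pw super_prd H AH closed_N[OF cl])
        moreover have "Y \<sqsubseteq> Pw (prd ?k A)" using that Q by blast
        ultimately show ?thesis by (rule super_sub[OF H(2)])
      qed
      show "Fun w k' A" if "r \<epsilon> om" "op r e \<epsilon> I" "op r k' \<epsilon> prd om (sg ?k)" "w \<epsilon> e" for r e k' w
        using that s unfolding SI_def by (auto simp del: N.simps)
    qed (auto simp: n simp del: N.simps)
    show ?thesis by (rule sat_rel_exists)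
  qed
  have ex: "\<exists>I. ?SI c (t c) I" if "C c" for c
  proof -
    define G where "G r = the_set (\<lambda>u. u \<epsilon> Pw (prd ?k (t c)) \<and> Fun u ?k (t c) \<and> ?Q c r u)" for r
    have D: "Df (\<lambda>e. ?Q c (v e) (w e))" if "Dt v" "Dt w" for v w
      by (intro Dfi Df3[OF Df_rel_of[OF rs]] that)
    have G: "u \<epsilon> G r \<longleftrightarrow> Fun u ?k (t c) \<and> ?Q c r u" for u r
    proof -
      have "u \<epsilon> G r \<longleftrightarrow> u \<epsilon> Pw (prd ?k (t c)) \<and> Fun u ?k (t c) \<and> ?Q c r u"
        unfolding G_def by (rule the_set_iff[OF sep]) (intro Dfi D)
      then show ?thesis using Fun_prd by auto
    qed
    have DG: "Dt (\<lambda>e. G (e 0))" unfolding G_def by (intro Dfi D)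
    have "?SI c (t c) (lam om G)" unfolding SI_def
      using that FunOn_lam[OF DG] by (simp add: op_lam[OF DG] G del: N.simps)
    then show ?thesis by blast
  qed
  have pr': "\<not> isset (\<lambda>x. \<exists>c A I. x = op A I \<and> ?SI c A I)"
  proof
    assume "isset (\<lambda>x. \<exists>c A I. x = op A I \<and> ?SI c A I)"
    then obtain S where S: "x \<epsilon> S \<longleftrightarrow> (\<exists>c A I. x = op A I \<and> ?SI c A I)" for x
      unfolding isset_def by blast
    have "c \<epsilon> uni (uni (uni S))" if c: "C c" for c
    proof -
      from ex[OF c] S obtain I where "op (t c) I \<epsilon> S" by blast
      moreover have "c \<epsilon> t c" using sup[OF c] ..
      ultimately show ?thesis using op_parts[of "t c" I] unfolding mem_basic(3) by blast
    qed
    then have "C = (\<lambda>x. x \<epsilon> uni (uni (uni S)) \<and> C x)" by blast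
    with sep[OF C, of "uni (uni (uni S))"] pr show False by simp
  qed
  show thesis
  proof (rule vopenka_relations[OF C dU Df_rel_of[OF rs] N_om _ _ pr'])
    show "A \<noteq> emp" if "C c" "A = t c" for c A using that by (rule ne)
    show "\<exists>S. SatRel om emp (prd om (sg ?k)) A I ?k S" if "?SI c A I" for c A I
      using that by (rule sat[OF refl])
    fix c A I c' A' I' j
    assume s: "?SI c A I" "?SI c' A' I'" and ne: "op A I \<noteq> op A' I'" and j: "Fun j A A'"
      and Q: "\<And>s u u'. s \<epsilon> om \<Longrightarrow> Fun u ?k A \<Longrightarrow> Fun u' ?k A' \<Longrightarrow>
        (\<And>i. i \<epsilon> ?k \<Longrightarrow> ap u' i = ap j (ap u i)) \<Longrightarrow> ?Q c s u \<longleftrightarrow> ?Q c' s u'"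
    have A: "A = t c" "A' = t c'" "C c" "C c'" using s unfolding SI_def by blast+
    have cc: "c \<noteq> c'"
    proof
      assume c: "c = c'"
      have "I = I'"
      proof (rule FunOn_ext)
        show I: "FunOn I om" "FunOn I' om" using s unfolding SI_def by blast+
        show "ap I t = ap I' t" if "t \<epsilon> om" for t
          using s ap_mem[OF I(1) that] ap_mem[OF I(2) that] c A unfolding SI_def
          by (intro ext) blast
      qed
      with ne A c show False by simp
    qed
    have r: "r c x y z \<longleftrightarrow> r c' (ap j x) (ap j y) (ap j z)"
      if "r \<in> set rs" and xyz: "x \<epsilon> t c" "y \<epsilon> t c" "z \<epsilon> t c" for r x y z
    proof -
      from that(1) obtain i where i: "i < length rs" "r = rs ! i" by (auto simp: in_set_conv_nth)
      have xyz': "ap j x \<epsilon> t c'" "ap j y \<epsilon> t c'" "ap j z \<epsilon> t c'"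
        using Fun_ap[OF j] xyz unfolding A by blast+
      note tr = triple[OF xyz] and tr' = triple[OF xyz']
      have "ap (triple (ap j x) (ap j y) (ap j z)) n = ap j (ap (triple x y z) n)" if n: "n \<epsilon> ?k" for n
      proof -
        from n have "n = N 0 \<or> n = N 1 \<or> n = N 2" unfolding mem_N
          by (auto simp: numeral_3_eq_3 numeral_2_eq_2 less_Suc_eq simp del: N.simps)
        then show ?thesis using tr(2-) tr'(2-) by metis
      qed
      from Q[OF N_om tr(1)[folded A(1)] tr'(1)[folded A(2)] this, of "0 + i"] show ?thesis
        unfolding rel_of_nth tr tr' using i by simp
    qed
    show thesis by (rule that[of c c' j, OF A(3,4) cc j[unfolded A(1,2)]]) (rule r)
  qed
qed

section \<open>Second-order models, their elementary extensions and least obstructions\<close>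

definition "SatC M q \<longleftrightarrow> (\<exists>n p s. q = op n (op p s) \<and> MemSats M n p s)"
text \<open>For closed \<open>M\<close> the triples of a number, a formula code and an assignment
  into \<open>M\<close> are elements of \<open>M\<close>, so agreement of \<open>SatC\<close> on
  \<open>M\<close> yields elementarity.\<close>

definition "Ext M M' \<longleftrightarrow> M \<sqsubseteq> M' \<and> (\<forall>q. q \<epsilon> M \<longrightarrow> (SatC M q \<longleftrightarrow> SatC M' q))"
definition "fdr f a r \<longleftrightarrow> FunOn f a \<and> (\<forall>y. y \<epsilon> r \<longleftrightarrow> (\<exists>x. op x y \<epsilon> f))"
text \<open>Second-order ZFC: under choice these are the stages V_\<kappa> with \<kappa>
  inaccessible. The last clause is Replacement for arbitrary functions.\<close>

definition "GM M \<longleftrightarrow> Lev M \<and> om \<epsilon> M \<and> (\<forall>x. x \<epsilon> M \<longrightarrow> Pw x \<epsilon> M) \<and>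
  (\<forall>f a r. fdr f a r \<longrightarrow> a \<epsilon> M \<longrightarrow> r \<sqsubseteq> M \<longrightarrow> r \<epsilon> M)"
text \<open>Obstructions to strong extendibility. They are confined to levels because levels are
  linearly ordered, so that \<open>wit\<close> singles out at most one of them.\<close>

definition "bad M W \<longleftrightarrow> Lev W \<and> (\<forall>M'. GM M' \<longrightarrow> W \<epsilon> M' \<longrightarrow> \<not> Ext M M')"
definition "wit M W \<longleftrightarrow> bad M W \<and> (\<forall>V. V \<epsilon> W \<longrightarrow> \<not> bad M V)"

lemma Df_SatC [Dfi]: "Dt t \<Longrightarrow> Dt u \<Longrightarrow> Df (\<lambda>e. SatC (t e) (u e))"
  by (rule Df2) (unfold SatC_def, intro Dfi)
lemma Df_Ext [Dfi]: "Dt t \<Longrightarrow> Dt u \<Longrightarrow> Df (\<lambda>e. Ext (t e) (u e))"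
  by (rule Df2) (unfold Ext_def, intro Dfi)
lemma Df_fdr [Dfi]: "Dt t \<Longrightarrow> Dt u \<Longrightarrow> Dt v \<Longrightarrow> Df (\<lambda>e. fdr (t e) (u e) (v e))"
  by (rule Df3) (unfold fdr_def, intro Dfi)
lemma Df_GM [Dfi]: "Dt t \<Longrightarrow> Df (\<lambda>e. GM (t e))"
  by (rule Df1) (unfold GM_def, intro Dfi)
lemma Df_bad [Dfi]: "Dt t \<Longrightarrow> Dt u \<Longrightarrow> Df (\<lambda>e. bad (t e) (u e))"
  by (rule Df2) (unfold bad_def, intro Dfi)
lemma Df_wit [Dfi]: "Dt t \<Longrightarrow> Dt u \<Longrightarrow> Df (\<lambda>e. wit (t e) (u e))"
  by (rule Df2) (unfold wit_def, intro Dfi)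

lemma Ext_trans: "Ext M M' \<Longrightarrow> Ext M' P \<Longrightarrow> Ext M P"
  unfolding Ext_def by blast

text \<open>The relations to be preserved are interpreted in the universe, not in the structure, so
  that an embedding only has to be elementary for atomic formulas.\<close>

definition rels :: "'a \<Rightarrow> ('a \<Rightarrow> 'a \<Rightarrow> 'a \<Rightarrow> 'a \<Rightarrow> bool) list" where
  "rels Th = [\<lambda>c x y z. x \<epsilon> y, \<lambda>c x y z. x = y, \<lambda>c x y z. x = c, \<lambda>c x y z. x = Th,
    \<lambda>c x y z. x = om, \<lambda>c x y z. x = emp, \<lambda>c x y z. y = suc x, \<lambda>c x y z. y = Pw x,
    \<lambda>c x y z. y = lv x, \<lambda>c x y z. y = Bof x, \<lambda>c x y z. z = op x y, \<lambda>c x y z. FunOn x y,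
    \<lambda>c x y z. fdr x y z, \<lambda>c x y z. SatC x y, \<lambda>c x y z. GM x, \<lambda>c x y z. Lev x,
    \<lambda>c x y z. wit x y, \<lambda>c x y z. Jon x y]"

lemma Df_rels: "\<forall>r\<in>set (rels Th). Df (\<lambda>e. r (e 0) (e 1) (e 2) (e 3))"
  unfolding rels_def by (simp only: list.set ball_simps) (intro conjI TrueI Dfi)

context
  fixes Z
  assumes Z: "transset Z"
begin

text \<open>Two limit stages above \<open>Z\<close>: the fixed levels are taken from the first,
  \<open>Bof Z\<close>, while sets and functions built over the whole of some \<open>Bof s\<close>,
  such as the Jonsson-type function, are elements of the second.\<close>

abbreviation (input) "DD \<equiv> Bof (Bof Z)"

lemma tB: "transset (Bof Z)"
  using closed_trans[OF super_closed[OF super_Bof[OF Z]]] unfolding transset_def by blast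

lemmas sB = super_Bof[OF Z] and sD = super_Bof[OF tB]
lemmas cB = super_closed[OF sB] and cD = super_closed[OF sD]

lemma B_D: "x \<epsilon> Bof Z \<Longrightarrow> x \<epsilon> DD" and sub_D: "x \<sqsubseteq> Bof Z \<Longrightarrow> x \<epsilon> DD"
  using sub_Bof[OF tB] Pw_Bof[OF tB] by simp_all

lemma om_D: "om \<epsilon> DD"
  using closed_om[OF cB] sub_D by blast

context
  fixes Th c c' j
  assumes pres: "\<And>r x y z. r \<in> set (rels Th) \<Longrightarrow> x \<epsilon> DD \<Longrightarrow> y \<epsilon> DD \<Longrightarrow> z \<epsilon> DD \<Longrightarrow>
      r c x y z \<longleftrightarrow> r c' (ap j x) (ap j y) (ap j z)"
begin

text \<open>One lemma for each relation in \<open>rels\<close>. For the graph of an operation,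
  preservation means that \<open>j\<close> commutes with it where argument and value lie in
  \<open>DD\<close>; for a constant, that \<open>j\<close> fixes it or, in the case of
  \<open>c\<close>, sends it to \<open>c'\<close>.\<close>

lemma J_mem: "x \<epsilon> DD \<Longrightarrow> y \<epsilon> DD \<Longrightarrow> x \<epsilon> y \<longleftrightarrow> ap j x \<epsilon> ap j y"
  using pres[of "\<lambda>c x y z. x \<epsilon> y" x y y] by (simp only: rels_def list.set insert_iff simp_thms)
lemma J_eq: "x \<epsilon> DD \<Longrightarrow> y \<epsilon> DD \<Longrightarrow> x = y \<longleftrightarrow> ap j x = ap j y"
  using pres[of "\<lambda>c x y z. x = y" x y y] by (simp only: rels_def list.set insert_iff simp_thms)
lemma J_c: "c \<epsilon> DD \<Longrightarrow> ap j c = c'"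
  using pres[of "\<lambda>c x y z. x = c" c c c] by (simp only: rels_def list.set insert_iff simp_thms)
lemma J_Th: "Th \<epsilon> DD \<Longrightarrow> ap j Th = Th"
  using pres[of "\<lambda>c x y z. x = Th" Th Th Th] by (simp only: rels_def list.set insert_iff simp_thms)
lemma J_om: "ap j om = om"
  using pres[of "\<lambda>c x y z. x = om" om om om] om_D by (simp only: rels_def list.set insert_iff simp_thms)
lemma J_emp: "ap j emp = emp"
  using pres[of "\<lambda>c x y z. x = emp" emp emp emp] closed_emp[OF cD]
  by (simp only: rels_def list.set insert_iff simp_thms)
lemma J_suc: "x \<epsilon> DD \<Longrightarrow> ap j (suc x) = suc (ap j x)"
  using pres[of "\<lambda>c x y z. y = suc x" x "suc x" x] closed_suc[OF cD, of x]
  by (simp only: rels_def list.set insert_iff simp_thms)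
lemma J_Pw: "x \<epsilon> DD \<Longrightarrow> ap j (Pw x) = Pw (ap j x)"
  using pres[of "\<lambda>c x y z. y = Pw x" x "Pw x" x] super_Pw[OF sD, of x]
  by (simp only: rels_def list.set insert_iff simp_thms)
lemma J_lv: "x \<epsilon> DD \<Longrightarrow> lv x \<epsilon> DD \<Longrightarrow> ap j (lv x) = lv (ap j x)"
  using pres[of "\<lambda>c x y z. y = lv x" x "lv x" x]
  by (simp only: rels_def list.set insert_iff simp_thms)
lemma J_Bof: "x \<epsilon> DD \<Longrightarrow> Bof x \<epsilon> DD \<Longrightarrow> ap j (Bof x) = Bof (ap j x)"
  using pres[of "\<lambda>c x y z. y = Bof x" x "Bof x" x]
  by (simp only: rels_def list.set insert_iff simp_thms)
lemma J_op: "x \<epsilon> DD \<Longrightarrow> y \<epsilon> DD \<Longrightarrow> ap j (op x y) = op (ap j x) (ap j y)"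
  using pres[of "\<lambda>c x y z. z = op x y" x y "op x y"] closed_op[OF cD, of x y]
  by (simp only: rels_def list.set insert_iff simp_thms)
lemma J_FunOn: "x \<epsilon> DD \<Longrightarrow> y \<epsilon> DD \<Longrightarrow> FunOn x y \<longleftrightarrow> FunOn (ap j x) (ap j y)"
  using pres[of "\<lambda>c x y z. FunOn x y" x y y] by (simp only: rels_def list.set insert_iff simp_thms)
lemma J_fdr: "x \<epsilon> DD \<Longrightarrow> y \<epsilon> DD \<Longrightarrow> z \<epsilon> DD \<Longrightarrow> fdr x y z \<longleftrightarrow> fdr (ap j x) (ap j y) (ap j z)"
  using pres[of "\<lambda>c x y z. fdr x y z" x y z] by (simp only: rels_def list.set insert_iff simp_thms)
lemma J_SatC: "x \<epsilon> DD \<Longrightarrow> y \<epsilon> DD \<Longrightarrow> SatC x y \<longleftrightarrow> SatC (ap j x) (ap j y)"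
  using pres[of "\<lambda>c x y z. SatC x y" x y y] by (simp only: rels_def list.set insert_iff simp_thms)
lemma J_GM: "x \<epsilon> DD \<Longrightarrow> GM x \<longleftrightarrow> GM (ap j x)"
  using pres[of "\<lambda>c x y z. GM x" x x x] by (simp only: rels_def list.set insert_iff simp_thms)
lemma J_Lev: "x \<epsilon> DD \<Longrightarrow> Lev x \<longleftrightarrow> Lev (ap j x)"
  using pres[of "\<lambda>c x y z. Lev x" x x x] by (simp only: rels_def list.set insert_iff simp_thms)
lemma J_wit: "x \<epsilon> DD \<Longrightarrow> y \<epsilon> DD \<Longrightarrow> wit x y \<longleftrightarrow> wit (ap j x) (ap j y)"
  using pres[of "\<lambda>c x y z. wit x y" x y y] by (simp only: rels_def list.set insert_iff simp_thms)
lemma J_Jon: "x \<epsilon> DD \<Longrightarrow> y \<epsilon> DD \<Longrightarrow> Jon x y \<longleftrightarrow> Jon (ap j x) (ap j y)"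
  using pres[of "\<lambda>c x y z. Jon x y" x y y] by (simp only: rels_def list.set insert_iff simp_thms)

lemma J_nat: "n \<epsilon> om \<Longrightarrow> ap j n = n"
proof (erule om_ind[of _ "\<lambda>n. ap j n = n"])
  show "Df (\<lambda>e. ap j (e 0) = e 0)" by (intro Dfi)
  show "ap j (suc n) = suc n" if "n \<epsilon> om" "ap j n = n" for n
    using J_suc[OF closed_om[OF cD that(1)]] that(2) by simp
qed (rule J_emp)

lemma J_app:
  assumes "f \<epsilon> DD" "x \<epsilon> DD" "y \<epsilon> DD" "op x y \<epsilon> f"
  shows "op (ap j x) (ap j y) \<epsilon> ap j f"
  using J_mem[OF closed_op[OF cD assms(2,3)] assms(1)] J_op[OF assms(2,3)] assms(4) by simp

text \<open>Kunen's argument: a Jonsson-type function on \<open>Bof s\<close> forces the embedding to be onto.\<close>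

lemma J_fix:
  assumes s: "s \<epsilon> Bof Z" "Lev s" "ap j s = s" and "x \<epsilon> s"
  shows "ap j x = x"
proof -
  note ts = lev_transset[OF s(2)]
  let ?B = "Bof s"
  \<comment> \<open>\<open>Bof Z\<close> is closed under power sets and so contains all iterates
    from \<open>s\<close>; this keeps Kunen's argument for \<open>s\<close> inside the
    structure.\<close>
  have BZ: "?B \<sqsubseteq> Bof Z"
  proof (intro HOL.allI HOL.impI)
    fix x assume "x \<epsilon> Bof s"
    then obtain n where n: "n \<epsilon> om" "x \<epsilon> it Pw s n" unfolding mem_Bof by blast
    have "it Pw s n \<epsilon> Bof Z"
    proof (rule om_ind[OF n(1), of "\<lambda>n. it Pw s n \<epsilon> Bof Z"])
      show "Df (\<lambda>e. it Pw s (e 0) \<epsilon> Bof Z)" by (intro Dfi Dt_it[OF Dt_Pw_var])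
    qed (use s(1) super_Pw[OF sB] in \<open>auto simp: it_Pw_suc\<close>)
    then show "x \<epsilon> Bof Z" using closed_trans[OF cB n(2)] by blast
  qed
  have BD: "?B \<epsilon> DD" by (rule sub_D[OF BZ])
  have inD: "x \<epsilon> DD" if "x \<epsilon> ?B" for x using BZ that B_D by blast
  have JB: "ap j ?B = ?B" using J_Bof[OF B_D[OF s(1)] BD] s(3) by simp
  have JBin: "ap j x \<epsilon> ?B" if "x \<epsilon> ?B" for x using J_mem[OF inD[OF that] BD] that JB by simp
  from Jon_exists[OF ts] obtain F where F: "F \<sqsubseteq> prd (Pw (prd om ?B)) ?B" "Jon ?B F" by blast
  have PD: "prd om ?B \<epsilon> DD" by (intro super_prd[OF sD] om_D BD)
  have FD: "F \<epsilon> DD" by (rule super_sub[OF sD _ F(1)]) (intro super_prd[OF sD] super_Pw[OF sD] PD BD)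
  have F': "Jon ?B (ap j F)" using J_Jon[OF BD FD] F(2) JB by simp
  have DJ: "Dt (\<lambda>e. ap j (e 0))" by (intro Dfi)
  \<comment> \<open>The image of \<open>Bof s\<close> is as large as \<open>Bof s\<close>, and
    \<open>j F\<close> is again a Jonsson-type function on \<open>Bof s\<close>, since
    \<open>j\<close> fixes \<open>Bof s\<close>. So \<open>j F\<close> reaches every element of
    \<open>Bof s\<close> from sequences in \<open>A\<close>.\<close>
  define A where "A = img (ap j) ?B"
  have A: "y \<epsilon> A \<longleftrightarrow> (\<exists>x. x \<epsilon> ?B \<and> y = ap j x)" for y unfolding A_def by (rule mem_img[OF DJ])
  have AB: "A \<sqsubseteq> ?B" using JBin unfolding A by blast
  have "injf (lam ?B (ap j)) ?B A"
    by (rule injfI[OF DJ]) (use A J_eq inD in blast)+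
  note onto = F'[unfolded Jon_def, THEN conjunct2, THEN conjunct2, rule_format, OF _ this]
  \<comment> \<open>The sequence \<open>t'\<close> has its values in the image, so it is
    \<open>j t\<close> for the sequence \<open>t\<close> of preimages, \<omega> being fixed
    pointwise. Hence \<open>b\<close> is the image under \<open>j\<close> of the value of
    \<open>F\<close> at \<open>t\<close>.\<close>
  have surj: "b \<epsilon> A" if b: "b \<epsilon> ?B" for b
  proof -
    from onto[OF _ b] AB obtain t' where t': "Fun t' om A" "op t' b \<epsilon> ap j F" by blast
    define ti where "ti n = the_set (\<lambda>z. \<exists>x. x \<epsilon> ?B \<and> op n (ap j x) \<epsilon> t' \<and> z \<epsilon> x)" for n
    have tiD: "Dt (\<lambda>e. ti (e 0))" unfolding ti_def by (intro Dfi)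
    have ti: "ti n \<epsilon> ?B \<and> ap j (ti n) = ap t' n" if n: "n \<epsilon> om" for n
    proof -
      from Fun_ap[OF t'(1) n] obtain x where x: "x \<epsilon> ?B" "ap t' n = ap j x" unfolding A by blast
      have t'F: "FunOn t' om" using t'(1) unfolding Fun_iff by blast
      have "x' = x" if "x' \<epsilon> ?B" "op n (ap j x') \<epsilon> t'" for x'
      proof -
        from that(2) have "ap t' n = ap j x'" unfolding FunOn_app[OF t'F] by blast
        with x J_eq[OF inD[OF that(1)] inD[OF x(1)]] show ?thesis by simp
      qed
      moreover have "op n (ap j x) \<epsilon> t'" unfolding FunOn_app[OF t'F] using n x by blast
      ultimately have "ti n = x" unfolding ti_def using x(1) by (intro the_set_eqI) blast
      with x show ?thesis by simp
    qed
    define t where "t = lam om ti"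
    have t: "Fun t om ?B" unfolding t_def by (rule Fun_lam[OF tiD]) (use ti in blast)
    have tF: "FunOn t om" unfolding t_def by (rule FunOn_lam[OF tiD])
    have tD: "t \<epsilon> DD" by (rule super_sub[OF sD PD Fun_prd[OF t]])
    from F(2) t obtain b0 where b0: "b0 \<epsilon> ?B" "op t b0 \<epsilon> F" unfolding Jon_def by blast
    have JtF: "FunOn (ap j t) om" using J_FunOn[OF tD om_D] tF J_om by simp
    have "ap j t = t'"
    proof (rule FunOn_ext[OF JtF])
      show "FunOn t' om" using t'(1) unfolding Fun_iff by blast
      fix n assume n: "n \<epsilon> om"
      have "op n (ti n) \<epsilon> t" unfolding t_def op_lam[OF tiD] using n by blast
      from J_app[OF tD closed_om[OF cD n] inD this] ti[OF n]
      have "op n (ap t' n) \<epsilon> ap j t" by (simp add: J_nat[OF n])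
      then show "ap (ap j t) n = ap t' n" unfolding FunOn_app[OF JtF] by blast
    qed
    with J_app[OF FD tD inD[OF b0(1)] b0(2)] have "op t' (ap j b0) \<epsilon> ap j F" by simp
    with t'(2) F' have "b = ap j b0" unfolding Jon_def by blast
    with b0(1) show ?thesis unfolding A by blast
  qed
  \<comment> \<open>An \<in>-embedding of a transitive set onto itself is the identity: a least
    moved element would have the same elements as its image.\<close>
  have idB: "ap j x = x" if "x \<epsilon> ?B" for x
  proof (rule ccontr)
    assume "ap j x \<noteq> x"
    have "Df (\<lambda>e. e 0 \<epsilon> ?B \<and> ap j (e 0) \<noteq> e 0)" by (intro Dfi)
    from eps_least[OF this] \<open>x \<epsilon> ?B\<close> \<open>ap j x \<noteq> x\<close> obtain y where y: "y \<epsilon> ?B" "ap j y \<noteq> y"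
      and least: "\<And>z. z \<epsilon> y \<Longrightarrow> \<not> (z \<epsilon> ?B \<and> ap j z \<noteq> z)" by blast
    have tr: "z \<epsilon> ?B" if "z \<epsilon> w" "w \<epsilon> ?B" for z w
      by (rule closed_trans[OF super_closed[OF super_Bof[OF ts]] that])
    have "z \<epsilon> ap j y \<longleftrightarrow> z \<epsilon> y" for z
    proof
      assume z: "z \<epsilon> y"
      then have "ap j z = z" using least tr[OF z y(1)] by blast
      with J_mem[OF inD[OF tr[OF z y(1)]] inD[OF y(1)]] z show "z \<epsilon> ap j y" by simp
    next
      assume z: "z \<epsilon> ap j y"
      from surj[OF tr[OF z JBin[OF y(1)]]] obtain w where w: "w \<epsilon> ?B" "z = ap j w" unfolding A by blast
      with z J_mem[OF inD[OF w(1)] inD[OF y(1)]] have "w \<epsilon> y" by simp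
      with least w show "z \<epsilon> y" by auto
    qed
    then have "ap j y = y" by (rule ext)
    with y(2) show False ..
  qed
  show ?thesis by (rule idB) (use sub_Bof[OF ts] assms(4) in blast)
qed

text \<open>If \<open>j\<close> lowered \<open>s\<close>, then by preservation of \<in> it would
  also lower \<open>j s\<close>, so there would be no least such level.\<close>

lemma J_up:
  assumes "Lev s" "s \<epsilon> DD"
  shows "\<not> ap j s \<epsilon> s"
proof
  assume "ap j s \<epsilon> s"
  let ?P = "\<lambda>s. Lev s \<and> s \<epsilon> DD \<and> ap j s \<epsilon> s"
  have "Df (\<lambda>e. ?P (e 0))" by (intro Dfi)
  from eps_least[OF this] assms \<open>ap j s \<epsilon> s\<close> obtain r where r: "?P r" and l: "\<And>z. z \<epsilon> r \<Longrightarrow> \<not> ?P z" by blast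
  have JD: "ap j r \<epsilon> DD" using closed_trans[OF cD] r by blast
  then have "?P (ap j r)" using r J_Lev[of r] J_mem[OF JD, of r] by blast
  with l r show False by blast
qed

lemma embedding_contradiction:
  assumes c: "Lev c" "c \<epsilon> Z" "c \<noteq> c'" and Th: "Lev Th" "Th \<epsilon> c" "om \<epsilon> Th" "th \<epsilon> Th"
    and W1: "\<And>M. GM M \<Longrightarrow> th \<epsilon> M \<Longrightarrow> \<exists>W. wit M W"
    and W2: "\<And>M W. M = c \<or> M \<epsilon> c \<Longrightarrow> wit M W \<Longrightarrow> W \<epsilon> Z"
  shows False
proof -
  obtain h where h: "\<And>s. s \<epsilon> h \<longleftrightarrow> s \<epsilon> Bof Z \<and> Lev s \<and> ap j s = s"
    by (rule separate[of "\<lambda>s. Lev s \<and> ap j s = s" "Bof Z"]) (intro Dfi, rule that)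
  define K where "K = acc h"
  have LK: "Lev K" unfolding K_def by (rule Lev_acc) (use h in blast)
  have hK: "s \<epsilon> K" if "s \<epsilon> h" for s unfolding K_def mem_acc using that by blast
  have KE: "\<exists>s. s \<epsilon> h \<and> x \<sqsubseteq> s" if "x \<epsilon> K" for x using that unfolding K_def mem_acc .
  have hPw: "Pw s \<epsilon> h" if "s \<epsilon> h" for s
    using that super_Pw[OF sB] Lev_Pw J_Pw[of s] B_D[of s] unfolding h by auto
  \<comment> \<open>An element \<open>x\<close> of \<open>K\<close> is only known to be a subset of
    a fixed level \<open>s\<close>; it is an element of \<open>Pw s\<close>, which is fixed as
    well.\<close>
  have fixK: "ap j x = x" if x: "x \<epsilon> K" for x
  proof -
    from KE[OF x] obtain s where s: "s \<epsilon> h" "x \<sqsubseteq> s" by blast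
    from hPw[OF s(1)] have p: "Pw s \<epsilon> Bof Z" "Lev (Pw s)" "ap j (Pw s) = Pw s" unfolding h by blast+
    show ?thesis by (rule J_fix[OF p]) (simp add: s)
  qed
  have cB: "c \<epsilon> Bof Z" using sub_Bof[OF Z] c(2) by blast
  \<comment> \<open>\<open>j\<close> moves \<open>c\<close>, so \<open>K\<close> cannot exceed
    \<open>c\<close>; this places \<open>K\<close> inside the structure and its witness in
    \<open>Z\<close>.\<close>
  have "\<not> c \<epsilon> K" using fixK[of c] J_c[OF B_D[OF cB]] c(3) by metis
  then have Kc: "K = c \<or> K \<epsilon> c" using lev_linear[OF LK c(1)] by blast
  then have KB: "K \<epsilon> Bof Z" using cB closed_trans[OF super_closed[OF sB]] by blast
  have KD: "K \<epsilon> DD" by (rule B_D[OF KB])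
  \<comment> \<open>A fixed \<open>K\<close> would itself be among the levels in \<open>h\<close>,
    and hence an element of \<open>K\<close>.\<close>
  have JK: "ap j K \<noteq> K" using h hK[of K] KB LK no_cycles(1) by blast
  have inB: "x \<epsilon> Bof Z" if "x \<epsilon> K" for x using closed_trans[OF super_closed[OF sB] that KB] .
  have "Th \<epsilon> Bof Z" using closed_trans[OF super_closed[OF sB] Th(2) cB] .
  then have ThK: "Th \<epsilon> K" by (intro hK) (simp add: h Th(1) J_Th[OF B_D])
  have G: "GM K" unfolding GM_def
  proof (intro conjI HOL.allI HOL.impI)
    show "Lev K" by (rule LK)
    show "om \<epsilon> K" by (rule lev_trans[OF LK ThK Th(3)])
    show "Pw x \<epsilon> K" if x: "x \<epsilon> K" for x
    proof -
      from KE[OF x] obtain s where s: "s \<epsilon> h" "x \<sqsubseteq> s" by blast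
      have "Pw x \<sqsubseteq> Pw s" using s(2) by simp
      with hPw[OF s(1)] show ?thesis unfolding K_def mem_acc by blast
    qed
    fix f a r assume f: "fdr f a r" and a: "a \<epsilon> K" and r: "r \<sqsubseteq> K"
    from lv_least[OF LK r] show "r \<epsilon> K"
    proof
      assume "lv r \<epsilon> K"
      from lev_super[OF LK this sub_lv] show ?thesis .
    next
      \<comment> \<open>Here \<open>r\<close> is unbounded in \<open>K\<close>. But \<open>f\<close>
        is fixed, since its arguments and values are; so \<open>r\<close>, then its level, and thus
        \<open>K\<close> would be fixed.\<close>
      assume l: "lv r = K"
      have fF: "FunOn f a" and rf: "\<And>y. y \<epsilon> r \<longleftrightarrow> (\<exists>x. op x y \<epsilon> f)" using f unfolding fdr_def by blast+
      have "Fun f a K" unfolding Fun_iff using fF rf r by blast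
      from super_sub[OF sB super_prd[OF sB inB[OF a] KB] Fun_prd[OF this]]
      have fD: "f \<epsilon> DD" by (rule B_D)
      have rD: "r \<epsilon> DD" by (rule B_D[OF super_sub[OF sB KB r]])
      have f': "fdr (ap j f) a (ap j r)" using J_fdr[OF fD B_D[OF inB[OF a]] rD] f fixK[OF a] by simp
      then have f'F: "FunOn (ap j f) a" unfolding fdr_def by blast
      have "ap j f = f"
      proof (rule FunOn_ext[OF f'F fF])
        fix x assume x: "x \<epsilon> a"
        note op = ap_mem[OF fF x]
        have xK: "x \<epsilon> K" by (rule lev_trans[OF LK a x])
        have yK: "ap f x \<epsilon> K" using r rf op by blast
        from J_app[OF fD B_D[OF inB[OF xK]] B_D[OF inB[OF yK]] op]
        have "op x (ap f x) \<epsilon> ap j f" by (simp add: fixK[OF xK] fixK[OF yK])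
        then show "ap (ap j f) x = ap f x" unfolding FunOn_app[OF f'F] by blast
      qed
      with f' have "ap j r = r" unfolding fdr_def using rf by (intro ext) simp
      with J_lv[OF rD] l KD have "ap j K = K" by simp
      with JK show ?thesis by blast
    qed
  qed
  have thK: "th \<epsilon> K" by (rule lev_trans[OF LK ThK Th(4)])
  have KJ: "K \<sqsubseteq> ap j K"
    using J_mem[OF B_D[OF inB] KD] fixK by metis
  have ext: "Ext K (ap j K)" unfolding Ext_def
    using KJ J_SatC[OF KD B_D[OF inB]] fixK by simp
  from W1[OF G thK] obtain W where W: "wit K W" by blast
  have "W \<epsilon> Z" by (rule W2[OF Kc W])
  then have WB: "W \<epsilon> Bof Z" using sub_Bof[OF Z] by blast
  note WD = B_D[OF WB]
  have bW: "bad K W" and LW: "Lev W" using W unfolding wit_def bad_def by blast+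
  have JW: "wit (ap j K) (ap j W)" using J_wit[OF KD WD] W by simp
  have LJW: "Lev (ap j W)" using J_Lev[OF WD] LW by simp
  \<comment> \<open>The two sides of the squeeze: \<open>W\<close> is bad for \<open>j K\<close>
    because extensions of \<open>j K\<close> extend \<open>K\<close>, and \<open>J_up\<close>
    excludes that \<open>j W\<close> lies below \<open>W\<close>.\<close>
  have "ap j W = W"
  proof (rule ccontr)
    assume "ap j W \<noteq> W"
    then have "W \<epsilon> ap j W" using lev_linear[OF LW LJW] J_up[OF LW WD] by auto
    with JW have "\<not> bad (ap j K) W" unfolding wit_def by blast
    then obtain M' where "GM M'" "W \<epsilon> M'" "Ext (ap j K) M'" unfolding bad_def using LW by blast
    with bW Ext_trans[OF ext] show False unfolding bad_def by blast
  qed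
  then have "W \<epsilon> K" by (intro hK) (simp add: h WB LW)
  then have "W \<epsilon> ap j K" using KJ by blast
  moreover have "GM (ap j K)" using J_GM[OF KD] G by simp
  ultimately show False using bW ext unfolding bad_def by blast
qed

end

end

text \<open>The existence of a second-order model containing \<open>th\<close> is part of what is
  proved: \<open>K\<close> arises from the embedding, and only then is the negated statement applied
  to it.\<close>

theorem strongly_extendible_levels:
  "\<exists>M. th \<epsilon> M \<and> GM M \<and> (\<forall>x. \<exists>M'. GM M' \<and> x \<epsilon> M' \<and> Ext M M')"
proof (rule ccontr)
  assume neg: "\<not> ?thesis"
  have W1: "\<exists>W. wit M W" if M: "GM M" "th \<epsilon> M" for M
  proof -
    from neg M obtain x where x: "\<And>M'. GM M' \<Longrightarrow> x \<epsilon> M' \<Longrightarrow> \<not> Ext M M'" by blast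
    have "bad M (lv (sg x))" unfolding bad_def
    proof (intro conjI HOL.allI HOL.impI)
      fix M' assume M': "GM M'" "lv (sg x) \<epsilon> M'"
      have "x \<epsilon> lv (sg x)" using sub_lv[of "sg x"] by simp
      with M' have "x \<epsilon> M'" using lev_trans unfolding GM_def by blast
      with x M'(1) show "\<not> Ext M M'" by blast
    qed (rule Lev_lv)
    moreover have "Df (\<lambda>e. bad M (e 0))" by (intro Dfi)
    ultimately obtain W where "bad M W" "\<And>V. V \<epsilon> W \<Longrightarrow> \<not> bad M V" using eps_least[of "bad M"] by blast
    then show ?thesis unfolding wit_def by blast
  qed
  have uniq: "W = V" if "wit M W" "wit M V" for M V W
  proof -
    have "Lev W" "Lev V" using that unfolding wit_def bad_def by blast+
    from lev_linear[OF this] that show ?thesis unfolding wit_def by blast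
  qed
  \<comment> \<open>Witnesses are gathered for \<open>X\<close> and for all its elements, since
    \<open>K\<close> will be one of these but is not known in advance.\<close>
  define ws where "ws X = the_set (\<lambda>W. \<exists>M. M \<epsilon> un X (sg X) \<and> wit M W)" for X
  define Zf where "Zf X = lv (un (sg X) (ws X))" for X
  \<comment> \<open>\<open>th\<close> and \<omega> are wrapped into a level because \<open>K\<close>
    is built from fixed levels; the constant for \<open>Th\<close> makes it one of them.\<close>
  define Th where "Th = lv (up th om)"
  have ws: "W \<epsilon> ws X \<longleftrightarrow> (\<exists>M. M \<epsilon> un X (sg X) \<and> wit M W)" for W X
    unfolding ws_def by (rule the_set_iff, rule repl) (intro Dfi, rule uniq)
  have Zt: "transset (Zf X)" for X unfolding Zf_def by (rule lev_transset[OF Lev_lv])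
  have Zmem: "X \<epsilon> Zf X" "W \<epsilon> ws X \<Longrightarrow> W \<epsilon> Zf X" for X W
    unfolding Zf_def using sub_lv[of "un (sg X) (ws X)"] by simp_all
  let ?C = "\<lambda>X. Lev X \<and> Th \<epsilon> X" and ?t = "\<lambda>X. Bof (Bof (Zf X))"
  \<comment> \<open>A set \<open>S\<close> of all levels above \<open>Th\<close> would be an element
    of the level \<open>?L\<close>, which is itself an element of \<open>S\<close>.\<close>
  have pr: "\<not> isset ?C"
  proof
    assume "isset ?C"
    then obtain S where S: "x \<epsilon> S \<longleftrightarrow> ?C x" for x unfolding isset_def by blast
    let ?L = "lv (up S Th)"
    have "S \<epsilon> ?L" "Th \<epsilon> ?L" using sub_lv[of "up S Th"] by simp_all
    then show False using S[of ?L] Lev_lv no_cycles(2) by blast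
  qed
  have sup: "super (?t X) \<and> X \<epsilon> ?t X" for X
    using sD[OF Zt] B_D[OF Zt] sub_Bof[OF Zt] Zmem(1) by blast
  have D: "Dt (\<lambda>e. ?t (e 0))" unfolding Zf_def ws_def by (intro Dfi)
  have DC: "Df (\<lambda>e. ?C (e 0))" by (intro Dfi)
  show False
  proof (rule vopenka_list[where rs = "rels Th" and C = ?C and t = ?t, OF Df_rels DC D sup pr])
    fix c c' j
    assume c: "?C c" "?C c'" "c \<noteq> c'"
    and pres: "\<And>r x y z. r \<in> set (rels Th) \<Longrightarrow> x \<epsilon> ?t c \<Longrightarrow> y \<epsilon> ?t c \<Longrightarrow> z \<epsilon> ?t c \<Longrightarrow>
      r c x y z \<longleftrightarrow> r c' (ap j x) (ap j y) (ap j z)"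
    have L: "om \<epsilon> Th" "th \<epsilon> Th" unfolding Th_def using sub_lv[of "up th om"] by simp_all
    show False
    proof (rule embedding_contradiction[where c = c and c' = c' and j = j and Th = Th and Z = "Zf c" and th = th, OF Zt])
      show "r c x y z \<longleftrightarrow> r c' (ap j x) (ap j y) (ap j z)"
        if "r \<in> set (rels Th)" "x \<epsilon> ?t c" "y \<epsilon> ?t c" "z \<epsilon> ?t c" for r x y z
        using that by (rule pres)
      show "W \<epsilon> Zf c" if "M = c \<or> M \<epsilon> c" "wit M W" for M W
        using that by (intro Zmem(2)) (auto simp: ws)
      show "\<exists>W. wit M W" if "GM M" "th \<epsilon> M" for M using W1[OF that] .
    qed (use c L Zmem(1) Lev_lv in \<open>simp_all add: Th_def\<close>)
  qed
qed

end

section \<open>Models\<close>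

context bst
begin

abbreviation (input) "elts M \<equiv> {u. u \<epsilon> M}"

context
  fixes M
  assumes M: "closed M"
begin

lemmas tr = closed_trans[OF M]

text \<open>The well-foundedness clause ranges over all sets, but Foundation makes it true both in
  \<open>M\<close> and outside; the remaining clauses look only at elements of
  \<open>M\<close>.\<close>

lemma abs_Ord: "x \<epsilon> M \<Longrightarrow> sOrd (elts M) x \<longleftrightarrow> Ord x"
proof -
  assume x: "x \<epsilon> M"
  have s: "sSub (elts M) y a \<longleftrightarrow> Sub y a" if "y \<epsilon> M" for y a
    unfolding sSub_def using tr that by blast
  have e: "sEmpty (elts M) y \<longleftrightarrow> Empty y" if "y \<epsilon> M" for y
    unfolding sEmpty_def using tr that by blast
  have 1: "sTrans (elts M) x \<longleftrightarrow> Trans x"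
    unfolding sTrans_def using s[of _ x] tr[OF _ x] by blast
  have "(\<forall>u\<in>elts M. sSub (elts M) u x \<and> \<not> sEmpty (elts M) u \<longrightarrow>
      (\<exists>y\<in>elts M. y \<epsilon> u \<and> (\<forall>z\<in>elts M. z \<epsilon> u \<longrightarrow> \<not> z \<epsilon> y)))"
  proof (intro ballI HOL.impI)
    fix u assume u: "u \<in> elts M" "sSub (elts M) u x \<and> \<not> sEmpty (elts M) u"
    then obtain v where "v \<epsilon> u" unfolding sEmpty_def by blast
    from foundation[OF this] show "\<exists>y\<in>elts M. y \<epsilon> u \<and> (\<forall>z\<in>elts M. z \<epsilon> u \<longrightarrow> \<not> z \<epsilon> y)"
      using tr u(1) by blast
  qed
  moreover have "(\<forall>u. Sub u x \<and> \<not> Empty u \<longrightarrow> (\<exists>y. y \<epsilon> u \<and> (\<forall>z. z \<epsilon> u \<longrightarrow> \<not> z \<epsilon> y)))"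
    unfolding sEmpty_def using foundation by blast
  moreover have "(\<forall>y\<in>elts M. y \<epsilon> x \<longrightarrow> (\<forall>z\<in>elts M. z \<epsilon> x \<longrightarrow> y \<epsilon> z \<or> y = z \<or> z \<epsilon> y)) \<longleftrightarrow>
      (\<forall>y. y \<epsilon> x \<longrightarrow> (\<forall>z. z \<epsilon> x \<longrightarrow> y \<epsilon> z \<or> y = z \<or> z \<epsilon> y))"
    using tr[OF _ x] by blast
  ultimately show ?thesis unfolding sOrd_def 1 by simp
qed

lemma abs_Lim: "x \<epsilon> M \<Longrightarrow> sLim (elts M) x \<longleftrightarrow> sLim UNIV x"
proof -
  assume x: "x \<epsilon> M"
  have "(\<forall>y\<in>elts M. y \<epsilon> x \<longrightarrow> (\<exists>z\<in>elts M. z \<epsilon> x \<and> y \<epsilon> z)) \<longleftrightarrow> (\<forall>y. y \<epsilon> x \<longrightarrow> (\<exists>z. z \<epsilon> x \<and> y \<epsilon> z))"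
    using tr[OF _ x] by blast
  moreover have "sEmpty (elts M) x \<longleftrightarrow> Empty x" unfolding sEmpty_def using tr[OF _ x] by blast
  ultimately show ?thesis unfolding sLim_def using abs_Ord[OF x] by simp
qed

lemma abs_Omega: "x \<epsilon> M \<Longrightarrow> sOmega (elts M) x \<longleftrightarrow> Omega x"
proof -
  assume x: "x \<epsilon> M"
  have "(\<forall>y\<in>elts M. y \<epsilon> x \<longrightarrow> \<not> sLim (elts M) y) \<longleftrightarrow> (\<forall>y. y \<epsilon> x \<longrightarrow> \<not> sLim UNIV y)"
    using tr[OF _ x] abs_Lim by blast
  then show ?thesis unfolding sOmega_def using abs_Lim[OF x] by simp
qed

lemma abs_Op: "p \<epsilon> M \<Longrightarrow> x \<epsilon> M \<Longrightarrow> y \<epsilon> M \<Longrightarrow> sOp (elts M) p x y \<longleftrightarrow> p = op x y"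
proof -
  assume p: "p \<epsilon> M" "x \<epsilon> M" "y \<epsilon> M"
  have u: "sUp (elts M) u v w \<longleftrightarrow> u = up v w" if "u \<epsilon> M" "v \<epsilon> M" "w \<epsilon> M" for u v w
  proof
    assume a: "sUp (elts M) u v w"
    show "u = up v w"
    proof (rule ext)
      show "z \<epsilon> u \<longleftrightarrow> z \<epsilon> up v w" for z
        using a that tr[of z u] unfolding sUp_def by auto
    qed
  qed (simp add: sUp_def)
  show ?thesis
  proof
    assume "sOp (elts M) p x y"
    then obtain a b where "a \<epsilon> M" "b \<epsilon> M" "sUp (elts M) a x x" "sUp (elts M) b x y" "sUp (elts M) p a b"
      unfolding sOp_def by blast
    then show "p = op x y" using u p unfolding op_def sg_def by metis
  next
    assume "p = op x y"
    moreover have "up x x \<epsilon> M" "up x y \<epsilon> M" using closed_up[OF M] p by blast+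
    ultimately show "sOp (elts M) p x y" unfolding sOp_def using u p unfolding op_def sg_def by blast
  qed
qed

lemma abs_App: "f \<epsilon> M \<Longrightarrow> x \<epsilon> M \<Longrightarrow> y \<epsilon> M \<Longrightarrow> sApp (elts M) f x y \<longleftrightarrow> op x y \<epsilon> f"
  unfolding sApp_def using abs_Op tr closed_op[OF M] by auto

lemma op_in: "op x y \<epsilon> f \<Longrightarrow> f \<epsilon> M \<Longrightarrow> x \<epsilon> M \<and> y \<epsilon> M"
  using tr closed_fst[OF M] closed_snd[OF M] by blast

lemma abs_FunOn:
  assumes "f \<epsilon> M" "a \<epsilon> M"
  shows "sFunOn (elts M) f a \<longleftrightarrow> FunOn f a"
proof
  assume f: "sFunOn (elts M) f a"
  show "FunOn f a" unfolding FunOn_iff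
  proof (intro conjI HOL.allI HOL.impI)
    fix p assume p: "p \<epsilon> f"
    then have pM: "p \<epsilon> M" using tr assms by blast
    with f p obtain x y where "x \<epsilon> M" "x \<epsilon> a" "y \<epsilon> M" "sOp (elts M) p x y" unfolding sFunOn_def by blast
    then show "\<exists>x. x \<epsilon> a \<and> (\<exists>y. p = op x y)" using abs_Op[OF pM] by blast
  next
    fix x assume x: "x \<epsilon> a"
    then have xM: "x \<epsilon> M" using tr assms by blast
    with f x obtain y where y: "y \<epsilon> M" "sApp (elts M) f x y" "\<forall>z\<in>elts M. sApp (elts M) f x z \<longrightarrow> z = y"
      unfolding sFunOn_def by blast
    have "z = y" if "op x z \<epsilon> f" for z
      using op_in[OF that assms(1)] y(3) abs_App[OF assms(1) xM, of z] that by blast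
    moreover have "op x y \<epsilon> f" using y(1,2) abs_App[OF assms(1) xM] by blast
    ultimately show "\<exists>!y. op x y \<epsilon> f" by blast
  qed
next
  assume f: "FunOn f a"
  show "sFunOn (elts M) f a" unfolding sFunOn_def
  proof (intro conjI ballI HOL.impI)
    fix p assume p: "p \<in> elts M" "p \<epsilon> f"
    with f obtain x y where xy: "x \<epsilon> a" "p = op x y" unfolding FunOn_iff by blast
    with op_in[of x y f] p assms have "x \<epsilon> M" "y \<epsilon> M" by blast+
    with xy p(1) abs_Op[of p x y] show "\<exists>x\<in>elts M. x \<epsilon> a \<and> (\<exists>y\<in>elts M. sOp (elts M) p x y)" by blast
  next
    fix x assume x: "x \<in> elts M" "x \<epsilon> a"
    note op = ap_mem[OF f x(2)]
    have yM: "ap f x \<epsilon> M" using op_in[OF op assms(1)] ..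
    have "z = ap f x" if "z \<epsilon> M" "sApp (elts M) f x z" for z
      using that x abs_App[OF assms(1), of x z] by (simp add: FunOn_app[OF f])
    moreover have "sApp (elts M) f x (ap f x)" using abs_App[OF assms(1) _ yM] op x by blast
    ultimately show "\<exists>y\<in>elts M. sApp (elts M) f x y \<and> (\<forall>z\<in>elts M. sApp (elts M) f x z \<longrightarrow> z = y)"
      using yM by blast
  qed
qed

lemma abs_Fun:
  assumes "f \<epsilon> M" "a \<epsilon> M"
  shows "sFun (elts M) f a b \<longleftrightarrow> Fun f a b"
  unfolding sFun_def[of "elts M"] Fun_iff abs_FunOn[OF assms]
  using abs_App[OF assms(1)] op_in[OF _ assms(1)] by blast

end

end

section \<open>Supertransitive sets are special and satisfy the single axioms\<close>

context zfc
begin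

text \<open>\<open>M\<close> contains every function from \<open>b\<close> to \<open>a\<close>,
  hence sees the same cofinal maps.\<close>

lemma super_Cofm:
  assumes M: "super M" and a: "a \<epsilon> M" "b \<epsilon> M"
  shows "sCofm (elts M) b a \<longleftrightarrow> sCofm UNIV b a"
proof -
  note abs = super_closed[OF M]
  have f: "(f \<epsilon> M \<and> sFun (elts M) f b a) \<longleftrightarrow> Fun f b a" for f
  proof (cases "f \<epsilon> M")
    case True
    then show ?thesis using abs_Fun[OF abs True a(2)] by simp
  next
    case False
    have "f \<epsilon> M" if "Fun f b a" by (rule super_sub[OF M super_prd[OF M a(2,1)] Fun_prd[OF that]])
    with False show ?thesis by blast
  qed
  have c: "(\<forall>x\<in>elts M. x \<epsilon> a \<longrightarrow> (\<exists>i\<in>elts M. i \<epsilon> b \<and> (\<exists>y\<in>elts M. sApp (elts M) f i y \<and> (x \<epsilon> y \<or> x = y)))) \<longleftrightarrow>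
      (\<forall>x. x \<epsilon> a \<longrightarrow> (\<exists>i. i \<epsilon> b \<and> (\<exists>y. op i y \<epsilon> f \<and> (x \<epsilon> y \<or> x = y))))" if "f \<epsilon> M" for f
    using abs_App[OF abs that] op_in[OF abs _ that] closed_trans[OF abs _ a(1)]
      closed_trans[OF abs _ a(2)] by blast
  show ?thesis unfolding sCofm_def using f c by auto
qed

lemma super_Special:
  assumes M: "super M" and om: "om \<epsilon> M"
  shows "Special M"
  unfolding Special_def
proof (intro HOL.allI HOL.impI)
  fix a assume a: "a \<epsilon> M" "Ord a"
  note abs = super_closed[OF M]
  have "(\<forall>c\<in>elts M. c \<epsilon> om \<longrightarrow> \<not> sCofm (elts M) c a) \<longleftrightarrow> (\<forall>c. c \<epsilon> om \<longrightarrow> \<not> sCofm UNIV c a)"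
    using super_Cofm[OF M a(1)] closed_trans[OF abs _ om] by blast
  then have "sCf (elts M) a om \<longleftrightarrow> sCf UNIV a om"
    unfolding sCf_def abs_Ord[OF abs om] super_Cofm[OF M a(1) om] by simp
  moreover have "(\<exists>w\<in>elts M. sOmega (elts M) w \<and> sCf (elts M) a w) \<longleftrightarrow> sCf (elts M) a om"
    using abs_Omega[OF abs] Omega_unique om by auto
  moreover have "(\<exists>w. Omega w \<and> sCf UNIV a w) \<longleftrightarrow> sCf UNIV a om"
    using Omega_unique by auto
  ultimately show "sCfOm (elts M) a \<longleftrightarrow> sCfOm UNIV a" unfolding sCfOm_def by simp
qed

lemma super_Single:
  assumes M: "super M" and om: "om \<epsilon> M" and uni: "\<And>x. x \<epsilon> M \<Longrightarrow> uni x \<epsilon> M"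
  shows "Single (elts M)"
  unfolding Single_def
proof (intro conjI ballI HOL.impI)
  note tr = closed_trans[OF super_closed[OF M]]
  fix x assume "x \<in> elts M"
  then have x: "x \<epsilon> M" by simp
  show "x = y" if "y \<in> elts M" "\<forall>z\<in>elts M. z \<epsilon> x \<longleftrightarrow> z \<epsilon> y" for y
    using that tr x by (intro ext) blast
  show "\<exists>y\<in>elts M. y \<epsilon> x \<and> (\<forall>z\<in>elts M. z \<epsilon> x \<longrightarrow> \<not> z \<epsilon> y)" if "\<not> sEmpty (elts M) x"
    using that foundation[of _ x] tr[OF _ x] unfolding sEmpty_def by blast
  show "\<exists>p\<in>elts M. sUp (elts M) p x y" if "y \<in> elts M" for y
    using closed_up[OF super_closed[OF M] x, of y] that
    by (intro bexI[of _ "up x y"]) (simp_all add: sUp_def)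
  show "\<exists>u\<in>elts M. \<forall>z\<in>elts M. z \<epsilon> u \<longleftrightarrow> (\<exists>y\<in>elts M. y \<epsilon> x \<and> z \<epsilon> y)"
    using uni[OF x] tr[OF _ x] by (intro bexI[of _ "uni x"]) auto
  have "z \<epsilon> Pw x \<longleftrightarrow> sSub (elts M) z x" if "z \<epsilon> M" for z
    using tr[OF _ that] unfolding sSub_def by auto
  then show "\<exists>p\<in>elts M. \<forall>z\<in>elts M. z \<epsilon> p \<longleftrightarrow> sSub (elts M) z x"
    using super_Pw[OF M x] by blast
  assume h: "(\<forall>y\<in>elts M. y \<epsilon> x \<longrightarrow> \<not> sEmpty (elts M) y) \<and>
    (\<forall>y\<in>elts M. y \<epsilon> x \<longrightarrow> (\<forall>z\<in>elts M. z \<epsilon> x \<longrightarrow> (\<exists>v\<in>elts M. v \<epsilon> y \<and> v \<epsilon> z) \<longrightarrow> y = z))"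
  have "\<exists>c. \<forall>y. y \<epsilon> x \<longrightarrow> (\<exists>!v. v \<epsilon> y \<and> v \<epsilon> c)"
  proof (rule choice)
    show "\<exists>v. v \<epsilon> y" if "y \<epsilon> x" for y
      using h that tr[OF that x] unfolding sEmpty_def by blast
    show "y = z" if "y \<epsilon> x" "z \<epsilon> x" "v \<epsilon> y" "v \<epsilon> z" for y z v
      using h that tr[OF _ x] tr[OF that(3)] by blast
  qed
  then obtain c where c: "\<forall>y. y \<epsilon> x \<longrightarrow> (\<exists>!v. v \<epsilon> y \<and> v \<epsilon> c)" by blast
  \<comment> \<open>The selector is cut down to \<open>uni x\<close>, so that it is a subset of a
    member of \<open>M\<close>.\<close>
  obtain b where b: "v \<epsilon> b \<longleftrightarrow> v \<epsilon> uni x \<and> v \<epsilon> c" for v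
    by (rule separate[of "\<lambda>v. v \<epsilon> c" "uni x"]) (intro Dfi, rule that)
  have bM: "b \<epsilon> M" by (rule super_sub[OF M uni[OF x]]) (simp only: b, blast)
  have "\<exists>v\<in>elts M. (v \<epsilon> y \<and> v \<epsilon> b) \<and> (\<forall>w\<in>elts M. w \<epsilon> y \<and> w \<epsilon> b \<longrightarrow> w = v)" if y: "y \<epsilon> x" for y
  proof -
    from c y obtain v where v: "v \<epsilon> y" "v \<epsilon> c" "\<And>w. w \<epsilon> y \<Longrightarrow> w \<epsilon> c \<Longrightarrow> w = v" by blast
    moreover have "w \<epsilon> b \<longleftrightarrow> w \<epsilon> c" if "w \<epsilon> y" for w unfolding b using that y by auto
    moreover have "v \<epsilon> M" using tr[OF v(1) tr[OF y x]] .
    ultimately show ?thesis by blast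
  qed
  then show "\<exists>c\<in>elts M. \<forall>y\<in>elts M. y \<epsilon> x \<longrightarrow>
      (\<exists>v\<in>elts M. (v \<epsilon> y \<and> v \<epsilon> c) \<and> (\<forall>w\<in>elts M. w \<epsilon> y \<and> w \<epsilon> c \<longrightarrow> w = v))"
    using bM by blast
next
  have "sEmpty (elts M) emp" by (simp add: sEmpty_def)
  moreover have "sSucc (elts M) (suc x) x" for x by (simp add: sSucc_def)
  ultimately have "(\<exists>u\<in>elts M. u \<epsilon> om \<and> sEmpty (elts M) u) \<and>
      (\<forall>x\<in>elts M. x \<epsilon> om \<longrightarrow> (\<exists>y\<in>elts M. y \<epsilon> om \<and> sSucc (elts M) y x))"
    using om_emp om_suc closed_om[OF super_closed[OF M]] by blast
  with om show "\<exists>w\<in>elts M. (\<exists>u\<in>elts M. u \<epsilon> w \<and> sEmpty (elts M) u) \<and>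
      (\<forall>x\<in>elts M. x \<epsilon> w \<longrightarrow> (\<exists>y\<in>elts M. y \<epsilon> w \<and> sSucc (elts M) y x))" by blast
qed

lemma mem_sat_rel_exists:
  assumes n: "n \<epsilon> om"
  shows "\<exists>S. MemSatRel M n S"
proof -
  obtain E' where E': "u \<epsilon> E' \<longleftrightarrow> u \<epsilon> Pw (prd (N 2) M) \<and> (Fun u (N 2) M \<and>
      (\<exists>x y. op (N 0) x \<epsilon> u \<and> op (N 1) y \<epsilon> u \<and> x \<epsilon> y))" for u
    by (rule separate[of "\<lambda>u. Fun u (N 2) M \<and> (\<exists>x y. op (N 0) x \<epsilon> u \<and> op (N 1) y \<epsilon> u \<and> x \<epsilon> y)"
        "Pw (prd (N 2) M)"]) (intro Dfi, rule that)
  have E2: "u \<epsilon> E' \<longleftrightarrow> Fun u (N 2) M \<and> (\<exists>x y. op (N 0) x \<epsilon> u \<and> op (N 1) y \<epsilon> u \<and> x \<epsilon> y)" for u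
    unfolding E' using Fun_prd by auto
  let ?R = "sg (N 0)" and ?a = "sg (op (N 0) (N 2))" and ?I = "sg (op (N 0) E')"
  have lang: "MemLang ?R emp ?a" unfolding MemLang_def rels Num_iff Op_iff
    by (intro exI[of _ "N 0"] exI[of _ "N 2"] exI) (simp add: sg_def del: N.simps)
  have inter: "MemInterp M ?I" unfolding MemInterp_def rels Num_iff Op_iff App_iff
    by (intro exI[of _ "N 0"] exI[of _ "N 1"] exI[of _ "N 2"] exI[of _ E'] exI)
      (simp add: sg_def E2 del: N.simps)
  \<comment> \<open>A supertransitive \<open>H\<close> containing \<open>M\<close> has all sets of
    assignments into \<open>M\<close> as elements, which is what \<open>satx\<close> asks
    for.\<close>
  obtain H where H: "sg M \<epsilon> H" "super H" using super_ex by blast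
  note cl = super_closed[OF H(2)]
  have MH: "M \<epsilon> H" using closed_trans[OF cl _ H(1)] by simp
  obtain Q where Q: "s \<epsilon> Q \<longleftrightarrow> s \<epsilon> Pw (prd n M) \<and> Fun s n M" for s
    by (rule separate[of "\<lambda>s. Fun s n M" "Pw (prd n M)"]) (intro Dfi, rule that)
  interpret satx E d H Q ?R emp ?a M ?I n
  proof unfold_locales
    show "closed H" by fact
    show "r \<epsilon> H" if "r \<epsilon> ?R" for r using that closed_N[OF cl] by (simp del: N.simps)
    show "s \<epsilon> Q \<longleftrightarrow> Fun s n M" for s unfolding Q using Fun_prd by auto
    show "Y \<epsilon> H" if "\<And>s. s \<epsilon> Y \<Longrightarrow> s \<epsilon> Q" for Y
    proof -
      have "Pw (prd n M) \<epsilon> H" by (intro super_Pw super_prd H MH closed_om[OF cl n])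
      moreover have "Y \<sqsubseteq> Pw (prd n M)" using that Q by blast
      ultimately show ?thesis by (rule super_sub[OF H(2)])
    qed
    show "Fun w k M" if "r \<epsilon> ?R" "op r e \<epsilon> ?I" "op r k \<epsilon> ?a" "w \<epsilon> e" for r e k w
      using that E2 by (auto simp del: N.simps)
  qed (auto simp: n simp del: N.simps)
  from sat_rel_exists lang inter show ?thesis unfolding MemSatRel_def by blast
qed

end

context zv
begin

lemma GM_super:
  assumes G: "GM M"
  shows "super M" "om \<epsilon> M" "x \<epsilon> M \<Longrightarrow> uni x \<epsilon> M"
proof -
  have L: "Lev M" and om: "om \<epsilon> M" and P: "\<And>x. x \<epsilon> M \<Longrightarrow> Pw x \<epsilon> M" using G unfolding GM_def by blast+
  show "om \<epsilon> M" by fact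
  have lev: "\<exists>s. s \<epsilon> M \<and> Lev s \<and> x \<sqsubseteq> s" if "x \<epsilon> M" for x using lev_char[OF L] that by blast
  show u: "uni x \<epsilon> M" if x: "x \<epsilon> M" for x
  proof -
    from lev[OF x] obtain s where s: "s \<epsilon> M" "Lev s" "x \<sqsubseteq> s" by blast
    have "uni x \<sqsubseteq> s" using lev_trans[OF s(2)] s(3) by auto
    then show ?thesis using lev_super[OF L s(1)] by blast
  qed
  have up: "up x y \<epsilon> M" if xy: "x \<epsilon> M" "y \<epsilon> M" for x y
  proof -
    from lev[OF xy(1)] obtain s where s: "s \<epsilon> M" "Lev s" "x \<sqsubseteq> s" by blast
    from lev[OF xy(2)] obtain t where t: "t \<epsilon> M" "Lev t" "y \<sqsubseteq> t" by blast
    have "\<exists>r. r \<epsilon> M \<and> x \<sqsubseteq> r \<and> y \<sqsubseteq> r"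
      using lev_linear[OF s(2) t(2)] s t lev_trans[OF s(2)] lev_trans[OF t(2)] by blast
    then obtain r where r: "r \<epsilon> M" "x \<sqsubseteq> r" "y \<sqsubseteq> r" by blast
    have "up x y \<sqsubseteq> Pw r" using r by auto
    then show ?thesis using lev_super[OF L P[OF r(1)]] by blast
  qed
  have "emp \<epsilon> M" using lev_super[OF L om] by simp
  then show "super M" unfolding super_def closed_def
  proof (intro conjI HOL.allI HOL.impI)
    show "x \<epsilon> M" if "x \<epsilon> y" "y \<epsilon> M" for x y by (rule lev_trans[OF L that(2,1)])
    show "un x y \<epsilon> M" if "x \<epsilon> M" "y \<epsilon> M" for x y unfolding un_def by (rule u[OF up[OF that]])
    show "y \<epsilon> M" if "x \<epsilon> M" "y \<sqsubseteq> x" for x y by (rule lev_super[OF L that])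
  qed (auto intro: up P)
qed

lemma GM_Model:
  assumes G: "GM M"
  shows "Model M"
  unfolding Model_def
proof (intro conjI)
  note S = GM_super[OF G]
  note tr = closed_trans[OF super_closed[OF S(1)]]
  show "Trans M" unfolding sTrans_def Sub_iff using tr by blast
  show "\<forall>n. Natl n \<longrightarrow> (\<exists>S. MemSatRel M n S)" using mem_sat_rel_exists by simp
  show "Single (elts M)" by (rule super_Single) (fact S)+
  show "SatSep M" unfolding SatSep_def
  proof (intro HOL.allI HOL.impI)
    fix z n p s a assume a: "a \<epsilon> M"
    obtain b where b: "x \<epsilon> b \<longleftrightarrow> x \<epsilon> a \<and> SatAt M n p s x" for x
      by (rule separate[of "\<lambda>x. SatAt M n p s x" a]) (intro Dfi, rule that)
    have "b \<epsilon> M" by (rule super_sub[OF S(1) a]) (simp add: b)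
    with b show "\<exists>b. b \<epsilon> M \<and> (\<forall>x. x \<epsilon> M \<longrightarrow> (x \<epsilon> b \<longleftrightarrow> x \<epsilon> a \<and> SatAt M n p s x))" by blast
  qed
  show "SatRepl M" unfolding SatRepl_def
  proof (intro HOL.allI HOL.impI)
    fix l n p s a assume a: "a \<epsilon> M" and fn: "\<forall>x. x \<epsilon> M \<longrightarrow> x \<epsilon> a \<longrightarrow> (\<forall>y. y \<epsilon> M \<longrightarrow> (\<forall>z. z \<epsilon> M \<longrightarrow>
      SatAt2 M n p s x y \<and> SatAt2 M n p s x z \<longrightarrow> y = z))"
    let ?P = "SatAt2 M n p s"
    \<comment> \<open>\<open>fdr\<close> needs a total function, so the domain is reduced to the
      arguments that have a value in \<open>M\<close>.\<close>
    obtain a' where a': "x \<epsilon> a' \<longleftrightarrow> x \<epsilon> a \<and> (\<exists>y. y \<epsilon> M \<and> ?P x y)" for x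
      by (rule separate[of "\<lambda>x. \<exists>y. y \<epsilon> M \<and> ?P x y" a]) (intro Dfi, rule that)
    have a'M: "a' \<epsilon> M" by (rule super_sub[OF S(1) a]) (simp add: a')
    obtain f where f: "q \<epsilon> f \<longleftrightarrow> q \<epsilon> prd a' M \<and> (\<exists>x y. q = op x y \<and> ?P x y)" for q
      by (rule separate[of "\<lambda>q. \<exists>x y. q = op x y \<and> ?P x y" "prd a' M"]) (intro Dfi, rule that)
    obtain b where b: "y \<epsilon> b \<longleftrightarrow> y \<epsilon> M \<and> (\<exists>x. x \<epsilon> a \<and> ?P x y)" for y
      by (rule separate[of "\<lambda>y. \<exists>x. x \<epsilon> a \<and> ?P x y" M]) (intro Dfi, rule that)
    have opf: "op x y \<epsilon> f \<longleftrightarrow> x \<epsilon> a \<and> y \<epsilon> M \<and> ?P x y" for x y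
      unfolding f using a' by auto
    have uq: "y = z" if "x \<epsilon> a" "y \<epsilon> M" "z \<epsilon> M" "?P x y" "?P x z" for x y z
      using fn tr[OF that(1) a] that by blast
    have "FunOn f a'" unfolding FunOn_iff
    proof (intro conjI HOL.allI HOL.impI)
      show "\<exists>x. x \<epsilon> a' \<and> (\<exists>y. p = op x y)" if "p \<epsilon> f" for p using that unfolding f by auto
      show "\<exists>!y. op x y \<epsilon> f" if "x \<epsilon> a'" for x
        using that uq unfolding a' opf by blast
    qed
    then have "fdr f a' b" unfolding fdr_def opf b by blast
    moreover have "b \<sqsubseteq> M" using b by blast
    ultimately have "b \<epsilon> M" using G a'M unfolding GM_def by blast
    moreover have "y \<epsilon> b \<longleftrightarrow> (\<exists>x. x \<epsilon> M \<and> x \<epsilon> a \<and> ?P x y)" if "y \<epsilon> M" for y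
      using that tr[OF _ a] unfolding b by blast
    ultimately show "\<exists>b. b \<epsilon> M \<and> (\<forall>y. y \<epsilon> M \<longrightarrow> (y \<epsilon> b \<longleftrightarrow> (\<exists>x. x \<epsilon> M \<and> x \<epsilon> a \<and> ?P x y)))" by blast
  qed
qed

end

section \<open>Closed sets contain the codes of formulas\<close>

context bst
begin

text \<open>Codes are built from numbers by pairing and finite tuples. That they lie in
  \<open>M\<close> lets \<open>Ext\<close>, which compares satisfaction only at elements of
  \<open>M\<close>, decide elementarity.\<close>

lemma MemForm_closed:
  assumes M: "closed M" and n: "n \<epsilon> om" and p: "MemForm n p"
  shows "p \<epsilon> M"
proof -
  from p obtain R F a where L: "MemLang R F a" and p: "IsForm R F a n p" unfolding MemForm_def by blast
  from L have R: "R = sg (N 0)" "F = emp" "a = sg (op (N 0) (N 2))"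
    unfolding MemLang_def rels Num_iff Op_iff by (auto simp: sg_def ext_iff[of F] simp del: N.simps)
  note opM = closed_op[OF M] and NM = closed_N[OF M]
  have D: "Df0 (\<lambda>e. e 0 \<epsilon> M)" by (intro Df0i)
  have i: "i \<epsilon> M" if "i \<epsilon> n" for i by (rule closed_om[OF M om_trans[OF that n]])
  have t: "t \<epsilon> M" if "IsTerm F a n t" for t
    using that unfolding IsTerm_def
    by (rule Gen_induct[of _ _ "\<lambda>t. t \<epsilon> M", OF _ D]) (auto simp: R intro: opM NM i simp del: N.simps)
  show ?thesis using p unfolding IsForm_def
  proof (rule Gen_induct[of _ _ "\<lambda>t. t \<epsilon> M", OF _ D])
    fix prev c assume prev: "\<And>z. prev z \<Longrightarrow> z \<epsilon> M"
    assume "(\<exists>t t'. IsTerm F a n t \<and> IsTerm F a n t' \<and> Node2 0 c t t') \<or>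
      (\<exists>r. r \<epsilon> R \<and> (\<exists>k u. App a r k \<and> TermTuple F a n k u \<and> Node2 1 c r u)) \<or>
      CBot c \<or> (\<exists>p q. prev p \<and> prev q \<and> Node2 3 c p q) \<or> (\<exists>i. i \<epsilon> n \<and> (\<exists>p. prev p \<and> Node2 4 c i p))"
    then show "c \<epsilon> M"
    proof (elim disjE exE conjE)
      fix r k u assume r: "r \<epsilon> R" "App a r k" "TermTuple F a n k u" "Node2 1 c r u"
      have k: "k = N 2" using r(1,2) unfolding R by (simp del: N.simps)
      have u: "FunOn u k" "\<And>i z. op i z \<epsilon> u \<Longrightarrow> z \<epsilon> M" using r(3) t unfolding TermTuple_def by simp_all
      have "u \<epsilon> M" by (rule closed_fun[OF M u(1)]) (simp_all only: k N_om, use ap_mem[OF u(1)] u(2) k in blast)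
      with r(1,4) show ?thesis unfolding R by (auto intro: opM NM simp del: N.simps)
    qed (auto simp: CBot_def intro: opM NM t prev i closed_emp[OF M] simp del: N.simps)
  qed
qed

text \<open>\<open>Sigma1Form\<close> has generating clauses of its own, so the induction runs along
  these rather than through \<open>MemForm\<close>.\<close>

lemma Sigma1_closed:
  assumes M: "closed M" and n: "n \<epsilon> om" and p: "Sigma1Form n p"
  shows "p \<epsilon> M"
proof -
  note opM = closed_op[OF M] and NM = closed_N[OF M]
  have D: "Df0 (\<lambda>e. e 0 \<epsilon> M)" by (intro Df0i)
  have i: "i \<epsilon> M" if "i \<epsilon> n" for i by (rule closed_om[OF M om_trans[OF that n]])
  have bot: "c \<epsilon> M" if "CBot c" for c
    using that closed_emp[OF M] unfolding CBot_def by (auto intro: opM NM simp del: N.simps)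
  have eq: "c \<epsilon> M" if "CVarEq c i j" "i \<epsilon> n" "j \<epsilon> n" for c i j
    using that unfolding CVarEq_def by (auto intro: opM NM i simp del: N.simps)
  have mem: "c \<epsilon> M" if c: "CVarMem c i j" and ij: "i \<epsilon> n" "j \<epsilon> n" for c i j
  proof -
    from c obtain u where u: "FunOn u (N 2)" "op (N 0) (op (N 0) i) \<epsilon> u" "op (N 1) (op (N 0) j) \<epsilon> u"
      "c = op (N 1) (op (N 0) u)"
      unfolding CVarMem_def by (auto simp del: N.simps)
    have "ap u k \<epsilon> M" if "k \<epsilon> N 2" for k
    proof -
      from that have "k = N 0 \<or> k = N 1" unfolding mem_N by (auto simp: numeral_2_eq_2 less_Suc_eq simp del: N.simps)
      moreover have "ap u (N 0) = op (N 0) i" "ap u (N 1) = op (N 0) j"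
        using u(2,3) unfolding FunOn_app[OF u(1)] by blast+
      ultimately show ?thesis using opM NM i ij by metis
    qed
    from closed_fun[OF M u(1) N_om this] show ?thesis unfolding u(4) by (intro opM NM)
  qed
  have delta: "c \<epsilon> M" if "Delta0Form n c" for c
    using that unfolding Delta0Form_def
  proof (rule Gen_induct[of _ _ "\<lambda>t. t \<epsilon> M", OF _ D])
    fix prev c assume prev: "\<And>z. prev z \<Longrightarrow> z \<epsilon> M"
    assume "(\<exists>i. i \<epsilon> n \<and> (\<exists>j. j \<epsilon> n \<and> (CVarEq c i j \<or> CVarMem c i j))) \<or> CBot c \<or>
      (\<exists>p q. prev p \<and> prev q \<and> Node2 3 c p q) \<or>
      (\<exists>i. i \<epsilon> n \<and> (\<exists>j. j \<epsilon> n \<and> i \<noteq> j \<and>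
        (\<exists>p m q. prev p \<and> CVarMem m i j \<and> Node2 3 q m p \<and> Node2 4 c i q)))"
    then show "c \<epsilon> M"
    proof (elim disjE exE conjE)
      show ?thesis if "CBot c" using that by (rule bot)
      show ?thesis if "i \<epsilon> n" "j \<epsilon> n" "CVarEq c i j" for i j using eq that by blast
      show ?thesis if "i \<epsilon> n" "j \<epsilon> n" "CVarMem c i j" for i j using mem that by blast
      show ?thesis if "prev p" "prev q" "Node2 3 c p q" for p q
        using that prev by (simp add: opM NM del: N.simps)
      show ?thesis if "i \<epsilon> n" "j \<epsilon> n" "prev p" "CVarMem m i j" "Node2 3 q m p" "Node2 4 c i q" for i j p m q
        using that prev mem i by (simp add: opM NM del: N.simps)
    qed
  qed
  show ?thesis using p unfolding Sigma1Form_def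
  proof (rule Gen_induct[of _ _ "\<lambda>t. t \<epsilon> M", OF _ D])
    fix prev c assume prev: "\<And>z. prev z \<Longrightarrow> z \<epsilon> M"
    assume "Delta0Form n c \<or> (\<exists>i. i \<epsilon> n \<and> (\<exists>p. prev p \<and> CEx c i p))"
    then show "c \<epsilon> M"
    proof (elim disjE exE conjE)
      fix i p assume "i \<epsilon> n" "prev p" "CEx c i p"
      then show ?thesis unfolding CEx_def CNot_def
        using prev i bot by (auto intro!: opM NM simp del: N.simps)
    qed (rule delta)
  qed
qed

end

context zv
begin

lemma Ext_ElemSub:
  assumes M: "closed M" and e: "Ext M M'"
  shows "ElemSub M M'" "ElemSub1 M M'"
proof -
  have S: "MemSats M n p s \<longleftrightarrow> MemSats M' n p s" if "n \<epsilon> om" "p \<epsilon> M" "Fun s n M" for n p s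
  proof -
    have sF: "FunOn s n" using that(3) unfolding Fun_iff by blast
    have "s \<epsilon> M" by (rule closed_fun[OF M sF that(1)]) (rule Fun_ap[OF that(3)])
    then have "op n (op p s) \<epsilon> M" using that(2) closed_om[OF M that(1)]
      by (intro closed_op[OF M])
    then have "SatC M (op n (op p s)) \<longleftrightarrow> SatC M' (op n (op p s))" using e unfolding Ext_def by blast
    moreover have "SatC K (op n (op p s)) \<longleftrightarrow> MemSats K n p s" for K unfolding SatC_def by auto
    ultimately show ?thesis by blast
  qed
  have sub: "Sub M M'" using e unfolding Ext_def by simp
  show "ElemSub M M'" unfolding ElemSub_def Natl_iff
    using sub S MemForm_closed[OF M] by blast
  show "ElemSub1 M M'" unfolding ElemSub1_def Natl_iff
    using sub S Sigma1_closed[OF M] by blast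
qed

theorem loc_extendible:
  "\<exists>M. x \<epsilon> M \<and> Model M \<and> (\<forall>y. \<exists>M'. Model M' \<and> y \<epsilon> M' \<and> ElemSub M M' \<and> ElemSub1 M M')"
  "\<exists>M. x \<epsilon> M \<and> Model M \<and> Special M"
proof -
  from strongly_extendible_levels[of x] obtain M where M: "x \<epsilon> M" "GM M"
    "\<And>y. \<exists>M'. GM M' \<and> y \<epsilon> M' \<and> Ext M M'" by blast
  note S = GM_super[OF M(2)]
  show "\<exists>M. x \<epsilon> M \<and> Model M \<and> (\<forall>y. \<exists>M'. Model M' \<and> y \<epsilon> M' \<and> ElemSub M M' \<and> ElemSub1 M M')"
    using M GM_Model Ext_ElemSub[OF super_closed[OF S(1)]] by blast
  show "\<exists>M. x \<epsilon> M \<and> Model M \<and> Special M"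
    using M(1) GM_Model[OF M(2)] super_Special[OF S(1,2)] by blast
qed

end

section \<open>The theories have the same models\<close>

context str
begin

lemma Df_sat1: "Df (\<lambda>e. sat UNIV E (case_nat (e 0) f) p)"
proof -
  have "(\<lambda>i. (case i of 0 \<Rightarrow> (\<lambda>e. e 0) | Suc j \<Rightarrow> (\<lambda>_. f j)) e) = case_nat (e 0) f" for e :: "nat \<Rightarrow> 'u"
    by (auto split: nat.split)
  then show ?thesis unfolding Dfn_def
    by (intro exI[of _ p] exI[of _ "case_nat (\<lambda>e. e 0) (\<lambda>j _. f j)"])
      (auto simp: isv_def split: nat.split)
qed

lemma Df_sat2: "Df (\<lambda>e. sat UNIV E (case_nat (e 0) (case_nat (e 1) f)) p)"
proof -
  let ?v = "case_nat (\<lambda>e. e 0) (case_nat (\<lambda>e. e 1) (\<lambda>j _. f j))"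
  have "(\<lambda>i. ?v i e) = case_nat (e 0) (case_nat (e 1) f)" for e :: "nat \<Rightarrow> 'u"
    by (auto split: nat.split)
  then show ?thesis unfolding Dfn_def
    by (intro exI[of _ p] exI[of _ ?v]) (auto simp: isv_def split: nat.split)
qed

text \<open>A formula with parameters and a definable predicate amount to the same, so each scheme
  becomes one statement quantifying over predicates.\<close>

definition "Seps \<longleftrightarrow> (\<forall>P a. Df (\<lambda>e. P (e 0)) \<longrightarrow> (\<exists>b. \<forall>x. x \<epsilon> b \<longleftrightarrow> x \<epsilon> a \<and> P x))"
definition "Repls \<longleftrightarrow> (\<forall>R a. Df (\<lambda>e. R (e 0) (e 1)) \<longrightarrow>
  (\<forall>x y z. x \<epsilon> a \<longrightarrow> R x y \<longrightarrow> R x z \<longrightarrow> y = z) \<longrightarrow> (\<exists>b. \<forall>y. y \<epsilon> b \<longleftrightarrow> (\<exists>x. x \<epsilon> a \<and> R x y)))"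

lemmas SepsD = Seps_def[THEN iffD1, rule_format]
lemmas ReplsD = Repls_def[THEN iffD1, rule_format]

lemma scoped_large: "\<exists>k. scoped (k + m) p"
  using scoped_exists[of p] scoped_mono le_add1 by blast

lemma sat_Seps: "(\<forall>q\<in>{separation k p | k p. scoped (k + 1) p}. sat UNIV E d q) \<longleftrightarrow> Seps"
proof
  assume s: "\<forall>q\<in>{separation k p | k p. scoped (k + 1) p}. sat UNIV E d q"
  show Seps unfolding Seps_def
  proof (intro HOL.allI HOL.impI)
    fix P a assume "Df (\<lambda>e. P (e 0))"
    then obtain p e where p: "\<And>x. P x \<longleftrightarrow> sat UNIV E (case_nat x e) p" by (rule Df_formula1) (rule that)
    obtain k where k: "scoped (k + 1) p" using scoped_large by blast
    with s have "sat UNIV E d (separation k p)" by blast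
    with sat_separation_scheme[OF k] show "\<exists>b. \<forall>x. x \<epsilon> b \<longleftrightarrow> x \<epsilon> a \<and> P x" unfolding p by blast
  qed
next
  assume s: Seps
  have "sat UNIV E d (separation k p)" if k: "scoped (k + 1) p" for k p
    unfolding sat_separation_scheme[OF k]
    using s Df_sat1 unfolding Seps_def by simp
  then show "\<forall>q\<in>{separation k p | k p. scoped (k + 1) p}. sat UNIV E d q" by blast
qed

lemma sat_Sep0:
  assumes s: "\<forall>q\<in>{separation k p | k p. scoped (k + 1) p \<and> delta0 p}. sat UNIV E d q"
    and "Df0 (\<lambda>e. P (e 0))"
  shows "\<exists>b. \<forall>x. x \<epsilon> b \<longleftrightarrow> x \<epsilon> a \<and> P x"
proof -
  from assms(2) obtain p e where p: "delta0 p" "\<And>x. P x \<longleftrightarrow> sat UNIV E (case_nat x e) p"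
    by (rule Df0_formula1) (rule that)
  obtain k where k: "scoped (k + 1) p" using scoped_large by blast
  with s p(1) have "sat UNIV E d (separation k p)" by blast
  with sat_separation_scheme[OF k] show ?thesis unfolding p(2) by blast
qed

lemma sat_Repls: "(\<forall>q\<in>{replacement k p | k p. scoped (k + 2) p}. sat UNIV E d q) \<longleftrightarrow> Repls"
proof
  assume s: "\<forall>q\<in>{replacement k p | k p. scoped (k + 2) p}. sat UNIV E d q"
  show Repls unfolding Repls_def
  proof (intro HOL.allI HOL.impI)
    fix R a assume "Df (\<lambda>e. R (e 0) (e 1))"
    then obtain p e where p: "\<And>x y. R x y \<longleftrightarrow> sat UNIV E (case_nat x (case_nat y e)) p"
      by (rule Df_formula2) (rule that)
    obtain k where k: "scoped (k + 2) p" using scoped_large by blast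
    with s have "sat UNIV E d (replacement k p)" by blast
    note r = this[unfolded sat_replacement_scheme[OF k], rule_format, of a e, folded p]
    assume "\<forall>x y z. x \<epsilon> a \<longrightarrow> R x y \<longrightarrow> R x z \<longrightarrow> y = z"
    then show "\<exists>b. \<forall>y. y \<epsilon> b \<longleftrightarrow> (\<exists>x. x \<epsilon> a \<and> R x y)" using r by blast
  qed
next
  assume s: Repls
  have "sat UNIV E d (replacement k p)" if k: "scoped (k + 2) p" for k p
    unfolding sat_replacement_scheme[OF k]
  proof (intro HOL.allI HOL.impI)
    fix e a
    assume "\<forall>x. x \<epsilon> a \<longrightarrow> (\<forall>y z. sat UNIV E (case_nat x (case_nat y e)) p \<and>
      sat UNIV E (case_nat x (case_nat z e)) p \<longrightarrow> y = z)"
    then show "\<exists>b. \<forall>y. y \<epsilon> b \<longleftrightarrow> (\<exists>x. x \<epsilon> a \<and> sat UNIV E (case_nat x (case_nat y e)) p)"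
      by (intro s[unfolded Repls_def, rule_format, of "\<lambda>x y. sat UNIV E (case_nat x (case_nat y e)) p"]
          Df_sat2) blast+
  qed
  then show "\<forall>q\<in>{replacement k p | k p. scoped (k + 2) p}. sat UNIV E d q" by blast
qed

lemma sat_VP:
  assumes s: "\<forall>q\<in>VP. sat UNIV E d q" and "Df (\<lambda>e. X (e 0))" and "IsLang R F a"
    and "\<And>x. X x \<Longrightarrow> IsStruct R F a x" and "\<not> (\<exists>b. \<forall>x. x \<epsilon> b \<longleftrightarrow> X x)"
  shows "\<exists>x y. X x \<and> X y \<and> x \<noteq> y \<and> (\<exists>j. ElemEmb R F a j x y)"
proof -
  from assms(2) obtain p e where p: "\<And>x. X x \<longleftrightarrow> sat UNIV E (case_nat x e) p"
    by (rule Df_formula1) (rule that)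
  obtain k where k: "scoped (k + 1) p" using scoped_large by blast
  with s have "sat UNIV E d (vopenka k p)" unfolding VP_def by blast
  note v = this[unfolded sat_vopenka_scheme[OF k] Let_def, rule_format, where e = e and R = R and F = F and a = a, folded p]
  show ?thesis by (rule v) (use assms(3-) in blast)
qed

lemma sat_ZFC: "(\<forall>q\<in>ZFC. sat UNIV E d q) \<longleftrightarrow> Single UNIV \<and> Seps \<and> Repls"
proof -
  have "(\<forall>q\<in>(\<lambda>P. P 0) ` set zfc_single_axioms. sat UNIV E d q) \<longleftrightarrow> Single UNIV"
    using bs_single[of UNIV 0] by (simp add: bs_0)
  then show ?thesis unfolding ZFC_def ball_Un sat_Seps sat_Repls by blast
qed

lemmas Single_ext = Single_def[THEN iffD1, THEN conjunct1, rule_format]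
lemmas Single_found = Single_def[THEN iffD1, THEN conjunct2, THEN conjunct1, rule_format]
lemmas Single_pair = Single_def[THEN iffD1, THEN conjunct2, THEN conjunct2, THEN conjunct1, rule_format]
lemmas Single_union = Single_def[THEN iffD1, THEN conjunct2, THEN conjunct2, THEN conjunct2, THEN conjunct1, rule_format]
lemmas Single_pow = Single_def[THEN iffD1, THEN conjunct2, THEN conjunct2, THEN conjunct2, THEN conjunct2, THEN conjunct1, rule_format]
lemmas Single_inf = Single_def[THEN iffD1, THEN conjunct2, THEN conjunct2, THEN conjunct2, THEN conjunct2, THEN conjunct2, THEN conjunct1, rule_format]
lemmas Single_choice = Single_def[THEN iffD1, THEN conjunct2, THEN conjunct2, THEN conjunct2, THEN conjunct2, THEN conjunct2, THEN conjunct2, rule_format]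

text \<open>ZFC has no product axiom: a Kuratowski pair is an element of the double power set of
  \<open>a \<union> b\<close>, from which the product is separated. Pairs appear through their
  defining formulas because the terms of \<open>bst_pre\<close> presuppose products.\<close>

lemma product_exists:
  assumes S: "Single UNIV" and sep: Seps
  shows "\<exists>c. \<forall>z. z \<epsilon> c \<longleftrightarrow> (\<exists>x. x \<epsilon> a \<and> (\<exists>y. y \<epsilon> b \<and> Op z x y))"
proof -
  have pair: "\<exists>p. \<forall>z. z \<epsilon> p \<longleftrightarrow> z = x \<or> z = y" for x y using Single_pair[OF S, of x y] unfolding sUp_def by simp
  have union: "\<exists>u. \<forall>z. z \<epsilon> u \<longleftrightarrow> (\<exists>y. y \<epsilon> x \<and> z \<epsilon> y)" for x using Single_union[OF S, of x] by simp
  have pow: "\<exists>p. \<forall>z. z \<epsilon> p \<longleftrightarrow> Sub z x" for x using Single_pow[OF S, of x] by simp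
  obtain ab where ab: "\<And>z. z \<epsilon> ab \<longleftrightarrow> z = a \<or> z = b" using pair by blast
  obtain u where u: "\<And>z. z \<epsilon> u \<longleftrightarrow> (\<exists>y. y \<epsilon> ab \<and> z \<epsilon> y)" using union by blast
  obtain p where p: "\<And>z. z \<epsilon> p \<longleftrightarrow> Sub z u" using pow by blast
  obtain q where q: "\<And>z. z \<epsilon> q \<longleftrightarrow> Sub z p" using pow by blast
  let ?P = "\<lambda>z. \<exists>x. x \<epsilon> a \<and> (\<exists>y. y \<epsilon> b \<and> Op z x y)"
  have "Df (\<lambda>e. ?P (e 0))" by (intro Dfi)
  from SepsD[OF sep this] obtain c where c: "\<And>z. z \<epsilon> c \<longleftrightarrow> z \<epsilon> q \<and> ?P z" by blast
  have "z \<epsilon> q" if "?P z" for z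
  proof -
    from that obtain x y v w where xy: "x \<epsilon> a" "y \<epsilon> b" and vw: "Up v x x" "Up w x y" "Up z v w"
      unfolding sOp_def by blast
    have "x \<epsilon> u" "y \<epsilon> u" using xy unfolding u ab by blast+
    then have "v \<epsilon> p" "w \<epsilon> p" unfolding p sSub_def using vw(1,2) unfolding sUp_def by auto
    then show ?thesis unfolding q sSub_def using vw(3) unfolding sUp_def by auto
  qed
  with c show ?thesis by blast
qed

end

section \<open>Passing between satisfied axioms and the locales\<close>

lemma zv_if_sat:
  fixes E :: "'a \<Rightarrow> 'a \<Rightarrow> bool"
  assumes s: "\<forall>q\<in>ZFC \<union> VP. sat UNIV E d q"
  shows "zv E"
proof -
  interpret str E d .
  have S: "Single UNIV" and sep: Seps and repl: Repls using s sat_ZFC by blast+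
  have sep': "\<exists>b. \<forall>x. E x b \<longleftrightarrow> E x a \<and> P x" if "Df (\<lambda>e. P (e 0))" for P a
    using SepsD[OF sep that] .
  have found: "\<exists>y. E y a \<and> (\<forall>z. E z a \<longrightarrow> \<not> E z y)" if "E x a" for x a
    using Single_found[OF S, of a] that unfolding sEmpty_def by auto
  have inf: "\<exists>w. (\<exists>u. E u w \<and> Empty u) \<and> (\<forall>x. E x w \<longrightarrow> (\<exists>y. E y w \<and> Succ y x))"
    using Single_inf[OF S] by simp
  \<comment> \<open>Entered without \<omega>, which is then obtained from Infinity by
    \<open>omega_exists\<close>.\<close>
  interpret bst_pre E d
  proof unfold_locales
    show "x = y" if "\<And>z. E z x \<longleftrightarrow> E z y" for x y using Single_ext[OF S, of x y] that by simp
    show "\<exists>x. \<forall>z. \<not> E z x" using inf unfolding sEmpty_def by blast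
    show "\<exists>p. \<forall>z. E z p \<longleftrightarrow> z = x \<or> z = y" for x y using Single_pair[OF S, of x y] unfolding sUp_def by simp
    show "\<exists>u. \<forall>z. E z u \<longleftrightarrow> (\<exists>y. E y x \<and> E z y)" for x using Single_union[OF S, of x] by simp
    show "\<exists>c. \<forall>z. E z c \<longleftrightarrow> (\<exists>x. E x a \<and> (\<exists>y. E y b \<and> Op z x y))" for a b
      by (rule product_exists[OF S sep])
    show "\<exists>b. \<forall>x. E x b \<longleftrightarrow> E x a \<and> P x" if "Df0 (\<lambda>e. P (e 0))" for P a
      by (rule sep'[OF Df0_Df[OF that]])
    show "\<exists>y. E y a \<and> (\<forall>z. E z a \<longrightarrow> \<not> E z y)" if "E x a" for x a by (rule found[OF that])
  qed
  show ?thesis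
  proof unfold_locales
    obtain I where I: "\<exists>u. E u I \<and> Empty u" "\<forall>x. E x I \<longrightarrow> (\<exists>y. E y I \<and> Succ y x)" using inf by blast
    show "\<exists>w. Omega w"
      by (rule omega_exists[of I]) (use I in auto)
    show "isset (\<lambda>x. E x a \<and> P x)" if "Df (\<lambda>e. P (e 0))" for P a
      unfolding isset_def by (rule sep'[OF that])
    show "isset (\<lambda>y. \<exists>x. E x a \<and> R x y)" if "Df (\<lambda>e. R (e 0) (e 1))"
      "\<And>x y z. E x a \<Longrightarrow> R x y \<Longrightarrow> R x z \<Longrightarrow> y = z" for R a
      unfolding isset_def using that by (rule ReplsD[OF repl])
    show "isset (\<lambda>z. \<forall>y. E y z \<longrightarrow> E y x)" for x
      using Single_pow[OF S, of x] unfolding isset_def Sub_iff by simp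
    show "\<exists>c. \<forall>y. E y x \<longrightarrow> (\<exists>!v. E v y \<and> E v c)" if "\<And>y. E y x \<Longrightarrow> \<exists>v. E v y"
      "\<And>y z v. E y x \<Longrightarrow> E z x \<Longrightarrow> E v y \<Longrightarrow> E v z \<Longrightarrow> y = z" for x
    proof -
      have "\<exists>c\<in>UNIV. \<forall>y\<in>UNIV. E y x \<longrightarrow>
          (\<exists>v\<in>UNIV. (E v y \<and> E v c) \<and> (\<forall>w\<in>UNIV. E w y \<and> E w c \<longrightarrow> w = v))"
        by (rule Single_choice[OF S UNIV_I]) (use that in \<open>unfold sEmpty_def, blast\<close>)
      then obtain c where "\<forall>y. E y x \<longrightarrow> (\<exists>v. (E v y \<and> E v c) \<and> (\<forall>w. E w y \<and> E w c \<longrightarrow> w = v))"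
        by auto
      then show ?thesis by (intro exI[of _ c]) blast
    qed
    show "\<exists>x y. X x \<and> X y \<and> x \<noteq> y \<and> (\<exists>j. ElemEmb R F a j x y)"
      if "Df (\<lambda>e. X (e 0))" "IsLang R F a" "\<And>x. X x \<Longrightarrow> IsStruct R F a x" "\<not> isset X" for X R F a
      by (rule sat_VP) (use s that in \<open>auto simp: isset_def\<close>)
  qed
qed

lemma (in zv) sat_BST: "q \<in> BST \<Longrightarrow> sat UNIV E d q"
proof -
  have sep: "sat UNIV E d (separation k p)" if k: "scoped (k + 1) p" for k p
    unfolding sat_separation_scheme[OF k]
    using sep[OF Df_sat1] unfolding isset_def by blast
  have "bs UNIV 0 e ax_empty" for e using ex_empty by (simp add: ax_empty_def sEmpty_def)
  moreover have "bs UNIV 0 e ax_extensionality" for e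
    using ext by (simp add: ax_extensionality_def)
  moreover have "bs UNIV 0 e ax_pair" for e
    using ex_pair by (simp add: ax_pair_def sUp_def del: rels)
  moreover have "bs UNIV 0 e ax_union" for e using ex_union by (simp add: ax_union_def)
  moreover have "bs UNIV 0 e ax_product" for e
    using ex_product by (simp add: ax_product_def del: Op_iff)
  moreover have "bs UNIV 0 e ax_omega" for e using ex_omega by (simp add: ax_omega_def)
  ultimately have "bs UNIV 0 e B"
    if "B \<in> {ax_empty, ax_extensionality, ax_pair, ax_union, ax_product, ax_omega}" for B e
    using that by blast
  then show "q \<in> BST \<Longrightarrow> sat UNIV E d q" unfolding BST_def using sep sat_bs by blast
qed

lemma (in str) Model_closed:
  assumes "Model M"
  shows "x \<epsilon> y \<Longrightarrow> y \<epsilon> M \<Longrightarrow> x \<epsilon> M" "Single {u. u \<epsilon> M}"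
  using assms unfolding Model_def sTrans_def sSub_def by blast+

lemma lz_if_sat:
  fixes E :: "'a \<Rightarrow> 'a \<Rightarrow> bool"
  assumes s: "\<forall>q\<in>LZFC \<union> VP. sat UNIV E d q"
  shows "lz E"
proof -
  interpret str E d .
  have loc: "\<exists>M. E x M \<and> Model M" for x using s sat_Loc unfolding LZFC_def by blast
  have B: "bs UNIV 0 (\<lambda>_. undefined) B"
    if "B \<in> {ax_empty, ax_extensionality, ax_pair, ax_union, ax_product, ax_omega}" for B
    using s that unfolding LZFC_def BST_def sat_bs[symmetric] by blast
  have sp: "\<forall>q\<in>{separation k p | k p. scoped (k + 1) p \<and> delta0 p}. sat UNIV E d q"
    using s unfolding LZFC_def BST_def by blast
  interpret bst E d
  proof unfold_locales
    show "x = y" if "\<And>z. E z x \<longleftrightarrow> E z y" for x y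
      using B[of ax_extensionality] that by (simp add: ax_extensionality_def)
    show "\<exists>x. \<forall>z. \<not> E z x" using B[of ax_empty] by (simp add: ax_empty_def sEmpty_def)
    show "\<exists>p. \<forall>z. E z p \<longleftrightarrow> z = x \<or> z = y" for x y
      using B[of ax_pair] by (simp add: ax_pair_def sUp_def)
    show "\<exists>u. \<forall>z. E z u \<longleftrightarrow> (\<exists>y. E y x \<and> E z y)" for x
      using B[of ax_union] by (simp add: ax_union_def)
    show "\<exists>c. \<forall>z. E z c \<longleftrightarrow> (\<exists>x. E x a \<and> (\<exists>y. E y b \<and> Op z x y))" for a b
      using B[of ax_product] by (simp add: ax_product_def)
    show "\<exists>w. Omega w" using B[of ax_omega] by (simp add: ax_omega_def)
    show "\<exists>b. \<forall>x. E x b \<longleftrightarrow> E x a \<and> P x" if "Df0 (\<lambda>e. P (e 0))" for P a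
      by (rule sat_Sep0[OF sp that])
    \<comment> \<open>A transitive model containing \<open>a\<close> contains all elements of
      \<open>a\<close>, so an element of \<open>a\<close> that is minimal in its eyes is
      minimal.\<close>
    show "\<exists>y. E y a \<and> (\<forall>z. E z a \<longrightarrow> \<not> E z y)" if "E x a" for x a
    proof -
      from loc obtain M where M: "E a M" "Model M" by blast
      note tr = Model_closed(1)[OF M(2)]
      from M(1) tr[OF that M(1)] that
      have "\<exists>y\<in>{u. E u M}. E y a \<and> (\<forall>z\<in>{u. E u M}. E z a \<longrightarrow> \<not> E z y)"
        using Single_found[OF Model_closed(2)[OF M(2)], of a] unfolding sEmpty_def by blast
      then show ?thesis using tr[OF _ M(1)] by blast
    qed
  qed
  show ?thesis
  proof unfold_locales
    show "\<exists>x y. X x \<and> X y \<and> x \<noteq> y \<and> (\<exists>j. ElemEmb R F a j x y)"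
      if "Df (\<lambda>e. X (e 0))" "IsLang R F a" "\<And>x. X x \<Longrightarrow> IsStruct R F a x" "\<not> isset X" for X R F a
      by (rule sat_VP) (use s that in \<open>auto simp: isset_def\<close>)
    show "\<exists>M. E x M \<and> closed M" for x
    proof -
      from loc obtain M where M: "E x M" "Model M" by blast
      note tr = Model_closed(1)[OF M(2)] and S = Model_closed(2)[OF M(2)]
      \<comment> \<open>What \<open>M\<close> takes to be a pair is the true pair, because
        \<open>M\<close> is transitive; unions and the empty set are treated alike.\<close>
      have up: "E (up a b) M" if ab: "E a M" "E b M" for a b
      proof -
        from ab obtain p where p: "E p M" "\<forall>z\<in>{u. E u M}. E z p \<longleftrightarrow> z = a \<or> z = b"
          using Single_pair[OF S, of a b] unfolding sUp_def by blast
        have "E z p \<longleftrightarrow> E z (up a b)" for z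
          unfolding mem_basic using p(2) ab tr[of z p, OF _ p(1)] by blast
        then have "p = up a b" by (rule ext)
        with p(1) show ?thesis by simp
      qed
      have uni: "E (uni a) M" if a: "E a M" for a
      proof -
        from a obtain p where p: "E p M" "\<forall>z\<in>{u. E u M}. E z p \<longleftrightarrow> (\<exists>y\<in>{u. E u M}. E y a \<and> E z y)"
          using Single_union[OF S, of a] by blast
        have "E z p \<longleftrightarrow> E z (uni a)" for z unfolding mem_basic
        proof
          show "\<exists>y. E y a \<and> E z y" if "E z p" using p(2) tr[OF that p(1)] that by blast
          assume "\<exists>y. E y a \<and> E z y"
          then obtain y where y: "E y a" "E z y" by blast
          note yM = tr[OF y(1) a]
          from tr[OF y(2) yM] yM y p(2) show "E z p" by blast
        qed
        then have "p = uni a" by (rule ext)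
        with p(1) show ?thesis by simp
      qed
      from Single_inf[OF S] obtain u where u: "E u M" "sEmpty {u. E u M} u" by blast
      have "E z u \<longleftrightarrow> E z emp" for z
        using u(2) tr[of z u, OF _ u(1)] mem_basic(1) unfolding sEmpty_def by blast
      then have "u = emp" by (rule ext)
      with u(1) have "closed M" unfolding closed_def un_def using up uni tr by blast
      with M(1) show ?thesis by blast
    qed
  qed
qed

text \<open>The schemes and Power Set come from VP through \<open>isset_coded\<close>. A single set
  is enough to state an instance of Choice, so a model containing that set can settle it.\<close>

lemma (in lz) sat_ZFC_if_Loc:
  assumes loc: "\<And>x. \<exists>M. x \<epsilon> M \<and> Model M"
  shows "\<forall>q\<in>ZFC. sat UNIV E d q"
  unfolding sat_ZFC
proof (intro conjI)
  show Seps unfolding Seps_def using separation_full unfolding isset_def by blast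
  show Repls unfolding Repls_def
  proof (intro HOL.allI HOL.impI)
    fix R a assume "Df (\<lambda>e. R (e 0) (e 1))" "\<forall>x y z. x \<epsilon> a \<longrightarrow> R x y \<longrightarrow> R x z \<longrightarrow> y = z"
    then show "\<exists>b. \<forall>y. y \<epsilon> b \<longleftrightarrow> (\<exists>x. x \<epsilon> a \<and> R x y)"
      using replacement_full[of R a] unfolding isset_def by blast
  qed
  show "Single UNIV" unfolding Single_def
  proof (intro conjI ballI HOL.impI)
    show "x = y" if "\<forall>z\<in>UNIV. z \<epsilon> x \<longleftrightarrow> z \<epsilon> y" for x y using that by (intro ext) simp
    show "\<exists>y\<in>UNIV. y \<epsilon> x \<and> (\<forall>z\<in>UNIV. z \<epsilon> x \<longrightarrow> \<not> z \<epsilon> y)" if "\<not> Empty x" for x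
      using that foundation[of _ x] unfolding sEmpty_def by blast
    show "\<exists>p\<in>UNIV. Up p x y" for x y by auto
    show "\<exists>u\<in>UNIV. \<forall>z\<in>UNIV. z \<epsilon> u \<longleftrightarrow> (\<exists>y\<in>UNIV. y \<epsilon> x \<and> z \<epsilon> y)" for x using ex_union[of x] by simp
    show "\<exists>p\<in>UNIV. \<forall>z\<in>UNIV. z \<epsilon> p \<longleftrightarrow> Sub z x" for x
      using power_set[of x] unfolding isset_def Sub_iff by blast
    show "\<exists>w\<in>UNIV. (\<exists>u\<in>UNIV. u \<epsilon> w \<and> Empty u) \<and> (\<forall>x\<in>UNIV. x \<epsilon> w \<longrightarrow> (\<exists>y\<in>UNIV. y \<epsilon> w \<and> Succ y x))"
      using om_emp om_suc by (intro bexI[of _ om]) auto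
    fix x assume h: "(\<forall>y\<in>UNIV. y \<epsilon> x \<longrightarrow> \<not> Empty y) \<and>
      (\<forall>y\<in>UNIV. y \<epsilon> x \<longrightarrow> (\<forall>z\<in>UNIV. z \<epsilon> x \<longrightarrow> (\<exists>v\<in>UNIV. v \<epsilon> y \<and> v \<epsilon> z) \<longrightarrow> y = z))"
    from loc obtain M where M: "x \<epsilon> M" "Model M" by blast
    note tr = Model_closed(1)[OF M(2)]
    \<comment> \<open>By transitivity \<open>M\<close> sees all members of \<open>x\<close> and all
      their elements, so hypothesis and conclusion of Choice mean the same inside and
      outside.\<close>
    have "(\<forall>y\<in>{u. u \<epsilon> M}. y \<epsilon> x \<longrightarrow> \<not> sEmpty {u. u \<epsilon> M} y) \<and>
      (\<forall>y\<in>{u. u \<epsilon> M}. y \<epsilon> x \<longrightarrow> (\<forall>z\<in>{u. u \<epsilon> M}. z \<epsilon> x \<longrightarrow> (\<exists>v\<in>{u. u \<epsilon> M}. v \<epsilon> y \<and> v \<epsilon> z) \<longrightarrow> y = z))"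
      using h tr unfolding sEmpty_def by blast
    then obtain c where c: "\<forall>y\<in>{u. u \<epsilon> M}. y \<epsilon> x \<longrightarrow>
        (\<exists>v\<in>{u. u \<epsilon> M}. (v \<epsilon> y \<and> v \<epsilon> c) \<and> (\<forall>w\<in>{u. u \<epsilon> M}. w \<epsilon> y \<and> w \<epsilon> c \<longrightarrow> w = v))"
      using Single_choice[OF Model_closed(2)[OF M(2)], of x] M(1) by blast
    have "\<exists>v\<in>UNIV. (v \<epsilon> y \<and> v \<epsilon> c) \<and> (\<forall>w\<in>UNIV. w \<epsilon> y \<and> w \<epsilon> c \<longrightarrow> w = v)" if y: "y \<epsilon> x" for y
    proof -
      note yM = tr[OF y M(1)]
      from c y yM obtain v where "v \<epsilon> y" "v \<epsilon> c" "\<forall>w\<in>{u. u \<epsilon> M}. w \<epsilon> y \<and> w \<epsilon> c \<longrightarrow> w = v" by blast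
      then show ?thesis using tr[OF _ yM] by blast
    qed
    then show "\<exists>c\<in>UNIV. \<forall>y\<in>UNIV. y \<epsilon> x \<longrightarrow>
        (\<exists>v\<in>UNIV. (v \<epsilon> y \<and> v \<epsilon> c) \<and> (\<forall>w\<in>UNIV. w \<epsilon> y \<and> w \<epsilon> c \<longrightarrow> w = v))" by blast
  qed
qed

text \<open>Isolates what depends on \<open>P\<close>: in every structure for ZFC and VP each set
  has to be placed in a model with property \<open>P\<close>. The converse inclusion goes through
  \<open>lz\<close>.\<close>

lemma theorems_LZFC_prop:
  assumes "\<And>(E :: nat \<Rightarrow> nat \<Rightarrow> bool) d x. zv E \<Longrightarrow> \<exists>M. E x M \<and> str.Model E M \<and>
    str.bs E d UNIV 2 ((\<lambda>_. undefined)(0 := x, 1 := M)) (P 1)"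
  shows "theorems (ZFC \<union> VP) = theorems (LZFC_prop P \<union> VP)"
proof (rule theorems_eqI)
  have "separation 0 (neg (Mem 0 0)) \<in> {separation k p | k p. scoped (k + 1) p \<and> delta0 p}"
    by (intro CollectI exI[of _ 0] exI[of _ "Imp (Mem 0 0) Bot"]) (auto intro: delta0.intros)
  then show "{ax_pair 0, ax_union 0, separation 0 (neg (Mem 0 0))} \<subseteq> ZFC \<union> VP"
    "{ax_pair 0, ax_union 0, separation 0 (neg (Mem 0 0))} \<subseteq> LZFC_prop P \<union> VP"
    unfolding ZFC_def LZFC_prop_def LZFC_def BST_def zfc_single_axioms_def by auto
  fix E :: "nat \<Rightarrow> nat \<Rightarrow> bool" and d
  show "(\<forall>q\<in>ZFC \<union> VP. sat UNIV E d q) \<longleftrightarrow> (\<forall>q\<in>LZFC_prop P \<union> VP. sat UNIV E d q)"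
  proof
    assume m: "\<forall>q\<in>ZFC \<union> VP. sat UNIV E d q"
    then have zv: "zv E" by (rule zv_if_sat)
    then interpret zv E d .
    have "sat UNIV E d (Loc_prop P)" unfolding sat_Loc_prop using assms[OF zv] by blast
    moreover have "sat UNIV E d Loc" unfolding sat_Loc using loc_extendible(2) by blast
    ultimately show "\<forall>q\<in>LZFC_prop P \<union> VP. sat UNIV E d q"
      unfolding LZFC_prop_def LZFC_def using sat_BST m by blast
  next
    assume m: "\<forall>q\<in>LZFC_prop P \<union> VP. sat UNIV E d q"
    then have l: "\<forall>q\<in>LZFC \<union> VP. sat UNIV E d q" unfolding LZFC_prop_def by blast
    then have "lz E" by (rule lz_if_sat)
    then interpret lz E d .
    show "\<forall>q\<in>ZFC \<union> VP. sat UNIV E d q"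
      using l sat_ZFC_if_Loc sat_Loc unfolding LZFC_def by blast
  qed
qed

theorem theorem6p16:
  "theorems (ZFC \<union> VP) = theorems (LZFC_prop strongly_extendible \<union> VP) \<and>
   theorems (ZFC \<union> VP) = theorems (LZFC_prop sigma1_strongly_extendible \<union> VP) \<and>
   theorems (ZFC \<union> VP) = theorems (LZFC_prop special \<union> VP)"
proof -
  have "\<exists>M. E x M \<and> str.Model E M \<and> str.bs E d UNIV 2 ((\<lambda>_. undefined)(0 := x, 1 := M)) (P 1)"
    if "zv E" and P: "P = strongly_extendible \<or> P = sigma1_strongly_extendible \<or> P = special"
    for E :: "nat \<Rightarrow> nat \<Rightarrow> bool" and d x P
  proof -
    interpret zv E d by fact
    from loc_extendible(1)[of x] obtain M where M: "E x M" "Model M"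
      "\<forall>y. \<exists>M'. Model M' \<and> E y M' \<and> ElemSub M M' \<and> ElemSub1 M M'" by blast
    from loc_extendible(2)[of x] obtain K where K: "E x K" "Model K" "Special K" by blast
    let ?e = "\<lambda>M. (\<lambda>_. undefined)(0 := x, 1 := M)"
    have "bs UNIV 2 (?e M) (strongly_extendible 1)" "bs UNIV 2 (?e M) (sigma1_strongly_extendible 1)"
      "bs UNIV 2 (?e K) (special 1)"
      using M(3) K(3) by (simp_all, blast+)
    with M(1,2) K(1,2) P show ?thesis by blast
  qed
  then show ?thesis by (intro conjI; intro theorems_LZFC_prop) blast+
qed

end
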